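(* Let $\nu,b\in(0,\infty)$, $a\in(0,b)$ and $\gamma\in(0,\pi)$. Let $q$ be a real-valued function in $AC_{\mathrm{loc}}(0,b]$ such that the function $x\mapsto xq(x)$ belongs to $L^r(0,b)$ for some $r\in(2,\infty]$. For every $F\in\mathcal B_b$ define $$\widetilde F(z)=\sum_{\lambda_n\in\sigma(S_{a,\gamma})}\frac{K_a(z,\lambda_n)}{K_a(\lambda_n,\lambda_n)}\,F(\lambda_n).$$ Then for each compact set $\mathbb K\subset\mathbb C$ there exists $D>0$ such that, for all $F\in\mathcal B_b$, $$|F(z)-\widetilde F(z)|\le D\,\|(I-P_{ab})F\|_{\mathcal B_b},\qquad z\in\mathbb K,$$ where $P_{ab}:\mathcal B_b\to\mathcal B_b$ is the orthogonal projector onto $\mathcal B_a$.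
   Context: Notation: $\xi_\nu(z,x)=z^{-\nu/2}\sqrt{\pi x/2}\,J_\nu(\sqrt z\,x)$ ($J_\nu$ the Bessel function), which is entire in $z$ and real for real $z$. Solution $\xi$: for each $z\in\mathbb C$, $\xi(z,\cdot)$ is the solution on $(0,b]$ of $-\varphi''+\left(\frac{\nu^2-1/4}{x^2}+q(x)\right)\varphi=z\varphi$ determined by the estimates, valid for all $z\in\mathbb C$, $x\in(0,b]$ with a constant $C=C(\nu,q,b)$, $$|\xi(z,x)-\xi_\nu(z,x)|\le C\Bigl(\tfrac{x}{1+|\sqrt z|x}\Bigr)^{\nu+\frac12}e^{|\mathrm{Im}\sqrt z|x}\int_0^x\frac{u|q(u)|}{1+|\sqrt z|u}du,$$ $$|\xi'(z,x)-\xi_\nu'(z,x)|\le C\Bigl(\tfrac{x}{1+|\sqrt z|x}\Bigr)^{\nu-\frac12}e^{|\mathrm{Im}\sqrt z|x}\int_0^x\frac{u|q(u)|}{1+|\sqrt z|u}du,$$ where $'$ is the derivative in $x$. The functions $\xi(\cdot,x)$ and $\xi'(\cdot,x)$ are entire and real on the real line. De Branges spaces: for $s\in(0,b]$, $\mathcal B_s=\{F(z)=\int_0^s\xi(z,x)\varphi(x)\,dx:\varphi\in L^2(0,s)\}$ with $\|F\|_{\mathcal B_s}^2=\int_0^s|\varphi(x)|^2dx$. Its reproducing kernel is $K_s(z,w)=\int_0^s\xi(z,x)\,\xi(\overline w,x)\,dx$. The space $\mathcal B_a$ is isometrically contained in $\mathcal B_b$ (extend $\varphi$ by zero). Operators and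 spectrum: $S_{s,\gamma}$ is the selfadjoint operator in $\mathcal B_s$ unitarily equivalent, via $\varphi\mapsto F$, to the selfadjoint operator $H_{s,\gamma}$ in $L^2(0,s)$ given by $-\frac{d^2}{dx^2}+\frac{\nu^2-1/4}{x^2}+q$ with boundary condition $\varphi(s)\cos\gamma+\varphi'(s)\sin\gamma=0$ and, if $\nu\in(0,1)$, also $\lim_{x\to0+}x^{\nu-1/2}\left((\nu+\tfrac12)\varphi(x)-x\varphi'(x)\right)=0$. Its spectrum is discrete, simple, bounded below, and equals $\sigma(S_{s,\gamma})=\sigma(H_{s,\gamma})=\{\lambda\in\mathbb R:\xi(\lambda,s)\cos\gamma+\xi'(\lambda,s)\sin\gamma=0\}$. *)

theory Defs
  imports "HOL-Analysis.Analysis"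
begin

section \<open>Function classes\<close>

definition abs_continuous_on :: "(real \<Rightarrow> 'a::real_normed_vector) \<Rightarrow> real \<Rightarrow> real \<Rightarrow> bool" where
  "abs_continuous_on f c d \<longleftrightarrow>
     (\<forall>\<epsilon>>0. \<exists>\<delta>>0. \<forall>I :: (real \<times> real) set.
        finite I \<and> (\<forall>(u, v)\<in>I. c \<le> u \<and> u \<le> v \<and> v \<le> d) \<and>
        pairwise (\<lambda>(u, v) (u', v'). {u<..<v} \<inter> {u'<..<v'} = {}) I \<and>
        (\<Sum>(u, v)\<in>I. v - u) < \<delta>
        \<longrightarrow> (\<Sum>(u, v)\<in>I. norm (f v - f u)) < \<epsilon>)"

text \<open>The class \<open>AC\<^sub>l\<^sub>o\<^sub>c(0,s]\<close>.\<close>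

definition AC_loc :: "real \<Rightarrow> (real \<Rightarrow> 'a::real_normed_vector) set" where
  "AC_loc s = {f. \<forall>c. 0 < c \<and> c < s \<longrightarrow> abs_continuous_on f c s}"

text \<open>The space \<open>L\<^sup>r(0,s)\<close>, with functions in place of classes modulo null sets. Every
  class of Lebesgue measurable functions has a Borel representative.\<close>

definition Lp :: "ereal \<Rightarrow> real \<Rightarrow> (real \<Rightarrow> 'a::{real_normed_vector, second_countable_topology}) set" where
  "Lp r s = {f. set_borel_measurable lborel {0<..<s} f \<and>
     (if r = \<infinity> then \<exists>M. AE x in lborel. x \<in> {0<..<s} \<longrightarrow> norm (f x) \<le> M
      else set_integrable lborel {0<..<s} (\<lambda>x. norm (f x) powr real_of_ereal r))}"

abbreviation L2 :: "real \<Rightarrow> (real \<Rightarrow> complex) set" where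
  "L2 s \<equiv> Lp 2 s"


section \<open>The unperturbed solution\<close>

definition bessel_J :: "real \<Rightarrow> complex \<Rightarrow> complex" where
  "bessel_J \<nu> w = (w / 2) powr of_real \<nu> *
     (\<Sum>k. (-1) ^ k / (fact k * Gamma (of_real \<nu> + of_nat k + 1)) * (w / 2) ^ (2 * k))"

text \<open>All branches are principal; at \<open>z = 0\<close> the removable singularity is filled in, see
  \<open>xi_free_series\<close> below.\<close>

definition xi_free :: "real \<Rightarrow> complex \<Rightarrow> real \<Rightarrow> complex" where
  "xi_free \<nu> z x =
     (if z = 0 then of_real (sqrt (pi * x / 2) * (x / 2) powr \<nu> / Gamma (\<nu> + 1))
      else z powr (- of_real \<nu> / 2) * of_real (sqrt (pi * x / 2)) * bessel_J \<nu> (csqrt z * of_real x))"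

lemma xi_free_series:
  assumes "x > 0"
  shows "xi_free \<nu> z x = of_real (sqrt (pi * x / 2) * (x / 2) powr \<nu>) *
     (\<Sum>k. (-1) ^ k / (fact k * Gamma (of_real \<nu> + of_nat k + 1)) * (z * (of_real x)\<^sup>2 / 4) ^ k)"
proof (cases "z = 0")
  case True
  have "(\<Sum>k. (-1) ^ k / (fact k * Gamma (complex_of_real \<nu> + of_nat k + 1)) * (0::complex) ^ k)
        = 1 / Gamma (complex_of_real \<nu> + 1)"
    using powser_zero[of "\<lambda>k. (-1) ^ k / (fact k * Gamma (complex_of_real \<nu> + of_nat k + 1))"]
    by simp
  moreover have "Gamma (complex_of_real \<nu> + 1) = of_real (Gamma (\<nu> + 1))"
    using Gamma_complex_of_real[of "\<nu> + 1"] by simp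
  ultimately show ?thesis
    using True by (simp add: xi_free_def)
next
  case False
  let ?w = "csqrt z * of_real x / 2"
  have w: "?w = exp (Ln z / 2 + of_real (ln (x / 2)))"
    using False assms by (simp add: csqrt_exp_Ln exp_add exp_of_real)
  have "- pi < Im (Ln z)" "Im (Ln z) \<le> pi"
    using False by (auto simp: mpi_less_Im_Ln Im_Ln_le_pi)
  then have "Ln ?w = Ln z / 2 + of_real (ln (x / 2))"
    unfolding w by (intro Ln_exp) auto
  moreover have "?w \<noteq> 0"
    using False assms by simp
  ultimately have "z powr (- of_real \<nu> / 2) * ?w powr of_real \<nu> = exp (of_real (\<nu> * ln (x / 2)))"
    using False by (simp add: powr_def exp_add [symmetric] algebra_simps)
  also have "\<dots> = of_real ((x / 2) powr \<nu>)"
    unfolding exp_of_real using assms by (simp add: powr_def)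
  finally have pre: "z powr (- of_real \<nu> / 2) * ?w powr of_real \<nu> = of_real ((x / 2) powr \<nu>)" .
  have sq: "?w ^ (2 * k) = (z * (of_real x)\<^sup>2 / 4) ^ k" for k
    by (simp add: power_mult power_mult_distrib power_divide)
  let ?S = "\<Sum>k. (-1) ^ k / (fact k * Gamma (of_real \<nu> + of_nat k + 1)) * (z * (of_real x)\<^sup>2 / 4) ^ k"
  have "xi_free \<nu> z x = z powr (- of_real \<nu> / 2) * of_real (sqrt (pi * x / 2)) * (?w powr of_real \<nu> * ?S)"
    using False unfolding xi_free_def bessel_J_def sq by simp
  also have "\<dots> = of_real (sqrt (pi * x / 2)) * (z powr (- of_real \<nu> / 2) * ?w powr of_real \<nu>) * ?S"
    by (simp only: mult_ac)
  also have "\<dots> = of_real (sqrt (pi * x / 2) * (x / 2) powr \<nu>) * ?S"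
    unfolding pre by simp
  finally show ?thesis .
qed


section \<open>The regular solution of the perturbed equation\<close>

definition potential :: "real \<Rightarrow> (real \<Rightarrow> real) \<Rightarrow> real \<Rightarrow> real" where
  "potential \<nu> q x = (\<nu>\<^sup>2 - 1 / 4) / x\<^sup>2 + q x"

text \<open>The derivative in \<open>x\<close> of a function on \<open>(0,b]\<close>, one-sided at \<open>b\<close>.\<close>

definition dx :: "real \<Rightarrow> (real \<Rightarrow> complex) \<Rightarrow> real \<Rightarrow> complex" where
  "dx b f x = vector_derivative f (at x within {0<..b})"

text \<open>The potential being continuous on \<open>(0,b]\<close>, solutions are classical.\<close>

definition solution :: "real \<Rightarrow> (real \<Rightarrow> real) \<Rightarrow> real \<Rightarrow> complex \<Rightarrow> (real \<Rightarrow> complex) \<Rightarrow> bool" where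
  "solution \<nu> q b z f \<longleftrightarrow> (\<forall>x\<in>{0<..b}.
     (f has_vector_derivative dx b f x) (at x within {0<..b}) \<and>
     (\<exists>f''. (dx b f has_vector_derivative f'') (at x within {0<..b}) \<and>
            - f'' + of_real (potential \<nu> q x) * f x = z * f x))"

text \<open>The two estimates determine \<open>\<xi>(z,x)\<close> for \<open>x \<in> (0,b]\<close>; values of \<open>\<xi>\<close> at other \<open>x\<close> are never used.\<close>

definition regular_solution ::
    "real \<Rightarrow> (real \<Rightarrow> real) \<Rightarrow> real \<Rightarrow> (complex \<Rightarrow> real \<Rightarrow> complex) \<Rightarrow> bool" where
  "regular_solution \<nu> q b \<xi> \<longleftrightarrow>
     (\<forall>z. solution \<nu> q b z (\<xi> z)) \<and>
     (\<exists>C. \<forall>z. \<forall>x\<in>{0<..b}.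
        cmod (\<xi> z x - xi_free \<nu> z x)
          \<le> C * (x / (1 + cmod (csqrt z) * x)) powr (\<nu> + 1 / 2) * exp (\<bar>Im (csqrt z)\<bar> * x) *
              (LBINT u:{0<..<x}. u * \<bar>q u\<bar> / (1 + cmod (csqrt z) * u)) \<and>
        cmod (dx b (\<xi> z) x - vector_derivative (xi_free \<nu> z) (at x))
          \<le> C * (x / (1 + cmod (csqrt z) * x)) powr (\<nu> - 1 / 2) * exp (\<bar>Im (csqrt z)\<bar> * x) *
              (LBINT u:{0<..<x}. u * \<bar>q u\<bar> / (1 + cmod (csqrt z) * u)))"


section \<open>The de Branges spaces\<close>

definition transform :: "(complex \<Rightarrow> real \<Rightarrow> complex) \<Rightarrow> real \<Rightarrow> (real \<Rightarrow> complex) \<Rightarrow> complex \<Rightarrow> complex" where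
  "transform \<xi> s \<phi> z = (LBINT x:{0<..<s}. \<xi> z x * \<phi> x)"

definition dB_space :: "(complex \<Rightarrow> real \<Rightarrow> complex) \<Rightarrow> real \<Rightarrow> (complex \<Rightarrow> complex) set" where
  "dB_space \<xi> s = transform \<xi> s ` L2 s"

text \<open>The next two definitions rely on \<open>\<phi> \<mapsto> F\<close> being injective modulo null sets.\<close>

definition dB_norm :: "(complex \<Rightarrow> real \<Rightarrow> complex) \<Rightarrow> real \<Rightarrow> (complex \<Rightarrow> complex) \<Rightarrow> real" where
  "dB_norm \<xi> s F = (THE r. \<exists>\<phi>\<in>L2 s. F = transform \<xi> s \<phi> \<and>
     r = sqrt (LBINT x:{0<..<s}. (cmod (\<phi> x))\<^sup>2))"

definition dB_inner ::
    "(complex \<Rightarrow> real \<Rightarrow> complex) \<Rightarrow> real \<Rightarrow> (complex \<Rightarrow> complex) \<Rightarrow> (complex \<Rightarrow> complex) \<Rightarrow> complex" where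
  "dB_inner \<xi> s F G = (THE c. \<exists>\<phi>\<in>L2 s. \<exists>\<psi>\<in>L2 s. F = transform \<xi> s \<phi> \<and> G = transform \<xi> s \<psi> \<and>
     c = (LBINT x:{0<..<s}. \<phi> x * cnj (\<psi> x)))"

definition dB_kernel :: "(complex \<Rightarrow> real \<Rightarrow> complex) \<Rightarrow> real \<Rightarrow> complex \<Rightarrow> complex \<Rightarrow> complex" where
  "dB_kernel \<xi> s z w = (LBINT x:{0<..<s}. \<xi> z x * \<xi> (cnj w) x)"

text \<open>The orthogonal projector of \<open>\<B>\<^sub>b\<close> onto its closed subspace \<open>\<B>\<^sub>a\<close>.\<close>

definition dB_proj ::
    "(complex \<Rightarrow> real \<Rightarrow> complex) \<Rightarrow> real \<Rightarrow> real \<Rightarrow> (complex \<Rightarrow> complex) \<Rightarrow> complex \<Rightarrow> complex" where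
  "dB_proj \<xi> a b F = (THE G. G \<in> dB_space \<xi> a \<and>
     (\<forall>H\<in>dB_space \<xi> a. dB_inner \<xi> b (\<lambda>z. F z - G z) H = 0))"


section \<open>The operators and their spectra\<close>

text \<open>The graph of \<open>H\<^bsub>s,\<gamma>\<^esub>\<close>: elements of the domain are given by their representatives with locally
  absolutely continuous derivative; the image \<open>g\<close> is determined almost everywhere.\<close>

definition H_graph ::
    "real \<Rightarrow> (real \<Rightarrow> real) \<Rightarrow> real \<Rightarrow> real \<Rightarrow> ((real \<Rightarrow> complex) \<times> (real \<Rightarrow> complex)) set" where
  "H_graph \<nu> q s \<gamma> = {(\<phi>, g). \<phi> \<in> L2 s \<and> g \<in> L2 s \<and>
     (\<forall>x\<in>{0<..s}. (\<phi> has_vector_derivative dx s \<phi> x) (at x within {0<..s})) \<and>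
     \<phi> \<in> AC_loc s \<and> dx s \<phi> \<in> AC_loc s \<and>
     (AE x in lborel. x \<in> {0<..<s} \<longrightarrow>
        (\<exists>\<phi>''. (dx s \<phi> has_vector_derivative \<phi>'') (at x) \<and>
               g x = - \<phi>'' + of_real (potential \<nu> q x) * \<phi> x)) \<and>
     \<phi> s * of_real (cos \<gamma>) + dx s \<phi> s * of_real (sin \<gamma>) = 0 \<and>
     (\<nu> \<in> {0<..<1} \<longrightarrow>
        ((\<lambda>x. of_real (x powr (\<nu> - 1 / 2)) * (of_real (\<nu> + 1 / 2) * \<phi> x - of_real x * dx s \<phi> x))
           \<longlongrightarrow> 0) (at_right 0))}"

definition S_graph ::
    "(complex \<Rightarrow> real \<Rightarrow> complex) \<Rightarrow> real \<Rightarrow> (real \<Rightarrow> real) \<Rightarrow> real \<Rightarrow> real \<Rightarrow>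
     ((complex \<Rightarrow> complex) \<times> (complex \<Rightarrow> complex)) set" where
  "S_graph \<xi> \<nu> q s \<gamma> = (\<lambda>(\<phi>, g). (transform \<xi> s \<phi>, transform \<xi> s g)) ` H_graph \<nu> q s \<gamma>"

text \<open>The spectrum of the operator with graph \<open>A\<close> in the space \<open>V\<close> of functions with norm \<open>N\<close>:
  those \<open>\<mu>\<close> for which \<open>A - \<mu>\<close> is not a bijection onto \<open>V\<close> with bounded inverse.\<close>

definition spectrum ::
    "(complex \<Rightarrow> complex) set \<Rightarrow> ((complex \<Rightarrow> complex) \<Rightarrow> real) \<Rightarrow>
     ((complex \<Rightarrow> complex) \<times> (complex \<Rightarrow> complex)) set \<Rightarrow> complex set" where
  "spectrum V N A = - {\<mu>.
     (\<forall>G\<in>V. \<exists>!F. (F, \<lambda>z. G z + \<mu> * F z) \<in> A) \<and>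
     (\<exists>C. \<forall>(F, G)\<in>A. N F \<le> C * N (\<lambda>z. G z - \<mu> * F z))}"

definition S_spectrum ::
    "(complex \<Rightarrow> real \<Rightarrow> complex) \<Rightarrow> real \<Rightarrow> (real \<Rightarrow> real) \<Rightarrow> real \<Rightarrow> real \<Rightarrow> complex set" where
  "S_spectrum \<xi> \<nu> q s \<gamma> = spectrum (dB_space \<xi> s) (dB_norm \<xi> s) (S_graph \<xi> \<nu> q s \<gamma>)"


section \<open>The sampling series\<close>

definition sampling_term ::
    "(complex \<Rightarrow> real \<Rightarrow> complex) \<Rightarrow> real \<Rightarrow> (complex \<Rightarrow> complex) \<Rightarrow> complex \<Rightarrow> complex \<Rightarrow> complex" where
  "sampling_term \<xi> a F z l = dB_kernel \<xi> a z l / dB_kernel \<xi> a l l * F l"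

definition sampling_series ::
    "(complex \<Rightarrow> real \<Rightarrow> complex) \<Rightarrow> real \<Rightarrow> (real \<Rightarrow> real) \<Rightarrow> real \<Rightarrow> real \<Rightarrow>
     (complex \<Rightarrow> complex) \<Rightarrow> complex \<Rightarrow> complex" where
  "sampling_series \<xi> \<nu> q a \<gamma> F z = (\<Sum>\<^sub>\<infinity>l\<in>S_spectrum \<xi> \<nu> q a \<gamma>. sampling_term \<xi> a F z l)"

end

theory Submission
  imports Defs "HOL-Library.Function_Algebras" "HOL-Complex_Analysis.Great_Picard"
begin

text \<open>Write \<open>F\<close> as the transform of \<open>\<phi>\<close>, and let \<open>\<phi>\<^sub>1\<close> be the restriction of \<open>\<phi>\<close> to \<open>[a,b)\<close>. On
  \<open>(0,a)\<close> the functions \<open>\<xi>(\<lambda>\<^sub>n,\<cdot>)\<close> form a complete orthogonal system, so the sampling series reproduces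
  the transform of the restriction of \<open>\<phi>\<close> to \<open>(0,a)\<close> exactly; only the contribution of \<open>\<phi>\<^sub>1\<close>, whose norm is
  that of \<open>(I - P)F\<close>, has to be bounded. By Lagrange's identity and the boundary condition,
  \<open>K(z,\<lambda>\<^sub>n) = O(|\<xi>(\<lambda>\<^sub>n,a)| / \<lambda>\<^sub>n)\<close> locally uniformly in \<open>z\<close>. For large \<open>\<lambda>\<^sub>n\<close> the energy
  \<open>E = |\<xi>'|\<^sup>2 + \<lambda>\<^sub>n |\<xi>|\<^sup>2\<close> is essentially constant on \<open>[a/2,b]\<close>, so that the \<open>n\<close>-th term is
  \<open>O(E / (\<lambda>\<^sub>n\<^sup>2 K(\<lambda>\<^sub>n,\<lambda>\<^sub>n)))\<close>. Moreover \<open>E\<close> is comparable to the integral of \<open>|\<xi>'|\<^sup>2\<close> over \<open>[a/2,a]\<close>, and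
  \<open>\<Sum>\<^sub>n |\<xi>'(\<lambda>\<^sub>n,x)|\<^sup>2 / (\<lambda>\<^sub>n\<^sup>2 K(\<lambda>\<^sub>n,\<lambda>\<^sub>n))\<close> is bounded by Bessel's inequality, since evaluating the derivative
  of a function in the image of Green's operator is a bounded functional. Completeness and the spectrum are obtained from
  Green's operator, built from \<open>\<xi>(m,\<cdot>)\<close> for \<open>m\<close> so negative that \<open>\<xi>(m,\<cdot>)\<close> is positive.\<close>

section \<open>Absolutely continuous functions\<close>

text \<open>No asymptotics of eigenvalues or eigenfunctions are derived. A term of the error series
  couples the value of \<open>\<xi>\<close> at the point a, through the kernel, with its mass on
  (a,b), so both are measured by one quantity, the energy, that hardly depends on the point.
  Evaluating \<open>green g\<close> only bounds the sum of |\<xi>|^2 / (l^2 K), one power of l short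
  of what E / (l^2 K) demands; its derivative gains that power, and averaging over an interval
  avoids the zeros of \<xi>'. The kernel has the right size because sin \<gamma> > 0 lets the
  boundary condition trade \<xi>'(l,a) for \<xi>(l,a). The domain of the operator is described by
  absolutely continuous derivatives and an equation valid almost everywhere, whence the real
  analysis at the start. At the singular endpoint one fact is decisive: a function of the domain has
  no boundary term at 0 against \<open>\<xi>\<close>. The spectrum is defined through the resolvent,
  which therefore has to be constructed at every complex number that is not an eigenvalue.\<close>

abbreviation nonoverlapping :: "(real \<times> real) set \<Rightarrow> bool" where
  "nonoverlapping \<equiv> pairwise (\<lambda>(u, v) (u', v'). {u<..<v} \<inter> {u'<..<v'} = {})"

abbreviation total_length :: "(real \<times> real) set \<Rightarrow> real" where
  "total_length I \<equiv> \<Sum>(u, v)\<in>I. v - u"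

abbreviation variation :: "(real \<Rightarrow> 'a::real_normed_vector) \<Rightarrow> (real \<times> real) set \<Rightarrow> real" where
  "variation f I \<equiv> \<Sum>(u, v)\<in>I. norm (f v - f u)"

lemma abs_continuous_onD:
  assumes "abs_continuous_on f c d" "\<epsilon> > 0"
  obtains \<delta> where "\<delta> > 0"
    "\<And>I. \<lbrakk>finite I; \<And>u v. (u, v) \<in> I \<Longrightarrow> c \<le> u \<and> u \<le> v \<and> v \<le> d;
      nonoverlapping I;
      total_length I < \<delta>\<rbrakk> \<Longrightarrow> variation f I < \<epsilon>"
proof -
  obtain \<delta> where \<delta>: "\<delta> > 0" "\<forall>I :: (real \<times> real) set.
        finite I \<and> (\<forall>(u, v)\<in>I. c \<le> u \<and> u \<le> v \<and> v \<le> d) \<and>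
        nonoverlapping I \<and>
        total_length I < \<delta>
        \<longrightarrow> variation f I < \<epsilon>"
    using assms unfolding abs_continuous_on_def by blast
  show thesis
  proof (rule that[OF \<delta>(1)])
    fix I :: "(real \<times> real) set"
    assume "finite I" "\<And>u v. (u, v) \<in> I \<Longrightarrow> c \<le> u \<and> u \<le> v \<and> v \<le> d"
      "nonoverlapping I" "total_length I < \<delta>"
    then show "variation f I < \<epsilon>"
      using \<delta>(2)[rule_format, of I] by blast
  qed
qed

lemma abs_continuous_onI:
  assumes "\<And>\<epsilon>. \<epsilon> > 0 \<Longrightarrow> \<exists>\<delta>>0. \<forall>I. finite I \<longrightarrow> (\<forall>u v. (u, v) \<in> I \<longrightarrow> c \<le> u \<and> u \<le> v \<and> v \<le> d) \<longrightarrow>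
      nonoverlapping I \<longrightarrow>
      total_length I < \<delta> \<longrightarrow> variation f I < \<epsilon>"
  shows "abs_continuous_on f c d"
  unfolding abs_continuous_on_def
proof (intro allI impI)
  fix \<epsilon> :: real assume "\<epsilon> > 0"
  from assms[OF this] obtain \<delta> where "\<delta> > 0" and
    *: "\<And>I. \<lbrakk>finite I; \<forall>u v. (u, v) \<in> I \<longrightarrow> c \<le> u \<and> u \<le> v \<and> v \<le> d;
      nonoverlapping I;
      total_length I < \<delta>\<rbrakk> \<Longrightarrow> variation f I < \<epsilon>"
    by blast
  show "\<exists>\<delta>>0. \<forall>I :: (real \<times> real) set.
        finite I \<and> (\<forall>(u, v)\<in>I. c \<le> u \<and> u \<le> v \<and> v \<le> d) \<and>
        nonoverlapping I \<and>
        total_length I < \<delta>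
        \<longrightarrow> variation f I < \<epsilon>"
    using \<open>\<delta> > 0\<close> * by (intro exI[of _ \<delta>]) auto
qed

lemma abs_continuous_on_diff_less:
  assumes "abs_continuous_on f c d" "\<epsilon> > 0"
  obtains \<delta> where "\<delta> > 0"
    "\<And>x y. \<lbrakk>x \<in> {c..d}; y \<in> {c..d}; \<bar>x - y\<bar> < \<delta>\<rbrakk> \<Longrightarrow> norm (f x - f y) < \<epsilon>"
proof -
  obtain \<delta> where \<delta>: "\<delta> > 0" and *: "\<And>I. \<lbrakk>finite I; \<And>u v. (u, v) \<in> I \<Longrightarrow> c \<le> u \<and> u \<le> v \<and> v \<le> d;
      nonoverlapping I;
      total_length I < \<delta>\<rbrakk> \<Longrightarrow> variation f I < \<epsilon>"
    using abs_continuous_onD[OF assms] by metis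
  have le: "norm (f y - f x) < \<epsilon>" if "x \<in> {c..d}" "y \<in> {c..d}" "\<bar>x - y\<bar> < \<delta>" "x \<le> y" for x y
    using *[of "{(x, y)}"] that by auto
  show thesis
  proof (rule that[OF \<delta>])
    fix x y assume "x \<in> {c..d}" "y \<in> {c..d}" "\<bar>x - y\<bar> < \<delta>"
    then show "norm (f x - f y) < \<epsilon>"
      using le[of x y] le[of y x] by (cases "x \<le> y") (auto simp: norm_minus_commute abs_minus_commute)
  qed
qed

lemma abs_continuous_on_imp_continuous_on:
  assumes "abs_continuous_on f c d"
  shows "continuous_on {c..d} f"
  unfolding continuous_on_iff dist_norm
proof (intro ballI allI impI)
  fix x \<epsilon> :: real assume x: "x \<in> {c..d}" and "\<epsilon> > 0"
  obtain \<delta> where "\<delta> > 0" "\<And>x y. \<lbrakk>x \<in> {c..d}; y \<in> {c..d}; \<bar>x - y\<bar> < \<delta>\<rbrakk> \<Longrightarrow> norm (f x - f y) < \<epsilon>"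
    using abs_continuous_on_diff_less[OF assms \<open>\<epsilon> > 0\<close>] by metis
  then show "\<exists>\<delta>>0. \<forall>x'\<in>{c..d}. norm (x' - x) < \<delta> \<longrightarrow> norm (f x' - f x) < \<epsilon>"
    using x by auto
qed

lemma abs_continuous_on_subset:
  assumes "abs_continuous_on f c d" "c \<le> c'" "d' \<le> d"
  shows "abs_continuous_on f c' d'"
proof (rule abs_continuous_onI)
  fix \<epsilon> :: real assume "\<epsilon> > 0"
  obtain \<delta> where \<delta>: "\<delta> > 0" and *: "\<And>I. \<lbrakk>finite I; \<And>u v. (u, v) \<in> I \<Longrightarrow> c \<le> u \<and> u \<le> v \<and> v \<le> d;
      nonoverlapping I;
      total_length I < \<delta>\<rbrakk> \<Longrightarrow> variation f I < \<epsilon>"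
    using abs_continuous_onD[OF assms(1) \<open>\<epsilon> > 0\<close>] by metis
  show "\<exists>\<delta>>0. \<forall>I. finite I \<longrightarrow> (\<forall>u v. (u, v) \<in> I \<longrightarrow> c' \<le> u \<and> u \<le> v \<and> v \<le> d') \<longrightarrow>
      nonoverlapping I \<longrightarrow>
      total_length I < \<delta> \<longrightarrow> variation f I < \<epsilon>"
  proof (intro exI[of _ \<delta>] conjI \<delta> allI impI)
    fix I :: "(real \<times> real) set"
    assume I: "finite I" "\<forall>u v. (u, v) \<in> I \<longrightarrow> c' \<le> u \<and> u \<le> v \<and> v \<le> d'"
      "nonoverlapping I" "total_length I < \<delta>"
    have "c \<le> u \<and> u \<le> v \<and> v \<le> d" if "(u, v) \<in> I" for u v
      using I(2) that assms(2,3) by force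
    then show "variation f I < \<epsilon>"
      using * I by blast
  qed
qed

text \<open>Sums, differences, products and functions that agree on the interval all reduce to this
  comparison of increments.\<close>

lemma abs_continuous_on_dominated2:
  assumes f: "abs_continuous_on f c d" and g: "abs_continuous_on g c d" and "A \<ge> 0" "B \<ge> 0"
    and le: "\<And>u v. \<lbrakk>c \<le> u; u \<le> v; v \<le> d\<rbrakk> \<Longrightarrow> norm (h v - h u) \<le> A * norm (f v - f u) + B * norm (g v - g u)"
  shows "abs_continuous_on h c d"
proof (rule abs_continuous_onI)
  fix \<epsilon> :: real assume "\<epsilon> > 0"
  \<comment> \<open>The extra 1 keeps the divisor positive when A = B = 0 and makes the final
    estimate strict.\<close>
  define e where "e = \<epsilon> / (A + B + 1)"
  have e: "e > 0"
    using \<open>\<epsilon> > 0\<close> \<open>A \<ge> 0\<close> \<open>B \<ge> 0\<close> by (simp add: e_def)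
  obtain \<delta>1 where \<delta>1: "\<delta>1 > 0" and *: "\<And>I. \<lbrakk>finite I; \<And>u v. (u, v) \<in> I \<Longrightarrow> c \<le> u \<and> u \<le> v \<and> v \<le> d;
      nonoverlapping I;
      total_length I < \<delta>1\<rbrakk> \<Longrightarrow> variation f I < e"
    using abs_continuous_onD[OF f e] by metis
  obtain \<delta>2 where \<delta>2: "\<delta>2 > 0" and **: "\<And>I. \<lbrakk>finite I; \<And>u v. (u, v) \<in> I \<Longrightarrow> c \<le> u \<and> u \<le> v \<and> v \<le> d;
      nonoverlapping I;
      total_length I < \<delta>2\<rbrakk> \<Longrightarrow> (\<Sum>(u, v)\<in>I. norm (g v - g u)) < e"
    using abs_continuous_onD[OF g e] by metis
  show "\<exists>\<delta>>0. \<forall>I. finite I \<longrightarrow> (\<forall>u v. (u, v) \<in> I \<longrightarrow> c \<le> u \<and> u \<le> v \<and> v \<le> d) \<longrightarrow>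
      nonoverlapping I \<longrightarrow>
      total_length I < \<delta> \<longrightarrow> (\<Sum>(u, v)\<in>I. norm (h v - h u)) < \<epsilon>"
  proof (intro exI[of _ "min \<delta>1 \<delta>2"] conjI allI impI)
    fix I :: "(real \<times> real) set"
    assume I: "finite I" "\<forall>u v. (u, v) \<in> I \<longrightarrow> c \<le> u \<and> u \<le> v \<and> v \<le> d"
      "nonoverlapping I" "total_length I < min \<delta>1 \<delta>2"
    have 1: "variation f I < e" and 2: "(\<Sum>(u, v)\<in>I. norm (g v - g u)) < e"
      using I by (auto intro!: * **)
    have "(\<Sum>(u, v)\<in>I. norm (h v - h u))
        \<le> (\<Sum>(u, v)\<in>I. A * norm (f v - f u) + B * norm (g v - g u))"
      using I(2) le by (intro sum_mono) (auto split: prod.splits)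
    also have "\<dots> = A * variation f I + B * (\<Sum>(u, v)\<in>I. norm (g v - g u))"
      by (simp add: case_prod_unfold sum.distrib sum_distrib_left)
    also have "\<dots> \<le> A * e + B * e"
      using 1 2 assms(3,4) by (intro add_mono mult_left_mono) auto
    also have "\<dots> < (A + B + 1) * e"
      using e by (simp add: algebra_simps)
    also have "\<dots> = \<epsilon>"
      using assms(3,4) by (simp add: e_def)
    finally show "(\<Sum>(u, v)\<in>I. norm (h v - h u)) < \<epsilon>" .
  qed (use \<delta>1 \<delta>2 in auto)
qed

lemma abs_continuous_on_add:
  "abs_continuous_on f c d \<Longrightarrow> abs_continuous_on g c d \<Longrightarrow> abs_continuous_on (\<lambda>x. f x + g x) c d"
  by (rule abs_continuous_on_dominated2[of f c d g 1 1])
     (auto simp: algebra_simps intro: order_trans[OF _ norm_triangle_ineq])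

lemma abs_continuous_on_diff:
  "abs_continuous_on f c d \<Longrightarrow> abs_continuous_on g c d \<Longrightarrow> abs_continuous_on (\<lambda>x. f x - g x) c d"
proof (rule abs_continuous_on_dominated2[of f c d g 1 1])
  fix u v
  have "(f v - g v) - (f u - g u) = (f v - f u) - (g v - g u)" by simp
  then have "norm ((f v - g v) - (f u - g u)) \<le> norm (f v - f u) + norm (g v - g u)"
    by (metis norm_triangle_ineq4)
  then show "norm ((f v - g v) - (f u - g u)) \<le> 1 * norm (f v - f u) + 1 * norm (g v - g u)"
    by simp
qed auto

lemma abs_continuous_on_mult:
  fixes f g :: "real \<Rightarrow> 'a::real_normed_algebra"
  assumes f: "abs_continuous_on f c d" and g: "abs_continuous_on g c d"
  shows "abs_continuous_on (\<lambda>x. f x * g x) c d"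
proof -
  have "bounded (f ` {c..d})" "bounded (g ` {c..d})"
    by (auto intro!: compact_imp_bounded compact_continuous_image abs_continuous_on_imp_continuous_on f g)
  then obtain A B where A: "A > 0" "\<And>x. x \<in> {c..d} \<Longrightarrow> norm (f x) \<le> A"
    and B: "B > 0" "\<And>x. x \<in> {c..d} \<Longrightarrow> norm (g x) \<le> B"
    by (auto simp: bounded_pos)
  show ?thesis
  proof (rule abs_continuous_on_dominated2[OF f g, of B A])
    fix u v assume uv: "c \<le> u" "u \<le> v" "v \<le> d"
    have "f v * g v - f u * g u = (f v - f u) * g v + f u * (g v - g u)"
      by (simp add: algebra_simps)
    also have "norm \<dots> \<le> norm (f v - f u) * norm (g v) + norm (f u) * norm (g v - g u)"
      by (intro order_trans[OF norm_triangle_ineq] add_mono norm_mult_ineq)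
    also have "\<dots> \<le> norm (f v - f u) * B + A * norm (g v - g u)"
      using uv by (intro add_mono mult_left_mono mult_right_mono A B) auto
    finally show "norm (f v * g v - f u * g u) \<le> B * norm (f v - f u) + A * norm (g v - g u)"
      by (simp add: mult.commute)
  qed (use A B in auto)
qed

lemma abs_continuous_on_lipschitz:
  assumes "\<And>u v. \<lbrakk>c \<le> u; u \<le> v; v \<le> d\<rbrakk> \<Longrightarrow> norm (f v - f u) \<le> L * (v - u)"
  shows "abs_continuous_on f c d"
proof (rule abs_continuous_onI)
  fix \<epsilon> :: real assume "\<epsilon> > 0"
  define M where "M = \<bar>L\<bar> + 1"
  have M: "M > 0" by (simp add: M_def)
  show "\<exists>\<delta>>0. \<forall>I. finite I \<longrightarrow> (\<forall>u v. (u, v) \<in> I \<longrightarrow> c \<le> u \<and> u \<le> v \<and> v \<le> d) \<longrightarrow>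
      nonoverlapping I \<longrightarrow>
      total_length I < \<delta> \<longrightarrow> variation f I < \<epsilon>"
  proof (intro exI[of _ "\<epsilon> / M"] conjI allI impI)
    fix I :: "(real \<times> real) set"
    assume I: "finite I" "\<forall>u v. (u, v) \<in> I \<longrightarrow> c \<le> u \<and> u \<le> v \<and> v \<le> d"
      "total_length I < \<epsilon> / M"
    have "variation f I \<le> (\<Sum>(u, v)\<in>I. M * (v - u))"
    proof (intro sum_mono, clarify)
      fix u v assume uv: "(u, v) \<in> I"
      then have "norm (f v - f u) \<le> L * (v - u)" using I(2) assms by auto
      also have "\<dots> \<le> M * (v - u)"
        using uv I(2) by (intro mult_right_mono) (auto simp: M_def)
      finally show "norm (f v - f u) \<le> M * (v - u)" .
    qed
    also have "\<dots> = M * total_length I"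
      by (simp add: case_prod_unfold sum_distrib_left)
    also have "\<dots> < \<epsilon>"
      using I(3) M by (simp add: field_simps)
    finally show "variation f I < \<epsilon>" .
  qed (use M \<open>\<epsilon> > 0\<close> in auto)
qed

lemma abs_continuous_on_C1:
  fixes f :: "real \<Rightarrow> 'a::real_normed_vector"
  assumes f: "\<And>x. x \<in> {c..d} \<Longrightarrow> (f has_vector_derivative f' x) (at x within {c..d})"
    and f': "continuous_on {c..d} f'"
  shows "abs_continuous_on f c d"
proof -
  have "bounded (f' ` {c..d})"
    by (auto intro!: compact_imp_bounded compact_continuous_image f')
  then obtain B where B: "\<And>x. x \<in> {c..d} \<Longrightarrow> norm (f' x) \<le> B"
    unfolding bounded_pos by blast
  show ?thesis
  proof (rule abs_continuous_on_lipschitz)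
    fix u v assume uv: "c \<le> u" "u \<le> v" "v \<le> d"
    have "norm (f v - f u) \<le> B * norm (v - u)"
    proof (rule differentiable_bound[of "{c..d}" f "\<lambda>x h. h *\<^sub>R f' x"])
      fix x assume x: "x \<in> {c..d}"
      show "(f has_derivative (\<lambda>h. h *\<^sub>R f' x)) (at x within {c..d})"
        using f[OF x] by (simp add: has_vector_derivative_def)
      have "onorm (\<lambda>h::real. h *\<^sub>R f' x) \<le> norm (f' x)"
        by (rule onorm_le) (simp add: mult.commute)
      then show "onorm (\<lambda>h. h *\<^sub>R f' x) \<le> B" using B[OF x] by simp
    qed (use uv in auto)
    then show "norm (f v - f u) \<le> B * (v - u)" using uv by simp
  qed
qed

text \<open>The pieces have disjoint interiors and lie in \<open>U\<close>, so their total length is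
  at most the measure of \<open>U\<close>, below the \<delta> of absolute continuity. The work is to
  turn tagged pieces into a set of endpoint pairs without merging any.\<close>

lemma abs_continuous_on_tagged_sum:
  fixes f :: "real \<Rightarrow> 'a::real_normed_vector" and p :: "(real \<times> real set) set"
  assumes ac: "\<And>I. \<lbrakk>finite I; \<And>u v. (u, v) \<in> I \<Longrightarrow> c \<le> u \<and> u \<le> v \<and> v \<le> d;
      nonoverlapping I;
      total_length I < \<delta>\<rbrakk> \<Longrightarrow> variation f I < \<epsilon>"
    and p: "p tagged_partial_division_of {c..d}"
    and U: "\<And>x K. (x, K) \<in> p \<Longrightarrow> K \<subseteq> U" "U \<in> lmeasurable" "measure lebesgue U < \<delta>"
  shows "(\<Sum>(x, K)\<in>p. norm (f (Sup K) - f (Inf K))) < \<epsilon>"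
proof -
  have fin: "finite p" using p by (rule tagged_partial_division_ofD)
  have intv: "\<exists>u v. K = {u..v} \<and> u \<le> v \<and> c \<le> u \<and> v \<le> d" if "(x, K) \<in> p" for x K
  proof -
    obtain u v :: real where uv: "K = {u..v}"
      using tagged_partial_division_ofD(4)[OF p \<open>(x, K) \<in> p\<close>] by auto
    moreover have "x \<in> K" "K \<subseteq> {c..d}"
      using tagged_partial_division_ofD(2,3)[OF p that] by auto
    ultimately show ?thesis by (intro exI[of _ u] exI[of _ v]) auto
  qed
  \<comment> \<open>Degenerate intervals add nothing to the sum, and they have no interior point, on
    which the injectivity argument rests.\<close>
  define p' where "p' = {(x, K) \<in> p. Inf K < Sup K}"
  have p': "p' \<subseteq> p" "finite p'" using fin by (auto simp: p'_def intro: finite_subset)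
  have p'tag: "p' tagged_partial_division_of {c..d}"
    using p p'(1) by (rule tagged_partial_division_subset)
  define \<phi> where "\<phi> = (\<lambda>K::real set. (Inf K, Sup K))"
  define I where "I = (\<phi> \<circ> snd) ` p'"
  have sep: "interior K \<inter> interior K' = {}" if "(x, K) \<in> p'" "(x', K') \<in> p'" "(x, K) \<noteq> (x', K')" for x K x' K'
    using tagged_partial_division_ofD(5)[OF p] that p'(1) by blast
  have form: "\<exists>u v. K = {u..v} \<and> u < v \<and> c \<le> u \<and> v \<le> d \<and> \<phi> K = (u, v)" if "(x, K) \<in> p'" for x K
  proof -
    from that have "(x, K) \<in> p" "Inf K < Sup K" by (auto simp: p'_def)
    from intv[OF this(1)] obtain u v where uv: "K = {u..v}" "u \<le> v" "c \<le> u" "v \<le> d" by blast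
    with \<open>Inf K < Sup K\<close> show ?thesis by (intro exI[of _ u] exI[of _ v]) (auto simp: \<phi>_def)
  qed
  have key: "\<exists>w. w \<in> interior K \<inter> interior K'" if K: "(x, K) \<in> p'" "(x', K') \<in> p'" and "\<phi> K = \<phi> K'" for x K x' K'
  proof -
    from form[OF K(1)] obtain u v where "K = {u..v}" "u < v" "\<phi> K = (u, v)" by blast
    moreover from form[OF K(2)] obtain u' v' where "K' = {u'..v'}" "\<phi> K' = (u', v')" by blast
    ultimately show ?thesis using that(3) by (intro exI[of _ "(u + v) / 2"]) auto
  qed
  have inj: "inj_on (\<phi> \<circ> snd) p'"
  proof (rule inj_onI)
    fix a b assume ab: "a \<in> p'" "b \<in> p'" and eq: "(\<phi> \<circ> snd) a = (\<phi> \<circ> snd) b"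
    obtain x K x' K' where ab2: "a = (x, K)" "b = (x', K')" by (metis prod.exhaust)
    show "a = b"
    proof (rule ccontr)
      assume "a \<noteq> b"
      then have "interior K \<inter> interior K' = {}" using sep ab ab2 by blast
      then show False using key[of x K x' K'] ab ab2 eq by auto
    qed
  qed
  have "(\<Sum>(x, K)\<in>p. norm (f (Sup K) - f (Inf K))) = (\<Sum>(x, K)\<in>p'. norm (f (Sup K) - f (Inf K)))"
  proof (rule sum.mono_neutral_right[OF fin p'(1)], clarify)
    fix x K assume xK: "(x, K) \<in> p" "(x, K) \<notin> p'"
    from intv[OF xK(1)] obtain u v where "K = {u..v}" "u \<le> v" by blast
    then show "norm (f (Sup K) - f (Inf K)) = 0"
      using xK by (auto simp: p'_def)
  qed
  also have "\<dots> = variation f I"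
    unfolding I_def by (subst sum.reindex[OF inj]) (auto simp: \<phi>_def case_prod_unfold)
  also have "\<dots> < \<epsilon>"
  proof (rule ac)
    show "finite I" using p'(2) by (simp add: I_def)
    show "c \<le> u \<and> u \<le> v \<and> v \<le> d" if uv: "(u, v) \<in> I" for u v
    proof -
      from uv obtain x K where "(x, K) \<in> p'" "\<phi> K = (u, v)" by (auto simp: I_def)
      with form[OF this(1)] show ?thesis by auto
    qed
    show "nonoverlapping I"
    proof (rule pairwiseI)
      fix i j assume ij: "i \<in> I" "j \<in> I" "i \<noteq> j"
      obtain x K x' K' where K: "(x, K) \<in> p'" "\<phi> K = i" "(x', K') \<in> p'" "\<phi> K' = j"
        using ij by (auto simp: I_def)
      obtain u v u' v' where uv: "i = (u, v)" "j = (u', v')" by (metis prod.exhaust)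
      have "K = {u..v}" "K' = {u'..v'}" using form[OF K(1)] form[OF K(3)] K uv by auto
      moreover have "(x, K) \<noteq> (x', K')" using K ij by auto
      ultimately have "{u<..<v} \<inter> {u'<..<v'} = {}"
        using sep[OF K(1,3)] by (metis interior_atLeastAtMost_real)
      then show "(case i of (u, v) \<Rightarrow> \<lambda>(u', v'). {u<..<v} \<inter> {u'<..<v'} = {}) j"
        unfolding uv by simp
    qed
    have "total_length I = (\<Sum>(x, K)\<in>p'. Sup K - Inf K)"
      unfolding I_def by (subst sum.reindex[OF inj]) (auto simp: \<phi>_def case_prod_unfold)
    also have "\<dots> = (\<Sum>(x, K)\<in>p'. measure lebesgue K)"
      by (intro sum.cong refl) (use form in fastforce)
    also have "\<dots> = sum (measure lebesgue) (snd ` p')"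
    proof (subst sum.reindex)
      show "inj_on snd p'" using inj by (rule inj_on_imageI2)
    qed (simp add: case_prod_unfold)
    also have "\<dots> = measure lebesgue (\<Union>(snd ` p'))"
      using content_division[OF partial_division_of_tagged_division[OF p'tag]] .
    also have "\<dots> \<le> measure lebesgue U"
    proof (rule measure_mono_fmeasurable)
      show "\<Union> (snd ` p') \<subseteq> U" using U(1) p'(1) by fastforce
      show "\<Union> (snd ` p') \<in> sets lebesgue"
        using p'(2) form by (intro sets.finite_Union) (auto dest!: form)
    qed (rule U)
    finally show "total_length I < \<delta>" using U(3) by simp
  qed
  finally show ?thesis .
qed

text \<open>The gauge at the points of the exceptional null set confines their intervals to a small open
  neighbourhood, where absolute continuity makes the total increment small.\<close>

theorem abs_continuous_on_has_integral:
  fixes f :: "real \<Rightarrow> 'a::banach"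
  assumes "c \<le> d" and ac: "abs_continuous_on f c d" and N: "negligible N"
    and der: "\<And>x. x \<in> {c..d} - N \<Longrightarrow> (f has_vector_derivative f' x) (at x within {c..d})"
  shows "(f' has_integral f d - f c) {c..d}"
proof -
  \<comment> \<open>On the null set f' is arbitrary; with the value 0 there, tags in
    \<open>N\<close> contribute only increments of f.\<close>
  define h where "h x = (if x \<in> N then 0 else f' x)" for x
  have "(h has_integral f d - f c) (cbox c d)"
    unfolding has_integral
  proof (intro allI impI)
    fix e :: real assume e: "e > 0"
    define e' where "e' = e / (2 * (d - c + 1))"
    have e': "e' > 0" using e \<open>c \<le> d\<close> by (simp add: e'_def)
    obtain \<delta> where \<delta>: "\<delta> > 0" and ac': "\<And>I. \<lbrakk>finite I; \<And>u v. (u, v) \<in> I \<Longrightarrow> c \<le> u \<and> u \<le> v \<and> v \<le> d;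
      nonoverlapping I;
      total_length I < \<delta>\<rbrakk> \<Longrightarrow> variation f I < e / 2"
      using abs_continuous_onD[OF ac, of "e / 2"] e by auto
    obtain U where U: "open U" "N \<subseteq> U" "U \<in> lmeasurable" "measure lebesgue U < \<delta>"
    proof -
      have Nl: "N \<in> lmeasurable" "measure lebesgue N = 0"
        using N by (auto simp: negligible_imp_measurable negligible_imp_measure0)
      obtain T where T: "open T" "N \<subseteq> T" "T - N \<in> lmeasurable" "emeasure lebesgue (T - N) < ennreal \<delta>"
        using sets_lebesgue_outer_open[OF fmeasurableD[OF Nl(1)] \<delta>] by blast
      have "T = N \<union> (T - N)" using T(2) by blast
      then have Tm: "T \<in> lmeasurable" "measure lebesgue T \<le> measure lebesgue N + measure lebesgue (T - N)"
        using fmeasurable.Un[OF Nl(1) T(3)] measure_Un_le[of N lebesgue "T - N"] Nl T(3)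
        by (auto dest: fmeasurableD)
      moreover have "measure lebesgue (T - N) < \<delta>"
        using T(3,4) \<delta> by (simp add: emeasure_eq_measure2 ennreal_less_iff)
      ultimately show thesis using T Nl by (intro that[of T]) auto
    qed
    have "\<exists>r>0. \<forall>y\<in>{c..d}. \<bar>y - x\<bar> < r \<longrightarrow> norm (f y - f x - (y - x) *\<^sub>R f' x) \<le> e' * \<bar>y - x\<bar>"
      if x: "x \<in> {c..d} - N" for x
      using der[OF x] e' unfolding has_vector_derivative_def has_derivative_within_alt by auto
    then obtain r where r: "\<And>x. x \<in> {c..d} - N \<Longrightarrow> r x > 0"
      and rd: "\<And>x y. \<lbrakk>x \<in> {c..d} - N; y \<in> {c..d}; \<bar>y - x\<bar> < r x\<rbrakk> \<Longrightarrow>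
            norm (f y - f x - (y - x) *\<^sub>R f' x) \<le> e' * \<bar>y - x\<bar>"
      by metis
    define \<gamma> where "\<gamma> x = (if x \<in> N then U else ball x (if x \<in> {c..d} then r x else 1))" for x
    have "gauge \<gamma>"
      using U r by (auto simp: gauge_def \<gamma>_def)
    moreover have "norm ((\<Sum>(x, K)\<in>\<D>. measure lborel K *\<^sub>R h x) - (f d - f c)) < e"
      if D: "\<D> tagged_division_of cbox c d" and fine: "\<gamma> fine \<D>" for \<D>
    proof -
      have Dp: "\<D> tagged_partial_division_of {c..d}"
        using D by (simp add: tagged_division_of_def)
      have fin: "finite \<D>" using D by (rule tagged_division_ofD)
      define \<D>1 \<D>2 where "\<D>1 = {(x, K) \<in> \<D>. x \<in> N}" and "\<D>2 = {(x, K) \<in> \<D>. x \<notin> N}"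
      have split: "\<D> = \<D>1 \<union> \<D>2" "\<D>1 \<inter> \<D>2 = {}" "finite \<D>1" "finite \<D>2"
        using fin by (auto simp: \<D>1_def \<D>2_def intro: finite_subset)
      define t where "t = (\<lambda>(x, K). measure lborel K *\<^sub>R h x - (f (Sup K) - f (Inf K)))"
      have "(\<Sum>(x, K)\<in>\<D>. measure lborel K *\<^sub>R h x) - (f d - f c) = sum t \<D>"
        using additive_tagged_division_1[OF \<open>c \<le> d\<close>, of \<D> f] D
        by (simp add: t_def sum_subtractf case_prod_unfold)
      also have "\<dots> = sum t \<D>1 + sum t \<D>2"
        using split by (simp add: sum.union_disjoint)
      finally have eq: "(\<Sum>(x, K)\<in>\<D>. measure lborel K *\<^sub>R h x) - (f d - f c) = sum t \<D>1 + sum t \<D>2" .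
      have "norm (sum t \<D>1) \<le> (\<Sum>z\<in>\<D>1. norm (t z))" by (rule norm_sum)
      also have "\<dots> = (\<Sum>(x, K)\<in>\<D>1. norm (f (Sup K) - f (Inf K)))"
        by (intro sum.cong) (auto simp: t_def \<D>1_def h_def norm_minus_commute)
      also have "\<dots> < e / 2"
      proof (rule abs_continuous_on_tagged_sum[of c d \<delta> f "e / 2" \<D>1 U])
        fix I :: "(real \<times> real) set"
        assume I: "finite I" "\<And>u v. (u, v) \<in> I \<Longrightarrow> c \<le> u \<and> u \<le> v \<and> v \<le> d"
          "nonoverlapping I" "total_length I < \<delta>"
        show "variation f I < e / 2" by (rule ac'[OF I])
      next
        show "\<D>1 tagged_partial_division_of {c..d}"
          using Dp by (rule tagged_partial_division_subset) (auto simp: \<D>1_def)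
        show "K \<subseteq> U" if "(x, K) \<in> \<D>1" for x K
          using that fine unfolding \<D>1_def fine_def \<gamma>_def by fastforce
      qed (use U in auto)
      finally have 1: "norm (sum t \<D>1) < e / 2" .
      have "norm (sum t \<D>2) \<le> (\<Sum>z\<in>\<D>2. norm (t z))" by (rule norm_sum)
      also have "\<dots> \<le> (\<Sum>(x, K)\<in>\<D>2. e' * measure lborel K)"
      proof (intro sum_mono, clarify)
        fix x K assume "(x, K) \<in> \<D>2"
        then have xK: "(x, K) \<in> \<D>" "x \<notin> N" by (auto simp: \<D>2_def)
        then obtain u v where K: "K = {u..v}"
          using tagged_division_ofD(4)[OF D] by (metis box_real(2))
        have xin: "x \<in> K" "K \<subseteq> {c..d}" using tagged_division_ofD(2,3)[OF D xK(1)] by auto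
        have x': "x \<in> {c..d} - N" using xin xK by auto
        have "K \<subseteq> \<gamma> x" using fine xK by (auto simp: fine_def)
        then have "K \<subseteq> ball x (r x)" using x' by (auto simp: \<gamma>_def)
        moreover have uvK: "u \<in> K" "v \<in> K" using xin K by auto
        ultimately have "u \<in> ball x (r x)" "v \<in> ball x (r x)" by auto
        then have uv: "u \<le> x" "x \<le> v" "\<bar>u - x\<bar> < r x" "\<bar>v - x\<bar> < r x" "u \<in> {c..d}" "v \<in> {c..d}"
          using xin K uvK by (auto simp: dist_real_def abs_minus_commute)
        \<comment> \<open>The tag lies between the endpoints, so the interval splits at it and the
          derivative estimate applies to either half.\<close>
        have "t (x, K) = - ((f v - f x - (v - x) *\<^sub>R f' x) - (f u - f x - (u - x) *\<^sub>R f' x))"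
          using uv xK K by (simp add: t_def h_def algebra_simps)
        also have "norm \<dots> \<le> e' * \<bar>v - x\<bar> + e' * \<bar>u - x\<bar>"
          unfolding norm_minus_cancel
          by (intro order_trans[OF norm_triangle_ineq4] add_mono rd x' uv)
        also have "\<dots> = e' * measure lborel K"
          using uv K by (simp add: algebra_simps)
        finally show "norm (t (x, K)) \<le> e' * measure lborel K" .
      qed
      also have "\<dots> \<le> (\<Sum>(x, K)\<in>\<D>. e' * measure lborel K)"
        using fin e' by (intro sum_mono2) (auto simp: \<D>2_def)
      also have "\<dots> = e' * (\<Sum>(x, K)\<in>\<D>. measure lborel K)"
        by (simp add: case_prod_unfold sum_distrib_left)
      also have "\<dots> = e' * (d - c)"
        using additive_content_tagged_division[OF D] \<open>c \<le> d\<close> by simp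
      also have "\<dots> < e / 2"
        using e \<open>c \<le> d\<close> by (simp add: e'_def field_simps)
      finally have 2: "norm (sum t \<D>2) < e / 2" .
      show ?thesis
        unfolding eq using norm_triangle_ineq[of "sum t \<D>1" "sum t \<D>2"] 1 2 by linarith
    qed
    ultimately show "\<exists>\<gamma>. gauge \<gamma> \<and> (\<forall>\<D>. \<D> tagged_division_of cbox c d \<and> \<gamma> fine \<D> \<longrightarrow>
        norm ((\<Sum>(x, K)\<in>\<D>. measure lborel K *\<^sub>R h x) - (f d - f c)) < e)"
      by (intro exI[of _ \<gamma>]) simp
  qed
  then have "(h has_integral f d - f c) {c..d}" by simp
  then show ?thesis
    by (rule has_integral_spike[OF N, rotated]) (auto simp: h_def)
qed

text \<open>Where differentiability fails, arbitrarily short intervals around x have a mean value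
  that is off by more than some \<eta>. Vitali's theorem picks disjoint ones covering almost all
  such points, and Henstock's lemma bounds their total deviation by \<eta> e / 2, hence their total
  length by e / 2.\<close>

theorem AE_has_vector_derivative_integral:
  fixes f :: "real \<Rightarrow> 'a::euclidean_space"
  assumes f: "f integrable_on {c..d}"
  obtains N where "negligible N"
    "\<And>x. x \<in> {c<..<d} - N \<Longrightarrow> ((\<lambda>y. integral {c..y} f) has_vector_derivative f x) (at x)"
proof -
  define F where "F x = integral {c..x} f" for x
  have sub: "F v - F u = integral {u..v} f" if "c \<le> u" "u \<le> v" "v \<le> d" for u v
  proof -
    have "f integrable_on {c..v}"
      using f that by (auto elim: integrable_subinterval_real)
    from Henstock_Kurzweil_Integration.integral_combine[OF that(1,2) this]
    show ?thesis by (simp add: F_def algebra_simps)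
  qed
  \<comment> \<open>A bad triple is a tag together with an interval around it, so a finite disjoint
    family of them is a tagged partial division.\<close>
  define bad where "bad \<eta> = {(x, u, v). c \<le> u \<and> u \<le> x \<and> x \<le> v \<and> v \<le> d \<and> u < v \<and>
      norm ((v - u) *\<^sub>R f x - integral {u..v} f) > \<eta> * (v - u)}" for \<eta>
  define B where "B \<eta> = {x. \<forall>\<delta>>0. \<exists>u v. (x, u, v) \<in> bad \<eta> \<and> v - u < \<delta>}" for \<eta>
  have negB: "negligible (B \<eta>)" if \<eta>: "\<eta> > 0" for \<eta>
    unfolding negligible_outer_le
  proof (intro allI impI)
    fix e :: real assume e: "e > 0"
    obtain \<gamma> where \<gamma>: "gauge \<gamma>"
      and hen: "\<And>p. \<lbrakk>p tagged_partial_division_of (cbox c d); \<gamma> fine p\<rbrakk> \<Longrightarrow>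
             (\<Sum>(x, K)\<in>p. norm (measure lborel K *\<^sub>R f x - integral K f)) < \<eta> * (e / 2)"
      using Henstock_lemma[of f c d "\<eta> * (e / 2)"] f e \<eta> by auto
    define K where "K = {(x, u, v) \<in> bad \<eta>. {u..v} \<subseteq> \<gamma> x}"
    define a r where "a = (\<lambda>(x::real, u, v). (u + v) / (2::real))" and "r = (\<lambda>(x::real, u, v). (v - u) / (2::real))"
    have cb: "cball (a i) (r i) = {fst (snd i)..snd (snd i)}" for i
      by (auto simp: a_def r_def cball_def dist_real_def abs_if field_simps split: prod.splits if_splits)
    have cov: "\<exists>i. i \<in> K \<and> x \<in> cball (a i) (r i) \<and> r i < \<delta>" if x: "x \<in> B \<eta>" and \<delta>: "\<delta> > 0" for x \<delta>
    proof -
      have "open (\<gamma> x)" "x \<in> \<gamma> x" using \<gamma> by (auto simp: gauge_def)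
      then obtain \<rho> where \<rho>: "\<rho> > 0" "ball x \<rho> \<subseteq> \<gamma> x" by (meson open_contains_ball)
      have "min \<rho> \<delta> > 0" using \<rho> \<delta> by simp
      then obtain u v where uv: "(x, u, v) \<in> bad \<eta>" "v - u < min \<rho> \<delta>"
        using x unfolding B_def by blast
      then have "u \<le> x" "x \<le> v" "u < v" by (auto simp: bad_def)
      then have "{u..v} \<subseteq> ball x \<rho>" using uv by (auto simp: dist_real_def)
      then have "(x, u, v) \<in> K" using uv \<rho> by (auto simp: K_def)
      moreover have "x \<in> cball (a (x, u, v)) (r (x, u, v))"
        unfolding cb using \<open>u \<le> x\<close> \<open>x \<le> v\<close> by simp
      moreover have "r (x, u, v) < \<delta>" using uv \<open>u < v\<close> by (simp add: r_def)
      ultimately show ?thesis by blast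
    qed
    have rpos: "r i > 0" if "i \<in> K" for i
      using that by (auto simp: K_def bad_def r_def)
    obtain C where C: "countable C" "C \<subseteq> K"
      "pairwise (\<lambda>i j. disjnt (cball (a i) (r i)) (cball (a j) (r j))) C"
      "negligible (B \<eta> - (\<Union>i\<in>C. cball (a i) (r i)))"
      using Vitali_covering_theorem_cballs[of K r "B \<eta>" a, OF rpos cov] by blast
    have bound: "measure lebesgue (\<Union>i\<in>C'. cball (a i) (r i)) \<le> e / 2" if C': "C' \<subseteq> C" "finite C'" for C'
    proof -
      define T where "T = (\<lambda>(x::real, u::real, v::real). (x, {u..v}))"
      have Kp: "c \<le> u \<and> u \<le> x \<and> x \<le> v \<and> v \<le> d \<and> u < v \<and> {u..v} \<subseteq> \<gamma> x \<and>
          norm ((v - u) *\<^sub>R f x - integral {u..v} f) > \<eta> * (v - u)" if "(x, u, v) \<in> C'" for x u v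
        using that C' C(2) by (auto simp: K_def bad_def)
      have inj: "inj_on T C'"
        by (rule inj_onI) (auto simp: T_def Icc_eq_Icc dest!: Kp)
      have dis: "{u..v} \<inter> {u'..v'} = {}" if "(x, u, v) \<in> C'" "(x', u', v') \<in> C'" "(x, u, v) \<noteq> (x', u', v')" for x u v x' u' v'
      proof -
        have "disjnt (cball (a (x, u, v)) (r (x, u, v))) (cball (a (x', u', v')) (r (x', u', v')))"
          using pairwiseD[OF C(3)] that C'(1) by blast
        then show ?thesis unfolding cb disjnt_def by simp
      qed
      have tag: "T ` C' tagged_partial_division_of cbox c d"
        unfolding tagged_partial_division_of_def
      proof (intro conjI allI impI)
        fix x1 K1 x2 K2 assume as: "(x1, K1) \<in> T ` C' \<and> (x2, K2) \<in> T ` C' \<and> (x1, K1) \<noteq> (x2, K2)"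
        obtain u1 v1 where 1: "(x1, u1, v1) \<in> C'" "K1 = {u1..v1}" using as by (auto simp: T_def)
        obtain u2 v2 where 2: "(x2, u2, v2) \<in> C'" "K2 = {u2..v2}" using as by (auto simp: T_def)
        have "K1 \<inter> K2 = {}" using dis[OF 1(1) 2(1)] 1 2 as by auto
        then show "interior K1 \<inter> interior K2 = {}"
          using interior_subset by blast
      next
        fix x L assume "(x, L) \<in> T ` C'"
        then obtain u v where uv: "(x, u, v) \<in> C'" "L = {u..v}" by (auto simp: T_def)
        show "x \<in> L" "L \<subseteq> cbox c d" using Kp[OF uv(1)] uv(2) by auto
        show "\<exists>a b. L = cbox a b" using uv(2) by (metis box_real(2))
      qed (use C'(2) in auto)
      have "\<gamma> fine T ` C'" unfolding fine_def T_def using Kp by fastforce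
      from hen[OF tag this] have "(\<Sum>(x, u, v)\<in>C'. norm (measure lborel {u..v} *\<^sub>R f x - integral {u..v} f)) < \<eta> * (e / 2)"
        by (subst (asm) sum.reindex[OF inj]) (simp add: T_def case_prod_unfold)
      moreover have "(\<Sum>(x, u, v)\<in>C'. \<eta> * (v - u)) \<le> (\<Sum>(x, u, v)\<in>C'. norm (measure lborel {u..v} *\<^sub>R f x - integral {u..v} f))"
        by (intro sum_mono) (auto dest!: Kp)
      ultimately have "(\<Sum>(x, u, v)\<in>C'. \<eta> * (v - u)) < \<eta> * (e / 2)" by linarith
      then have le: "(\<Sum>(x, u, v)\<in>C'. v - u) < e / 2"
        using \<eta> by (simp add: case_prod_unfold flip: sum_distrib_left)
      have "measure lebesgue (\<Union>i\<in>C'. cball (a i) (r i)) \<le> (\<Sum>i\<in>C'. measure lebesgue (cball (a i) (r i)))"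
        by (rule measure_UNION_le) (use C' in auto)
      also have "\<dots> = (\<Sum>(x, u, v)\<in>C'. v - u)"
        unfolding cb by (intro sum.cong refl) (auto dest!: Kp)
      finally show ?thesis using le by simp
    qed
    have meas: "(\<Union>i\<in>C. cball (a i) (r i)) \<in> lmeasurable" "measure lebesgue (\<Union>i\<in>C. cball (a i) (r i)) \<le> e / 2"
      using fmeasurable_UN_bound[OF C(1), of "\<lambda>i. cball (a i) (r i)" lebesgue "e / 2"]
        measure_UN_bound[OF C(1), of "\<lambda>i. cball (a i) (r i)" lebesgue "e / 2"] bound by auto
    let ?N = "B \<eta> - (\<Union>i\<in>C. cball (a i) (r i))"
    have N: "?N \<in> lmeasurable" "measure lebesgue ?N = 0"
      using C(4) by (auto simp: negligible_imp_measurable negligible_imp_measure0)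
    show "\<exists>T. B \<eta> \<subseteq> T \<and> T \<in> lmeasurable \<and> measure lebesgue T \<le> e"
    proof (intro exI[of _ "?N \<union> (\<Union>i\<in>C. cball (a i) (r i))"] conjI)
      show "?N \<union> (\<Union>i\<in>C. cball (a i) (r i)) \<in> lmeasurable"
        using N meas by (intro fmeasurable.Un)
      have "measure lebesgue (?N \<union> (\<Union>i\<in>C. cball (a i) (r i)))
          \<le> measure lebesgue ?N + measure lebesgue (\<Union>i\<in>C. cball (a i) (r i))"
        using N meas by (intro measure_Un_le fmeasurableD)
      then show "measure lebesgue (?N \<union> (\<Union>i\<in>C. cball (a i) (r i))) \<le> e"
        using N meas e by linarith
    qed auto
  qed
  \<comment> \<open>One null set for all \<eta>: failure at any \<eta> implies failure at some 1 /
    (n + 1).\<close>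
  define N where "N = (\<Union>n. B (1 / Suc n))"
  show thesis
  proof (rule that)
    show "negligible N"
      unfolding N_def by (intro negligible_countable_Union) (auto intro: negB)
    fix x assume x: "x \<in> {c<..<d} - N"
    have "((\<lambda>y. F y) has_vector_derivative f x) (at x)"
      unfolding has_vector_derivative_def has_derivative_at_alt
    proof (intro conjI allI impI)
      show "bounded_linear (\<lambda>h. h *\<^sub>R f x)" by (rule bounded_linear_scaleR_left)
      fix e :: real assume "e > 0"
      then obtain n where n: "1 / Suc n < e" using nat_approx_posE by metis
      have "x \<notin> B (1 / Suc n)" using x by (auto simp: N_def)
      then obtain \<delta> where \<delta>: "\<delta> > 0" "\<And>u v. (x, u, v) \<in> bad (1 / Suc n) \<Longrightarrow> v - u \<ge> \<delta>"
        unfolding B_def by force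
      have good: "norm ((v - u) *\<^sub>R f x - integral {u..v} f) \<le> e * (v - u)"
        if "c \<le> u" "u \<le> x" "x \<le> v" "v \<le> d" "v - u < \<delta>" for u v
      proof (cases "u < v")
        case True
        then have "norm ((v - u) *\<^sub>R f x - integral {u..v} f) \<le> 1 / Suc n * (v - u)"
          using \<delta>(2)[of u v] that unfolding bad_def by force
        also have "\<dots> \<le> e * (v - u)" using n True by (intro mult_right_mono) auto
        finally show ?thesis .
      next
        case False
        then have "u = v" using that by simp
        then show ?thesis by simp
      qed
      show "\<exists>d>0. \<forall>y. norm (y - x) < d \<longrightarrow> norm (F y - F x - (y - x) *\<^sub>R f x) \<le> e * norm (y - x)"
      proof (intro exI[of _ "min \<delta> (min (x - c) (d - x))"] conjI allI impI)
        fix y assume y: "norm (y - x) < min \<delta> (min (x - c) (d - x))"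
        show "norm (F y - F x - (y - x) *\<^sub>R f x) \<le> e * norm (y - x)"
        proof (cases "x \<le> y")
          case True
          then show ?thesis
            using good[of x y] sub[of x y] x y by (auto simp: norm_minus_commute)
        next
          case False
          have "F y - F x - (y - x) *\<^sub>R f x = (x - y) *\<^sub>R f x - integral {y..x} f"
            using sub[of y x] False x y by (auto simp: algebra_simps)
          then show ?thesis
            using good[of y x] False x y by auto
        qed
      qed (use \<delta> x in auto)
    qed
    then show "((\<lambda>y. integral {c..y} f) has_vector_derivative f x) (at x)"
      by (simp add: F_def)
  qed
qed

text \<open>The excess \<open>h n\<close> of |f| over the level n has small integral for large n,
  while the part below the level contributes at most n times the total length; the choice of
  \<delta> makes each of the two less than \<epsilon> / 2.\<close>

lemma abs_continuous_on_integral: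
  fixes f :: "real \<Rightarrow> 'a::euclidean_space"
  assumes f: "set_integrable lborel {c..d} f"
  shows "abs_continuous_on (\<lambda>x. integral {c..x} f) c d"
proof (rule abs_continuous_onI)
  fix \<epsilon> :: real assume e: "\<epsilon> > 0"
  define h where "h n t = indicator {c..d} t * max 0 (norm (f t) - real n)" for n t
  have fn: "integrable lborel (\<lambda>t. indicator {c..d} t * norm (f t))"
    using set_integrable_norm[OF f] by (simp add: set_integrable_def)
  have meas: "(\<lambda>t. indicator {c..d} t * norm (f t)) \<in> borel_measurable lborel"
    using fn by auto
  have h_eq: "h n t = max 0 (indicator {c..d} t * norm (f t) - indicator {c..d} t * real n)" for n t
    by (auto simp: h_def indicator_def)
  have hm: "h n \<in> borel_measurable lborel" for n
    unfolding h_eq[abs_def] using meas by measurable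
  have "(\<lambda>n. LINT t|lborel. h n t) \<longlonglongrightarrow> (LINT t::real|lborel. (0::real))"
  proof (rule integral_dominated_convergence[where w = "\<lambda>t. indicator {c..d} t * norm (f t)"])
    show "AE t in lborel. (\<lambda>n. h n t) \<longlonglongrightarrow> 0"
    proof (intro AE_I2 tendsto_eventually)
      fix t
      obtain n0 :: nat where "norm (f t) \<le> n0" using real_arch_simple by blast
      then show "\<forall>\<^sub>F n in sequentially. h n t = 0"
        by (intro eventually_sequentiallyI[of n0]) (auto simp: h_def)
    qed
    show "AE t in lborel. norm (h n t) \<le> indicator {c..d} t * norm (f t)" for n
      by (intro AE_I2) (auto simp: h_def indicator_def)
  qed (use fn hm in auto)
  then have "(\<lambda>n. LINT t|lborel. h n t) \<longlonglongrightarrow> 0" by simp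
  from order_tendstoD(2)[OF this, of "\<epsilon> / 2"] e
  obtain n where n: "(LINT t|lborel. h n t) < \<epsilon> / 2"
    by (auto simp: eventually_sequentially)
  have hi: "integrable lborel (h n)"
    by (rule Bochner_Integration.integrable_bound[OF fn hm]) (auto simp: h_def indicator_def)
  show "\<exists>\<delta>>0. \<forall>I. finite I \<longrightarrow> (\<forall>u v. (u, v) \<in> I \<longrightarrow> c \<le> u \<and> u \<le> v \<and> v \<le> d) \<longrightarrow>
      nonoverlapping I \<longrightarrow>
      total_length I < \<delta> \<longrightarrow> (\<Sum>(u, v)\<in>I. norm (integral {c..v} f - integral {c..u} f)) < \<epsilon>"
  proof (intro exI[of _ "\<epsilon> / (2 * (real n + 1))"] conjI allI impI)
    fix I :: "(real \<times> real) set"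
    assume I: "finite I" "\<forall>u v. (u, v) \<in> I \<longrightarrow> c \<le> u \<and> u \<le> v \<and> v \<le> d"
      and dis: "nonoverlapping I"
      and small: "total_length I < \<epsilon> / (2 * (real n + 1))"
    have one: "norm (integral {c..v} f - integral {c..u} f)
        \<le> (LINT t|lborel. indicator {u<..<v} t * h n t) + real n * (v - u)" if uv: "(u, v) \<in> I" for u v
    proof -
      have cuv: "c \<le> u" "u \<le> v" "v \<le> d" using I(2) uv by auto
      have fi: "set_integrable lborel {x..y} f" if "c \<le> x" "y \<le> d" for x y
        by (rule set_integrable_subset[OF f]) (use that in auto)
      have hui: "integrable lborel (\<lambda>t. indicator {u<..<v} t * h n t)"
        using integrable_mult_indicator[OF _ hi, of "{u<..<v}"] by simp
      have "f integrable_on {c..v}" using fi[of c v] cuv by (auto dest: set_borel_integral_eq_integral(1))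
      from Henstock_Kurzweil_Integration.integral_combine[OF cuv(1,2) this]
      have "integral {c..v} f - integral {c..u} f = integral {u..v} f" by (simp add: algebra_simps)
      also have "\<dots> = (LBINT t:{u..v}. f t)"
        using set_borel_integral_eq_integral(2)[OF fi[of u v]] cuv by simp
      also have "norm \<dots> \<le> (LBINT t:{u..v}. norm (f t))"
        unfolding set_lebesgue_integral_def using cuv
        by (rule_tac order_trans[OF integral_norm_bound]) (auto intro!: Bochner_Integration.integral_mono_AE)
      also have "\<dots> \<le> (LINT t|lborel. indicator {u<..<v} t * h n t + real n * indicator {u..v} t)"
        unfolding set_lebesgue_integral_def
      proof (rule integral_mono_AE)
        show "integrable lborel (\<lambda>t. indicator {u..v} t *\<^sub>R norm (f t))"
          using set_integrable_norm[OF fi[of u v]] cuv by (simp add: set_integrable_def)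
        show "integrable lborel (\<lambda>t. indicator {u<..<v} t * h n t + real n * indicator {u..v} t)"
          using hui cuv by (auto intro!: Bochner_Integration.integrable_add)
        have "AE t in lborel. t \<noteq> u" "AE t in lborel. t \<noteq> v" by (rule AE_lborel_singleton)+
        then show "AE t in lborel. indicator {u..v} t *\<^sub>R norm (f t)
            \<le> indicator {u<..<v} t * h n t + real n * indicator {u..v} t"
          by eventually_elim (use cuv in \<open>auto simp: indicator_def h_def\<close>)
      qed
      also have "\<dots> = (LINT t|lborel. indicator {u<..<v} t * h n t) + real n * (v - u)"
        using hui cuv by (subst Bochner_Integration.integral_add) auto
      finally show ?thesis .
    qed
    have disf: "disjoint_family_on (\<lambda>(u, v). {u<..<v}) I"
      using dis by (simp add: pairwise_def disjoint_family_on_def case_prod_unfold)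
    have "(\<Sum>(u, v)\<in>I. norm (integral {c..v} f - integral {c..u} f))
        \<le> (\<Sum>(u, v)\<in>I. (LINT t|lborel. indicator {u<..<v} t * h n t) + real n * (v - u))"
      using one by (intro sum_mono) auto
    also have "\<dots> = (\<Sum>i\<in>I. LINT t|lborel. indicator (case i of (u, v) \<Rightarrow> {u<..<v}) t * h n t) + real n * total_length I"
      by (simp add: case_prod_unfold sum.distrib sum_distrib_left)
    also have "(\<Sum>i\<in>I. LINT t|lborel. indicator (case i of (u, v) \<Rightarrow> {u<..<v}) t * h n t)
        = (LINT t|lborel. (\<Sum>i\<in>I. indicator (case i of (u, v) \<Rightarrow> {u<..<v}) t * h n t))"
    proof (rule Bochner_Integration.integral_sum[symmetric])
      fix i
      show "integrable lborel (\<lambda>t. indicator (case i of (u, v) \<Rightarrow> {u<..<v}) t * h n t)"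
        using integrable_mult_indicator[OF _ hi, of "case i of (u, v) \<Rightarrow> {u<..<v}"] by (auto split: prod.splits)
    qed
    also have "\<dots> = (LINT t|lborel. indicator (\<Union>i\<in>I. case i of (u, v) \<Rightarrow> {u<..<v}) t * h n t)"
      by (simp add: indicator_UN_disjoint[OF I(1) disf] sum_distrib_right)
    also have "\<dots> \<le> (LINT t|lborel. h n t)"
    proof (rule integral_mono)
      have "(\<Union>i\<in>I. case i of (u, v) \<Rightarrow> {u<..<v}) \<in> sets lborel"
        by (intro sets.finite_UN I) (auto split: prod.splits)
      from integrable_mult_indicator[OF this hi]
      show "integrable lborel (\<lambda>t. indicator (\<Union>i\<in>I. case i of (u, v) \<Rightarrow> {u<..<v}) t * h n t)" by simp
    next
      fix t
      have "h n t \<ge> 0" by (simp add: h_def)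
      then show "indicator (\<Union>i\<in>I. case i of (u, v) \<Rightarrow> {u<..<v}) t * h n t \<le> h n t"
        by (simp add: indicator_def)
    qed (rule hi)
    also have "(LINT t|lborel. h n t) + real n * total_length I
        \<le> (LINT t|lborel. h n t) + (real n + 1) * total_length I"
      using I(2) by (intro add_left_mono mult_right_mono sum_nonneg) auto
    also have "\<dots> < \<epsilon> / 2 + \<epsilon> / 2"
      using n small by (intro add_strict_mono) (auto simp: field_simps)
    finally show "(\<Sum>(u, v)\<in>I. norm (integral {c..v} f - integral {c..u} f)) < \<epsilon>" by simp
  qed (use e in auto)
qed

lemma of_real_cmod_sq: "(complex_of_real (cmod z))\<^sup>2 = z * cnj z"
  using complex_norm_square[of z] by simp

section \<open>Semi-inner product spaces\<close>

text \<open>Functions are not identified modulo null sets, so the form is only semidefinite and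
  all statements about vectors hold up to a vector of norm zero.\<close>

locale semi_inner =
  fixes V :: "'a::ab_group_add set" and sc :: "complex \<Rightarrow> 'a \<Rightarrow> 'a" and ip :: "'a \<Rightarrow> 'a \<Rightarrow> complex"
  assumes V_zero: "0 \<in> V"
    and V_add: "x \<in> V \<Longrightarrow> y \<in> V \<Longrightarrow> x + y \<in> V"
    and V_sc: "x \<in> V \<Longrightarrow> sc c x \<in> V"
    and sc_minus1: "sc (- 1) x = - x"
    and ip_add: "x \<in> V \<Longrightarrow> y \<in> V \<Longrightarrow> z \<in> V \<Longrightarrow> ip (x + y) z = ip x z + ip y z"
    and ip_sc: "x \<in> V \<Longrightarrow> y \<in> V \<Longrightarrow> ip (sc c x) y = c * ip x y"
    and ip_cnj: "x \<in> V \<Longrightarrow> y \<in> V \<Longrightarrow> ip y x = cnj (ip x y)"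
    and ip_nonneg: "x \<in> V \<Longrightarrow> 0 \<le> Re (ip x x)"
begin

definition nrm :: "'a \<Rightarrow> real" where "nrm x = sqrt (Re (ip x x))"

lemma V_minus: "x \<in> V \<Longrightarrow> - x \<in> V"
  using V_sc[of x "- 1"] by (simp add: sc_minus1)

lemma V_diff: "x \<in> V \<Longrightarrow> y \<in> V \<Longrightarrow> x - y \<in> V"
  using V_add[OF _ V_minus, of x y] by simp

lemma V_sum: "(\<And>i. i \<in> A \<Longrightarrow> f i \<in> V) \<Longrightarrow> sum f A \<in> V"
  by (induction A rule: infinite_finite_induct) (auto simp: V_zero V_add)

lemma ip_minus: "x \<in> V \<Longrightarrow> y \<in> V \<Longrightarrow> ip (- x) y = - ip x y"
  using ip_sc[of x y "- 1"] by (simp add: sc_minus1)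

lemma ip_diff: "x \<in> V \<Longrightarrow> y \<in> V \<Longrightarrow> z \<in> V \<Longrightarrow> ip (x - y) z = ip x z - ip y z"
  using ip_add[of x "- y" z] by (simp add: V_minus ip_minus)

lemma ip_zero_left: "y \<in> V \<Longrightarrow> ip 0 y = 0"
  using ip_diff[of 0 0 y] V_zero by simp

lemma ip_add_right: "x \<in> V \<Longrightarrow> y \<in> V \<Longrightarrow> z \<in> V \<Longrightarrow> ip x (y + z) = ip x y + ip x z"
  using ip_cnj[of "y + z" x] ip_cnj[of y x] ip_cnj[of z x] by (simp add: V_add ip_add)

lemma ip_diff_right: "x \<in> V \<Longrightarrow> y \<in> V \<Longrightarrow> z \<in> V \<Longrightarrow> ip x (y - z) = ip x y - ip x z"
  using ip_cnj[of "y - z" x] ip_cnj[of y x] ip_cnj[of z x] by (simp add: V_diff ip_diff)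

lemma ip_sc_right: "x \<in> V \<Longrightarrow> y \<in> V \<Longrightarrow> ip x (sc c y) = cnj c * ip x y"
  using ip_cnj[of "sc c y" x] ip_cnj[of y x] by (simp add: V_sc ip_sc)

lemma ip_sum: "(\<And>i. i \<in> A \<Longrightarrow> f i \<in> V) \<Longrightarrow> y \<in> V \<Longrightarrow> ip (sum f A) y = (\<Sum>i\<in>A. ip (f i) y)"
  by (induction A rule: infinite_finite_induct) (auto simp: ip_zero_left ip_add V_sum)

lemma nrm_nonneg: "x \<in> V \<Longrightarrow> 0 \<le> nrm x"
  using ip_nonneg by (simp add: nrm_def)

lemma nrm_sq: "x \<in> V \<Longrightarrow> (nrm x)\<^sup>2 = Re (ip x x)"
  using ip_nonneg by (simp add: nrm_def)

lemma ip_self: "x \<in> V \<Longrightarrow> ip x x = of_real ((nrm x)\<^sup>2)"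
proof -
  assume x: "x \<in> V"
  have "Im (ip x x) = 0" using ip_cnj[OF x x] by (simp add: complex_eq_iff)
  then show ?thesis using nrm_sq[OF x] by (simp add: complex_eq_iff)
qed

lemma nrm_sq_eqI: "x \<in> V \<Longrightarrow> ip x x = of_real r \<Longrightarrow> (nrm x)\<^sup>2 = r"
  by (simp add: nrm_sq)

lemma nrm_sc: "x \<in> V \<Longrightarrow> nrm (sc c x) = cmod c * nrm x"
proof -
  assume x: "x \<in> V"
  have "ip (sc c x) (sc c x) = c * cnj c * ip x x"
    using x by (simp add: ip_sc ip_sc_right V_sc)
  also have "\<dots> = of_real ((cmod c * nrm x)\<^sup>2)"
    unfolding ip_self[OF x] by (simp add: of_real_cmod_sq power_mult_distrib)
  finally have "(nrm (sc c x))\<^sup>2 = (cmod c * nrm x)\<^sup>2"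
    by (rule nrm_sq_eqI[OF V_sc[OF x]])
  then show ?thesis
    using nrm_nonneg[OF x] nrm_nonneg[OF V_sc[OF x]] by (simp add: power2_eq_iff_nonneg)
qed

lemma nrm_minus_commute: "x \<in> V \<Longrightarrow> y \<in> V \<Longrightarrow> nrm (x - y) = nrm (y - x)"
  using nrm_sc[of "x - y" "- 1"] by (simp add: V_diff sc_minus1)

text \<open>The optimal multiple of y exists only for nrm y > 0. In a semidefinite form nrm y can
  vanish for a nonzero y; then the quadratic inequality is linear in t and fails for large t unless
  ip x y = 0.\<close>

lemma cauchy_schwarz:
  assumes x: "x \<in> V" and y: "y \<in> V"
  shows "cmod (ip x y) \<le> nrm x * nrm y"
proof -
  define c where "c = ip x y"
  \<comment> \<open>The multiplier t times ip x y already has the right phase, so a real parameter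
    suffices.\<close>
  have ineq: "0 \<le> (nrm x)\<^sup>2 - 2 * t * (cmod c)\<^sup>2 + t\<^sup>2 * (cmod c)\<^sup>2 * (nrm y)\<^sup>2" for t :: real
  proof -
    let ?w = "of_real t * c"
    have yx: "ip y x = cnj c" using ip_cnj[OF x y] by (simp add: c_def)
    have "ip (x - sc ?w y) (x - sc ?w y) = ip x x - cnj ?w * ip x y - ?w * ip y x + ?w * cnj ?w * ip y y"
      using x y by (simp add: ip_diff ip_diff_right V_sc V_diff ip_sc ip_sc_right algebra_simps)
    also have "\<dots> = of_real ((nrm x)\<^sup>2 - 2 * t * (cmod c)\<^sup>2 + t\<^sup>2 * (cmod c)\<^sup>2 * (nrm y)\<^sup>2)"
      unfolding ip_self[OF x] ip_self[OF y] yx c_def[symmetric] of_real_add of_real_diff of_real_mult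
        of_real_power
      by (simp add: of_real_cmod_sq) (simp add: algebra_simps power2_eq_square)
    finally have "(nrm (x - sc ?w y))\<^sup>2 = (nrm x)\<^sup>2 - 2 * t * (cmod c)\<^sup>2 + t\<^sup>2 * (cmod c)\<^sup>2 * (nrm y)\<^sup>2"
      by (rule nrm_sq_eqI[OF V_diff[OF x V_sc[OF y]]])
    then show ?thesis by (metis zero_le_power2)
  qed
  have "(cmod c)\<^sup>2 \<le> (nrm x * nrm y)\<^sup>2"
  proof (cases "nrm y = 0")
    case True
    have "cmod c = 0"
    proof (rule ccontr)
      assume "cmod c \<noteq> 0"
      then have "((nrm x)\<^sup>2 + 1) / (cmod c)\<^sup>2 * (cmod c)\<^sup>2 = (nrm x)\<^sup>2 + 1" by simp
      then have "0 \<le> (nrm x)\<^sup>2 - 2 * ((nrm x)\<^sup>2 + 1)"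
        using ineq[of "((nrm x)\<^sup>2 + 1) / (cmod c)\<^sup>2"] True by (simp only: mult.assoc) simp
      moreover have "0 \<le> (nrm x)\<^sup>2" by simp
      ultimately show False by (smt (verit))
    qed
    then show ?thesis by simp
  next
    case False
    then have ny: "(nrm y)\<^sup>2 > 0" by simp
    have "(1 / (nrm y)\<^sup>2)\<^sup>2 * (cmod c)\<^sup>2 * (nrm y)\<^sup>2 = (cmod c)\<^sup>2 / (nrm y)\<^sup>2"
      using ny by (simp add: power_divide power2_eq_square)
    then have "(cmod c)\<^sup>2 / (nrm y)\<^sup>2 \<le> (nrm x)\<^sup>2"
      using ineq[of "1 / (nrm y)\<^sup>2"] by simp
    then show ?thesis
      using ny by (simp add: pos_divide_le_eq power_mult_distrib)
  qed
  then show ?thesis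
    unfolding c_def by (rule power2_le_imp_le) (intro mult_nonneg_nonneg nrm_nonneg x y)
qed

lemma nrm_triangle:
  assumes x: "x \<in> V" and y: "y \<in> V"
  shows "nrm (x + y) \<le> nrm x + nrm y"
proof (rule power2_le_imp_le)
  have "(nrm (x + y))\<^sup>2 = (nrm x)\<^sup>2 + (nrm y)\<^sup>2 + 2 * Re (ip x y)"
    using x y ip_cnj[OF x y] by (simp add: nrm_sq V_add ip_add ip_add_right)
  also have "Re (ip x y) \<le> nrm x * nrm y"
    using cauchy_schwarz[OF x y] complex_Re_le_cmod order_trans by blast
  finally show "(nrm (x + y))\<^sup>2 \<le> (nrm x + nrm y)\<^sup>2"
    by (simp add: power2_sum)
qed (use nrm_nonneg x y in auto)

lemma nrm_triangle_diff:
  assumes "x \<in> V" "y \<in> V" "z \<in> V"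
  shows "nrm (x - z) \<le> nrm (x - y) + nrm (y - z)"
  using nrm_triangle[of "x - y" "y - z"] assms by (simp add: V_diff)

lemma nrm_diff_ge:
  assumes "x \<in> V" "y \<in> V"
  shows "\<bar>nrm x - nrm y\<bar> \<le> nrm (x - y)"
  using nrm_triangle[of "x - y" y] nrm_triangle[of "y - x" x] nrm_minus_commute[of x y] assms
  by (simp add: V_diff abs_le_iff)

text \<open>Let m be the norm of T and g n a sequence in the unit ball with nrm (T (g n)) tending to
  m. Then T(T(g n)) - m^2 g n tends to 0, and compactness yields a limit w of T (g n) with T(T w) =
  m^2 w. Factoring T^2 - m^2 gives an eigenvector for m or for -m. Working with the limit of T (g n)
  instead of g n avoids any completeness of V.\<close>

lemma spectral:
  assumes TV: "\<And>x. x \<in> V \<Longrightarrow> T x \<in> V"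
    and Tadd: "\<And>x y. x \<in> V \<Longrightarrow> y \<in> V \<Longrightarrow> T (x + y) = T x + T y"
    and Tsc: "\<And>c x. x \<in> V \<Longrightarrow> T (sc c x) = sc c (T x)"
    and sym: "\<And>x y. x \<in> V \<Longrightarrow> y \<in> V \<Longrightarrow> ip (T x) y = ip x (T y)"
    and bd: "\<And>x. x \<in> V \<Longrightarrow> nrm (T x) \<le> K * nrm x"
    and cpt: "\<And>f :: nat \<Rightarrow> 'a. (\<And>n. f n \<in> V \<and> nrm (f n) \<le> 1) \<Longrightarrow>
        \<exists>k h. strict_mono (k :: nat \<Rightarrow> nat) \<and> h \<in> V \<and> (\<lambda>n. nrm (T (f (k n)) - h)) \<longlonglongrightarrow> 0"
    and f: "f \<in> V" "nrm (T f) > 0"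
  obtains \<tau> :: real and v where "\<tau> \<noteq> 0" "v \<in> V" "nrm v > 0" "nrm (T v - sc (of_real \<tau>) v) = 0"
proof -
  have Tdiff: "T (x - y) = T x - T y" if "x \<in> V" "y \<in> V" for x y
    using Tadd[OF that(1) V_minus[OF that(2)]] Tsc[OF that(2), of "- 1"] by (simp add: sc_minus1)
  define U where "U = {nrm (T x) | x. x \<in> V \<and> nrm x \<le> 1}"
  define m where "m = Sup U"
  have "nrm f \<noteq> 0" using bd[OF f(1)] f(2) by auto
  then have nf: "nrm f > 0" using nrm_nonneg[OF f(1)] by simp
  have bdd: "bdd_above U"
  proof (rule bdd_aboveI[of _ "\<bar>K\<bar>"])
    fix u assume "u \<in> U"
    then obtain x where x: "x \<in> V" "nrm x \<le> 1" "u = nrm (T x)" by (auto simp: U_def)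
    have "nrm (T x) \<le> K * nrm x" by (rule bd) fact
    also have "\<dots> \<le> \<bar>K\<bar> * 1"
      using x nrm_nonneg[OF x(1)] by (intro mult_mono) auto
    finally show "u \<le> \<bar>K\<bar>" using x by simp
  qed
  have upper: "nrm (T x) \<le> m * nrm x" if x: "x \<in> V" for x
  proof (cases "nrm x = 0")
    case True
    then show ?thesis using bd[OF x] by simp
  next
    case False
    then have nx: "nrm x > 0" using nrm_nonneg[OF x] by simp
    let ?y = "sc (of_real (1 / nrm x)) x"
    have "nrm ?y = 1" using nx nrm_sc[OF x, of "of_real (1 / nrm x)"] by (simp add: norm_divide)
    then have "nrm (T ?y) \<in> U" using V_sc[OF x] unfolding U_def by force
    then have "nrm (T ?y) \<le> m" unfolding m_def using bdd by (rule cSup_upper)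
    moreover have "nrm (T ?y) = nrm (T x) / nrm x"
      using Tsc[OF x, of "of_real (1 / nrm x)"] nx nrm_sc[OF TV[OF x], of "of_real (1 / nrm x)"]
      by (simp add: norm_divide)
    ultimately have "nrm (T x) / nrm x \<le> m" by simp
    then show ?thesis using nx by (simp add: pos_divide_le_eq)
  qed
  have m: "m > 0"
    using upper[OF f(1)] f(2) nf by (smt (verit) mult_nonpos_nonneg)
  have "\<exists>u. u \<in> V \<and> nrm u \<le> 1 \<and> nrm (T u) > m - 1 / Suc n" for n
  proof -
    have "U \<noteq> {}" using V_zero nrm_sq[OF V_zero] ip_zero_left[OF V_zero] unfolding U_def by force
    moreover have "m - 1 / Suc n < Sup U" by (simp add: m_def)
    ultimately obtain z where "z \<in> U" "z > m - 1 / Suc n" using less_cSup_iff[OF _ bdd] by blast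
    then show ?thesis by (auto simp: U_def)
  qed
  then obtain u where u: "\<And>n. u n \<in> V" "\<And>n. nrm (u n) \<le> 1" "\<And>n. nrm (T (u n)) > m - 1 / Suc n"
    by metis
  obtain k w where k: "strict_mono (k :: nat \<Rightarrow> nat)" and w: "w \<in> V"
    and lim: "(\<lambda>n. nrm (T (u (k n)) - w)) \<longlonglongrightarrow> 0"
    using cpt[of u] u by blast
  define g where "g n = u (k n)" for n
  have gV: "g n \<in> V" and g1: "nrm (g n) \<le> 1" for n using u by (auto simp: g_def)
  have limg: "(\<lambda>n. nrm (T (g n) - w)) \<longlonglongrightarrow> 0" using lim by (simp add: g_def)
  have Tg_le: "nrm (T (g n)) \<le> m" for n
  proof -
    have "nrm (T (g n)) \<le> m * nrm (g n)" by (rule upper[OF gV])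
    also have "\<dots> \<le> m * 1" using g1 m by (intro mult_left_mono) auto
    finally show ?thesis by simp
  qed
  have Tgm: "(\<lambda>n. nrm (T (g n))) \<longlonglongrightarrow> m"
  proof (rule tendsto_sandwich[of "\<lambda>n. m - 1 / Suc n" _ _ "\<lambda>_. m"])
    have "m - 1 / Suc n \<le> nrm (T (g n))" for n
    proof -
      have "1 / Suc (k n) \<le> 1 / Suc n"
        using seq_suble[OF k, of n] by (simp add: frac_le)
      then show ?thesis using u(3)[of "k n"] by (simp add: g_def)
    qed
    then show "\<forall>\<^sub>F n in sequentially. m - 1 / Suc n \<le> nrm (T (g n))" by simp
    show "(\<lambda>n. m - 1 / real (Suc n)) \<longlonglongrightarrow> m"
      using tendsto_diff[OF tendsto_const LIMSEQ_inverse_real_of_nat, of m] by (simp add: inverse_eq_divide)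
  qed (use Tg_le in auto)
  have nw: "nrm w = m"
  proof -
    have "(\<lambda>n. nrm (T (g n)) - nrm w) \<longlonglongrightarrow> 0"
      by (rule tendsto_rabs_zero_cancel, rule tendsto_sandwich[OF _ _ tendsto_const limg])
         (use nrm_diff_ge[OF TV[OF gV] w] in auto)
    then have "(\<lambda>n. nrm (T (g n))) \<longlonglongrightarrow> nrm w" by (simp add: LIM_zero_iff)
    then show ?thesis by (rule LIMSEQ_unique[OF _ Tgm])
  qed
  let ?m2 = "of_real (m\<^sup>2) :: complex"
  have res: "(\<lambda>n. nrm (T (T (g n)) - sc ?m2 (g n))) \<longlonglongrightarrow> 0"
  proof -
    \<comment> \<open>Symmetry turns both cross terms of the expanded square into -m^2 |T g|^2, and
      |T(T g)| is at most m |T g|. The bound tends to 0 because |T g| tends to m.\<close>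
    have sq: "(nrm (T (T (g n)) - sc ?m2 (g n)))\<^sup>2 \<le> m\<^sup>2 * (m\<^sup>2 - (nrm (T (g n)))\<^sup>2)" for n
    proof -
      note V = gV[of n] TV[OF gV[of n]] TV[OF TV[OF gV[of n]]] V_sc[OF gV[of n], of ?m2]
      have c1: "ip (T (T (g n))) (g n) = of_real ((nrm (T (g n)))\<^sup>2)"
        using sym[OF V(2) V(1)] ip_self[OF V(2)] by simp
      have c2: "ip (g n) (T (T (g n))) = of_real ((nrm (T (g n)))\<^sup>2)"
        using sym[OF V(1) V(2)] ip_self[OF V(2)] by simp
      have "ip (T (T (g n)) - sc ?m2 (g n)) (T (T (g n)) - sc ?m2 (g n))
          = ip (T (T (g n))) (T (T (g n))) - ?m2 * ip (T (T (g n))) (g n) - ?m2 * ip (g n) (T (T (g n)))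
            + ?m2 * ?m2 * ip (g n) (g n)"
        using V by (simp add: ip_diff ip_diff_right V_diff ip_sc ip_sc_right algebra_simps)
      also have "\<dots> = of_real ((nrm (T (T (g n))))\<^sup>2 - 2 * m\<^sup>2 * (nrm (T (g n)))\<^sup>2 + m\<^sup>2 * m\<^sup>2 * (nrm (g n))\<^sup>2)"
        unfolding c1 c2 ip_self[OF V(1)] ip_self[OF V(3)] by simp
      finally have "(nrm (T (T (g n)) - sc ?m2 (g n)))\<^sup>2
          = (nrm (T (T (g n))))\<^sup>2 - 2 * m\<^sup>2 * (nrm (T (g n)))\<^sup>2 + m\<^sup>2 * m\<^sup>2 * (nrm (g n))\<^sup>2"
        by (rule nrm_sq_eqI[OF V_diff[OF V(3,4)]])
      moreover have "(nrm (T (T (g n))))\<^sup>2 \<le> (m * nrm (T (g n)))\<^sup>2"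
        using upper[OF V(2)] nrm_nonneg[OF V(3)] by (intro power_mono)
      moreover have "m\<^sup>2 * m\<^sup>2 * (nrm (g n))\<^sup>2 \<le> m\<^sup>2 * m\<^sup>2 * 1"
        using g1[of n] nrm_nonneg[OF V(1)] by (intro mult_left_mono) (auto simp: power_le_one)
      ultimately show ?thesis by (simp add: algebra_simps power_mult_distrib)
    qed
    have "(\<lambda>n. m\<^sup>2 * (m\<^sup>2 - (nrm (T (g n)))\<^sup>2)) \<longlonglongrightarrow> m\<^sup>2 * (m\<^sup>2 - m\<^sup>2)"
      by (intro tendsto_intros Tgm)
    then have "(\<lambda>n. m\<^sup>2 * (m\<^sup>2 - (nrm (T (g n)))\<^sup>2)) \<longlonglongrightarrow> 0" by simp
    then have "(\<lambda>n. (nrm (T (T (g n)) - sc ?m2 (g n)))\<^sup>2) \<longlonglongrightarrow> 0"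
      by (rule tendsto_sandwich[OF _ _ tendsto_const, rotated 2]) (use sq in auto)
    then have "(\<lambda>n. sqrt ((nrm (T (T (g n)) - sc ?m2 (g n)))\<^sup>2)) \<longlonglongrightarrow> sqrt 0"
      by (rule tendsto_real_sqrt)
    then show ?thesis using nrm_nonneg[OF V_diff[OF TV[OF TV[OF gV]] V_sc[OF gV]]] by simp
  qed
  \<comment> \<open>Only T (g n) is known to converge, so T is applied once more: T(T w) is compared
    with m^2 T (g n), and that with m^2 w.\<close>
  have eig2: "nrm (T (T w) - sc ?m2 w) = 0"
  proof -
    let ?b = "\<lambda>n. m * (m * nrm (T (g n) - w) + nrm (T (T (g n)) - sc ?m2 (g n))) + m\<^sup>2 * nrm (T (g n) - w)"
    have "nrm (T (T w) - sc ?m2 w) \<le> ?b n" for n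
    proof -
      note V = gV[of n] TV[OF gV[of n]] TV[OF TV[OF gV[of n]]] V_sc[OF gV[of n], of ?m2] w TV[OF w] TV[OF TV[OF w]]
        V_sc[OF w, of ?m2]
      have scd: "sc ?m2 (T (g n)) - sc ?m2 w \<in> V" using V by (intro V_diff V_sc) auto
      have a: "nrm (T w - sc ?m2 (g n)) \<le> m * nrm (T (g n) - w) + nrm (T (T (g n)) - sc ?m2 (g n))"
      proof -
        have "nrm (T w - T (T (g n))) \<le> m * nrm (w - T (g n))"
          using upper[OF V_diff[OF V(5,2)]] Tdiff[OF V(5,2)] by simp
        then show ?thesis
          using nrm_triangle_diff[OF V(6,3,4)] nrm_minus_commute[OF V(5,2)] by simp
      qed
      have "nrm (T (T w) - T (sc ?m2 (g n))) \<le> m * nrm (T w - sc ?m2 (g n))"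
        using upper[OF V_diff[OF V(6,4)]] Tdiff[OF V(6,4)] by simp
      also have "\<dots> \<le> m * (m * nrm (T (g n) - w) + nrm (T (T (g n)) - sc ?m2 (g n)))"
        using a m by (intro mult_left_mono) auto
      finally have b: "nrm (T (T w) - sc ?m2 (T (g n))) \<le> m * (m * nrm (T (g n) - w) + nrm (T (T (g n)) - sc ?m2 (g n)))"
        using Tsc[OF V(1)] by simp
      have "ip (sc ?m2 (T (g n)) - sc ?m2 w) (sc ?m2 (T (g n)) - sc ?m2 w)
          = ?m2 * ?m2 * ip (T (g n) - w) (T (g n) - w)"
        using V V_sc[OF V(2), of ?m2]
        by (simp add: ip_diff ip_diff_right V_diff ip_sc ip_sc_right algebra_simps)
      also have "\<dots> = of_real ((m\<^sup>2 * nrm (T (g n) - w))\<^sup>2)"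
        using V by (simp add: ip_self V_diff power2_eq_square algebra_simps)
      finally have "(nrm (sc ?m2 (T (g n)) - sc ?m2 w))\<^sup>2 = (m\<^sup>2 * nrm (T (g n) - w))\<^sup>2"
        by (rule nrm_sq_eqI[OF scd])
      then have c: "nrm (sc ?m2 (T (g n)) - sc ?m2 w) = m\<^sup>2 * nrm (T (g n) - w)"
        using nrm_nonneg[OF scd] nrm_nonneg[OF V_diff[OF V(2,5)]] by (simp add: power2_eq_iff_nonneg)
      have "nrm (T (T w) - sc ?m2 w) \<le> nrm (T (T w) - sc ?m2 (T (g n))) + nrm (sc ?m2 (T (g n)) - sc ?m2 w)"
        by (rule nrm_triangle_diff[OF V(7) V_sc[OF V(2)] V(8)])
      also have "\<dots> \<le> ?b n"
        by (intro add_mono b) (simp only: c)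
      finally show ?thesis .
    qed
    moreover have "?b \<longlonglongrightarrow> m * (m * 0 + 0) + m\<^sup>2 * 0"
      by (intro tendsto_intros limg res)
    ultimately have "nrm (T (T w) - sc ?m2 w) \<le> 0"
      by (intro LIMSEQ_le_const[of ?b]) auto
    then show ?thesis using nrm_nonneg[OF V_diff[OF TV[OF TV[OF w]] V_sc[OF w]], of ?m2] by linarith
  qed
  \<comment> \<open>The vector (T - m)(T + m) w has norm 0: either (T + m) w has norm 0 and w
    belongs to -m, or it is an eigenvector for m.\<close>
  let ?y = "T w + sc (of_real m) w"
  have yV: "?y \<in> V" by (intro V_add TV V_sc w)
  show thesis
  proof (cases "nrm ?y = 0")
    case True
    have "nrm (T w - sc (of_real (- m)) w) = nrm ?y"
    proof -
      note V = w TV[OF w] V_sc[OF w, of "of_real m"] V_sc[OF w, of "of_real (- m)"]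
      have "ip (T w - sc (of_real (- m)) w) (T w - sc (of_real (- m)) w) = ip ?y ?y"
        using V by (simp add: ip_diff ip_diff_right ip_add ip_add_right V_diff V_add ip_sc ip_sc_right algebra_simps)
      then show ?thesis by (simp add: nrm_def)
    qed
    then have "nrm (T w - sc (of_real (- m)) w) = 0" using True by (rule trans)
    then show thesis using m nw w by (intro that[of "- m" w]) auto
  next
    case False
    then have ny: "nrm ?y > 0" using nrm_nonneg[OF yV] by simp
    have "nrm (T ?y - sc (of_real m) ?y) = nrm (T (T w) - sc ?m2 w)"
    proof -
      note V = w TV[OF w] TV[OF TV[OF w]] V_sc[OF w, of "of_real m"] V_sc[OF w, of ?m2] V_sc[OF TV[OF w], of "of_real m"]
         V_sc[OF yV, of "of_real m"] yV
      have Ty: "T ?y = T (T w) + sc (of_real m) (T w)" using V by (simp add: Tadd Tsc)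
      have "ip (T ?y - sc (of_real m) ?y) (T ?y - sc (of_real m) ?y) = ip (T (T w) - sc ?m2 w) (T (T w) - sc ?m2 w)"
        unfolding Ty using V
        by (simp add: ip_diff ip_diff_right ip_add ip_add_right V_diff V_add ip_sc ip_sc_right algebra_simps power2_eq_square)
      then show ?thesis by (simp add: nrm_def)
    qed
    then show thesis using m ny yV eig2 by (intro that[of m ?y]) auto
  qed
qed

end

section \<open>Orthogonal systems: Bessel, Riesz-Fischer and Parseval\<close>

locale orthogonal_family = semi_inner V sc ip
  for V :: "'a::ab_group_add set" and sc ip +
  fixes e :: "'i \<Rightarrow> 'a" and I :: "'i set"
  assumes eV: "i \<in> I \<Longrightarrow> e i \<in> V"
    and e_pos: "i \<in> I \<Longrightarrow> nrm (e i) > 0"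
    and e_orth: "i \<in> I \<Longrightarrow> j \<in> I \<Longrightarrow> i \<noteq> j \<Longrightarrow> ip (e i) (e j) = 0"
begin

lemma ip_comb_e:
  assumes "finite A" "A \<subseteq> I" "i \<in> I"
  shows "ip (\<Sum>j\<in>A. sc (m j) (e j)) (e i) = (if i \<in> A then m i * of_real ((nrm (e i))\<^sup>2) else 0)"
proof -
  have "ip (\<Sum>j\<in>A. sc (m j) (e j)) (e i) = (\<Sum>j\<in>A. m j * ip (e j) (e i))"
    using assms eV by (subst ip_sum) (auto simp: V_sc ip_sc intro!: sum.cong)
  also have "\<dots> = (\<Sum>j\<in>A. if j = i then m i * of_real ((nrm (e i))\<^sup>2) else 0)"
    using assms e_orth eV by (intro sum.cong refl) (auto simp: ip_self subset_eq)
  also have "\<dots> = (if i \<in> A then m i * of_real ((nrm (e i))\<^sup>2) else 0)"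
    using assms(1) by simp
  finally show ?thesis .
qed

lemma nrm_comb:
  assumes "finite A" "A \<subseteq> I"
  shows "(nrm (\<Sum>j\<in>A. sc (m j) (e j)))\<^sup>2 = (\<Sum>j\<in>A. (cmod (m j))\<^sup>2 * (nrm (e j))\<^sup>2)"
proof -
  let ?S = "\<Sum>j\<in>A. sc (m j) (e j)"
  have SV: "?S \<in> V" using assms eV by (intro V_sum V_sc) auto
  have e: "ip (e j) ?S = cnj (m j) * of_real ((nrm (e j))\<^sup>2)" if "j \<in> A" for j
    using ip_comb_e[OF assms, of j m] ip_cnj[OF SV eV, of j] that assms by auto
  have "ip ?S ?S = (\<Sum>j\<in>A. m j * ip (e j) ?S)"
    using assms eV SV by (subst ip_sum) (auto simp: V_sc ip_sc intro!: sum.cong)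
  also have "\<dots> = (\<Sum>j\<in>A. of_real ((cmod (m j))\<^sup>2 * (nrm (e j))\<^sup>2))"
    using e by (intro sum.cong refl) (simp add: of_real_cmod_sq)
  finally have "ip ?S ?S = of_real (\<Sum>j\<in>A. (cmod (m j))\<^sup>2 * (nrm (e j))\<^sup>2)" by simp
  then show ?thesis by (rule nrm_sq_eqI[OF SV])
qed

definition coef :: "'a \<Rightarrow> 'i \<Rightarrow> complex" where "coef f i = ip f (e i) / of_real ((nrm (e i))\<^sup>2)"

lemma nrm_diff_projection:
  assumes "finite A" "A \<subseteq> I" "f \<in> V"
  shows "(nrm (f - (\<Sum>j\<in>A. sc (coef f j) (e j))))\<^sup>2
    = (nrm f)\<^sup>2 - (\<Sum>j\<in>A. (cmod (ip f (e j)))\<^sup>2 / (nrm (e j))\<^sup>2)"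
proof -
  let ?S = "\<Sum>j\<in>A. sc (coef f j) (e j)"
  have SV: "?S \<in> V" using assms eV by (intro V_sum V_sc) auto
  have sq: "(cmod (coef f j))\<^sup>2 * (nrm (e j))\<^sup>2 = (cmod (ip f (e j)))\<^sup>2 / (nrm (e j))\<^sup>2" if "j \<in> A" for j
    using e_pos[of j] that assms(2)
    by (auto simp: coef_def norm_divide norm_power norm_mult power_divide field_simps power2_eq_square)
  have "ip ?S f = (\<Sum>j\<in>A. coef f j * ip (e j) f)"
    using assms eV by (subst ip_sum) (auto simp: V_sc ip_sc intro!: sum.cong)
  also have "\<dots> = (\<Sum>j\<in>A. of_real ((cmod (ip f (e j)))\<^sup>2 / (nrm (e j))\<^sup>2))"
  proof (intro sum.cong refl)
    fix j assume "j \<in> A"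
    then have "ip (e j) f = cnj (ip f (e j))" using ip_cnj[of f "e j"] assms eV by auto
    then show "coef f j * ip (e j) f = of_real ((cmod (ip f (e j)))\<^sup>2 / (nrm (e j))\<^sup>2)"
      by (simp add: coef_def of_real_cmod_sq)
  qed
  finally have Sf: "ip ?S f = of_real (\<Sum>j\<in>A. (cmod (ip f (e j)))\<^sup>2 / (nrm (e j))\<^sup>2)" by simp
  have SS: "ip ?S ?S = of_real (\<Sum>j\<in>A. (cmod (ip f (e j)))\<^sup>2 / (nrm (e j))\<^sup>2)"
    using ip_self[OF SV] nrm_comb[OF assms(1,2)] sq by simp
  have "ip (f - ?S) (f - ?S) = ip f f - cnj (ip ?S f) - ip ?S f + ip ?S ?S"
    using assms(3) SV ip_cnj[OF SV assms(3)] by (simp add: ip_diff ip_diff_right V_diff)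
  also have "\<dots> = of_real ((nrm f)\<^sup>2 - (\<Sum>j\<in>A. (cmod (ip f (e j)))\<^sup>2 / (nrm (e j))\<^sup>2))"
    unfolding Sf SS ip_self[OF assms(3)] by simp
  finally show ?thesis by (rule nrm_sq_eqI[OF V_diff[OF assms(3) SV]])
qed

lemma bessel:
  assumes "finite A" "A \<subseteq> I" "f \<in> V"
  shows "(\<Sum>j\<in>A. (cmod (ip f (e j)))\<^sup>2 / (nrm (e j))\<^sup>2) \<le> (nrm f)\<^sup>2"
  using nrm_diff_projection[OF assms] zero_le_power2[of "nrm (f - (\<Sum>j\<in>A. sc (coef f j) (e j)))"] by linarith

lemma bessel_summable:
  assumes "f \<in> V"
  shows "(\<lambda>j. (cmod (ip f (e j)))\<^sup>2 / (nrm (e j))\<^sup>2) summable_on I"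
  by (rule nonneg_bdd_above_summable_on) (auto intro!: bdd_aboveI[of _ "(nrm f)\<^sup>2"] bessel[OF _ _ assms])

end

locale complete_orthogonal_family = orthogonal_family +
  assumes complete: "\<And>f :: nat \<Rightarrow> 'a. (\<And>n. f n \<in> V) \<Longrightarrow>
      (\<And>\<epsilon>. \<epsilon> > 0 \<Longrightarrow> \<exists>N. \<forall>m\<ge>N. \<forall>n\<ge>N. nrm (f m - f n) < \<epsilon>) \<Longrightarrow>
      \<exists>h\<in>V. (\<lambda>n. nrm (f n - h)) \<longlonglongrightarrow> 0"
    and total: "\<And>f. f \<in> V \<Longrightarrow> (\<And>i. i \<in> I \<Longrightarrow> ip f (e i) = 0) \<Longrightarrow> nrm f = 0"
begin

text \<open>The index set is not enumerated. Finite sets that exhaust the sum up to 1 / (k + 1),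
  made increasing by unions, give a Cauchy sequence of partial sums whose limit is the required
  vector.\<close>

lemma riesz_fischer:
  assumes sm: "(\<lambda>i. (cmod (m i))\<^sup>2 * (nrm (e i))\<^sup>2) summable_on I"
  obtains h where "h \<in> V" "\<And>i. i \<in> I \<Longrightarrow> ip h (e i) = m i * of_real ((nrm (e i))\<^sup>2)"
    "((\<lambda>i. (cmod (m i))\<^sup>2 * (nrm (e i))\<^sup>2) has_sum (nrm h)\<^sup>2) I"
proof -
  define a where "a i = (cmod (m i))\<^sup>2 * (nrm (e i))\<^sup>2" for i
  have a0: "a i \<ge> 0" for i by (simp add: a_def)
  define t where "t = infsum a I"
  have ha: "(a has_sum t) I" using sm by (simp add: t_def a_def[abs_def])
  have le_t: "sum a B \<le> t" if "finite B" "B \<subseteq> I" for B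
    using finite_sum_le_has_sum[OF ha that] a0 by simp
  have "\<exists>A. finite A \<and> A \<subseteq> I \<and> t - sum a A < 1 / Suc k" for k
  proof -
    have "\<forall>\<^sub>F A in finite_subsets_at_top I. dist (sum a A) t < 1 / Suc k"
      using ha unfolding has_sum_def by (rule tendstoD) simp
    then obtain A where "finite A" "A \<subseteq> I" "dist (sum a A) t < 1 / Suc k"
      by (auto simp: eventually_finite_subsets_at_top)
    then show ?thesis by (intro exI[of _ A]) (auto simp: dist_real_def)
  qed
  then obtain A where A: "\<And>k. finite (A k)" "\<And>k. A k \<subseteq> I" "\<And>k. t - sum a (A k) < 1 / Suc k"
    by metis
  define B where "B k = (\<Union>j\<le>k. A j)" for k
  have B: "finite (B k)" "B k \<subseteq> I" "B k \<subseteq> B l" if "k \<le> l" for k l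
  proof -
    show "finite (B k)" "B k \<subseteq> I" using A by (auto simp: B_def)
    show "B k \<subseteq> B l" unfolding B_def using that by (intro UN_mono) auto
  qed
  have Bt: "t - sum a (B k) < 1 / Suc k" for k
  proof -
    have "sum a (A k) \<le> sum a (B k)"
      using B[of k k] a0 by (intro sum_mono2) (auto simp: B_def)
    then show ?thesis using A(3)[of k] by linarith
  qed
  define S where "S k = (\<Sum>j\<in>B k. sc (m j) (e j))" for k
  have SV: "S k \<in> V" for k unfolding S_def using B[of k k] eV by (intro V_sum V_sc) auto
  have Snorm: "(nrm (S k))\<^sup>2 = sum a (B k)" for k
    unfolding S_def a_def using B[of k k] by (intro nrm_comb) auto
  have Sdiff: "(nrm (S l - S k))\<^sup>2 < 1 / Suc k" if "k \<le> l" for k l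
  proof -
    have "S l - S k = (\<Sum>j\<in>B l - B k. sc (m j) (e j))"
      unfolding S_def using B[OF that] B[of l l] by (simp add: sum_diff)
    then have "(nrm (S l - S k))\<^sup>2 = sum a (B l - B k)"
      unfolding a_def using B[of l l] by (simp add: nrm_comb subset_eq)
    also have "\<dots> = sum a (B l) - sum a (B k)"
      using B[OF that] B[of l l] by (simp add: sum_diff)
    also have "\<dots> < 1 / Suc k"
      using le_t[of "B l"] Bt[of k] B[of l l] by simp
    finally show ?thesis .
  qed
  have "\<exists>h\<in>V. (\<lambda>n. nrm (S n - h)) \<longlonglongrightarrow> 0"
  proof (rule complete[OF SV])
    fix \<epsilon> :: real assume \<epsilon>: "\<epsilon> > 0"
    obtain N where N: "1 / Suc N < \<epsilon>\<^sup>2" using nat_approx_posE[of "\<epsilon>\<^sup>2"] \<epsilon> by auto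
    have le: "nrm (S l - S k) < \<epsilon>" if "N \<le> k" "k \<le> l" for k l
    proof (rule power2_less_imp_less)
      have "1 / Suc k \<le> 1 / Suc N" using that by (simp add: frac_le)
      then show "(nrm (S l - S k))\<^sup>2 < \<epsilon>\<^sup>2" using Sdiff[OF that(2)] N by linarith
    qed (use \<epsilon> in auto)
    show "\<exists>N. \<forall>m\<ge>N. \<forall>n\<ge>N. nrm (S m - S n) < \<epsilon>"
    proof (intro exI[of _ N] allI impI)
      fix m n assume "N \<le> m" "N \<le> n"
      then show "nrm (S m - S n) < \<epsilon>"
        using le[of n m] le[of m n] nrm_minus_commute[OF SV SV, of m n] by (cases "n \<le> m") auto
    qed
  qed
  then obtain h where h: "h \<in> V" and lim: "(\<lambda>n. nrm (S n - h)) \<longlonglongrightarrow> 0" by blast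
  have "ip h (e i) = m i * of_real ((nrm (e i))\<^sup>2)" if i: "i \<in> I" for i
  proof -
    have "(\<lambda>n. ip (S n) (e i) - ip h (e i)) \<longlonglongrightarrow> 0"
    proof (rule tendsto_norm_zero_cancel, rule tendsto_sandwich[OF _ _ tendsto_const])
      show "(\<lambda>n. nrm (S n - h) * nrm (e i)) \<longlonglongrightarrow> 0"
        using tendsto_mult_right[OF lim, of "nrm (e i)"] by simp
      show "\<forall>\<^sub>F n in sequentially. cmod (ip (S n) (e i) - ip h (e i)) \<le> nrm (S n - h) * nrm (e i)"
        using cauchy_schwarz[OF V_diff[OF SV h] eV[OF i]] ip_diff[OF SV h eV[OF i]] by simp
    qed simp
    then have l1: "(\<lambda>n. ip (S n) (e i)) \<longlonglongrightarrow> ip h (e i)" by (simp add: LIM_zero_iff)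
    have "(\<lambda>n. ip (S n) (e i)) \<longlonglongrightarrow> m i * of_real ((nrm (e i))\<^sup>2)"
    proof (cases "\<exists>n. i \<in> B n")
      case True
      then obtain n where n: "i \<in> B n" by blast
      show ?thesis
      proof (rule tendsto_eventually, rule eventually_sequentiallyI[of n])
        fix l assume "n \<le> l"
        then have "i \<in> B l" using B(3) n by blast
        then show "ip (S l) (e i) = m i * of_real ((nrm (e i))\<^sup>2)"
          unfolding S_def using ip_comb_e[of "B l" i m] B[of l l] i by simp
      qed
    next
      \<comment> \<open>An index in none of the \<open>B k\<close> could be added to each of them
        without exceeding \<open>t\<close>, so its term is at most 1 / (k + 1) for all k and hence
        0.\<close>
      case False
      have "a i \<le> 1 / Suc k" for k
      proof -
        have "sum a (insert i (B k)) \<le> t" using B[of k k] i by (intro le_t) auto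
        then show ?thesis using False B[of k k] Bt[of k] by simp
      qed
      then have "a i \<le> 0"
        using LIMSEQ_le_const[OF LIMSEQ_inverse_real_of_nat, of "a i"] by (auto simp: inverse_eq_divide)
      then have "a i = 0" using a0[of i] by simp
      then have "m i = 0" using e_pos[OF i] by (simp add: a_def)
      moreover have "ip (S l) (e i) = 0" for l
        unfolding S_def using ip_comb_e[of "B l" i m] B[of l l] i False by simp
      ultimately show ?thesis by simp
    qed
    from LIMSEQ_unique[OF l1 this] show ?thesis .
  qed
  moreover have "(nrm h)\<^sup>2 = t"
  proof -
    have "(\<lambda>n. nrm (S n) - nrm h) \<longlonglongrightarrow> 0"
      by (rule tendsto_rabs_zero_cancel, rule tendsto_sandwich[OF _ _ tendsto_const lim])
         (use nrm_diff_ge[OF SV h] in auto)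
    then have "(\<lambda>n. nrm (S n)) \<longlonglongrightarrow> nrm h" by (simp add: LIM_zero_iff)
    then have l1: "(\<lambda>n. (nrm (S n))\<^sup>2) \<longlonglongrightarrow> (nrm h)\<^sup>2" by (intro tendsto_power)
    have "(\<lambda>n. sum a (B n)) \<longlonglongrightarrow> t"
    proof (rule tendsto_sandwich[of "\<lambda>n. t - 1 / Suc n" _ _ "\<lambda>_. t"])
      show "\<forall>\<^sub>F n in sequentially. t - 1 / Suc n \<le> sum a (B n)"
        using Bt by (auto intro!: always_eventually simp: less_imp_le diff_le_eq add.commute) (smt (verit) Bt of_nat_Suc)
      show "(\<lambda>n. t - 1 / real (Suc n)) \<longlonglongrightarrow> t"
        using tendsto_diff[OF tendsto_const LIMSEQ_inverse_real_of_nat, of t] by (simp add: inverse_eq_divide)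
      show "\<forall>\<^sub>F n in sequentially. sum a (B n) \<le> t"
        by (intro always_eventually allI le_t B(1)[OF order_refl] B(2)[OF order_refl])
    qed auto
    from LIMSEQ_unique[OF l1[unfolded Snorm] this] show ?thesis .
  qed
  ultimately show thesis
    using h ha by (intro that[of h]) (auto simp: a_def[abs_def])
qed

text \<open>Totality identifies f, up to a vector of norm 0, with the vector that
  \<open>riesz_fischer\<close> builds from its coefficients; that vector comes with the norm
  identity.\<close>

lemma parseval_norm:
  assumes f: "f \<in> V"
  shows "((\<lambda>i. (cmod (ip f (e i)))\<^sup>2 / (nrm (e i))\<^sup>2) has_sum (nrm f)\<^sup>2) I"
proof -
  have eq: "(cmod (coef f i))\<^sup>2 * (nrm (e i))\<^sup>2 = (cmod (ip f (e i)))\<^sup>2 / (nrm (e i))\<^sup>2" if "i \<in> I" for i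
    using e_pos[OF that]
    by (auto simp: coef_def norm_divide norm_power norm_mult power_divide field_simps power2_eq_square)
  have "(\<lambda>i. (cmod (coef f i))\<^sup>2 * (nrm (e i))\<^sup>2) summable_on I"
    using bessel_summable[OF f] eq by (simp cong: summable_on_cong)
  then obtain h where h: "h \<in> V" "\<And>i. i \<in> I \<Longrightarrow> ip h (e i) = coef f i * of_real ((nrm (e i))\<^sup>2)"
    "((\<lambda>i. (cmod (coef f i))\<^sup>2 * (nrm (e i))\<^sup>2) has_sum (nrm h)\<^sup>2) I"
    by (rule riesz_fischer) blast
  have "nrm (f - h) = 0"
  proof (rule total)
    fix i assume i: "i \<in> I"
    then show "ip (f - h) (e i) = 0"
      using h(2)[OF i] e_pos[OF i] f h(1) eV[OF i] by (simp add: ip_diff coef_def)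
  qed (use f h in \<open>auto intro: V_diff\<close>)
  then have "nrm f = nrm h" using nrm_diff_ge[OF f h(1)] by simp
  then show ?thesis using h(3) has_sum_cong[of I, OF eq] by simp
qed

text \<open>The partial sums are inner products of projections of f with g, so Cauchy-Schwarz bounds
  the error by the norm of the remainder of f, which tends to 0 by
  \<open>parseval_norm\<close>.\<close>

theorem parseval:
  assumes f: "f \<in> V" and g: "g \<in> V"
  shows "((\<lambda>i. ip f (e i) * ip (e i) g / of_real ((nrm (e i))\<^sup>2)) has_sum ip f g) I"
proof -
  define S where "S A = (\<Sum>j\<in>A. sc (coef f j) (e j))" for A
  define r where "r A = (nrm f)\<^sup>2 - (\<Sum>j\<in>A. (cmod (ip f (e j)))\<^sup>2 / (nrm (e j))\<^sup>2)" for A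
  have "(r \<longlongrightarrow> (nrm f)\<^sup>2 - (nrm f)\<^sup>2) (finite_subsets_at_top I)"
    unfolding r_def using parseval_norm[OF f] unfolding has_sum_def by (intro tendsto_intros)
  then have "((\<lambda>A. sqrt (r A) * nrm g) \<longlongrightarrow> sqrt 0 * nrm g) (finite_subsets_at_top I)"
    by (intro tendsto_intros) simp
  then have lim: "((\<lambda>A. sqrt (r A) * nrm g) \<longlongrightarrow> 0) (finite_subsets_at_top I)" by simp
  have "((\<lambda>A. (\<Sum>i\<in>A. ip f (e i) * ip (e i) g / of_real ((nrm (e i))\<^sup>2)) - ip f g) \<longlongrightarrow> 0) (finite_subsets_at_top I)"
  proof (rule tendsto_norm_zero_cancel, rule tendsto_sandwich[OF _ _ tendsto_const lim])
    show "\<forall>\<^sub>F A in finite_subsets_at_top I.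
      cmod ((\<Sum>i\<in>A. ip f (e i) * ip (e i) g / of_real ((nrm (e i))\<^sup>2)) - ip f g) \<le> sqrt (r A) * nrm g"
    proof (rule eventually_finite_subsets_at_top_weakI)
      fix A assume A: "finite A" "A \<subseteq> I"
      have SV: "S A \<in> V" unfolding S_def using A eV by (intro V_sum V_sc) auto
      have "ip (S A) g = (\<Sum>i\<in>A. ip f (e i) * ip (e i) g / of_real ((nrm (e i))\<^sup>2))"
        unfolding S_def using A eV g by (subst ip_sum) (auto simp: V_sc ip_sc coef_def intro!: sum.cong)
      then have "cmod ((\<Sum>i\<in>A. ip f (e i) * ip (e i) g / of_real ((nrm (e i))\<^sup>2)) - ip f g) = cmod (ip (f - S A) g)"
        using f g SV by (simp add: ip_diff norm_minus_commute)
      also have "\<dots> \<le> nrm (f - S A) * nrm g"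
        using f g SV by (intro cauchy_schwarz V_diff)
      also have "nrm (f - S A) = sqrt (r A)"
        using nrm_diff_projection[OF A f] nrm_nonneg[OF V_diff[OF f SV]]
        by (simp add: r_def S_def real_sqrt_unique)
      finally show "cmod ((\<Sum>i\<in>A. ip f (e i) * ip (e i) g / of_real ((nrm (e i))\<^sup>2)) - ip f g) \<le> sqrt (r A) * nrm g" .
    qed
  qed simp
  then show ?thesis
    unfolding has_sum_def by (simp add: LIM_zero_iff)
qed

end

section \<open>The space of square integrable functions\<close>

lemma L2_iff:
  "f \<in> L2 s \<longleftrightarrow> set_borel_measurable lborel {0<..<s} f \<and> set_integrable lborel {0<..<s} (\<lambda>x. (cmod (f x))\<^sup>2)"
proof -
  have "(2::ereal) \<noteq> \<infinity>" by simp
  moreover have "real_of_ereal 2 = 2" by simp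
  ultimately show ?thesis by (simp add: Lp_def)
qed

text \<open>The simplifier turns the exponent into \<open>ereal 2\<close>, so both forms are needed.\<close>

lemmas L2_iffs = L2_iff L2_iff [unfolded numeral_eq_ereal]

lemma set_borel_measurable_mult:
  fixes f g :: "real \<Rightarrow> 'a::{real_normed_algebra, second_countable_topology}"
  assumes "set_borel_measurable lborel A f" "set_borel_measurable lborel A g"
  shows "set_borel_measurable lborel A (\<lambda>x. f x * g x)"
proof -
  have "(\<lambda>x. indicator A x *\<^sub>R (f x * g x)) = (\<lambda>x. (indicator A x *\<^sub>R f x) * (indicator A x *\<^sub>R g x))"
    by (auto simp: indicator_def fun_eq_iff)
  then show ?thesis
    using assms unfolding set_borel_measurable_def by (simp only:) (rule borel_measurable_times)
qed

lemma set_borel_measurable_add: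
  fixes f g :: "real \<Rightarrow> 'a::{real_normed_vector, second_countable_topology}"
  assumes "set_borel_measurable lborel A f" "set_borel_measurable lborel A g"
  shows "set_borel_measurable lborel A (\<lambda>x. f x + g x)"
  using borel_measurable_add[OF assms[unfolded set_borel_measurable_def]]
  unfolding set_borel_measurable_def by (simp add: scaleR_add_right)

lemma set_borel_measurable_comp:
  fixes f :: "real \<Rightarrow> 'a::real_normed_vector" and h :: "'a \<Rightarrow> 'b::real_normed_vector"
  assumes f: "set_borel_measurable lborel A f" and h: "continuous_on UNIV h" "h 0 = 0"
  shows "set_borel_measurable lborel A (\<lambda>x. h (f x))"
proof -
  have "(\<lambda>x. indicator A x *\<^sub>R h (f x)) = (\<lambda>x. h (indicator A x *\<^sub>R f x))"
    using h(2) by (auto simp: fun_eq_iff indicator_def)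
  moreover have "h \<in> borel_measurable borel"
    using h(1) by (rule borel_measurable_continuous_onI)
  ultimately show ?thesis
    using measurable_compose[OF f[unfolded set_borel_measurable_def]]
    unfolding set_borel_measurable_def by metis
qed

lemma set_borel_measurable_cnj:
  fixes f :: "real \<Rightarrow> complex"
  shows "set_borel_measurable lborel A f \<Longrightarrow> set_borel_measurable lborel A (\<lambda>x. cnj (f x))"
  by (erule set_borel_measurable_comp[where h = cnj])
     (auto intro: linear_continuous_on bounded_linear_cnj)

lemma set_borel_measurable_norm_sq:
  fixes f :: "real \<Rightarrow> 'a::real_normed_vector"
  shows "set_borel_measurable lborel A f \<Longrightarrow> set_borel_measurable lborel A (\<lambda>x. (norm (f x))\<^sup>2)"
  by (erule set_borel_measurable_comp[where h = "\<lambda>z. (norm z)\<^sup>2"]) (auto intro!: continuous_intros)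

lemma L2_mult_integrable:
  assumes f: "f \<in> L2 s" and g: "g \<in> L2 s"
  shows "set_integrable lborel {0<..<s} (\<lambda>x. f x * g x)"
proof (rule set_integrable_bound)
  show "set_integrable lborel {0<..<s} (\<lambda>x. (cmod (f x))\<^sup>2 + (cmod (g x))\<^sup>2)"
    using f g by (auto simp: L2_iffs)
  show "set_borel_measurable lborel {0<..<s} (\<lambda>x. f x * g x)"
    using f g by (auto simp: L2_iffs intro: set_borel_measurable_mult)
  have "cmod (f x * g x) \<le> (cmod (f x))\<^sup>2 + (cmod (g x))\<^sup>2" for x
  proof -
    have "0 \<le> cmod (f x) * cmod (g x)" by simp
    then show ?thesis
      using sum_squares_bound[of "cmod (f x)" "cmod (g x)"] by (simp only: norm_mult)
  qed
  then show "AE x in lborel. x \<in> {0<..<s} \<longrightarrow> cmod (f x * g x) \<le> norm ((cmod (f x))\<^sup>2 + (cmod (g x))\<^sup>2)"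
    by (intro AE_I2) auto
qed

lemma L2_cnj: "f \<in> L2 s \<Longrightarrow> (\<lambda>x. cnj (f x)) \<in> L2 s"
  by (auto simp: L2_iffs set_borel_measurable_cnj)

lemma L2_mult_cnj_integrable:
  "f \<in> L2 s \<Longrightarrow> g \<in> L2 s \<Longrightarrow> set_integrable lborel {0<..<s} (\<lambda>x. f x * cnj (g x))"
  by (intro L2_mult_integrable L2_cnj)

lemma L2_add:
  assumes f: "f \<in> L2 s" and g: "g \<in> L2 s"
  shows "(\<lambda>x. f x + g x) \<in> L2 s"
  unfolding L2_iff
proof
  show m: "set_borel_measurable lborel {0<..<s} (\<lambda>x. f x + g x)"
    using f g by (auto simp: L2_iffs intro: set_borel_measurable_add)
  show "set_integrable lborel {0<..<s} (\<lambda>x. (cmod (f x + g x))\<^sup>2)"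
  proof (rule set_integrable_bound)
    show "set_integrable lborel {0<..<s} (\<lambda>x. 2 * (cmod (f x))\<^sup>2 + 2 * (cmod (g x))\<^sup>2)"
      using f g by (auto simp: L2_iffs)
    show "set_borel_measurable lborel {0<..<s} (\<lambda>x. (cmod (f x + g x))\<^sup>2)"
      using m by (rule set_borel_measurable_norm_sq)
    have "(cmod (f x + g x))\<^sup>2 \<le> 2 * (cmod (f x))\<^sup>2 + 2 * (cmod (g x))\<^sup>2" for x
    proof -
      have "(cmod (f x + g x))\<^sup>2 \<le> (cmod (f x) + cmod (g x))\<^sup>2"
        by (intro power_mono norm_triangle_ineq) auto
      also have "\<dots> \<le> 2 * (cmod (f x))\<^sup>2 + 2 * (cmod (g x))\<^sup>2"
        using sum_squares_bound[of "cmod (f x)" "cmod (g x)"] by (simp add: power2_sum)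
      finally show ?thesis .
    qed
    then show "AE x in lborel. x \<in> {0<..<s} \<longrightarrow> norm ((cmod (f x + g x))\<^sup>2) \<le> norm (2 * (cmod (f x))\<^sup>2 + 2 * (cmod (g x))\<^sup>2)"
      by (intro AE_I2) auto
  qed
qed

lemma L2_scale: "f \<in> L2 s \<Longrightarrow> (\<lambda>x. c * f x) \<in> L2 s"
proof -
  assume f: "f \<in> L2 s"
  then have "set_borel_measurable lborel {0<..<s} f" by (simp add: L2_iffs)
  then have "set_borel_measurable lborel {0<..<s} (\<lambda>x. c * f x)"
    by (rule set_borel_measurable_comp) (auto intro!: continuous_intros)
  moreover have "set_integrable lborel {0<..<s} (\<lambda>x. (cmod (c * f x))\<^sup>2)"
    using f by (auto simp: L2_iffs norm_mult power_mult_distrib)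
  ultimately show ?thesis by (simp add: L2_iffs)
qed

lemma L2_zero: "(\<lambda>x. 0) \<in> L2 s"
  by (simp add: L2_iffs set_borel_measurable_def set_integrable_def)

lemma L2_diff: "f \<in> L2 s \<Longrightarrow> g \<in> L2 s \<Longrightarrow> (\<lambda>x. f x - g x) \<in> L2 s"
  using L2_add[OF _ L2_scale[of g s "- 1"], of f] by simp

lemma L2_bounded:
  assumes "set_borel_measurable lborel {0<..<s} f" "\<And>x. x \<in> {0<..<s} \<Longrightarrow> cmod (f x) \<le> B"
  shows "f \<in> L2 s"
  unfolding L2_iff
proof
  show "set_integrable lborel {0<..<s} (\<lambda>x. (cmod (f x))\<^sup>2)"
  proof (rule set_integrable_bound)
    show "set_integrable lborel {0<..<s} (\<lambda>x. B\<^sup>2)"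
      by (cases "0 \<le> s") (auto simp: set_integrable_def)
    show "set_borel_measurable lborel {0<..<s} (\<lambda>x. (cmod (f x))\<^sup>2)"
      using assms(1) by (rule set_borel_measurable_norm_sq)
    have "(cmod (f x))\<^sup>2 \<le> B\<^sup>2" if "x \<in> {0<..<s}" for x
      using assms(2)[OF that] by (intro power_mono) auto
    then show "AE x in lborel. x \<in> {0<..<s} \<longrightarrow> norm ((cmod (f x))\<^sup>2) \<le> norm (B\<^sup>2)"
      by (intro AE_I2) auto
  qed
qed fact

lemma set_borel_measurable_continuous:
  fixes f :: "real \<Rightarrow> 'a::real_normed_vector"
  assumes "continuous_on {0<..<s} f"
  shows "set_borel_measurable lborel {0<..<s} f"
  unfolding set_borel_measurable_def
  using borel_measurable_continuous_on_indicator[OF _ assms] by simp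

lemma L2_continuous_bounded:
  assumes "continuous_on {0<..<s} f" "\<And>x. x \<in> {0<..<s} \<Longrightarrow> cmod (f x) \<le> B"
  shows "f \<in> L2 s"
  by (rule L2_bounded[OF set_borel_measurable_continuous[OF assms(1)] assms(2)])

lemma L2_integrable: "f \<in> L2 s \<Longrightarrow> set_integrable lborel {0<..<s} f"
  using L2_mult_integrable[of f s "\<lambda>_. 1"] L2_continuous_bounded[of s "\<lambda>_. 1" 1] by simp

lemma L2_subset:
  assumes "f \<in> L2 s" "t \<le> s"
  shows "f \<in> L2 t"
proof -
  have "set_borel_measurable lborel {0<..<t} f"
    using assms by (auto simp: L2_iffs intro: set_borel_measurable_subset[of lborel "{0<..<s}"])
  moreover have "set_integrable lborel {0<..<t} (\<lambda>x. (cmod (f x))\<^sup>2)"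
    using assms by (auto simp: L2_iffs intro: set_integrable_subset[of lborel "{0<..<s}"])
  ultimately show ?thesis by (simp add: L2_iffs)
qed

lemma L2_cutoff:
  assumes "f \<in> L2 s" "S \<in> sets borel"
  shows "(\<lambda>x. if x \<in> S then f x else 0) \<in> L2 s"
  unfolding L2_iff
proof
  have eq: "(\<lambda>x. indicator {0<..<s} x *\<^sub>R (if x \<in> S then f x else 0)) = (\<lambda>x. indicator S x *\<^sub>R (indicator {0<..<s} x *\<^sub>R f x))"
    by (auto simp: indicator_def fun_eq_iff)
  show "set_borel_measurable lborel {0<..<s} (\<lambda>x. if x \<in> S then f x else 0)"
    unfolding set_borel_measurable_def eq using assms
    by (rule_tac borel_measurable_scaleR[OF borel_measurable_indicator]) (auto simp: L2_iffs set_borel_measurable_def)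
  have eq2: "(\<lambda>x. indicator {0<..<s} x *\<^sub>R (cmod (if x \<in> S then f x else 0))\<^sup>2) = (\<lambda>x. indicator S x *\<^sub>R (indicator {0<..<s} x *\<^sub>R (cmod (f x))\<^sup>2))"
    by (auto simp: indicator_def fun_eq_iff)
  show "set_integrable lborel {0<..<s} (\<lambda>x. (cmod (if x \<in> S then f x else 0))\<^sup>2)"
    unfolding set_integrable_def eq2 using assms
    by (rule_tac integrable_mult_indicator) (auto simp: L2_iffs set_integrable_def)
qed

lemma L2_AE_cong:
  assumes "f \<in> L2 s" "set_borel_measurable lborel {0<..<s} g" "AE x in lborel. x \<in> {0<..<s} \<longrightarrow> g x = f x"
  shows "g \<in> L2 s"
proof -
  have m: "set_borel_measurable lborel {0<..<s} f" "set_integrable lborel {0<..<s} (\<lambda>x. (cmod (f x))\<^sup>2)"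
    using assms(1) by (auto simp: L2_iffs)
  have gm: "set_borel_measurable lborel {0<..<s} (\<lambda>x. (cmod (g x))\<^sup>2)"
    using assms(2) by (rule set_borel_measurable_norm_sq)
  have "set_integrable lborel {0<..<s} (\<lambda>x. (cmod (g x))\<^sup>2)"
    by (rule set_integrable_bound[OF m(2) gm]) (use assms(3) in eventually_elim, auto)
  then show ?thesis using assms(2) by (simp add: L2_iffs)
qed

definition ip2 :: "real \<Rightarrow> (real \<Rightarrow> complex) \<Rightarrow> (real \<Rightarrow> complex) \<Rightarrow> complex" where
  "ip2 s f g = (LBINT x:{0<..<s}. f x * cnj (g x))"

lemma set_integral_cnj: "(LINT x:A|M. cnj (f x)) = cnj (LINT x:A|M. f x)"
  unfolding set_lebesgue_integral_def
  using Bochner_Integration.integral_cnj[of M "\<lambda>x. indicator A x *\<^sub>R f x"] by simp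

lemma ip2_self: "ip2 s f f = of_real (LBINT x:{0<..<s}. (cmod (f x))\<^sup>2)"
proof -
  have "ip2 s f f = (LBINT x:{0<..<s}. of_real ((cmod (f x))\<^sup>2))"
    unfolding ip2_def by (simp add: of_real_cmod_sq)
  also have "\<dots> = of_real (LBINT x:{0<..<s}. (cmod (f x))\<^sup>2)"
    unfolding set_lebesgue_integral_def
    by (subst integral_complex_of_real[symmetric]) (simp add: scaleR_conv_of_real)
  finally show ?thesis .
qed

global_interpretation L2: semi_inner "L2 s" "\<lambda>c f x. c * f x" "ip2 s" for s
proof
  show "0 \<in> L2 s" using L2_zero by (simp add: zero_fun_def)
  show "\<And>x y. x \<in> L2 s \<Longrightarrow> y \<in> L2 s \<Longrightarrow> x + y \<in> L2 s"
    using L2_add by (simp add: plus_fun_def)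
  show "\<And>x c. x \<in> L2 s \<Longrightarrow> (\<lambda>xa. c * x xa) \<in> L2 s" by (rule L2_scale)
  show "\<And>x. (\<lambda>xa. - 1 * x xa) = - (x :: real \<Rightarrow> complex)" by (simp add: fun_eq_iff)
  show "\<And>x y z. x \<in> L2 s \<Longrightarrow> y \<in> L2 s \<Longrightarrow> z \<in> L2 s \<Longrightarrow> ip2 s (x + y) z = ip2 s x z + ip2 s y z"
  proof -
    fix x y z assume "x \<in> L2 s" "y \<in> L2 s" "z \<in> L2 s"
    then have "set_integrable lborel {0<..<s} (\<lambda>t. x t * cnj (z t))" "set_integrable lborel {0<..<s} (\<lambda>t. y t * cnj (z t))"
      by (auto intro: L2_mult_cnj_integrable)
    from set_integral_add(2)[OF this] show "ip2 s (x + y) z = ip2 s x z + ip2 s y z"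
      by (simp add: ip2_def distrib_right)
  qed
  show "\<And>x y c. x \<in> L2 s \<Longrightarrow> y \<in> L2 s \<Longrightarrow> ip2 s (\<lambda>xa. c * x xa) y = c * ip2 s x y"
    by (simp add: ip2_def mult.assoc)
  show "\<And>x y. x \<in> L2 s \<Longrightarrow> y \<in> L2 s \<Longrightarrow> ip2 s y x = cnj (ip2 s x y)"
    by (simp add: ip2_def mult.commute flip: set_integral_cnj)
  show "\<And>x. x \<in> L2 s \<Longrightarrow> 0 \<le> Re (ip2 s x x)"
    unfolding ip2_self Re_complex_of_real set_lebesgue_integral_def by (auto intro!: integral_nonneg)
qed

abbreviation nrm2 :: "real \<Rightarrow> (real \<Rightarrow> complex) \<Rightarrow> real" where "nrm2 s \<equiv> L2.nrm s"

lemma nrm2_eq: "nrm2 s f = sqrt (LBINT x:{0<..<s}. (cmod (f x))\<^sup>2)"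
  by (simp add: L2.nrm_def ip2_self)

lemma nrm2_sq: "f \<in> L2 s \<Longrightarrow> (nrm2 s f)\<^sup>2 = (LBINT x:{0<..<s}. (cmod (f x))\<^sup>2)"
  by (simp add: L2.nrm_sq ip2_self)

lemma nrm2_eq_0_iff:
  assumes "f \<in> L2 s"
  shows "nrm2 s f = 0 \<longleftrightarrow> (AE x in lborel. x \<in> {0<..<s} \<longrightarrow> f x = 0)"
proof -
  have "nrm2 s f = 0 \<longleftrightarrow> (LINT x|lborel. indicator {0<..<s} x *\<^sub>R (cmod (f x))\<^sup>2) = 0"
    by (simp add: nrm2_eq set_lebesgue_integral_def)
  also have "\<dots> \<longleftrightarrow> (AE x in lborel. indicator {0<..<s} x *\<^sub>R (cmod (f x))\<^sup>2 = 0)"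
    using assms by (intro integral_nonneg_eq_0_iff_AE) (auto simp: L2_iffs set_integrable_def)
  also have "\<dots> \<longleftrightarrow> (AE x in lborel. x \<in> {0<..<s} \<longrightarrow> f x = 0)"
    by (intro AE_cong) (auto simp: indicator_def)
  finally show ?thesis .
qed

lemma L2_integral_le:
  assumes f: "f \<in> L2 s" and g: "g \<in> L2 s"
  shows "cmod (LBINT x:{0<..<s}. f x * g x) \<le> nrm2 s f * nrm2 s g"
proof -
  have "(LBINT x:{0<..<s}. f x * g x) = ip2 s f (\<lambda>x. cnj (g x))"
    by (simp add: ip2_def)
  moreover have "nrm2 s (\<lambda>x. cnj (g x)) = nrm2 s g"
    by (simp add: nrm2_eq)
  ultimately show ?thesis
    using L2.cauchy_schwarz[OF f L2_cnj[OF g]] by simp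
qed

text \<open>Cauchy-Schwarz against the constant 1; it converts L2 control into L1 control on the
  bounded interval.\<close>

lemma L2_norm_integral_le:
  assumes f: "f \<in> L2 s" and "s > 0"
  shows "(LBINT x:{0<..<s}. cmod (f x)) \<le> sqrt s * nrm2 s f"
proof -
  have fm: "(\<lambda>x. of_real (cmod (f x))) \<in> L2 s"
  proof -
    have "set_borel_measurable lborel {0<..<s} f" using f by (simp add: L2_iffs)
    then have "set_borel_measurable lborel {0<..<s} (\<lambda>x. complex_of_real (cmod (f x)))"
      by (rule set_borel_measurable_comp) (auto intro!: continuous_intros)
    then show ?thesis using f by (simp add: L2_iffs)
  qed
  have one: "(\<lambda>_. 1) \<in> L2 s" by (rule L2_continuous_bounded[of _ _ 1]) auto
  have "nrm2 s (\<lambda>_. 1) = sqrt s" using \<open>s > 0\<close> by (simp add: nrm2_eq set_lebesgue_integral_def)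
  moreover have "nrm2 s (\<lambda>x. of_real (cmod (f x))) = nrm2 s f" by (simp add: nrm2_eq)
  moreover have "(LBINT x:{0<..<s}. of_real (cmod (f x)) * (1::complex)) = of_real (LBINT x:{0<..<s}. cmod (f x))"
    unfolding set_lebesgue_integral_def
    by (subst integral_complex_of_real[symmetric]) (simp add: scaleR_conv_of_real)
  ultimately show ?thesis
    using L2_integral_le[OF fm one] by (simp add: mult.commute)
qed

text \<open>Along a rapidly converging subsequence the increments have summable L1 norms, so it
  converges almost everywhere; Fatou's lemma then turns the Cauchy property into convergence of the
  whole sequence to the pointwise limit.\<close>

theorem L2_complete:
  assumes "s > 0" and fL: "\<And>n :: nat. f n \<in> L2 s"
    and cauchy: "\<And>\<epsilon>. \<epsilon> > 0 \<Longrightarrow> \<exists>N. \<forall>m\<ge>N. \<forall>n\<ge>N. nrm2 s (f m - f n) < \<epsilon>"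
  shows "\<exists>h\<in>L2 s. (\<lambda>n. nrm2 s (f n - h)) \<longlonglongrightarrow> 0"
proof -
  define N where "N j = (SOME N. \<forall>m\<ge>N. \<forall>n\<ge>N. nrm2 s (f m - f n) < (1/2) ^ j)" for j :: nat
  have N: "nrm2 s (f m - f n) < (1/2) ^ j" if "m \<ge> N j" "n \<ge> N j" for m n j
    using someI_ex[OF cauchy[of "(1/2) ^ j"]] that unfolding N_def by (auto simp: N_def)
  \<comment> \<open>Adding up the thresholds makes consecutive members of the subsequence both reach
    \<open>N j\<close>; the summand j lets \<open>k\<close> dominate the identity.\<close>
  define k where "k j = j + (\<Sum>i\<le>j. N i)" for j
  have kN: "N j \<le> k j" "N j \<le> k (Suc j)" "j \<le> k j" for j
  proof -
    have "N j \<le> (\<Sum>i\<le>j. N i)" by (rule member_le_sum) auto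
    then show "N j \<le> k j" "N j \<le> k (Suc j)" "j \<le> k j" by (auto simp: k_def)
  qed
  define F where "F n x = indicator {0<..<s} x *\<^sub>R f n x" for n x
  have Fm: "F n \<in> borel_measurable lborel" for n
    using fL[of n] unfolding F_def[abs_def] by (simp add: L2_iffs set_borel_measurable_def)
  define d where "d j x = cmod (F (k (Suc j)) x - F (k j) x)" for j x
  have dm[measurable]: "d j \<in> borel_measurable lborel" for j
    unfolding d_def[abs_def] using Fm by measurable
  have d_int: "(\<integral>\<^sup>+x. ennreal (d j x) \<partial>lborel) \<le> ennreal (sqrt s * (1/2) ^ j)" for j
  proof -
    have D: "f (k (Suc j)) - f (k j) \<in> L2 s" by (intro L2.V_diff fL)
    have deq: "d j x = indicator {0<..<s} x *\<^sub>R cmod ((f (k (Suc j)) - f (k j)) x)" for x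
      by (simp add: d_def F_def indicator_def)
    have "integrable lborel (d j)"
      using set_integrable_norm[OF L2_integrable[OF D]] unfolding set_integrable_def
      by (simp add: deq[abs_def])
    then have "(\<integral>\<^sup>+x. ennreal (d j x) \<partial>lborel) = ennreal (LINT x|lborel. d j x)"
      by (rule nn_integral_eq_integral) (simp add: d_def)
    also have "(LINT x|lborel. d j x) = (LBINT x:{0<..<s}. cmod ((f (k (Suc j)) - f (k j)) x))"
      unfolding set_lebesgue_integral_def deq ..
    also have "\<dots> \<le> sqrt s * nrm2 s (f (k (Suc j)) - f (k j))"
      by (rule L2_norm_integral_le[OF D \<open>s > 0\<close>])
    also have "\<dots> \<le> sqrt s * (1/2) ^ j"
      using N[OF kN(2) kN(1), of j] \<open>s > 0\<close> by (intro mult_left_mono) auto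
    finally show ?thesis by (simp add: ennreal_leI)
  qed
  have "(\<integral>\<^sup>+x. (\<Sum>j. ennreal (d j x)) \<partial>lborel) = (\<Sum>j. \<integral>\<^sup>+x. ennreal (d j x) \<partial>lborel)"
    by (rule nn_integral_suminf) simp
  also have "\<dots> \<le> (\<Sum>j. ennreal (sqrt s * (1/2) ^ j))"
    by (intro suminf_le d_int) auto
  also have "\<dots> = ennreal (\<Sum>j. sqrt s * (1/2) ^ j)"
    using \<open>s > 0\<close> by (intro suminf_ennreal2 summable_mult) (auto simp: summable_geometric)
  also have "\<dots> < \<infinity>" by simp
  finally have "(\<integral>\<^sup>+x. (\<Sum>j. ennreal (d j x)) \<partial>lborel) \<noteq> \<infinity>" by simp
  then have "AE x in lborel. (\<Sum>j. ennreal (d j x)) \<noteq> \<infinity>"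
    by (intro nn_integral_PInf_AE) auto
  then have conv: "AE x in lborel. convergent (\<lambda>j. F (k j) x)"
  proof eventually_elim
    case (elim x)
    have "summable (\<lambda>j. d j x)"
      using elim by (intro summable_suminf_not_top) (auto simp: d_def)
    then have "summable (\<lambda>j. F (k (Suc j)) x - F (k j) x)"
      unfolding d_def by (rule summable_norm_cancel)
    then have "convergent (\<lambda>n. \<Sum>j<n. F (k (Suc j)) x - F (k j) x)"
      by (simp add: summable_iff_convergent)
    then have "convergent (\<lambda>n. F (k n) x - F (k 0) x)"
      by (simp add: sum_lessThan_telescope[of "\<lambda>j. F (k j) x"])
    then obtain l where "(\<lambda>n. F (k n) x - F (k 0) x) \<longlonglongrightarrow> l" by (auto simp: convergent_def)
    then have "(\<lambda>n. (F (k n) x - F (k 0) x) + F (k 0) x) \<longlonglongrightarrow> l + F (k 0) x" by (intro tendsto_intros)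
    then show ?case by (auto simp: convergent_def)
  qed
  \<comment> \<open>Points without a limit form a null set, so the unspecified value of
    \<open>lim\<close> there is harmless.\<close>
  define h where "h x = lim (\<lambda>j. F (k j) x)" for x
  have hm[measurable]: "h \<in> borel_measurable lborel"
    unfolding h_def[abs_def] by (rule borel_measurable_lim_metric) (rule Fm)
  have h0: "h x = 0" if "x \<notin> {0<..<s}" for x
    using that by (auto simp: h_def F_def indicator_def intro!: limI)
  have fatou: "(\<integral>\<^sup>+x. ennreal ((cmod (F m x - h x))\<^sup>2) \<partial>lborel) \<le> ennreal (\<epsilon>\<^sup>2)"
    if m: "\<And>n. n \<ge> N0 \<Longrightarrow> nrm2 s (f m - f n) \<le> \<epsilon>" and \<epsilon>: "\<epsilon> > 0" for m N0 \<epsilon>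
  proof -
    let ?u = "\<lambda>j x. ennreal ((cmod (F m x - F (k j) x))\<^sup>2)"
    have "(\<integral>\<^sup>+x. ennreal ((cmod (F m x - h x))\<^sup>2) \<partial>lborel) = (\<integral>\<^sup>+x. liminf (\<lambda>j. ?u j x) \<partial>lborel)"
    proof (rule nn_integral_cong_AE, use conv in eventually_elim)
      fix x assume "convergent (\<lambda>j. F (k j) x)"
      then have "(\<lambda>j. F (k j) x) \<longlonglongrightarrow> h x" by (simp add: h_def convergent_LIMSEQ_iff)
      then have "(\<lambda>j. ?u j x) \<longlonglongrightarrow> ennreal ((cmod (F m x - h x))\<^sup>2)"
        by (intro tendsto_intros)
      then show "ennreal ((cmod (F m x - h x))\<^sup>2) = liminf (\<lambda>j. ?u j x)"
        by (rule lim_imp_Liminf[OF sequentially_bot, symmetric])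
    qed
    also have "\<dots> \<le> liminf (\<lambda>j. \<integral>\<^sup>+x. ?u j x \<partial>lborel)"
    proof (rule nn_integral_liminf)
      fix j
      have [measurable]: "F m \<in> borel_measurable lborel" "F (k j) \<in> borel_measurable lborel" by (rule Fm)+
      show "?u j \<in> borel_measurable lborel" by measurable
    qed
    also have "\<dots> \<le> limsup (\<lambda>j. \<integral>\<^sup>+x. ?u j x \<partial>lborel)"
      by (rule Liminf_le_Limsup) simp
    also have "\<dots> \<le> ennreal (\<epsilon>\<^sup>2)"
    proof (rule Limsup_bounded, rule eventually_sequentiallyI[of N0])
      fix j assume "N0 \<le> j"
      then have kj: "N0 \<le> k j" using kN(3)[of j] by simp
      have D: "f m - f (k j) \<in> L2 s" by (intro L2.V_diff fL)
      have deq: "(cmod (F m x - F (k j) x))\<^sup>2 = indicator {0<..<s} x *\<^sub>R (cmod ((f m - f (k j)) x))\<^sup>2" for x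
        by (simp add: F_def indicator_def)
      have "integrable lborel (\<lambda>x. (cmod (F m x - F (k j) x))\<^sup>2)"
        using D unfolding L2_iff set_integrable_def deq by simp
      then have "(\<integral>\<^sup>+x. ?u j x \<partial>lborel) = ennreal (LINT x|lborel. (cmod (F m x - F (k j) x))\<^sup>2)"
        by (intro nn_integral_eq_integral) auto
      also have "(LINT x|lborel. (cmod (F m x - F (k j) x))\<^sup>2) = (nrm2 s (f m - f (k j)))\<^sup>2"
        unfolding nrm2_sq[OF D] set_lebesgue_integral_def deq ..
      also have "\<dots> \<le> \<epsilon>\<^sup>2"
        using m[OF kj] L2.nrm_nonneg[OF D] by (intro power_mono)
      finally show "(\<integral>\<^sup>+x. ?u j x \<partial>lborel) \<le> ennreal (\<epsilon>\<^sup>2)" by (simp add: ennreal_leI)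
    qed
    finally show ?thesis .
  qed
  have FL: "F n \<in> L2 s" for n
  proof (rule L2_AE_cong[OF fL[of n]])
    show "set_borel_measurable lborel {0<..<s} (F n)"
      using Fm[of n] unfolding set_borel_measurable_def by simp
  qed (auto simp: F_def)
  have diff: "F m - h \<in> L2 s \<and> nrm2 s (F m - h) \<le> \<epsilon>"
    if m: "\<And>n. n \<ge> N0 \<Longrightarrow> nrm2 s (f m - f n) \<le> \<epsilon>" and \<epsilon>: "\<epsilon> > 0" for m N0 \<epsilon>
  proof -
    let ?g = "\<lambda>x. (cmod (F m x - h x))\<^sup>2"
    have [measurable]: "F m \<in> borel_measurable lborel" by (rule Fm)
    have le: "(\<integral>\<^sup>+x. ennreal (?g x) \<partial>lborel) \<le> ennreal (\<epsilon>\<^sup>2)" by (rule fatou[OF m \<epsilon>])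
    have "integrable lborel ?g"
      unfolding integrable_iff_bounded using le_less_trans[OF le ennreal_less_top] by simp
    then have int: "set_integrable lborel {0<..<s} (\<lambda>x. (cmod ((F m - h) x))\<^sup>2)"
      unfolding set_integrable_def by (intro integrable_mult_indicator) auto
    have mb: "F m - h \<in> L2 s"
      unfolding L2_iff
    proof
      have "(\<lambda>x. F m x - h x) \<in> borel_measurable lborel" by measurable
      then show "set_borel_measurable lborel {0<..<s} (F m - h)"
        unfolding set_borel_measurable_def by (simp add: fun_diff_def)
    qed (rule int)
    have "(nrm2 s (F m - h))\<^sup>2 = (LINT x|lborel. ?g x)"
      unfolding nrm2_sq[OF mb] set_lebesgue_integral_def
      by (intro Bochner_Integration.integral_cong) (auto simp: h0 F_def indicator_def)
    also have "ennreal \<dots> \<le> ennreal (\<epsilon>\<^sup>2)"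
      using le \<open>integrable lborel ?g\<close> by (subst (asm) nn_integral_eq_integral) auto
    finally have "(nrm2 s (F m - h))\<^sup>2 \<le> \<epsilon>\<^sup>2" by (simp add: ennreal_le_iff)
    then have "nrm2 s (F m - h) \<le> \<epsilon>" by (rule power2_le_imp_le) (use \<epsilon> in auto)
    with mb show ?thesis by simp
  qed
  have ev: "\<exists>N0. \<forall>m\<ge>N0. F m - h \<in> L2 s \<and> nrm2 s (F m - h) \<le> \<epsilon>" if "\<epsilon> > 0" for \<epsilon>
  proof -
    obtain N0 where N0: "\<forall>m\<ge>N0. \<forall>n\<ge>N0. nrm2 s (f m - f n) < \<epsilon>" using cauchy[OF \<open>\<epsilon> > 0\<close>] by blast
    show ?thesis
    proof (intro exI[of _ N0] allI impI)
      fix m assume "N0 \<le> m"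
      then have "\<And>n. n \<ge> N0 \<Longrightarrow> nrm2 s (f m - f n) \<le> \<epsilon>" using N0 by (meson less_imp_le)
      then show "F m - h \<in> L2 s \<and> nrm2 s (F m - h) \<le> \<epsilon>" by (rule diff[OF _ \<open>\<epsilon> > 0\<close>])
    qed
  qed
  have hL: "h \<in> L2 s"
  proof -
    obtain N0 where "F N0 - h \<in> L2 s" using ev[of 1] by auto
    then have "F N0 - (F N0 - h) \<in> L2 s" by (rule L2.V_diff[OF FL])
    then show ?thesis by simp
  qed
  have same: "nrm2 s (f n - h) = nrm2 s (F n - h)" for n
    unfolding nrm2_eq set_lebesgue_integral_def
    by (intro arg_cong[where f = sqrt] Bochner_Integration.integral_cong) (auto simp: F_def indicator_def)
  have "(\<lambda>n. nrm2 s (f n - h)) \<longlonglongrightarrow> 0"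
  proof (rule LIMSEQ_I)
    fix \<epsilon> :: real assume "\<epsilon> > 0"
    then obtain N0 where N0: "\<forall>m\<ge>N0. nrm2 s (F m - h) \<le> \<epsilon> / 2" using ev[of "\<epsilon> / 2"] by auto
    show "\<exists>no. \<forall>n\<ge>no. norm (nrm2 s (f n - h) - 0) < \<epsilon>"
    proof (intro exI[of _ N0] allI impI)
      fix n assume "N0 \<le> n"
      then have "nrm2 s (f n - h) \<le> \<epsilon> / 2" using N0 same by simp
      then show "norm (nrm2 s (f n - h) - 0) < \<epsilon>"
        using \<open>\<epsilon> > 0\<close> L2.nrm_nonneg[OF L2.V_diff[OF fL[of n] hL]] by simp
    qed
  qed
  with hL show ?thesis by blast
qed

section \<open>The unperturbed solution as a power series\<close>

definition bessel_coeff :: "real \<Rightarrow> nat \<Rightarrow> real" where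
  "bessel_coeff \<nu> k = 1 / (fact k * Gamma (\<nu> + real k + 1))"

text \<open>The Bessel function without its branch point: J(t) is (t/2)^\<nu> times this function at
  t^2 / 4. It is entire in w, which makes \<open>xi_free\<close> entire in z.\<close>

definition bessel_entire :: "real \<Rightarrow> complex \<Rightarrow> complex" where
  "bessel_entire \<nu> w = (\<Sum>k. of_real ((-1) ^ k * bessel_coeff \<nu> k) * w ^ k)"

text \<open>The modified Bessel function without its power: I(t) is (t/2)^\<nu> times this. It
  describes \<open>xi_free\<close> at z = -k^2, with t = k x.\<close>

definition bessel_mod :: "real \<Rightarrow> real \<Rightarrow> real" where
  "bessel_mod \<nu> t = (\<Sum>k. bessel_coeff \<nu> k * (t\<^sup>2 / 4) ^ k)"

definition xi_const :: "real \<Rightarrow> real" where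
  "xi_const \<nu> = sqrt pi / 2 powr (\<nu> + 1 / 2)"

lemma xi_const_pos: "xi_const \<nu> > 0"
  by (simp add: xi_const_def)

lemma bessel_coeff_pos: "\<nu> > -1 \<Longrightarrow> bessel_coeff \<nu> k > 0"
  by (simp add: bessel_coeff_def Gamma_real_pos)

text \<open>Termwise form of the rule that \<open>bessel_entire \<nu>\<close> has derivative minus
  \<open>bessel_entire (\<nu> + 1)\<close>.\<close>

lemma bessel_coeff_Suc:
  assumes "\<nu> > -1"
  shows "(real k + 1) * bessel_coeff \<nu> (Suc k) = bessel_coeff (\<nu> + 1) k"
proof -
  have "\<nu> + real (Suc k) + 1 = \<nu> + 1 + real k + 1" by simp
  then show ?thesis by (simp add: bessel_coeff_def divide_simps add_ac)
qed

lemma bessel_coeff_Suc':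
  assumes "\<nu> > -1"
  shows "bessel_coeff \<nu> (Suc k) * ((real k + 1) * (\<nu> + real k + 1)) = bessel_coeff \<nu> k"
proof -
  have "Gamma (\<nu> + real k + 1 + 1) = (\<nu> + real k + 1) * Gamma (\<nu> + real k + 1)"
    using assms by (intro Gamma_plus1) auto
  moreover have "Gamma (\<nu> + real k + 1) > 0" using assms by (intro Gamma_real_pos) auto
  ultimately show ?thesis using assms by (simp add: bessel_coeff_def add_ac divide_simps)
qed

lemma bessel_coeff_le:
  assumes "\<nu> \<ge> 0"
  shows "bessel_coeff \<nu> k \<le> bessel_coeff \<nu> 0 / fact k"
proof (induction k)
  case (Suc k)
  have pos: "bessel_coeff \<nu> (Suc k) > 0" using assms by (simp add: bessel_coeff_pos)
  have "bessel_coeff \<nu> (Suc k) * ((real k + 1) * 1) \<le> bessel_coeff \<nu> (Suc k) * ((real k + 1) * (\<nu> + real k + 1))"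
    using assms pos by (intro mult_left_mono) auto
  also have "\<dots> = bessel_coeff \<nu> k" using assms by (intro bessel_coeff_Suc') auto
  also have "\<dots> \<le> bessel_coeff \<nu> 0 / fact k" by (rule Suc.IH)
  finally have "bessel_coeff \<nu> (Suc k) \<le> bessel_coeff \<nu> 0 / fact k / (real k + 1)"
    by (simp add: pos_le_divide_eq mult_ac)
  then show ?case by (simp add: mult.commute add.commute)
qed simp

lemma summable_bessel:
  fixes w :: "'a::{real_normed_field, banach}"
  assumes "\<nu> \<ge> 0" "\<And>k. \<bar>c k\<bar> = bessel_coeff \<nu> k"
  shows "summable (\<lambda>k. of_real (c k) * w ^ k)"
proof (rule summable_comparison_test')
  show "summable (\<lambda>k. bessel_coeff \<nu> 0 * (inverse (fact k) * norm w ^ k))"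
    by (intro summable_mult summable_exp)
  show "norm (of_real (c k) * w ^ k) \<le> bessel_coeff \<nu> 0 * (inverse (fact k) * norm w ^ k)" if "k \<ge> 0" for k
  proof -
    have "norm (of_real (c k) * w ^ k) = bessel_coeff \<nu> k * norm w ^ k"
      using assms(2)[of k] by (simp add: norm_mult norm_power)
    also have "\<dots> \<le> (bessel_coeff \<nu> 0 / fact k) * norm w ^ k"
      using bessel_coeff_le[OF assms(1)] by (intro mult_right_mono) auto
    finally show ?thesis by (simp add: field_simps)
  qed
qed

lemma summable_bessel_entire:
  "\<nu> \<ge> 0 \<Longrightarrow> summable (\<lambda>k. of_real ((-1) ^ k * bessel_coeff \<nu> k) * (w :: complex) ^ k)"
  using bessel_coeff_pos[of \<nu>] by (intro summable_bessel[of \<nu>]) (auto simp: abs_mult less_imp_le)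

lemma summable_bessel_mod:
  "\<nu> \<ge> 0 \<Longrightarrow> summable (\<lambda>k. bessel_coeff \<nu> k * (t\<^sup>2 / 4) ^ k)"
  using summable_bessel[of \<nu> "bessel_coeff \<nu>" "t\<^sup>2 / 4 :: real"] bessel_coeff_pos[of \<nu>]
  by (simp add: less_imp_le)

lemma bessel_entire_has_derivative:
  assumes "\<nu> \<ge> 0"
  shows "(bessel_entire \<nu> has_field_derivative - bessel_entire (\<nu> + 1) w) (at w)"
proof -
  let ?c = "\<lambda>k. complex_of_real ((-1) ^ k * bessel_coeff \<nu> k)"
  have "((\<lambda>w. \<Sum>k. ?c k * w ^ k) has_field_derivative (\<Sum>k. diffs ?c k * w ^ k)) (at w)"
    by (rule termdiffs_strong_converges_everywhere) (rule summable_bessel_entire[OF assms])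
  moreover have "diffs ?c k = - of_real ((-1) ^ k * bessel_coeff (\<nu> + 1) k)" for k
  proof -
    have "diffs ?c k = of_real (real (Suc k) * ((-1) ^ Suc k * bessel_coeff \<nu> (Suc k)))"
      by (simp add: diffs_def)
    also have "real (Suc k) * ((-1) ^ Suc k * bessel_coeff \<nu> (Suc k)) = - ((-1) ^ k * ((real k + 1) * bessel_coeff \<nu> (Suc k)))"
      by (simp add: algebra_simps)
    also have "(real k + 1) * bessel_coeff \<nu> (Suc k) = bessel_coeff (\<nu> + 1) k"
      using assms by (intro bessel_coeff_Suc) auto
    finally show ?thesis by simp
  qed
  moreover have "(\<Sum>k. - of_real ((-1) ^ k * bessel_coeff (\<nu> + 1) k) * w ^ k) = - bessel_entire (\<nu> + 1) w"
    unfolding bessel_entire_def using summable_bessel_entire[of "\<nu> + 1" w] assms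
    by (simp add: suminf_minus)
  ultimately show ?thesis
    by (simp add: bessel_entire_def[abs_def])
qed

lemma continuous_on_bessel_entire:
  assumes "\<nu> \<ge> 0"
  shows "continuous_on S (bessel_entire \<nu>)"
  by (intro continuous_at_imp_continuous_on ballI) (rule DERIV_isCont[OF bessel_entire_has_derivative[OF assms]])

lemma bessel_entire_0: "bessel_entire \<nu> 0 = of_real (bessel_coeff \<nu> 0)"
  unfolding bessel_entire_def by (subst powser_zero) simp

lemma bessel_entire_neg:
  assumes "\<nu> \<ge> 0"
  shows "bessel_entire \<nu> (of_real (- (t\<^sup>2 / 4))) = of_real (bessel_mod \<nu> t)"
proof -
  have "of_real ((-1) ^ k * bessel_coeff \<nu> k) * (of_real (- (t\<^sup>2 / 4)) :: complex) ^ k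
      = of_real (bessel_coeff \<nu> k * (t\<^sup>2 / 4) ^ k)" for k
  proof -
    have "(-1) ^ k * bessel_coeff \<nu> k * (- (t\<^sup>2 / 4)) ^ k = bessel_coeff \<nu> k * (t\<^sup>2 / 4) ^ k"
    proof -
      have 1: "(-1) ^ k * (-1) ^ k = (1 :: real)" by (simp flip: power_mult_distrib)
      have "(-1) ^ k * bessel_coeff \<nu> k * (- (t\<^sup>2 / 4)) ^ k
          = ((-1) ^ k * (-1) ^ k) * (bessel_coeff \<nu> k * (t\<^sup>2 / 4) ^ k)"
        unfolding power_minus[of "t\<^sup>2 / 4"] by (simp only: mult_ac)
      then show ?thesis unfolding 1 by simp
    qed
    then show ?thesis by (metis of_real_mult of_real_power)
  qed
  then show ?thesis
    unfolding bessel_entire_def bessel_mod_def suminf_of_real[OF summable_bessel_mod[OF assms]]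
    by (simp only:)
qed

lemma xi_free_eq:
  assumes "x > 0"
  shows "xi_free \<nu> z x = of_real (xi_const \<nu> * x powr (\<nu> + 1 / 2)) * bessel_entire \<nu> (z * of_real (x\<^sup>2 / 4))"
proof -
  have "sqrt (pi * x / 2) * (x / 2) powr \<nu> = xi_const \<nu> * x powr (\<nu> + 1 / 2)"
  proof -
    have "sqrt (pi * x / 2) = sqrt pi * (x / 2) powr (1 / 2)"
      using assms by (simp add: powr_half_sqrt flip: real_sqrt_mult)
    then have "sqrt (pi * x / 2) * (x / 2) powr \<nu> = sqrt pi * (x / 2) powr (\<nu> + 1 / 2)"
      by (simp add: powr_add)
    then show ?thesis using assms by (simp add: xi_const_def powr_divide)
  qed
  moreover have "(-1) ^ k / (fact k * Gamma (complex_of_real \<nu> + of_nat k + 1)) = of_real ((-1) ^ k * bessel_coeff \<nu> k)" for k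
  proof -
    have "Gamma (complex_of_real \<nu> + of_nat k + 1) = of_real (Gamma (\<nu> + real k + 1))"
      using Gamma_complex_of_real[of "\<nu> + real k + 1"] by simp
    then show ?thesis by (simp add: bessel_coeff_def)
  qed
  moreover have "z * (of_real x)\<^sup>2 / 4 = z * of_real (x\<^sup>2 / 4)" by simp
  ultimately show ?thesis
    unfolding xi_free_series[OF assms] bessel_entire_def by simp
qed

definition xi_free' :: "real \<Rightarrow> complex \<Rightarrow> real \<Rightarrow> complex" where
  "xi_free' \<nu> z x = of_real (xi_const \<nu> * x powr (\<nu> - 1 / 2)) *
     (of_real (\<nu> + 1 / 2) * bessel_entire \<nu> (z * of_real (x\<^sup>2 / 4))
      - z * of_real (x\<^sup>2 / 2) * bessel_entire (\<nu> + 1) (z * of_real (x\<^sup>2 / 4)))"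

lemma xi_free_has_vector_derivative:
  assumes "x > 0" "\<nu> \<ge> 0"
  shows "(xi_free \<nu> z has_vector_derivative xi_free' \<nu> z x) (at x)"
proof -
  let ?w = "\<lambda>x. z * of_real (x\<^sup>2 / 4)"
  have w: "(?w has_vector_derivative z * of_real (x / 2)) (at x)"
    unfolding has_vector_derivative_def
    by (auto intro!: derivative_eq_intros simp: fun_eq_iff scaleR_conv_of_real field_simps)
  have E: "((\<lambda>x. bessel_entire \<nu> (?w x)) has_vector_derivative (z * of_real (x / 2)) * (- bessel_entire (\<nu> + 1) (?w x))) (at x)"
    using field_vector_diff_chain_at[OF w bessel_entire_has_derivative[OF assms(2), of "?w x"]]
    by (simp add: o_def)
  have P: "((\<lambda>x. complex_of_real (xi_const \<nu> * x powr (\<nu> + 1 / 2))) has_vector_derivative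
      of_real (xi_const \<nu> * ((\<nu> + 1 / 2) * x powr (\<nu> + 1 / 2 - 1)))) (at x)"
    using assms(1) by (intro has_vector_derivative_of_real has_real_derivative_iff_has_vector_derivative[THEN iffD1])
      (auto intro!: derivative_eq_intros)
  have "x powr (\<nu> + 1 / 2) = x * x powr (\<nu> - 1 / 2)"
    using powr_mult_base[of x "\<nu> - 1 / 2"] assms(1) by (simp add: add.commute)
  then have "of_real (xi_const \<nu> * x powr (\<nu> + 1 / 2)) * ((z * of_real (x / 2)) * (- bessel_entire (\<nu> + 1) (?w x)))
      + of_real (xi_const \<nu> * ((\<nu> + 1 / 2) * x powr (\<nu> + 1 / 2 - 1))) * bessel_entire \<nu> (?w x) = xi_free' \<nu> z x"
    by (simp add: xi_free'_def algebra_simps power2_eq_square)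
  then have "((\<lambda>x. of_real (xi_const \<nu> * x powr (\<nu> + 1 / 2)) * bessel_entire \<nu> (?w x)) has_vector_derivative xi_free' \<nu> z x) (at x)"
    using has_vector_derivative_mult[OF P E] by simp
  then show ?thesis
    by (rule has_vector_derivative_transform_within_open[where S = "{0<..}"])
       (use assms xi_free_eq[of _ \<nu> z] in auto)
qed

text \<open>All singular behaviour at 0 sits in the powers of x; the remaining factors are
  continuous in (z, x) on the compact product of K and [0,b], endpoint 0 included.\<close>

lemma xi_free_bound:
  assumes "\<nu> \<ge> 0" "compact K"
  obtains M where "M > 0" "\<And>z x. z \<in> K \<Longrightarrow> 0 < x \<Longrightarrow> x \<le> b \<Longrightarrow> cmod (xi_free \<nu> z x) \<le> M * x powr (\<nu> + 1 / 2)"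
    "\<And>z x. z \<in> K \<Longrightarrow> 0 < x \<Longrightarrow> x \<le> b \<Longrightarrow> cmod (xi_free' \<nu> z x) \<le> M * x powr (\<nu> - 1 / 2)"
proof -
  have "compact ((\<lambda>(z, x). z * complex_of_real (x\<^sup>2 / 4)) ` (K \<times> {0..b}))"
    using assms(2) by (intro compact_continuous_image compact_Times) (auto simp: case_prod_unfold intro!: continuous_intros)
  then have "compact (bessel_entire \<nu> ` ((\<lambda>(z, x). z * complex_of_real (x\<^sup>2 / 4)) ` (K \<times> {0..b})))"
    "compact (bessel_entire (\<nu> + 1) ` ((\<lambda>(z, x). z * complex_of_real (x\<^sup>2 / 4)) ` (K \<times> {0..b})))"
    using assms(1) by (auto intro!: compact_continuous_image continuous_on_bessel_entire)
  then have "bounded (bessel_entire \<nu> ` ((\<lambda>(z, x). z * complex_of_real (x\<^sup>2 / 4)) ` (K \<times> {0..b})))"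
    "bounded (bessel_entire (\<nu> + 1) ` ((\<lambda>(z, x). z * complex_of_real (x\<^sup>2 / 4)) ` (K \<times> {0..b})))"
    "bounded K" using assms(2) by (auto intro: compact_imp_bounded)
  then obtain A B R where A: "A > 0" "\<And>z x. z \<in> K \<Longrightarrow> x \<in> {0..b} \<Longrightarrow> cmod (bessel_entire \<nu> (z * of_real (x\<^sup>2 / 4))) \<le> A"
    and B: "B > 0" "\<And>z x. z \<in> K \<Longrightarrow> x \<in> {0..b} \<Longrightarrow> cmod (bessel_entire (\<nu> + 1) (z * of_real (x\<^sup>2 / 4))) \<le> B"
    and R: "R > 0" "\<And>z. z \<in> K \<Longrightarrow> cmod z \<le> R"
  proof -
    assume "bounded (bessel_entire \<nu> ` ((\<lambda>(z, x). z * complex_of_real (x\<^sup>2 / 4)) ` (K \<times> {0..b})))"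
      "bounded (bessel_entire (\<nu> + 1) ` ((\<lambda>(z, x). z * complex_of_real (x\<^sup>2 / 4)) ` (K \<times> {0..b})))"
      "bounded K"
    then obtain A B R where "A > 0" "B > 0" "R > 0" and
      A: "\<forall>y\<in>bessel_entire \<nu> ` ((\<lambda>(z, x). z * complex_of_real (x\<^sup>2 / 4)) ` (K \<times> {0..b})). cmod y \<le> A" and
      B: "\<forall>y\<in>bessel_entire (\<nu> + 1) ` ((\<lambda>(z, x). z * complex_of_real (x\<^sup>2 / 4)) ` (K \<times> {0..b})). cmod y \<le> B" and
      R: "\<forall>y\<in>K. cmod y \<le> R"
      unfolding bounded_pos by blast
    have in1: "bessel_entire \<mu> (z * of_real (x\<^sup>2 / 4)) \<in> bessel_entire \<mu> ` ((\<lambda>(z, x). z * complex_of_real (x\<^sup>2 / 4)) ` (K \<times> {0..b}))"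
      if "z \<in> K" "x \<in> {0..b}" for \<mu> z x
      using that by (intro imageI image_eqI[of _ _ "(z, x)"]) auto
    show thesis
      by (rule that[OF \<open>A > 0\<close> bspec[OF A in1] \<open>B > 0\<close> bspec[OF B in1] \<open>R > 0\<close> bspec[OF R]])
  qed
  let ?c = "xi_const \<nu>"
  have c: "?c > 0" by (rule xi_const_pos)
  define M where "M = ?c * A + ?c * ((\<nu> + 1 / 2) * A + R * b\<^sup>2 * B)"
  have M1: "?c * A \<le> M" and M2: "?c * ((\<nu> + 1 / 2) * A + R * b\<^sup>2 * B) \<le> M"
    using A(1) B(1) R(1) c assms(1) by (auto simp: M_def)
  have "?c * A > 0" using c A by simp
  with M1 have Mpos: "M > 0" by linarith
  show thesis
  proof (rule that[OF Mpos])
    fix z x assume z: "z \<in> K" and x: "0 < x" "x \<le> b"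
    have "cmod (xi_free \<nu> z x) = ?c * x powr (\<nu> + 1 / 2) * cmod (bessel_entire \<nu> (z * of_real (x\<^sup>2 / 4)))"
      unfolding xi_free_eq[OF x(1)] using c by (simp only: norm_mult norm_of_real) (simp add: abs_mult)
    also have "\<dots> \<le> ?c * x powr (\<nu> + 1 / 2) * A"
      using A(2)[OF z, of x] x c by (intro mult_left_mono) auto
    also have "\<dots> = (?c * A) * x powr (\<nu> + 1 / 2)" by simp
    also have "\<dots> \<le> M * x powr (\<nu> + 1 / 2)" using M1 by (intro mult_right_mono) auto
    finally show "cmod (xi_free \<nu> z x) \<le> M * x powr (\<nu> + 1 / 2)" .
    have "cmod (of_real (\<nu> + 1 / 2) * bessel_entire \<nu> (z * of_real (x\<^sup>2 / 4))
      - z * of_real (x\<^sup>2 / 2) * bessel_entire (\<nu> + 1) (z * of_real (x\<^sup>2 / 4))) \<le> (\<nu> + 1 / 2) * A + R * b\<^sup>2 * B"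
    proof (rule order_trans[OF norm_triangle_ineq4], rule add_mono)
      show "cmod (of_real (\<nu> + 1 / 2) * bessel_entire \<nu> (z * of_real (x\<^sup>2 / 4))) \<le> (\<nu> + 1 / 2) * A"
        unfolding norm_mult norm_of_real using A(2)[OF z, of x] x assms(1) by (intro mult_mono) auto
      have "x\<^sup>2 / 2 \<le> b\<^sup>2" using power_mono[of x b 2] x zero_le_power2[of b] by linarith
      then show "cmod (z * of_real (x\<^sup>2 / 2) * bessel_entire (\<nu> + 1) (z * of_real (x\<^sup>2 / 4))) \<le> R * b\<^sup>2 * B"
        unfolding norm_mult norm_of_real using B(2)[OF z, of x] R(2)[OF z] R(1) B(1) x
        by (intro mult_mono) auto
    qed
    then have "cmod (xi_free' \<nu> z x) \<le> ?c * x powr (\<nu> - 1 / 2) * ((\<nu> + 1 / 2) * A + R * b\<^sup>2 * B)"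
      unfolding xi_free'_def norm_mult norm_of_real using c by (intro mult_mono) (auto simp: abs_mult)
    also have "\<dots> = (?c * ((\<nu> + 1 / 2) * A + R * b\<^sup>2 * B)) * x powr (\<nu> - 1 / 2)" by simp
    also have "\<dots> \<le> M * x powr (\<nu> - 1 / 2)" using M2 by (intro mult_right_mono) auto
    finally show "cmod (xi_free' \<nu> z x) \<le> M * x powr (\<nu> - 1 / 2)" .
  qed
qed

lemma xi_free_at_0:
  assumes "\<nu> \<ge> 0"
  shows "((\<lambda>x. xi_free \<nu> z x / of_real (x powr (\<nu> + 1 / 2))) \<longlongrightarrow> of_real (xi_const \<nu> * bessel_coeff \<nu> 0)) (at_right 0)"
    and "((\<lambda>x. xi_free' \<nu> z x / of_real (x powr (\<nu> - 1 / 2))) \<longlongrightarrow>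
      of_real ((\<nu> + 1 / 2) * (xi_const \<nu> * bessel_coeff \<nu> 0))) (at_right 0)"
proof -
  have w: "((\<lambda>x. z * complex_of_real (x\<^sup>2 / 4)) \<longlongrightarrow> z * of_real (0\<^sup>2 / 4)) (at_right 0)"
    by (intro tendsto_intros) auto
  have E: "((\<lambda>x. bessel_entire \<mu> (z * complex_of_real (x\<^sup>2 / 4))) \<longlongrightarrow> of_real (bessel_coeff \<mu> 0)) (at_right 0)"
    if "\<mu> \<ge> 0" for \<mu>
  proof -
    have "isCont (bessel_entire \<mu>) 0"
      by (rule DERIV_isCont[OF bessel_entire_has_derivative[OF that]])
    then show ?thesis using isCont_tendsto_compose[of 0 "bessel_entire \<mu>"] w by (simp add: bessel_entire_0)
  qed
  have "((\<lambda>x. of_real (xi_const \<nu>) * bessel_entire \<nu> (z * complex_of_real (x\<^sup>2 / 4))) \<longlongrightarrow> of_real (xi_const \<nu>) * of_real (bessel_coeff \<nu> 0)) (at_right 0)"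
    by (intro tendsto_intros E assms)
  then show "((\<lambda>x. xi_free \<nu> z x / of_real (x powr (\<nu> + 1 / 2))) \<longlongrightarrow> of_real (xi_const \<nu> * bessel_coeff \<nu> 0)) (at_right 0)"
    unfolding of_real_mult
    by (rule Lim_transform_eventually) (rule eventually_mono[OF eventually_at_right_less[of 0]], simp add: xi_free_eq)
  have "((\<lambda>x. of_real (xi_const \<nu>) * (of_real (\<nu> + 1 / 2) * bessel_entire \<nu> (z * of_real (x\<^sup>2 / 4))
      - z * of_real (x\<^sup>2 / 2) * bessel_entire (\<nu> + 1) (z * of_real (x\<^sup>2 / 4)))) \<longlongrightarrow>
      of_real (xi_const \<nu>) * (of_real (\<nu> + 1 / 2) * of_real (bessel_coeff \<nu> 0) - z * of_real (0\<^sup>2 / 2) * of_real (bessel_coeff (\<nu> + 1) 0))) (at_right 0)"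
    using assms by (intro tendsto_intros E) auto
  then have "((\<lambda>x. of_real (xi_const \<nu>) * (of_real (\<nu> + 1 / 2) * bessel_entire \<nu> (z * of_real (x\<^sup>2 / 4))
      - z * of_real (x\<^sup>2 / 2) * bessel_entire (\<nu> + 1) (z * of_real (x\<^sup>2 / 4)))) \<longlongrightarrow>
      of_real ((\<nu> + 1 / 2) * (xi_const \<nu> * bessel_coeff \<nu> 0))) (at_right 0)"
    by (simp add: mult_ac)
  then show "((\<lambda>x. xi_free' \<nu> z x / of_real (x powr (\<nu> - 1 / 2))) \<longlongrightarrow>
      of_real ((\<nu> + 1 / 2) * (xi_const \<nu> * bessel_coeff \<nu> 0))) (at_right 0)"
    by (rule Lim_transform_eventually) (rule eventually_mono[OF eventually_at_right_less[of 0]], simp add: xi_free'_def)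
qed

subsection \<open>Growth of the modified Bessel function\<close>

lemma cosh_even_sums: "(\<lambda>k. t ^ (2 * k) / fact (2 * k)) sums cosh (t :: real)"
proof -
  have "(\<lambda>n. sum (\<lambda>n. if even n then t ^ n /\<^sub>R fact n else 0) {n * 2..<n * 2 + 2}) sums cosh t"
    by (rule sums_group[OF cosh_converges]) simp
  moreover have "sum (\<lambda>n. if even n then t ^ n /\<^sub>R fact n else 0) {n * 2..<n * 2 + 2} = t ^ (2 * n) / fact (2 * n)" for n
  proof -
    have "{n * 2..<n * 2 + 2} = {2 * n, Suc (2 * n)}" by auto
    then show ?thesis by (simp add: divide_inverse mult_ac)
  qed
  ultimately show ?thesis by simp
qed

text \<open>The first moment of the weights t^(2k) / (2k)!, which enters when a tangent line is
  summed in \<open>bessel_mod_lower\<close>.\<close>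

lemma sinh_even_sums: "(\<lambda>k. real (2 * k) * (t ^ (2 * k) / fact (2 * k))) sums (t * sinh (t :: real))"
proof -
  have "(\<lambda>n. sum (\<lambda>n. if even n then 0 else t ^ n /\<^sub>R fact n) {n * 2..<n * 2 + 2}) sums sinh t"
    by (rule sums_group[OF sinh_converges]) simp
  moreover have "sum (\<lambda>n. if even n then 0 else t ^ n /\<^sub>R fact n) {n * 2..<n * 2 + 2} = t ^ (2 * n + 1) / fact (2 * n + 1)" for n
  proof -
    have "{n * 2..<n * 2 + 2} = {2 * n, Suc (2 * n)}" by auto
    then show ?thesis by (simp add: divide_inverse mult_ac)
  qed
  ultimately have "(\<lambda>n. t * (t ^ (2 * n + 1) / fact (2 * n + 1))) sums (t * sinh t)"
    by (intro sums_mult) simp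
  moreover have "t * (t ^ (2 * n + 1) / fact (2 * n + 1)) = real (2 * Suc n) * (t ^ (2 * Suc n) / fact (2 * Suc n))" for n
  proof -
    have "fact (2 * Suc n) = real (2 * Suc n) * fact (2 * n + 1)"
      by (simp add: algebra_simps)
    moreover have "real (2 * Suc n) \<noteq> 0" by simp
    ultimately show ?thesis by (simp only: nonzero_mult_divide_mult_cancel_left times_divide_eq_right) simp
  qed
  ultimately have "(\<lambda>n. real (2 * Suc n) * (t ^ (2 * Suc n) / fact (2 * Suc n))) sums (t * sinh t)" by simp
  then show ?thesis by (subst (asm) sums_Suc_iff) simp
qed

text \<open>With c_k the Bessel coefficients, the numbers w k = (2k)! c_k / 4^k obey w (k+1) / w k =
  (2k+1) / (2k+1+2p), p = \<nu> + 1/2, so they decay like (2k)^(-p). The induction makes this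
  quantitative through ln y \<ge> 1 - 1/y at y = (2k+3) / (2k+1).\<close>

lemma bessel_coeff_lower:
  assumes "\<nu> \<ge> 0"
  obtains c where "c > 0" "\<And>k. bessel_coeff \<nu> k / 4 ^ k \<ge> c * (1 + real (2 * k)) powr - (\<nu> + 1 / 2) / fact (2 * k)"
proof -
  define p where "p = \<nu> + 1 / 2"
  define w where "w k = fact (2 * k) * bessel_coeff \<nu> k / 4 ^ k" for k
  have wpos: "w k > 0" for k using assms by (simp add: w_def bessel_coeff_pos)
  have wSuc: "w (Suc k) * (2 * real k + 1 + 2 * p) = w k * (2 * real k + 1)" for k
  proof -
    have b: "bessel_coeff \<nu> k = bessel_coeff \<nu> (Suc k) * ((real k + 1) * (\<nu> + real k + 1))"
      using assms by (intro bessel_coeff_Suc'[symmetric]) auto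
    have f: "fact (2 * Suc k) = (2 * real k + 2) * ((2 * real k + 1) * fact (2 * k))" by (simp add: algebra_simps)
    show ?thesis unfolding w_def b f by (simp add: p_def field_simps)
  qed
  \<comment> \<open>Starting at index 1 makes the base case trivial; w 0 enters only through the
    minimum that defines the constant.\<close>
  have ind: "w (Suc k) * (2 * real k + 1) powr p \<ge> w 1" for k
  proof (induction k)
    case (Suc k)
    let ?y = "(2 * real k + 3) / (2 * real k + 1)"
    have y: "?y > 0" by simp
    have "1 - 1 / ?y \<le> ln ?y" using ln_one_minus_pos_upper_bound[of "1 - 1 / ?y"] ln_add_one_self_le_self2[of "1 / ?y - 1"] y
      by (simp add: ln_div)
    then have "2 / (2 * real k + 3) \<le> ln ?y" by (simp add: field_simps)
    then have "1 + p * (2 / (2 * real k + 3)) \<le> 1 + p * ln ?y"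
      using assms by (intro add_left_mono mult_left_mono) (auto simp: p_def)
    also have "\<dots> \<le> exp (p * ln ?y)" by (rule exp_ge_add_one_self)
    also have "\<dots> = ?y powr p" using y by (simp add: powr_def)
    also have "\<dots> = (2 * real k + 3) powr p / (2 * real k + 1) powr p" by (rule powr_divide)
    finally have "1 + p * (2 / (2 * real k + 3)) \<le> (2 * real k + 3) powr p / (2 * real k + 1) powr p" .
    moreover have "1 + p * (2 / (2 * real k + 3)) = (2 * real k + 3 + 2 * p) / (2 * real k + 3)"
      by (simp add: field_simps)
    ultimately have key: "(2 * real k + 3 + 2 * p) / (2 * real k + 3) \<le> (2 * real k + 3) powr p / (2 * real k + 1) powr p"
      by simp
    have pp: "2 * real k + 3 + 2 * p > 0" "2 * real k + 3 > 0" using assms by (auto simp: p_def)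
    have "w (Suc (Suc k)) = w (Suc k) * (2 * real k + 3) / (2 * real k + 3 + 2 * p)"
      using wSuc[of "Suc k"] pp by (simp add: field_simps)
    then have "w (Suc (Suc k)) * (2 * real k + 3) powr p
        = w (Suc k) * ((2 * real k + 3) / (2 * real k + 3 + 2 * p)) * (2 * real k + 3) powr p" by simp
    also have "\<dots> \<ge> w (Suc k) * (2 * real k + 1) powr p"
    proof -
      have "(2 * real k + 1) powr p \<le> (2 * real k + 3) / (2 * real k + 3 + 2 * p) * (2 * real k + 3) powr p"
        using key pp by (simp add: field_simps)
      from mult_left_mono[OF this less_imp_le[OF wpos[of "Suc k"]]]
      show ?thesis by (simp only: mult.assoc)
    qed
    finally show ?case using Suc.IH by (simp add: add.commute algebra_simps)
  qed simp
  define c where "c = min (w 0) (w 1)"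
  have c: "c > 0" using wpos by (simp add: c_def)
  have "c * (1 + real (2 * k)) powr - p \<le> w k" for k
  proof (cases k)
    case 0
    then show ?thesis by (simp add: c_def)
  next
    case (Suc j)
    have "c * (1 + real (2 * k)) powr - p \<le> w 1 * (2 * real j + 1) powr - p"
      using c Suc assms by (intro mult_mono powr_mono2') (auto simp: c_def p_def)
    also have "\<dots> \<le> w k"
      using ind[of j] Suc by (simp add: powr_minus field_simps)
    finally show ?thesis .
  qed
  then have "c * (1 + real (2 * k)) powr - p / fact (2 * k) \<le> bessel_coeff \<nu> k / 4 ^ k" for k
    by (simp add: w_def field_simps)
  then show thesis using c by (intro that[of c]) (auto simp: p_def)
qed

text \<open>Jensen's inequality for the convex function \<open>n \<mapsto> (1 + n) powr - p\<close> and the even Poisson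
  distribution with weights \<open>t ^ n / n!\<close>, whose mean is \<open>t * tanh t \<le> t\<close>.\<close>

lemma bessel_mod_lower:
  assumes "\<nu> \<ge> 0"
  obtains c where "c > 0" "\<And>t. t \<ge> 0 \<Longrightarrow> bessel_mod \<nu> t \<ge> c * exp t * (1 + t) powr - (\<nu> + 1 / 2)"
proof -
  define p where "p = \<nu> + 1 / 2"
  have p: "p > 0" using assms by (simp add: p_def)
  obtain c where c: "c > 0" and low: "\<And>k. bessel_coeff \<nu> k / 4 ^ k \<ge> c * (1 + real (2 * k)) powr - p / fact (2 * k)"
    using bessel_coeff_lower[OF assms] unfolding p_def by metis
  have "bessel_mod \<nu> t \<ge> c / 2 * exp t * (1 + t) powr - p" if t: "t \<ge> 0" for t
  proof -
    let ?e = "\<lambda>k. t ^ (2 * k) / fact (2 * k)"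
    let ?l = "\<lambda>k. c * (1 + t) powr - p * ((1 + p) * ?e k - p / (1 + t) * (?e k + real (2 * k) * ?e k))"
    have S: "?l sums (c * (1 + t) powr - p * ((1 + p) * cosh t - p / (1 + t) * (cosh t + t * sinh t)))"
      by (intro sums_mult sums_diff sums_add cosh_even_sums sinh_even_sums)
    \<comment> \<open>The tangent line of y^(-p) at y = 1, used at y = (1 + 2k) / (1 + t), so that
      2k is compared with t.\<close>
    have term_le: "?l k \<le> bessel_coeff \<nu> k * (t\<^sup>2 / 4) ^ k" for k
    proof -
      let ?y = "(1 + real (2 * k)) / (1 + t)"
      have y: "?y > 0" using t by simp
      have "1 - p * (?y - 1) \<le> 1 - p * ln ?y"
        using ln_le_minus_one[OF y] p by simp
      also have "\<dots> \<le> exp (- (p * ln ?y))" using exp_ge_add_one_self[of "- (p * ln ?y)"] by simp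
      also have "\<dots> = ?y powr - p" using y t by (simp add: powr_def)
      finally have "(1 + t) powr - p * (1 - p * (?y - 1)) \<le> (1 + t) powr - p * ?y powr - p"
        by (intro mult_left_mono) auto
      also have "\<dots> = (1 + real (2 * k)) powr - p"
        using t by (simp add: powr_divide)
      finally have J: "(1 + t) powr - p * (1 - p * (?y - 1)) \<le> (1 + real (2 * k)) powr - p" .
      have "?l k = c * ?e k * ((1 + t) powr - p * (1 - p * (?y - 1)))"
      proof -
        have "c * P * ((1 + p) * e - p / d * (e + n * e)) = c * e * (P * (1 - p * ((1 + n) / d - 1)))"
          for P e d n :: real
          by (simp add: algebra_simps add_divide_distrib)
        then show ?thesis .
      qed
      also have "\<dots> \<le> c * ?e k * (1 + real (2 * k)) powr - p"
        using c t J by (intro mult_left_mono) auto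
      also have "\<dots> = t ^ (2 * k) * (c * (1 + real (2 * k)) powr - p / fact (2 * k))" by simp
      also have "\<dots> \<le> t ^ (2 * k) * (bessel_coeff \<nu> k / 4 ^ k)"
        using low t by (intro mult_left_mono) auto
      also have "t ^ (2 * k) * (bessel_coeff \<nu> k / 4 ^ k) = bessel_coeff \<nu> k * (t\<^sup>2 / 4) ^ k"
        by (simp add: power_divide power_mult)
      finally show ?thesis .
    qed
    have "c * (1 + t) powr - p * ((1 + p) * cosh t - p / (1 + t) * (cosh t + t * sinh t)) \<le> bessel_mod \<nu> t"
      unfolding bessel_mod_def
      using sums_le[OF term_le S summable_sums[OF summable_bessel_mod[OF assms]]] .
    \<comment> \<open>Since sinh t \<le> cosh t, the linear correction costs at most p cosh t, which
      the coefficient 1 + p covers.\<close>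
    moreover have "c * (1 + t) powr - p * cosh t
        \<le> c * (1 + t) powr - p * ((1 + p) * cosh t - p / (1 + t) * (cosh t + t * sinh t))"
    proof (rule mult_left_mono)
      have "sinh t \<le> cosh t" by (simp add: sinh_def cosh_def)
      then have "cosh t + t * sinh t \<le> (1 + t) * cosh t"
        using t by (simp add: algebra_simps mult_left_mono)
      then have "p / (1 + t) * (cosh t + t * sinh t) \<le> p / (1 + t) * ((1 + t) * cosh t)"
        using p t by (intro mult_left_mono) auto
      also have "\<dots> = p * cosh t" using t by simp
      finally show "cosh t \<le> (1 + p) * cosh t - p / (1 + t) * (cosh t + t * sinh t)"
        by (simp add: algebra_simps)
    qed (use c in auto)
    moreover have "c / 2 * exp t * (1 + t) powr - p \<le> c * (1 + t) powr - p * cosh t"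
    proof -
      have "exp t / 2 \<le> cosh t" by (simp add: cosh_def)
      then have "c * (1 + t) powr - p * (exp t / 2) \<le> c * (1 + t) powr - p * cosh t"
        using c by (intro mult_left_mono) auto
      then show ?thesis by (simp add: mult_ac)
    qed
    ultimately show ?thesis by linarith
  qed
  then show thesis using c by (intro that[of "c / 2"]) (auto simp: p_def)
qed

text \<open>With T k the terms of \<open>bessel_mod \<nu> t\<close>, the right-hand side is both the
  sum of k T k and the sum of (k+1) T (k+1). Half of the first dominates A T k for large k, half of
  the second does so for the finitely many small k once t is large. In
  \<open>positive_solution\<close> this lets the derivative term win over a negative cos
  \<gamma>.\<close>

lemma bessel_mod_ratio:
  assumes "\<nu> \<ge> 0"
  obtains t0 where "t0 > 0" "\<And>t. t \<ge> t0 \<Longrightarrow> A * bessel_mod \<nu> t \<le> t\<^sup>2 / 4 * bessel_mod (\<nu> + 1) t"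
proof -
  obtain N :: nat where N: "2 * \<bar>A\<bar> \<le> N" using real_arch_simple by blast
  define t0 where "t0 = 1 + 8 * (\<bar>A\<bar> + 1) * (\<nu> + N + 1)"
  have t0: "t0 \<ge> 1" using assms by (simp add: t0_def)
  have "A * bessel_mod \<nu> t \<le> t\<^sup>2 / 4 * bessel_mod (\<nu> + 1) t" if t: "t \<ge> t0" for t
  proof -
    let ?T = "\<lambda>k. bessel_coeff \<nu> k * (t\<^sup>2 / 4) ^ k"
    let ?T' = "\<lambda>k. t\<^sup>2 / 4 * (bessel_coeff (\<nu> + 1) k * (t\<^sup>2 / 4) ^ k)"
    have Tpos: "?T k \<ge> 0" for k using bessel_coeff_pos[of \<nu> k] assms by simp
    have s': "?T' sums (t\<^sup>2 / 4 * bessel_mod (\<nu> + 1) t)"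
      unfolding bessel_mod_def using assms by (intro sums_mult summable_sums summable_bessel_mod) auto
    have eq: "?T' k = real (Suc k) * ?T (Suc k)" for k
    proof -
      have b: "bessel_coeff (\<nu> + 1) k = (real k + 1) * bessel_coeff \<nu> (Suc k)"
        using bessel_coeff_Suc[of \<nu> k] assms by simp
      show ?thesis unfolding b by (simp add: algebra_simps)
    qed
    have s'': "(\<lambda>k. real k * ?T k) sums (t\<^sup>2 / 4 * bessel_mod (\<nu> + 1) t)"
      using s' unfolding eq sums_Suc_iff[of "\<lambda>k. real k * ?T k"] by simp
    have sT: "(\<lambda>k. A * ?T k) sums (A * bessel_mod \<nu> t)"
      unfolding bessel_mod_def using assms by (intro sums_mult summable_sums summable_bessel_mod) auto
    have comb: "(\<lambda>k. 1 / 2 * (real k * ?T k) + 1 / 2 * ?T' k) sums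
        (1 / 2 * (t\<^sup>2 / 4 * bessel_mod (\<nu> + 1) t) + 1 / 2 * (t\<^sup>2 / 4 * bessel_mod (\<nu> + 1) t))"
      by (intro sums_add sums_mult s' s'')
    have term_le: "A * ?T k \<le> 1 / 2 * (real k * ?T k) + 1 / 2 * ?T' k" for k
    proof (cases "k \<ge> N")
      case True
      then have "A \<le> 1 / 2 * real k" using N by linarith
      then have "A * ?T k \<le> (1 / 2 * real k) * ?T k" using Tpos by (intro mult_right_mono) auto
      moreover have "?T' k \<ge> 0" unfolding eq using Tpos[of "Suc k"] by simp
      ultimately show ?thesis by (simp add: mult.assoc)
    next
      case False
      have d: "\<nu> + real k + 1 > 0" using assms by simp
      have "t \<le> t\<^sup>2" using t t0 by (simp add: power2_eq_square)
      have "2 * \<bar>A\<bar> * (\<nu> + real k + 1) \<le> 2 * (\<bar>A\<bar> + 1) * (\<nu> + real N + 1)"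
        using False assms by (intro mult_mono) auto
      also have "\<dots> \<le> t\<^sup>2 / 4" using t \<open>t \<le> t\<^sup>2\<close> unfolding t0_def by linarith
      finally have "2 * \<bar>A\<bar> \<le> t\<^sup>2 / 4 / (\<nu> + real k + 1)" using d by (simp add: field_simps)
      then have "2 * A * ?T k \<le> t\<^sup>2 / 4 / (\<nu> + real k + 1) * ?T k" using Tpos by (intro mult_right_mono) auto
      also have "\<dots> = real (Suc k) * ?T (Suc k)"
      proof -
        have "bessel_coeff \<nu> k / (\<nu> + real k + 1) = real (Suc k) * bessel_coeff \<nu> (Suc k)"
          using bessel_coeff_Suc'[of \<nu> k] assms d by (simp add: nonzero_divide_eq_eq mult_ac add_ac)
        moreover have "t\<^sup>2 / 4 / (\<nu> + real k + 1) * ?T k = bessel_coeff \<nu> k / (\<nu> + real k + 1) * (t\<^sup>2 / 4) ^ Suc k"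
          by (simp add: mult_ac)
        ultimately show ?thesis by simp
      qed
      finally have "A * ?T k \<le> 1 / 2 * ?T' k" unfolding eq by simp
      moreover have "real k * ?T k \<ge> 0" using Tpos by simp
      ultimately show ?thesis by linarith
    qed
    have "1 / 2 * (t\<^sup>2 / 4 * bessel_mod (\<nu> + 1) t) + 1 / 2 * (t\<^sup>2 / 4 * bessel_mod (\<nu> + 1) t)
        = t\<^sup>2 / 4 * bessel_mod (\<nu> + 1) t" by simp
    then show ?thesis using sums_le[OF term_le sT comb] by (simp only:)
  qed
  then show thesis using t0 by (intro that[of t0]) auto
qed

section \<open>Auxiliary facts on functions on a half-open interval\<close>

lemma at_within_Ioc:
  fixes c s x :: real
  assumes "c < x" "0 < c"
  shows "at x within {0<..s} = at x within {c..s}"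
  using assms by (intro at_within_nhd[of x "{c<..}"]) auto

lemma at_within_Ioo:
  fixes s x :: real
  assumes "0 < x" "x < s"
  shows "at x within {0<..s} = at x"
  using assms at_within_interior[of x "{0<..s}"] by simp

lemma continuous_on_Ioc:
  fixes f :: "real \<Rightarrow> 'a::topological_space"
  assumes "\<And>c. 0 < c \<Longrightarrow> c < s \<Longrightarrow> continuous_on {c..s} f"
  shows "continuous_on {0<..s} f"
  unfolding continuous_on_eq_continuous_within
proof
  fix x assume x: "x \<in> {0<..s}"
  have "continuous (at x within {x / 2..s}) f"
    using assms[of "x / 2"] x by (auto simp: continuous_on_eq_continuous_within)
  then show "continuous (at x within {0<..s}) f"
    using at_within_Ioc[of "x / 2" x s] x by simp
qed

text \<open>Translates between two notions of exceptional set: the domain of the operator uses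
  \<open>AE\<close> over \<open>lborel\<close>, the calculus of the gauge integral uses
  \<open>negligible\<close>.\<close>

lemma AE_lborel_negligibleE:
  fixes P :: "real \<Rightarrow> bool"
  assumes "AE x in lborel. P x"
  obtains N where "negligible N" "\<And>x. x \<notin> N \<Longrightarrow> P x"
proof -
  obtain N where N: "{x\<in>space lborel. \<not> P x} \<subseteq> N" "N \<in> null_sets lborel"
    using assms by (auto simp: eventually_ae_filter)
  then have "negligible N"
    by (simp add: negligible_iff_null_sets null_sets_completionI)
  then show thesis using N(1) by (intro that[of N]) auto
qed

lemma negligible_AE_lborel:
  assumes "negligible N" "\<And>x. x \<notin> N \<Longrightarrow> P x"
  shows "AE x in lborel. P (x :: real)"
proof -
  have "AE x in lebesgue. P x"
    using assms by (intro AE_I'[of N]) (auto simp: negligible_iff_null_sets)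
  then show ?thesis by (simp add: AE_completion_iff)
qed

text \<open>E exp(-K t) is nonincreasing and E exp(K t) is nondecreasing; one of the two settles
  each order of x and y.\<close>

lemma gronwall_nonneg_right:
  fixes E :: "real \<Rightarrow> real"
  assumes E: "\<And>x. x \<in> {c..d} \<Longrightarrow> (E has_real_derivative E' x) (at x within {c..d})"
    and le: "\<And>x. x \<in> {c..d} \<Longrightarrow> \<bar>E' x\<bar> \<le> K * E x" and xy: "x \<in> {c..d}" "y \<in> {c..d}"
  shows "E x \<le> exp (K * \<bar>x - y\<bar>) * E y"
proof (cases "y \<le> x")
  case True
  let ?h = "\<lambda>t. E t * exp (- (K * t))"
  have "\<exists>t\<in>{y..x}. ?h x - ?h y = (x - y) * ((E' t - K * E t) * exp (- (K * t)))"
  proof (rule mvt_very_simple[OF True])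
    fix t assume t: "y \<le> t" "t \<le> x"
    have "(E has_real_derivative E' t) (at t within {y..x})"
      using E[of t] t xy by (intro DERIV_subset[where t = "{y..x}"]) (auto intro: DERIV_subset)
    then have "(?h has_real_derivative ((E' t - K * E t) * exp (- (K * t)))) (at t within {y..x})"
      by (auto intro!: derivative_eq_intros simp: algebra_simps)
    then show "(?h has_derivative (\<lambda>d. d * ((E' t - K * E t) * exp (- (K * t))))) (at t within {y..x})"
      by (simp add: has_field_derivative_def mult_commute_abs)
  qed
  then obtain t where t: "t \<in> {y..x}" and eq: "?h x - ?h y = (x - y) * ((E' t - K * E t) * exp (- (K * t)))" by blast
  have "E' t - K * E t \<le> 0" using le[of t] t xy by auto
  then have "(x - y) * ((E' t - K * E t) * exp (- (K * t))) \<le> 0"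
    using True by (intro mult_nonneg_nonpos mult_nonpos_nonneg) auto
  with eq have "?h x \<le> ?h y" by linarith
  then have "E x * exp (- (K * x)) * exp (K * x) \<le> E y * exp (- (K * y)) * exp (K * x)"
    by (intro mult_right_mono) auto
  moreover have "exp (- (K * y)) * exp (K * x) = exp (K * \<bar>x - y\<bar>)"
    using True by (simp add: algebra_simps flip: exp_add)
  moreover have "exp (- (K * x)) * exp (K * x) = 1" by (simp flip: exp_add)
  ultimately show ?thesis by (simp only: mult.assoc) (simp add: mult.commute)
next
  case False
  then have xy': "x \<le> y" by simp
  let ?h = "\<lambda>t. E t * exp (K * t)"
  have "\<exists>t\<in>{x..y}. ?h y - ?h x = (y - x) * ((E' t + K * E t) * exp (K * t))"
  proof (rule mvt_very_simple[OF xy'])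
    fix t assume t: "x \<le> t" "t \<le> y"
    have "(E has_real_derivative E' t) (at t within {x..y})"
      using E[of t] t xy by (auto intro: DERIV_subset)
    then have "(?h has_real_derivative ((E' t + K * E t) * exp (K * t))) (at t within {x..y})"
      by (auto intro!: derivative_eq_intros simp: algebra_simps)
    then show "(?h has_derivative (\<lambda>d. d * ((E' t + K * E t) * exp (K * t)))) (at t within {x..y})"
      by (simp add: has_field_derivative_def mult_commute_abs)
  qed
  then obtain t where t: "t \<in> {x..y}" and eq: "?h y - ?h x = (y - x) * ((E' t + K * E t) * exp (K * t))" by blast
  have "E' t + K * E t \<ge> 0" using le[of t] t xy by auto
  then have "(y - x) * ((E' t + K * E t) * exp (K * t)) \<ge> 0"
    using xy' by (intro mult_nonneg_nonneg) auto
  with eq have "?h x \<le> ?h y" by linarith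
  then have "E x * exp (K * x) * exp (- (K * x)) \<le> E y * exp (K * y) * exp (- (K * x))"
    by (intro mult_right_mono) auto
  moreover have "exp (K * y) * exp (- (K * x)) = exp (K * \<bar>x - y\<bar>)"
    using xy' by (simp add: algebra_simps flip: exp_add)
  moreover have "exp (K * x) * exp (- (K * x)) = 1" by (simp flip: exp_add)
  ultimately show ?thesis by (simp only: mult.assoc) (simp add: mult.commute)
qed

text \<open>The Lebesgue integrals of the definitions run over open intervals, the gauge integrals
  of the calculus theorems over closed ones.\<close>

lemma set_integrable_imp_integrable_on_Icc:
  fixes f :: "real \<Rightarrow> 'a::euclidean_space"
  assumes "set_integrable lborel {0<..<s} f"
  shows "f integrable_on {0..s}" and "(LBINT x:{0<..<s}. f x) = integral {0..s} f"
proof -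
  have "f integrable_on {0<..<s}" and eq: "(LBINT x:{0<..<s}. f x) = integral {0<..<s} f"
    using set_borel_integral_eq_integral[OF assms] by auto
  then show "f integrable_on {0..s}"
    using integrable_on_open_interval[of f 0 s] by (simp add: box_real)
  show "(LBINT x:{0<..<s}. f x) = integral {0..s} f"
    using eq integral_open_interval[of 0 s f] by (simp add: box_real)
qed

lemma integral_0_tendsto_0:
  fixes f :: "real \<Rightarrow> 'a::banach"
  assumes "f integrable_on {0..s}" "s > 0"
  shows "((\<lambda>x. integral {0..x} f) \<longlongrightarrow> 0) (at_right 0)"
proof -
  have "continuous_on {0..s} (\<lambda>x. integral {0..x} f)"
    by (rule indefinite_integral_continuous_1[OF assms(1)])
  then have "((\<lambda>x. integral {0..x} f) \<longlongrightarrow> integral {0..0} f) (at 0 within {0..s})"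
    using assms(2) unfolding continuous_on_def by (drule_tac bspec[of _ _ 0]) auto
  moreover have "at 0 within {0..s} = at_right (0::real)"
    using assms(2) by (simp add: at_within_Icc_at_right)
  ultimately show ?thesis by simp
qed

lemma divide_le_self: "0 \<le> A \<Longrightarrow> 1 \<le> B \<Longrightarrow> A / B \<le> (A :: real)"
  using frac_le[of A A 1 B] by simp

section \<open>The regular solution near the singular endpoint\<close>

locale schroedinger =
  fixes \<nu> b :: real and q :: "real \<Rightarrow> real" and \<xi> :: "complex \<Rightarrow> real \<Rightarrow> complex"
  assumes nu: "0 < \<nu>" and b_pos: "0 < b" and q_AC: "q \<in> AC_loc b"
    and uq: "set_integrable lborel {0<..<b} (\<lambda>u. u * \<bar>q u\<bar>)"
    and reg: "regular_solution \<nu> q b \<xi>"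
begin

abbreviation V :: "real \<Rightarrow> real" where "V \<equiv> potential \<nu> q"
abbreviation p :: real where "p \<equiv> \<nu> + 1 / 2"

definition \<xi>' :: "complex \<Rightarrow> real \<Rightarrow> complex" where "\<xi>' z = dx b (\<xi> z)"

definition c0 :: real where "c0 = xi_const \<nu> * bessel_coeff \<nu> 0"

lemma c0_pos: "c0 > 0"
  using nu by (simp add: c0_def xi_const_pos bessel_coeff_pos)

lemma continuous_q: "continuous_on {0<..b} q"
  using q_AC by (intro continuous_on_Ioc) (auto simp: AC_loc_def abs_continuous_on_imp_continuous_on)

lemma continuous_V: "continuous_on {0<..b} V"
  unfolding potential_def[abs_def] by (intro continuous_intros continuous_q) auto

lemma xi_deriv: "x \<in> {0<..b} \<Longrightarrow> (\<xi> z has_vector_derivative \<xi>' z x) (at x within {0<..b})"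
  using reg by (auto simp: regular_solution_def solution_def \<xi>'_def)

lemma xi'_deriv:
  assumes "x \<in> {0<..b}"
  shows "(\<xi>' z has_vector_derivative (of_real (V x) - z) * \<xi> z x) (at x within {0<..b})"
proof -
  obtain f'' where f: "(\<xi>' z has_vector_derivative f'') (at x within {0<..b})"
    "- f'' + of_real (V x) * \<xi> z x = z * \<xi> z x"
    using reg assms unfolding regular_solution_def solution_def \<xi>'_def by blast
  have "f'' = (of_real (V x) - z) * \<xi> z x" using f(2) by (simp add: algebra_simps)
  then show ?thesis using f(1) by simp
qed

lemma continuous_xi: "continuous_on {0<..b} (\<xi> z)"
  unfolding continuous_on_eq_continuous_within using xi_deriv has_vector_derivative_continuous by blast

lemma continuous_xi': "continuous_on {0<..b} (\<xi>' z)"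
  unfolding continuous_on_eq_continuous_within using xi'_deriv has_vector_derivative_continuous by blast

section \<open>The perturbation integral and the size of the regular solution\<close>

definition J :: "real \<Rightarrow> real \<Rightarrow> real" where
  "J k x = (LBINT u:{0<..<x}. u * \<bar>q u\<bar> / (1 + k * u))"

abbreviation majorant :: "real \<Rightarrow> real \<Rightarrow> complex \<Rightarrow> real \<Rightarrow> real" where
  "majorant C c z x \<equiv> C * (x / (1 + cmod (csqrt z) * x)) powr c * exp (\<bar>Im (csqrt z)\<bar> * x) * J (cmod (csqrt z)) x"

lemma J_integrable:
  assumes "k \<ge> 0" "x \<le> b"
  shows "set_integrable lborel {0<..<x} (\<lambda>u. u * \<bar>q u\<bar> / (1 + k * u))"
proof (rule set_integrable_bound)
  show "set_integrable lborel {0<..<x} (\<lambda>u. u * \<bar>q u\<bar>)"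
    using assms(2) by (intro set_integrable_subset[OF uq]) auto
  have "1 + k * u \<noteq> 0" if "u \<in> {0<..<x}" for u
  proof -
    have "1 + k * u \<ge> 1" using assms that by simp
    then show ?thesis by linarith
  qed
  then have "continuous_on {0<..<x} (\<lambda>u. u * \<bar>q u\<bar> / (1 + k * u))"
    using assms by (intro continuous_intros continuous_on_subset[OF continuous_q]) auto
  then show "set_borel_measurable lborel {0<..<x} (\<lambda>u. u * \<bar>q u\<bar> / (1 + k * u))"
    by (rule set_borel_measurable_continuous)
  have "norm (u * \<bar>q u\<bar> / (1 + k * u)) \<le> norm (u * \<bar>q u\<bar>)" if "u \<in> {0<..<x}" for u
  proof -
    have "1 + k * u \<ge> 1" using assms that by simp
    then show ?thesis using that divide_le_self[of "u * \<bar>q u\<bar>" "1 + k * u"] by (simp add: abs_mult)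
  qed
  then show "AE u in lborel. u \<in> {0<..<x} \<longrightarrow> norm (u * \<bar>q u\<bar> / (1 + k * u)) \<le> norm (u * \<bar>q u\<bar>)" by auto
qed

lemma J_mono:
  assumes "k \<ge> 0" "x \<le> y" "y \<le> b"
  shows "J k x \<le> J k y"
  unfolding J_def set_lebesgue_integral_def
  using J_integrable[of k x] J_integrable[of k y] assms
  by (intro integral_mono) (auto simp: set_integrable_def indicator_def)

lemma J_nonneg:
  assumes "k \<ge> 0"
  shows "J k x \<ge> 0"
  unfolding J_def set_lebesgue_integral_def
  using assms by (intro Bochner_Integration.integral_nonneg) (auto simp: indicator_def)

lemma J_le_J0:
  assumes "k \<ge> 0" "x \<le> b"
  shows "J k x \<le> J 0 x"
  unfolding J_def set_lebesgue_integral_def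
proof (rule integral_mono)
  fix u
  have "u * \<bar>q u\<bar> / (1 + k * u) \<le> u * \<bar>q u\<bar> / (1 + 0 * u)" if "u \<in> {0<..<x}"
  proof -
    have "1 + k * u \<ge> 1" using assms that by simp
    then show ?thesis using that divide_le_self[of "u * \<bar>q u\<bar>" "1 + k * u"] by simp
  qed
  then show "indicator {0<..<x} u *\<^sub>R (u * \<bar>q u\<bar> / (1 + k * u)) \<le> indicator {0<..<x} u *\<^sub>R (u * \<bar>q u\<bar> / (1 + 0 * u))"
    by (simp add: indicator_def)
qed (use J_integrable[of k x] J_integrable[of 0 x] assms in \<open>auto simp: set_integrable_def\<close>)

lemma J0_tendsto: "((\<lambda>x. J 0 x) \<longlongrightarrow> 0) (at_right 0)"
proof -
  let ?f = "\<lambda>u. u * \<bar>q u\<bar> / (1 + 0 * u)"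
  have "((\<lambda>x. integral {0..x} ?f) \<longlongrightarrow> 0) (at_right 0)"
    by (rule integral_0_tendsto_0[OF set_integrable_imp_integrable_on_Icc(1)[OF J_integrable[of 0 b]] b_pos]) auto
  moreover have "\<forall>\<^sub>F x in at_right 0. integral {0..x} ?f = J 0 x"
  proof (rule eventually_at_rightI[of 0 b])
    fix x assume "x \<in> {0<..<b}"
    then show "integral {0..x} ?f = J 0 x"
      unfolding J_def by (intro set_integrable_imp_integrable_on_Icc(2)[symmetric] J_integrable) auto
  qed (rule b_pos)
  ultimately show ?thesis by (rule Lim_transform_eventually)
qed

lemma J_tendsto_at_top: "(\<lambda>n. J (real n) b) \<longlonglongrightarrow> 0"
proof -
  have "(\<lambda>n. LINT u|lborel. indicator {0<..<b} u *\<^sub>R (u * \<bar>q u\<bar> / (1 + real n * u))) \<longlonglongrightarrow> (LINT u::real|lborel. (0::real))"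
  proof (rule integral_dominated_convergence[where w = "\<lambda>u. indicator {0<..<b} u *\<^sub>R (u * \<bar>q u\<bar>)"])
    show "(\<lambda>u. indicator {0<..<b} u *\<^sub>R (u * \<bar>q u\<bar> / (1 + real n * u))) \<in> borel_measurable lborel" for n
      using J_integrable[of "real n" b] by (auto simp: set_integrable_def)
    show "integrable lborel (\<lambda>u. indicator {0<..<b} u *\<^sub>R (u * \<bar>q u\<bar>))"
      using uq by (simp add: set_integrable_def)
    show "AE u in lborel. (\<lambda>n. indicator {0<..<b} u *\<^sub>R (u * \<bar>q u\<bar> / (1 + real n * u))) \<longlonglongrightarrow> 0"
    proof (rule AE_I2)
      fix u :: real
      have "(\<lambda>n. u * \<bar>q u\<bar> / (1 + real n * u)) \<longlonglongrightarrow> 0" if "u > 0"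
      proof -
        have "filterlim (\<lambda>n. 1 + real n * u) at_infinity sequentially"
          using that by (intro filterlim_at_top_imp_at_infinity filterlim_tendsto_add_at_top[OF tendsto_const]
            filterlim_at_top_mult_tendsto_pos[OF tendsto_const] filterlim_real_sequentially)
        then show ?thesis by (rule tendsto_divide_0[OF tendsto_const])
      qed
      then show "(\<lambda>n. indicator {0<..<b} u *\<^sub>R (u * \<bar>q u\<bar> / (1 + real n * u))) \<longlonglongrightarrow> 0"
        by (cases "u \<in> {0<..<b}") auto
    qed
    show "AE u in lborel. norm (indicator {0<..<b} u *\<^sub>R (u * \<bar>q u\<bar> / (1 + real n * u))) \<le> indicator {0<..<b} u *\<^sub>R (u * \<bar>q u\<bar>)" for n
    proof (rule AE_I2)
      fix u
      have "u * \<bar>q u\<bar> / (1 + real n * u) \<le> u * \<bar>q u\<bar>" if "u \<in> {0<..<b}"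
      proof -
        have "1 + real n * u \<ge> 1" using that by simp
        then show ?thesis using that by (intro divide_le_self) auto
      qed
      then show "norm (indicator {0<..<b} u *\<^sub>R (u * \<bar>q u\<bar> / (1 + real n * u))) \<le> indicator {0<..<b} u *\<^sub>R (u * \<bar>q u\<bar>)"
        by (simp add: indicator_def abs_mult)
    qed
  qed simp
  then show ?thesis by (simp add: J_def set_lebesgue_integral_def)
qed

lemma estimates:
  obtains C where "C \<ge> 0"
    "\<And>z x. x \<in> {0<..b} \<Longrightarrow> cmod (\<xi> z x - xi_free \<nu> z x)
          \<le> majorant C p z x"
    "\<And>z x. x \<in> {0<..b} \<Longrightarrow> cmod (\<xi>' z x - xi_free' \<nu> z x)
          \<le> majorant C (\<nu> - 1 / 2) z x"
proof -
  obtain C where C: "\<And>z x. x \<in> {0<..b} \<Longrightarrow> cmod (\<xi> z x - xi_free \<nu> z x)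
          \<le> majorant C p z x"
    "\<And>z x. x \<in> {0<..b} \<Longrightarrow> cmod (\<xi>' z x - vector_derivative (xi_free \<nu> z) (at x))
          \<le> majorant C (\<nu> - 1 / 2) z x"
    using reg unfolding regular_solution_def \<xi>'_def J_def by blast
  have le: "C * A * B * J k x \<le> \<bar>C\<bar> * A * B * J k x" if "A \<ge> 0" "B \<ge> 0" "k \<ge> 0" for A B k x
    using that J_nonneg[of k x] by (intro mult_right_mono) auto
  show thesis
  proof (rule that[of "\<bar>C\<bar>"])
    fix z x assume x: "x \<in> {0<..b}"
    show "cmod (\<xi> z x - xi_free \<nu> z x)
          \<le> majorant \<bar>C\<bar> p z x"
      by (rule order_trans[OF C(1)[OF x] le]) auto
    have "vector_derivative (xi_free \<nu> z) (at x) = xi_free' \<nu> z x"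
      using x nu by (intro vector_derivative_at xi_free_has_vector_derivative) auto
    then show "cmod (\<xi>' z x - xi_free' \<nu> z x)
          \<le> majorant \<bar>C\<bar> (\<nu> - 1 / 2) z x"
      using order_trans[OF C(2)[OF x, of z] le] by simp
  qed simp
qed

text \<open>For fixed z the error is \<open>J 0 x\<close>, which tends to 0 with x, times the
  leading power of x; in this form the estimates identify the behaviour at 0.\<close>

lemma rough_estimates:
  obtains C where "C \<ge> 0"
    "\<And>z x. x \<in> {0<..b} \<Longrightarrow> cmod (\<xi> z x - xi_free \<nu> z x)
          \<le> C * exp (cmod (csqrt z) * b) * J 0 x * x powr p"
    "\<And>z x. x \<in> {0<..b} \<Longrightarrow> cmod (\<xi>' z x - xi_free' \<nu> z x)
          \<le> C * (1 + cmod (csqrt z) * b) * exp (cmod (csqrt z) * b) * J 0 x * x powr (\<nu> - 1 / 2)"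
proof -
  obtain C where C: "C \<ge> 0"
    "\<And>z x. x \<in> {0<..b} \<Longrightarrow> cmod (\<xi> z x - xi_free \<nu> z x)
          \<le> majorant C p z x"
    "\<And>z x. x \<in> {0<..b} \<Longrightarrow> cmod (\<xi>' z x - xi_free' \<nu> z x)
          \<le> majorant C (\<nu> - 1 / 2) z x"
    using estimates by metis
  show thesis
  proof (rule that[OF C(1)])
    fix z x assume x: "x \<in> {0<..b}"
    let ?k = "cmod (csqrt z)"
    have k1: "1 + ?k * x \<ge> 1" and k2: "1 + ?k * x \<le> 1 + ?k * b"
      using x by (auto intro: mult_left_mono)
    have e: "exp (\<bar>Im (csqrt z)\<bar> * x) \<le> exp (?k * b)"
      using x abs_Im_le_cmod[of "csqrt z"] by (intro exp_le_cancel_iff[THEN iffD2] mult_mono) auto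
    have j: "0 \<le> J ?k x" "J ?k x \<le> J 0 x" using x by (auto intro: J_nonneg J_le_J0)
    have "(x / (1 + ?k * x)) powr p \<le> x powr p"
      using x nu k1 divide_le_self[of x "1 + ?k * x"] by (intro powr_mono2) auto
    then have "C * (x / (1 + ?k * x)) powr p * exp (\<bar>Im (csqrt z)\<bar> * x) * J ?k x
        \<le> C * x powr p * exp (?k * b) * J 0 x"
      using C(1) e j by (intro mult_mono) auto
    then show "cmod (\<xi> z x - xi_free \<nu> z x) \<le> C * exp (?k * b) * J 0 x * x powr p"
      using C(2)[OF x, of z] by (simp add: mult_ac)
    \<comment> \<open>For \<nu> < 1/2 the exponent \<nu> - 1/2 is negative and the denominator works
      in the wrong direction; it costs at most a factor 1 + k b.\<close>
    have "(1 + ?k * x) powr (1 / 2 - \<nu>) \<le> (1 + ?k * x) powr 1"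
      using k1 nu by (intro powr_mono) auto
    then have "(1 + ?k * x) powr (1 / 2 - \<nu>) \<le> 1 + ?k * b" using k1 k2 by simp
    moreover have "(x / (1 + ?k * x)) powr (\<nu> - 1 / 2) = x powr (\<nu> - 1 / 2) * (1 + ?k * x) powr (1 / 2 - \<nu>)"
    proof -
      have "(1 + ?k * x) powr (1 / 2 - \<nu>) = inverse ((1 + ?k * x) powr (\<nu> - 1 / 2))"
        using powr_minus[of "1 + ?k * x" "\<nu> - 1 / 2"] by simp
      then show ?thesis by (simp only: powr_divide divide_inverse[of "x powr (\<nu> - 1 / 2)"])
    qed
    ultimately have "(x / (1 + ?k * x)) powr (\<nu> - 1 / 2) \<le> x powr (\<nu> - 1 / 2) * (1 + ?k * b)"
      by (simp add: mult_left_mono)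
    then have "C * (x / (1 + ?k * x)) powr (\<nu> - 1 / 2) * exp (\<bar>Im (csqrt z)\<bar> * x) * J ?k x
        \<le> C * (x powr (\<nu> - 1 / 2) * (1 + ?k * b)) * exp (?k * b) * J 0 x"
      using C(1) e j b_pos by (intro mult_mono) auto
    then show "cmod (\<xi>' z x - xi_free' \<nu> z x)
          \<le> C * (1 + ?k * b) * exp (?k * b) * J 0 x * x powr (\<nu> - 1 / 2)"
      using C(3)[OF x, of z] by (simp add: mult_ac)
  qed
qed

text \<open>Relative to the leading power the error is o(1), so the perturbed solution inherits the
  leading coefficients of the free one.\<close>

lemma xi_at_0:
  "((\<lambda>x. \<xi> z x / of_real (x powr p)) \<longlongrightarrow> of_real c0) (at_right 0)"
  "((\<lambda>x. \<xi>' z x / of_real (x powr (\<nu> - 1 / 2))) \<longlongrightarrow> of_real (p * c0)) (at_right 0)"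
proof -
  obtain C where C: "C \<ge> 0"
    "\<And>z x. x \<in> {0<..b} \<Longrightarrow> cmod (\<xi> z x - xi_free \<nu> z x) \<le> C * exp (cmod (csqrt z) * b) * J 0 x * x powr p"
    "\<And>z x. x \<in> {0<..b} \<Longrightarrow> cmod (\<xi>' z x - xi_free' \<nu> z x)
          \<le> C * (1 + cmod (csqrt z) * b) * exp (cmod (csqrt z) * b) * J 0 x * x powr (\<nu> - 1 / 2)"
    using rough_estimates by metis
  have gen: "((\<lambda>x. f x / of_real (x powr a)) \<longlongrightarrow> l) (at_right 0)"
    if "\<And>x. x \<in> {0<..b} \<Longrightarrow> cmod (f x - g x) \<le> D * J 0 x * x powr a"
      and g: "((\<lambda>x. g x / of_real (x powr a)) \<longlongrightarrow> l) (at_right 0)" for f g :: "real \<Rightarrow> complex" and D a l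
  proof -
    have "((\<lambda>x. (f x - g x) / of_real (x powr a)) \<longlongrightarrow> 0) (at_right 0)"
    proof (rule tendsto_norm_zero_cancel, rule tendsto_sandwich[OF _ _ tendsto_const])
      show "((\<lambda>x. D * J 0 x) \<longlongrightarrow> 0) (at_right 0)"
        using tendsto_mult_right_zero[OF J0_tendsto] by simp
      show "\<forall>\<^sub>F x in at_right 0. cmod ((f x - g x) / of_real (x powr a)) \<le> D * J 0 x"
      proof (rule eventually_at_rightI[of 0 b])
        fix x assume "x \<in> {0<..<b}"
        then show "cmod ((f x - g x) / of_real (x powr a)) \<le> D * J 0 x"
          using that(1)[of x] by (simp add: norm_divide divide_le_eq)
      qed (rule b_pos)
    qed simp
    from tendsto_add[OF this g] show ?thesis by (simp add: diff_divide_distrib)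
  qed
  show "((\<lambda>x. \<xi> z x / of_real (x powr p)) \<longlongrightarrow> of_real c0) (at_right 0)"
    unfolding c0_def by (rule gen[OF C(2) xi_free_at_0(1)]) (use nu in auto)
  show "((\<lambda>x. \<xi>' z x / of_real (x powr (\<nu> - 1 / 2))) \<longlongrightarrow> of_real (p * c0)) (at_right 0)"
    unfolding c0_def by (rule gen[OF C(3) xi_free_at_0(2)]) (use nu in auto)
qed

lemma xi_bound_compact:
  assumes "compact K"
  obtains M where "M > 0"
    "\<And>z x. z \<in> K \<Longrightarrow> x \<in> {0<..b} \<Longrightarrow> cmod (\<xi> z x) \<le> M * x powr p"
    "\<And>z x. z \<in> K \<Longrightarrow> x \<in> {0<..b} \<Longrightarrow> cmod (\<xi>' z x) \<le> M * x powr (\<nu> - 1 / 2)"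
proof -
  obtain C where C: "C \<ge> 0"
    "\<And>z x. x \<in> {0<..b} \<Longrightarrow> cmod (\<xi> z x - xi_free \<nu> z x) \<le> C * exp (cmod (csqrt z) * b) * J 0 x * x powr p"
    "\<And>z x. x \<in> {0<..b} \<Longrightarrow> cmod (\<xi>' z x - xi_free' \<nu> z x)
          \<le> C * (1 + cmod (csqrt z) * b) * exp (cmod (csqrt z) * b) * J 0 x * x powr (\<nu> - 1 / 2)"
    using rough_estimates by metis
  obtain M where M: "M > 0" "\<And>z x. z \<in> K \<Longrightarrow> 0 < x \<Longrightarrow> x \<le> b \<Longrightarrow> cmod (xi_free \<nu> z x) \<le> M * x powr p"
    "\<And>z x. z \<in> K \<Longrightarrow> 0 < x \<Longrightarrow> x \<le> b \<Longrightarrow> cmod (xi_free' \<nu> z x) \<le> M * x powr (\<nu> - 1 / 2)"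
    using xi_free_bound[OF less_imp_le[OF nu] assms] by metis
  obtain R where R: "R > 0" "\<And>z. z \<in> K \<Longrightarrow> cmod z \<le> R"
    using compact_imp_bounded[OF assms] unfolding bounded_pos by blast
  have k: "cmod (csqrt z) \<le> sqrt R" if "z \<in> K" for z
    using R(2)[OF that] real_sqrt_le_mono norm_csqrt by metis
  define B where "B = C * (1 + sqrt R * b) * exp (sqrt R * b) * J 0 b"
  have B0: "B \<ge> 0" using C(1) R(1) b_pos J_nonneg[of 0 b] by (simp add: B_def)
  show thesis
  proof (rule that[of "M + B"])
    show "M + B > 0" using M(1) B0 by simp
    fix z x assume z: "z \<in> K" and x: "x \<in> {0<..b}"
    have J: "0 \<le> J 0 x" "J 0 x \<le> J 0 b" using x by (auto intro: J_nonneg J_mono)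
    have kb: "0 \<le> cmod (csqrt z) * b" "cmod (csqrt z) * b \<le> sqrt R * b"
      using k[OF z] b_pos by auto
    have "C * 1 * exp (cmod (csqrt z) * b) * J 0 x \<le> B"
      unfolding B_def using C(1) J kb by (intro mult_mono) auto
    then have "C * exp (cmod (csqrt z) * b) * J 0 x * x powr p \<le> B * x powr p"
      by (intro mult_right_mono) auto
    then have "cmod (\<xi> z x - xi_free \<nu> z x) \<le> B * x powr p"
      using C(2)[OF x, of z] by linarith
    then show "cmod (\<xi> z x) \<le> (M + B) * x powr p"
      using M(2)[OF z, of x] x norm_triangle_sub[of "\<xi> z x" "xi_free \<nu> z x"] by (simp add: distrib_right)
    have "C * (1 + cmod (csqrt z) * b) * exp (cmod (csqrt z) * b) * J 0 x \<le> B"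
      unfolding B_def using C(1) J kb by (intro mult_mono) auto
    then have "C * (1 + cmod (csqrt z) * b) * exp (cmod (csqrt z) * b) * J 0 x * x powr (\<nu> - 1 / 2) \<le> B * x powr (\<nu> - 1 / 2)"
      by (intro mult_right_mono) auto
    then have "cmod (\<xi>' z x - xi_free' \<nu> z x) \<le> B * x powr (\<nu> - 1 / 2)"
      using C(3)[OF x, of z] by linarith
    then show "cmod (\<xi>' z x) \<le> (M + B) * x powr (\<nu> - 1 / 2)"
      using M(3)[OF z, of x] x norm_triangle_sub[of "\<xi>' z x" "xi_free' \<nu> z x"] by (simp add: distrib_right)
  qed
qed

lemma xi_bound:
  obtains M where "M > 0"
    "\<And>x. x \<in> {0<..b} \<Longrightarrow> cmod (\<xi> z x) \<le> M * x powr p"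
    "\<And>x. x \<in> {0<..b} \<Longrightarrow> cmod (\<xi>' z x) \<le> M * x powr (\<nu> - 1 / 2)"
  using xi_bound_compact[of "{z}"] by (metis compact_sing singletonI)

lemma xi_L2:
  assumes "s \<le> b"
  shows "\<xi> z \<in> L2 s"
proof -
  obtain M where M: "M > 0" "\<And>x. x \<in> {0<..b} \<Longrightarrow> cmod (\<xi> z x) \<le> M * x powr p"
    using xi_bound by metis
  show ?thesis
  proof (rule L2_continuous_bounded)
    show "continuous_on {0<..<s} (\<xi> z)"
      using assms by (intro continuous_on_subset[OF continuous_xi]) auto
    fix x assume x: "x \<in> {0<..<s}"
    have "cmod (\<xi> z x) \<le> M * x powr p" using M(2)[of x] x assms by simp
    also have "\<dots> \<le> M * b powr p"
      using M(1) x assms nu by (intro mult_left_mono powr_mono2) auto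
    finally show "cmod (\<xi> z x) \<le> M * b powr p" .
  qed
qed

lemma xi_lower:
  obtains \<delta> where "\<delta> > 0" "\<delta> \<le> b" "\<And>x. x \<in> {0<..<\<delta>} \<Longrightarrow> c0 / 2 * x powr p \<le> cmod (\<xi> z x)"
    "\<And>x. x \<in> {0<..<\<delta>} \<Longrightarrow> \<xi> z x \<noteq> 0"
proof -
  have "((\<lambda>x. cmod (\<xi> z x / of_real (x powr p))) \<longlongrightarrow> c0) (at_right 0)"
    using tendsto_norm[OF xi_at_0(1)[of z]] c0_pos by simp
  then have "\<forall>\<^sub>F x in at_right 0. c0 / 2 < cmod (\<xi> z x / of_real (x powr p))"
    by (rule order_tendstoD(1)) (use c0_pos in simp)
  then obtain e where e: "e > 0" "\<And>x. 0 < x \<Longrightarrow> x < e \<Longrightarrow> c0 / 2 < cmod (\<xi> z x / of_real (x powr p))"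
    by (auto simp: eventually_at_right_field)
  have le: "c0 / 2 * x powr p < cmod (\<xi> z x)" if "x \<in> {0<..<e}" for x
    using e(2)[of x] that by (simp add: norm_divide less_divide_eq)
  show thesis
  proof (rule that[of "min e b"])
    fix x assume x: "x \<in> {0<..<min e b}"
    show "c0 / 2 * x powr p \<le> cmod (\<xi> z x)" using le[of x] x by simp
    have "0 < c0 / 2 * x powr p" using c0_pos x by simp
    then show "\<xi> z x \<noteq> 0" using le[of x] x by auto
  qed (use e b_pos in auto)
qed

text \<open>The derivative of |f'|^2 + w |f|^2 is twice the inner product of (V - \<mu> + w) f with
  f', and 2 sqrt(w) |f| |f'| is at most the energy. With w = 1 this gives uniqueness; with w = \<mu>
  only V remains in the bracket.\<close>

lemma energy_bound:
  fixes f f' :: "real \<Rightarrow> complex"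
  assumes cd: "{c..d} \<subseteq> {0<..b}" and w: "w > 0"
    and f: "\<And>x. x \<in> {c..d} \<Longrightarrow> (f has_vector_derivative f' x) (at x within {c..d})"
    and f': "\<And>x. x \<in> {c..d} \<Longrightarrow> (f' has_vector_derivative (of_real (V x) - \<mu>) * f x) (at x within {c..d})"
    and K: "\<And>x. x \<in> {c..d} \<Longrightarrow> cmod (of_real (V x) - \<mu> + of_real w) \<le> K * sqrt w"
    and xy: "x \<in> {c..d}" "y \<in> {c..d}"
  shows "(cmod (f' x))\<^sup>2 + w * (cmod (f x))\<^sup>2 \<le> exp (K * \<bar>x - y\<bar>) * ((cmod (f' y))\<^sup>2 + w * (cmod (f y))\<^sup>2)"
proof -
  let ?E = "\<lambda>x. (cmod (f' x))\<^sup>2 + w * (cmod (f x))\<^sup>2"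
  let ?E' = "\<lambda>x. 2 * inner ((of_real (V x) - \<mu>) * f x) (f' x) + w * (2 * inner (f' x) (f x))"
  have sq: "(cmod u)\<^sup>2 = inner u u" for u by (simp add: power2_norm_eq_inner)
  show ?thesis
  proof (rule gronwall_nonneg_right[of c d ?E ?E' K, OF _ _ xy])
    fix x assume x: "x \<in> {c..d}"
    have self: "((\<lambda>x. inner (g x) (g x)) has_real_derivative 2 * inner g' (g x)) (at x within {c..d})"
      if "(g has_vector_derivative g') (at x within {c..d})" for g :: "real \<Rightarrow> complex" and g'
    proof -
      have "((\<lambda>x. inner (g x) (g x)) has_derivative (\<lambda>h. inner (g x) (h *\<^sub>R g') + inner (h *\<^sub>R g') (g x))) (at x within {c..d})"
        using has_derivative_inner[OF that[unfolded has_vector_derivative_def] that[unfolded has_vector_derivative_def]] .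
      moreover have "(\<lambda>h. inner (g x) (h *\<^sub>R g') + inner (h *\<^sub>R g') (g x)) = (*) (2 * inner g' (g x))"
        by (simp add: fun_eq_iff inner_commute[of "g x"])
      ultimately show ?thesis by (simp add: has_field_derivative_def)
    qed
    have "((\<lambda>x. inner (f x) (f x)) has_real_derivative 2 * inner (f' x) (f x)) (at x within {c..d})"
      by (rule self[OF f[OF x]])
    moreover have "((\<lambda>x. inner (f' x) (f' x)) has_real_derivative 2 * inner ((of_real (V x) - \<mu>) * f x) (f' x)) (at x within {c..d})"
      by (rule self[OF f'[OF x]])
    ultimately show "(?E has_real_derivative ?E' x) (at x within {c..d})"
      unfolding sq by (intro DERIV_add DERIV_cmult)
    have "?E' x = 2 * inner ((of_real (V x) - \<mu> + of_real w) * f x) (f' x)"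
      using inner_scaleR_left[of w "f x" "f' x"]
      by (simp only: distrib_right inner_add_left scaleR_conv_of_real inner_commute[of "f' x" "f x"]) (simp add: algebra_simps)
    then have "\<bar>?E' x\<bar> \<le> 2 * (cmod ((of_real (V x) - \<mu> + of_real w) * f x) * cmod (f' x))"
      using Cauchy_Schwarz_ineq2[of "(of_real (V x) - \<mu> + of_real w) * f x" "f' x"] by simp
    also have "\<dots> \<le> 2 * (K * sqrt w * cmod (f x) * cmod (f' x))"
      unfolding norm_mult using K[OF x] by (intro mult_left_mono mult_right_mono) auto
    also have "\<dots> = K * (2 * (sqrt w * cmod (f x)) * cmod (f' x))" by simp
    also have "\<dots> \<le> K * ?E x"
    proof (rule mult_left_mono)
      show "2 * (sqrt w * cmod (f x)) * cmod (f' x) \<le> ?E x"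
        using sum_squares_bound[of "sqrt w * cmod (f x)" "cmod (f' x)"] w by (simp add: power_mult_distrib)
      have "0 \<le> K * sqrt w" using K[OF x] norm_ge_zero order_trans by blast
      then show "0 \<le> K" using w by (simp add: zero_le_mult_iff)
    qed
    finally show "\<bar>?E' x\<bar> \<le> K * ?E x" .
  qed
qed

lemma ode_unique:
  fixes f f' :: "real \<Rightarrow> complex"
  assumes s: "s \<le> b" and x0: "x0 \<in> {0<..s}"
    and f: "\<And>x. x \<in> {0<..s} \<Longrightarrow> (f has_vector_derivative f' x) (at x within {0<..s})"
    and f': "\<And>x. x \<in> {0<..s} \<Longrightarrow> (f' has_vector_derivative (of_real (V x) - \<mu>) * f x) (at x within {0<..s})"
    and 0: "f x0 = 0" "f' x0 = 0" and x: "x \<in> {0<..s}"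
  shows "f x = 0 \<and> f' x = 0"
proof -
  define c where "c = min x x0"
  have sub: "{c..s} \<subseteq> {0<..s}" using x x0 by (auto simp: c_def)
  have "continuous_on {c..s} (\<lambda>x. of_real (V x) - \<mu> + of_real 1)"
    using sub s by (intro continuous_intros continuous_on_subset[OF continuous_V]) auto
  then have "bounded ((\<lambda>x. of_real (V x) - \<mu> + of_real 1) ` {c..s})"
    by (intro compact_imp_bounded compact_continuous_image) auto
  then obtain K where K: "\<And>x. x \<in> {c..s} \<Longrightarrow> cmod (of_real (V x) - \<mu> + of_real 1) \<le> K"
    unfolding bounded_pos by blast
  have "(cmod (f' x))\<^sup>2 + 1 * (cmod (f x))\<^sup>2 \<le> exp (K * \<bar>x - x0\<bar>) * ((cmod (f' x0))\<^sup>2 + 1 * (cmod (f x0))\<^sup>2)"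
  proof (rule energy_bound[of c s 1 f f' \<mu> K x x0])
    show "(f has_vector_derivative f' x) (at x within {c..s})" if "x \<in> {c..s}" for x
      using f[of x] that sub has_vector_derivative_within_subset by blast
    show "(f' has_vector_derivative (of_real (V x) - \<mu>) * f x) (at x within {c..s})" if "x \<in> {c..s}" for x
      using f'[of x] that sub has_vector_derivative_within_subset by blast
  qed (use sub s x x0 K in \<open>auto simp: c_def\<close>)
  then have le: "(cmod (f' x))\<^sup>2 + (cmod (f x))\<^sup>2 \<le> 0" using 0 by simp
  have "0 \<le> (cmod (f' x))\<^sup>2" "0 \<le> (cmod (f x))\<^sup>2" by auto
  with le have "(cmod (f' x))\<^sup>2 = 0" "(cmod (f x))\<^sup>2 = 0" by linarith+
  then show ?thesis by simp
qed

end

lemma tendsto_powr_0_right: "a > 0 \<Longrightarrow> ((\<lambda>x::real. x powr a) \<longlongrightarrow> 0) (at_right 0)"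
  by (rule tendsto_zero_powrI[OF tendsto_ident_at tendsto_const])
     (auto intro!: eventually_mono[OF eventually_at_right_less[of 0]])

text \<open>The real rule, applied to the real and imaginary parts of r over x^(-a). The version for
  an unbounded denominator is used, so no limit of r has to be known.\<close>

lemma lhopital_complex_powr:
  fixes r :: "real \<Rightarrow> complex"
  assumes a: "a > 0" and r: "\<forall>\<^sub>F x in at_right 0. (r has_vector_derivative r' x) (at x)"
    and lim: "((\<lambda>x. r' x * of_real (x powr (a + 1))) \<longlongrightarrow> m) (at_right 0)"
  shows "((\<lambda>x. r x * of_real (x powr a)) \<longlongrightarrow> - m / of_real a) (at_right 0)"
proof -
  have top: "LIM x at_right 0. x powr (- a) :> at_top"
  proof -
    have "LIM x at_right 0. inverse (x powr a) :> at_top"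
      by (rule filterlim_inverse_at_top[OF tendsto_powr_0_right[OF a]])
         (auto intro!: eventually_mono[OF eventually_at_right_less[of 0]])
    then show ?thesis by (simp add: powr_minus)
  qed
  have pos: "\<forall>\<^sub>F x::real in at_right 0. x > 0" by (rule eventually_at_right_less)
  have part: "((\<lambda>x. R x * x powr a) \<longlongrightarrow> - n / a) (at_right 0)"
    if R: "\<forall>\<^sub>F x in at_right 0. (R has_real_derivative R' x) (at x)"
      and l: "((\<lambda>x. R' x * x powr (a + 1)) \<longlongrightarrow> n) (at_right 0)" for R R' :: "real \<Rightarrow> real" and n
  proof -
    have "((\<lambda>x. R x / x powr (- a)) \<longlongrightarrow> - n / a) (at_right 0)"
    proof (rule lhopital_right_0_at_top[OF top _ R, where g' = "\<lambda>x. - a * x powr (- a - 1)"])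
      show "\<forall>\<^sub>F x in at_right 0. - a * x powr (- a - 1) \<noteq> 0"
        using pos by eventually_elim (use a in auto)
      show "\<forall>\<^sub>F x in at_right 0. ((\<lambda>x. x powr - a) has_real_derivative - a * x powr (- a - 1)) (at x)"
        using pos by eventually_elim (auto intro!: derivative_eq_intros)
      have "((\<lambda>x. - (R' x * x powr (a + 1)) / a) \<longlongrightarrow> - n / a) (at_right 0)"
        using a by (intro tendsto_intros l) auto
      then show "((\<lambda>x. R' x / (- a * x powr (- a - 1))) \<longlongrightarrow> - n / a) (at_right 0)"
      proof (rule Lim_transform_eventually)
        show "\<forall>\<^sub>F x in at_right 0. - (R' x * x powr (a + 1)) / a = R' x / (- a * x powr (- a - 1))"
          using pos
        proof eventually_elim
          case (elim x)
          have "x powr (- a - 1) = inverse (x powr (a + 1))"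
            using powr_minus[of x "a + 1"] by simp
          then show ?case using a by (simp add: field_simps)
        qed
      qed
    qed
    then show ?thesis by (simp add: powr_minus divide_inverse)
  qed
  have "((\<lambda>x. Re (r x) * x powr a) \<longlongrightarrow> - Re m / a) (at_right 0)"
  proof (rule part)
    show "\<forall>\<^sub>F x in at_right 0. ((\<lambda>x. Re (r x)) has_real_derivative Re (r' x)) (at x)"
      using r by eventually_elim
        (simp add: has_real_derivative_iff_has_vector_derivative bounded_linear.has_vector_derivative[OF bounded_linear_Re])
    show "((\<lambda>x. Re (r' x) * x powr (a + 1)) \<longlongrightarrow> Re m) (at_right 0)"
      using tendsto_Re[OF lim] by simp
  qed
  moreover have "((\<lambda>x. Im (r x) * x powr a) \<longlongrightarrow> - Im m / a) (at_right 0)"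
  proof (rule part)
    show "\<forall>\<^sub>F x in at_right 0. ((\<lambda>x. Im (r x)) has_real_derivative Im (r' x)) (at x)"
      using r by eventually_elim
        (simp add: has_real_derivative_iff_has_vector_derivative bounded_linear.has_vector_derivative[OF bounded_linear_Im])
    show "((\<lambda>x. Im (r' x) * x powr (a + 1)) \<longlongrightarrow> Im m) (at_right 0)"
      using tendsto_Im[OF lim] by simp
  qed
  ultimately show ?thesis
    by (simp add: tendsto_complex_iff Re_divide_of_real Im_divide_of_real)
qed

section \<open>Positivity of the solution at very negative energies\<close>

context schroedinger
begin

lemma J_antimono:
  assumes "0 \<le> k" "k \<le> l" "x \<le> b"
  shows "J l x \<le> J k x"
  unfolding J_def set_lebesgue_integral_def
proof (rule integral_mono)
  fix u
  have "u * \<bar>q u\<bar> / (1 + l * u) \<le> u * \<bar>q u\<bar> / (1 + k * u)" if "u \<in> {0<..<x}"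
    using that assms by (intro divide_left_mono add_left_mono mult_right_mono mult_pos_pos add_pos_nonneg) auto
  then show "indicator {0<..<x} u *\<^sub>R (u * \<bar>q u\<bar> / (1 + l * u)) \<le> indicator {0<..<x} u *\<^sub>R (u * \<bar>q u\<bar> / (1 + k * u))"
    by (simp add: indicator_def)
qed (use J_integrable[of k x] J_integrable[of l x] assms in \<open>auto simp: set_integrable_def\<close>)

text \<open>For \<open>z = -k\<^sup>2\<close> the unperturbed solution grows like \<open>(x / (1 + k x))\<^sup>p e\<^sup>k\<^sup>x\<close>, which beats the
  perturbation because \<open>J k b\<close> tends to zero.\<close>

theorem positive_solution:
  assumes s: "0 < s" "s \<le> b" and \<gamma>: "0 < \<gamma>" "\<gamma> < pi"
  obtains \<mu>0 :: real where "\<And>\<mu> x. \<mu> \<le> \<mu>0 \<Longrightarrow> x \<in> {0<..s} \<Longrightarrow> 0 < Re (\<xi> (of_real \<mu>) x)"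
    "\<And>\<mu>. \<mu> \<le> \<mu>0 \<Longrightarrow> 0 < cos \<gamma> * Re (\<xi> (of_real \<mu>) s) + sin \<gamma> * Re (\<xi>' (of_real \<mu>) s)"
proof -
  define K where "K = xi_const \<nu>"
  have K: "K > 0" unfolding K_def by (rule xi_const_pos)
  have sg: "sin \<gamma> > 0" using \<gamma> by (rule sin_gt_zero)
  obtain C where C: "C \<ge> 0"
    "\<And>z x. x \<in> {0<..b} \<Longrightarrow> cmod (\<xi> z x - xi_free \<nu> z x)
          \<le> majorant C p z x"
    "\<And>z x. x \<in> {0<..b} \<Longrightarrow> cmod (\<xi>' z x - xi_free' \<nu> z x)
          \<le> majorant C (\<nu> - 1 / 2) z x"
    using estimates by metis
  obtain c where c: "c > 0" "\<And>t. t \<ge> 0 \<Longrightarrow> bessel_mod \<nu> t \<ge> c * exp t * (1 + t) powr - p"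
    using bessel_mod_lower[OF less_imp_le[OF nu]] by metis
  obtain c1 where c1: "c1 > 0" "\<And>t. t \<ge> 0 \<Longrightarrow> bessel_mod (\<nu> + 1) t \<ge> c1 * exp t * (1 + t) powr - (\<nu> + 1 + 1 / 2)"
    using bessel_mod_lower[of "\<nu> + 1"] nu by auto
  \<comment> \<open>Since cos \<gamma> may be negative, A measures the coefficient of the
    \<open>bessel_mod \<nu>\<close> term in the boundary form against sin \<gamma>; half of the
    \<open>bessel_mod (\<nu> + 1)\<close> term will absorb it.\<close>
  define A where "A = \<bar>s * cos \<gamma> + p * sin \<gamma>\<bar> / sin \<gamma>"
  obtain t0 where t0: "t0 > 0" "\<And>t. t \<ge> t0 \<Longrightarrow> A * bessel_mod \<nu> t \<le> t\<^sup>2 / 4 * bessel_mod (\<nu> + 1) t"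
    using bessel_mod_ratio[OF less_imp_le[OF nu], of A] by metis
  \<comment> \<open>The first bound serves positivity inside, the second the boundary form; 16 comes
    from (1 + t)^2 \<le> 4 t^2 and the factor 1/4 left in front of t^2.\<close>
  define \<epsilon> where "\<epsilon> = min (K * c) (K * sin \<gamma> * c1 / 16)"
  have \<epsilon>: "\<epsilon> > 0" using K c c1 sg by (simp add: \<epsilon>_def)
  have "(\<lambda>n. C * (1 + s) * J (real n) b) \<longlonglongrightarrow> C * (1 + s) * 0"
    by (intro tendsto_intros J_tendsto_at_top)
  then have "\<forall>\<^sub>F n in sequentially. C * (1 + s) * J (real n) b < \<epsilon>"
    using \<epsilon> by (intro order_tendstoD(2)) auto
  then obtain n1 where n1: "\<And>n. n \<ge> n1 \<Longrightarrow> C * (1 + s) * J (real n) b < \<epsilon>"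
    by (auto simp: eventually_sequentially)
  \<comment> \<open>Ensures k s \<ge> t0 and k s \<ge> 1, the two conditions under which the
    comparison at the endpoint works.\<close>
  obtain n2 :: nat where n2: "max (t0 / s) (1 / s) \<le> n2" using real_arch_simple by blast
  define n where "n = max n1 n2"
  have main: "(\<forall>x\<in>{0<..s}. 0 < Re (\<xi> (of_real \<mu>) x)) \<and> 0 < cos \<gamma> * Re (\<xi> (of_real \<mu>) s) + sin \<gamma> * Re (\<xi>' (of_real \<mu>) s)"
    if \<mu>: "\<mu> \<le> - ((real n)\<^sup>2)" for \<mu>
  proof -
    define k where "k = sqrt (- \<mu>)"
    have nk: "real n \<le> k" unfolding k_def by (rule real_le_rsqrt) (use \<mu> in simp)
    have k0: "k \<ge> 0" using nk by (rule order_trans[rotated]) simp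
    have k\<mu>: "\<mu> = - (k\<^sup>2)" using order_trans[OF \<mu>, of 0] by (simp add: k_def)
    have "C * (1 + s) * J k b \<le> C * (1 + s) * J (real n) b"
      using C(1) s nk by (intro mult_left_mono J_antimono) auto
    then have nJ: "C * (1 + s) * J k b < \<epsilon>" using n1[of n] by (simp add: n_def)
    have "max (t0 / s) (1 / s) \<le> n" using n2 by (rule order_trans) (simp add: n_def)
    then have "max (t0 / s) (1 / s) \<le> k" using nk by (rule order_trans)
    then have ns: "k * s \<ge> t0" "k * s \<ge> 1" using s by (auto simp: divide_le_eq)
    define z where "z = complex_of_real (- (k\<^sup>2))"
    have sqz: "csqrt z = \<i> * of_real k"
      unfolding z_def using k0 by (subst csqrt_of_real_nonpos) auto
    have kz: "cmod (csqrt z) = k" "\<bar>Im (csqrt z)\<bar> = k"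
      using k0 by (simp_all add: sqz norm_mult)
    have w: "z * of_real (x\<^sup>2 / 4) = of_real (- ((k * x)\<^sup>2 / 4))" for x
      by (simp add: z_def power_mult_distrib)
    have free: "xi_free \<nu> z x = of_real (K * x powr p * bessel_mod \<nu> (k * x))" if "x > 0" for x
      unfolding xi_free_eq[OF that] w bessel_entire_neg[OF less_imp_le[OF nu]] K_def by simp
    have free': "xi_free' \<nu> z x = of_real (K * x powr (\<nu> - 1 / 2) * (p * bessel_mod \<nu> (k * x)
        + (k * x)\<^sup>2 / 2 * bessel_mod (\<nu> + 1) (k * x)))" for x
    proof -
      have "z * of_real (x\<^sup>2 / 2) = - of_real ((k * x)\<^sup>2 / 2)"
        by (simp add: z_def power_mult_distrib)
      moreover have "bessel_entire (\<nu> + 1) (of_real (- ((k * x)\<^sup>2 / 4))) = of_real (bessel_mod (\<nu> + 1) (k * x))"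
        using nu by (intro bessel_entire_neg) auto
      ultimately show ?thesis
        unfolding xi_free'_def w bessel_entire_neg[OF less_imp_le[OF nu]] K_def by simp
    qed
    have quot: "(x / (1 + k * x)) powr a = x powr a * (1 + k * x) powr - a" for x a
      using powr_divide[of x "1 + k * x" a] by (simp only: powr_minus divide_inverse)
    show ?thesis
      unfolding k\<mu>
    proof (intro conjI ballI)
      fix x assume x: "x \<in> {0<..s}"
      have xb: "x \<in> {0<..b}" using x s by auto
      let ?T = "(x / (1 + k * x)) powr p * exp (k * x)"
      have T: "?T > 0"
      proof -
        have "1 + k * x > 0" using x k0 by (simp add: add_pos_nonneg)
        then show ?thesis using x by simp
      qed
      have "C * J k x \<le> C * (1 + s) * J k b"
      proof -
        have "C * J k x \<le> C * J k b" using k0 C(1) xb by (intro mult_left_mono J_mono) auto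
        also have "\<dots> \<le> C * (1 + s) * J k b"
          using k0 C(1) s J_nonneg[of k b] by (intro mult_right_mono) (auto simp: mult_le_cancel_left1)
        finally show ?thesis .
      qed
      then have small: "C * J k x < K * c" using nJ by (simp add: \<epsilon>_def)
      have "Re (xi_free \<nu> z x) - cmod (\<xi> z x - xi_free \<nu> z x) \<le> Re (\<xi> z x)"
        using abs_Re_le_cmod[of "\<xi> z x - xi_free \<nu> z x"] by (simp add: abs_le_iff)
      moreover have "cmod (\<xi> z x - xi_free \<nu> z x) \<le> C * J k x * ?T"
        using C(2)[OF xb, of z] unfolding kz by (simp add: mult_ac)
      moreover have "C * J k x * ?T < K * c * ?T"
        using small T by (rule mult_strict_right_mono)
      moreover have "K * c * ?T \<le> Re (xi_free \<nu> z x)"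
      proof -
        have "K * x powr p * (c * exp (k * x) * (1 + k * x) powr - p) \<le> K * x powr p * bessel_mod \<nu> (k * x)"
          using x K k0 by (intro mult_left_mono c(2)) auto
        moreover have "K * c * ?T = K * x powr p * (c * exp (k * x) * (1 + k * x) powr - p)"
          by (simp only: quot) (simp only: mult_ac)
        moreover have "Re (xi_free \<nu> z x) = K * x powr p * bessel_mod \<nu> (k * x)"
          using x by (subst free) simp_all
        ultimately show ?thesis by (simp only:)
      qed
      ultimately show "0 < Re (\<xi> (complex_of_real (- (k\<^sup>2))) x)"
        unfolding z_def by linarith
    next
      have sb: "s \<in> {0<..b}" using s by auto
      let ?t = "k * s"
      let ?T = "(s / (1 + ?t)) powr (\<nu> - 1 / 2) * exp ?t"
      have t1: "1 + ?t > 0" using ns by simp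
      have T: "?T > 0" using s t1 by simp
      have e1: "cmod (\<xi>' z s - xi_free' \<nu> z s) \<le> C * J k b * ?T"
      proof -
        have "C * J k s * ?T \<le> C * J k b * ?T"
          using k0 C(1) s T by (intro mult_right_mono mult_left_mono J_mono) auto
        then show ?thesis using C(3)[OF sb, of z] unfolding kz by (simp add: mult_ac)
      qed
      \<comment> \<open>The two powers differ by one factor s / (1 + k s) \<le> s, so both errors
        can be measured by the same \<open>?T\<close>.\<close>
      have e2: "cmod (\<xi> z s - xi_free \<nu> z s) \<le> C * J k b * s * ?T"
      proof -
        have "s / (1 + ?t) \<le> s" using s ns by (intro divide_le_self) auto
        moreover have "(s / (1 + ?t)) powr p = (s / (1 + ?t)) * (s / (1 + ?t)) powr (\<nu> - 1 / 2)"
          using powr_mult_base[of "s / (1 + ?t)" "\<nu> - 1 / 2"] s t1 by (simp add: add.commute)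
        ultimately have le: "(s / (1 + ?t)) powr p \<le> s * (s / (1 + ?t)) powr (\<nu> - 1 / 2)"
          by (simp only:) (intro mult_right_mono, auto)
        have "cmod (\<xi> z s - xi_free \<nu> z s) \<le> C * (s / (1 + ?t)) powr p * exp ?t * J k s"
          using C(2)[OF sb, of z] unfolding kz .
        also have "\<dots> \<le> C * (s * (s / (1 + ?t)) powr (\<nu> - 1 / 2)) * exp ?t * J k b"
          using k0 C(1) s le J_nonneg[of k s] by (intro mult_mono J_mono mult_nonneg_nonneg) auto
        finally show ?thesis by (simp add: mult_ac)
      qed
      let ?g = "bessel_mod \<nu> ?t" and ?g1 = "bessel_mod (\<nu> + 1) ?t"
      have main: "cos \<gamma> * Re (xi_free \<nu> z s) + sin \<gamma> * Re (xi_free' \<nu> z s) \<ge> K * sin \<gamma> * c1 / 16 * ?T"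
      proof -
        have sp: "s powr p = s * s powr (\<nu> - 1 / 2)"
          using powr_mult_base[of s "\<nu> - 1 / 2"] s by (simp add: add.commute)
        have m1: "cos \<gamma> * Re (xi_free \<nu> z s) + sin \<gamma> * Re (xi_free' \<nu> z s)
            = K * s powr (\<nu> - 1 / 2) * ((s * cos \<gamma> + p * sin \<gamma>) * ?g + sin \<gamma> * (?t\<^sup>2 / 2 * ?g1))"
          unfolding free[OF s(1)] free' Re_complex_of_real sp by (simp add: algebra_simps)
        have m2: "(s * cos \<gamma> + p * sin \<gamma>) * ?g + sin \<gamma> * (?t\<^sup>2 / 2 * ?g1) \<ge> sin \<gamma> * (?t\<^sup>2 / 4 * ?g1)"
        proof -
          have gpos: "?g \<ge> 0"
            using c(2)[of ?t] c(1) ns by (meson less_imp_le mult_nonneg_nonneg order_trans exp_ge_zero powr_ge_zero zero_le_one)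
          have "- (s * cos \<gamma> + p * sin \<gamma>) * ?g \<le> \<bar>s * cos \<gamma> + p * sin \<gamma>\<bar> * ?g"
            using gpos by (intro mult_right_mono) auto
          also have "\<dots> = sin \<gamma> * (A * ?g)" using sg by (simp add: A_def)
          also have "\<dots> \<le> sin \<gamma> * (?t\<^sup>2 / 4 * ?g1)" using t0(2)[OF ns(1)] sg by simp
          finally show ?thesis by (simp add: algebra_simps)
        qed
        have m3: "sin \<gamma> * (?t\<^sup>2 / 4 * ?g1) \<ge> sin \<gamma> * c1 / 16 * (exp ?t * (1 + ?t) powr - (\<nu> - 1 / 2))"
        proof -
          have pw: "(1 + ?t) powr - (\<nu> + 1 + 1 / 2) * (1 + ?t)\<^sup>2 = (1 + ?t) powr - (\<nu> - 1 / 2)"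
          proof -
            have "(1 + ?t)\<^sup>2 = (1 + ?t) powr 2" using t1 by (simp add: powr_numeral)
            then show ?thesis by (simp flip: powr_add)
          qed
          have "1 + ?t \<le> 2 * ?t" "0 \<le> 1 + ?t" using ns by linarith+
          then have "(1 + ?t)\<^sup>2 \<le> (2 * ?t)\<^sup>2" by (rule power_mono)
          then have tt: "(1 + ?t)\<^sup>2 / 4 \<le> ?t\<^sup>2" by (simp add: power_mult_distrib)
          have "c1 / 16 * (exp ?t * (1 + ?t) powr - (\<nu> - 1 / 2))
              = ((1 + ?t)\<^sup>2 / 4) / 4 * (c1 * exp ?t * (1 + ?t) powr - (\<nu> + 1 + 1 / 2))"
            unfolding pw[symmetric] by simp
          also have "\<dots> \<le> ?t\<^sup>2 / 4 * ?g1"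
          proof (rule mult_mono)
            show "c1 * exp ?t * (1 + ?t) powr - (\<nu> + 1 + 1 / 2) \<le> ?g1" using ns by (intro c1(2)) auto
          qed (use tt c1 in auto)
          finally have "sin \<gamma> * (c1 / 16 * (exp ?t * (1 + ?t) powr - (\<nu> - 1 / 2))) \<le> sin \<gamma> * (?t\<^sup>2 / 4 * ?g1)"
            using sg by (intro mult_left_mono) auto
          then show ?thesis by (simp add: mult.assoc)
        qed
        have "K * s powr (\<nu> - 1 / 2) * (sin \<gamma> * c1 / 16 * (exp ?t * (1 + ?t) powr - (\<nu> - 1 / 2)))
            \<le> cos \<gamma> * Re (xi_free \<nu> z s) + sin \<gamma> * Re (xi_free' \<nu> z s)"
          unfolding m1 by (rule mult_left_mono[OF order_trans[OF m3 m2]]) (use K in auto)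
        moreover have "K * sin \<gamma> * c1 / 16 * ?T
            = K * s powr (\<nu> - 1 / 2) * (sin \<gamma> * c1 / 16 * (exp ?t * (1 + ?t) powr - (\<nu> - 1 / 2)))"
          by (simp only: quot) simp
        ultimately show ?thesis by (simp only:)
      qed
      have d1: "Re (xi_free' \<nu> z s) - Re (\<xi>' z s) \<le> C * J k b * ?T"
        using abs_Re_le_cmod[of "\<xi>' z s - xi_free' \<nu> z s"] e1 by (simp add: abs_le_iff)
      have d2: "\<bar>Re (xi_free \<nu> z s) - Re (\<xi> z s)\<bar> \<le> C * J k b * s * ?T"
        using abs_Re_le_cmod[of "\<xi> z s - xi_free \<nu> z s"] e2 by (simp add: abs_minus_commute)
      have J0: "0 \<le> C * J k b * ?T"
        using k0 C(1) J_nonneg[of k b] T by (intro mult_nonneg_nonneg) auto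
      have "sin \<gamma> * (Re (xi_free' \<nu> z s) - Re (\<xi>' z s)) \<le> sin \<gamma> * (C * J k b * ?T)"
        using d1 sg by (intro mult_left_mono) auto
      also have "\<dots> \<le> 1 * (C * J k b * ?T)"
        using J0 by (intro mult_right_mono) auto
      finally have f1: "sin \<gamma> * Re (xi_free' \<nu> z s) - sin \<gamma> * Re (\<xi>' z s) \<le> C * J k b * ?T"
        by (simp add: right_diff_distrib)
      have "cos \<gamma> * (Re (xi_free \<nu> z s) - Re (\<xi> z s)) \<le> \<bar>cos \<gamma>\<bar> * \<bar>Re (xi_free \<nu> z s) - Re (\<xi> z s)\<bar>"
        by (metis abs_ge_self abs_mult)
      also have "\<dots> \<le> 1 * (C * J k b * s * ?T)"
        using d2 by (intro mult_mono) auto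
      finally have f2: "cos \<gamma> * Re (xi_free \<nu> z s) - cos \<gamma> * Re (\<xi> z s) \<le> C * J k b * s * ?T"
        by (simp add: right_diff_distrib)
      have "C * J k b * ?T + C * J k b * s * ?T = (C * (1 + s) * J k b) * ?T"
        by (simp add: algebra_simps)
      also have "\<dots> < \<epsilon> * ?T" using nJ T by (rule mult_strict_right_mono)
      also have "\<dots> \<le> K * sin \<gamma> * c1 / 16 * ?T" using T by (intro mult_right_mono) (auto simp: \<epsilon>_def)
      finally show "0 < cos \<gamma> * Re (\<xi> (complex_of_real (- (k\<^sup>2))) s) + sin \<gamma> * Re (\<xi>' (complex_of_real (- (k\<^sup>2))) s)"
        using main f1 f2 unfolding z_def[symmetric] by linarith
    qed
  qed
  show thesis by (rule that[of "- ((real n)\<^sup>2)"]) (use main in auto)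
qed

end

lemma abs_continuous_on_cmult:
  fixes f :: "real \<Rightarrow> complex"
  shows "abs_continuous_on f c d \<Longrightarrow> abs_continuous_on (\<lambda>x. a * f x) c d"
  by (rule abs_continuous_on_mult[OF abs_continuous_on_lipschitz[of c d "\<lambda>_. a" 0]]) auto

context schroedinger
begin

section \<open>Lagrange's identity and boundary terms\<close>

text \<open>\<open>sol_pair s f f' g\<close> says that \<open>f\<close> lies in the maximal domain of the differential expression on
  \<open>(0,s]\<close>, with derivative \<open>f'\<close> and image \<open>g = -f'' + V f\<close>.\<close>

definition sol_pair :: "real \<Rightarrow> (real \<Rightarrow> complex) \<Rightarrow> (real \<Rightarrow> complex) \<Rightarrow> (real \<Rightarrow> complex) \<Rightarrow> bool" where
  "sol_pair s f f' g \<longleftrightarrow> (\<forall>x\<in>{0<..s}. (f has_vector_derivative f' x) (at x within {0<..s})) \<and>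
     f' \<in> AC_loc s \<and>
     (AE x in lborel. x \<in> {0<..<s} \<longrightarrow> (f' has_vector_derivative of_real (V x) * f x - g x) (at x))"

definition wronskian :: "(real \<Rightarrow> complex) \<Rightarrow> (real \<Rightarrow> complex) \<Rightarrow> (real \<Rightarrow> complex) \<Rightarrow> (real \<Rightarrow> complex) \<Rightarrow> real \<Rightarrow> complex" where
  "wronskian f f' h h' x = f' x * h x - f x * h' x"

lemma sol_pair_deriv: "sol_pair s f f' g \<Longrightarrow> x \<in> {0<..s} \<Longrightarrow> (f has_vector_derivative f' x) (at x within {0<..s})"
  by (simp add: sol_pair_def)

lemma sol_pair_AC': "sol_pair s f f' g \<Longrightarrow> 0 < c \<Longrightarrow> c < s \<Longrightarrow> abs_continuous_on f' c s"
  by (simp add: sol_pair_def AC_loc_def)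

lemma sol_pair_continuous':
  assumes "sol_pair s f f' g"
  shows "continuous_on {0<..s} f'"
  using sol_pair_AC'[OF assms] by (intro continuous_on_Ioc abs_continuous_on_imp_continuous_on)

lemma sol_pair_continuous:
  assumes "sol_pair s f f' g"
  shows "continuous_on {0<..s} f"
  unfolding continuous_on_eq_continuous_within
  using sol_pair_deriv[OF assms] has_vector_derivative_continuous by blast

lemma sol_pair_AC:
  assumes "sol_pair s f f' g" "0 < c" "c < s"
  shows "abs_continuous_on f c s"
proof (rule abs_continuous_on_C1)
  show "(f has_vector_derivative f' x) (at x within {c..s})" if "x \<in> {c..s}" for x
    using sol_pair_deriv[OF assms(1), of x] that assms(2)
    by (auto intro: has_vector_derivative_within_subset[of _ _ _ "{0<..s}"])
  show "continuous_on {c..s} f'"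
    using assms(2) by (intro continuous_on_subset[OF sol_pair_continuous'[OF assms(1)]]) auto
qed

lemma sol_pair_negligibleE:
  assumes "sol_pair s f f' g"
  obtains N where "negligible N"
    "\<And>x. x \<in> {0<..<s} - N \<Longrightarrow> (f' has_vector_derivative of_real (V x) * f x - g x) (at x)"
proof -
  have "AE x in lborel. x \<in> {0<..<s} \<longrightarrow> (f' has_vector_derivative of_real (V x) * f x - g x) (at x)"
    using assms by (simp add: sol_pair_def)
  then obtain N where "negligible N" "\<And>x. x \<notin> N \<Longrightarrow> x \<in> {0<..<s} \<longrightarrow> (f' has_vector_derivative of_real (V x) * f x - g x) (at x)"
    by (rule AE_lborel_negligibleE) blast
  then show thesis by (intro that[of N]) auto
qed

lemma sol_pair_lin:
  assumes f: "sol_pair s f f' g" and h: "sol_pair s h h' k"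
  shows "sol_pair s (\<lambda>x. a * f x + c * h x) (\<lambda>x. a * f' x + c * h' x) (\<lambda>x. a * g x + c * k x)"
  unfolding sol_pair_def
proof (intro conjI ballI)
  fix x assume x: "x \<in> {0<..s}"
  show "((\<lambda>x. a * f x + c * h x) has_vector_derivative a * f' x + c * h' x) (at x within {0<..s})"
    by (intro has_vector_derivative_add has_vector_derivative_mult_right sol_pair_deriv[OF f x] sol_pair_deriv[OF h x])
next
  show "(\<lambda>x. a * f' x + c * h' x) \<in> AC_loc s"
    using sol_pair_AC'[OF f] sol_pair_AC'[OF h]
    by (auto simp: AC_loc_def intro!: abs_continuous_on_add abs_continuous_on_cmult)
next
  have "AE x in lborel. x \<in> {0<..<s} \<longrightarrow> (f' has_vector_derivative of_real (V x) * f x - g x) (at x)"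
    "AE x in lborel. x \<in> {0<..<s} \<longrightarrow> (h' has_vector_derivative of_real (V x) * h x - k x) (at x)"
    using f h by (auto simp: sol_pair_def)
  then show "AE x in lborel. x \<in> {0<..<s} \<longrightarrow> ((\<lambda>x. a * f' x + c * h' x) has_vector_derivative
      of_real (V x) * (a * f x + c * h x) - (a * g x + c * k x)) (at x)"
  proof eventually_elim
    case (elim x)
    show ?case
    proof
      assume "x \<in> {0<..<s}"
      with elim have 1: "(f' has_vector_derivative of_real (V x) * f x - g x) (at x)"
        and 2: "(h' has_vector_derivative of_real (V x) * h x - k x) (at x)" by auto
      have "((\<lambda>x. a * f' x + c * h' x) has_vector_derivative
        a * (of_real (V x) * f x - g x) + c * (of_real (V x) * h x - k x)) (at x)"
        by (intro has_vector_derivative_add has_vector_derivative_mult_right 1 2)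
      then show "((\<lambda>x. a * f' x + c * h' x) has_vector_derivative
        of_real (V x) * (a * f x + c * h x) - (a * g x + c * k x)) (at x)"
        by (simp add: algebra_simps)
    qed
  qed
qed

lemma sol_pair_cnj:
  assumes f: "sol_pair s f f' g"
  shows "sol_pair s (\<lambda>x. cnj (f x)) (\<lambda>x. cnj (f' x)) (\<lambda>x. cnj (g x))"
  unfolding sol_pair_def
proof (intro conjI ballI)
  fix x assume x: "x \<in> {0<..s}"
  show "((\<lambda>x. cnj (f x)) has_vector_derivative cnj (f' x)) (at x within {0<..s})"
    by (rule bounded_linear.has_vector_derivative[OF bounded_linear_cnj sol_pair_deriv[OF f x]])
next
  have "abs_continuous_on (\<lambda>x. cnj (f' x)) c s" if "0 < c" "c < s" for c
    using sol_pair_AC'[OF f that] unfolding abs_continuous_on_def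
    by (simp flip: complex_cnj_diff)
  then show "(\<lambda>x. cnj (f' x)) \<in> AC_loc s" by (simp add: AC_loc_def)
next
  have "AE x in lborel. x \<in> {0<..<s} \<longrightarrow> (f' has_vector_derivative of_real (V x) * f x - g x) (at x)"
    using f by (auto simp: sol_pair_def)
  then show "AE x in lborel. x \<in> {0<..<s} \<longrightarrow> ((\<lambda>x. cnj (f' x)) has_vector_derivative
      of_real (V x) * cnj (f x) - cnj (g x)) (at x)"
  proof eventually_elim
    case (elim x)
    then show ?case
      using bounded_linear.has_vector_derivative[OF bounded_linear_cnj, of f' "of_real (V x) * f x - g x" "at x"] by simp
  qed
qed

lemma sol_pair_xi:
  assumes s: "0 < s" "s \<le> b"
  shows "sol_pair s (\<xi> z) (\<xi>' z) (\<lambda>x. z * \<xi> z x)"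
  unfolding sol_pair_def
proof (intro conjI ballI)
  have sub: "{0<..s} \<subseteq> {0<..b}" using s by auto
  show "(\<xi> z has_vector_derivative \<xi>' z x) (at x within {0<..s})" if "x \<in> {0<..s}" for x
    using has_vector_derivative_within_subset[OF xi_deriv sub] that sub by blast
  have d: "(\<xi>' z has_vector_derivative (of_real (V x) - z) * \<xi> z x) (at x within {0<..s})" if "x \<in> {0<..s}" for x
    using has_vector_derivative_within_subset[OF xi'_deriv sub] that sub by blast
  have "abs_continuous_on (\<xi>' z) c s" if "0 < c" "c < s" for c
  proof (rule abs_continuous_on_C1)
    show "(\<xi>' z has_vector_derivative (of_real (V x) - z) * \<xi> z x) (at x within {c..s})" if "x \<in> {c..s}" for x
      using d[of x] that \<open>0 < c\<close> by (auto intro: has_vector_derivative_within_subset[of _ _ _ "{0<..s}"])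
    show "continuous_on {c..s} (\<lambda>x. (of_real (V x) - z) * \<xi> z x)"
      using \<open>0 < c\<close> s by (intro continuous_intros continuous_on_subset[OF continuous_V] continuous_on_subset[OF continuous_xi]) auto
  qed
  then show "\<xi>' z \<in> AC_loc s" by (simp add: AC_loc_def)
  show "AE x in lborel. x \<in> {0<..<s} \<longrightarrow> (\<xi>' z has_vector_derivative of_real (V x) * \<xi> z x - z * \<xi> z x) (at x)"
  proof (rule AE_I2, rule impI)
    fix x assume x: "x \<in> {0<..<s}"
    then show "(\<xi>' z has_vector_derivative of_real (V x) * \<xi> z x - z * \<xi> z x) (at x)"
      using d[of x] at_within_Ioo[of x s] by (simp add: left_diff_distrib)
  qed
qed

text \<open>The Wronskian is absolutely continuous, and where both equations hold its derivative is
  f k - g h, the potential cancelling. The fundamental theorem for absolutely continuous functions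
  integrates this.\<close>

lemma lagrange:
  assumes f: "sol_pair s f f' g" and h: "sol_pair s h h' k" and xy: "0 < x" "x \<le> y" "y \<le> s"
  shows "((\<lambda>t. f t * k t - g t * h t) has_integral wronskian f f' h h' y - wronskian f f' h h' x) {x..y}"
proof (cases "x = y")
  case False
  then have xs: "x < s" using xy by simp
  obtain N1 where N1: "negligible N1" "\<And>x. x \<in> {0<..<s} - N1 \<Longrightarrow> (f' has_vector_derivative of_real (V x) * f x - g x) (at x)"
    using sol_pair_negligibleE[OF f] by metis
  obtain N2 where N2: "negligible N2" "\<And>x. x \<in> {0<..<s} - N2 \<Longrightarrow> (h' has_vector_derivative of_real (V x) * h x - k x) (at x)"
    using sol_pair_negligibleE[OF h] by metis
  show ?thesis
  proof (rule abs_continuous_on_has_integral[OF xy(2)])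
    have "abs_continuous_on (wronskian f f' h h') x s"
      unfolding wronskian_def
      by (intro abs_continuous_on_diff abs_continuous_on_mult sol_pair_AC'[OF f] sol_pair_AC'[OF h]
          sol_pair_AC[OF f] sol_pair_AC[OF h] xy xs)
    then show "abs_continuous_on (wronskian f f' h h') x y"
      by (rule abs_continuous_on_subset) (use xy in auto)
    show "negligible (N1 \<union> N2 \<union> {x, y})" using N1 N2 by (intro negligible_Un) auto
    fix t assume t: "t \<in> {x..y} - (N1 \<union> N2 \<union> {x, y})"
    then have t': "t \<in> {0<..<s}" "t \<in> {0<..s}" using xy by auto
    have at: "at t within {0<..s} = at t" using t' at_within_Ioo by auto
    have f1: "(f has_vector_derivative f' t) (at t)" and h1: "(h has_vector_derivative h' t) (at t)"
      using sol_pair_deriv[OF f t'(2)] sol_pair_deriv[OF h t'(2)] unfolding at by auto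
    have f2: "(f' has_vector_derivative of_real (V t) * f t - g t) (at t)" using N1(2)[of t] t t' by auto
    have h2: "(h' has_vector_derivative of_real (V t) * h t - k t) (at t)" using N2(2)[of t] t t' by auto
    have "(wronskian f f' h h' has_vector_derivative
      (f' t * h' t + (of_real (V t) * f t - g t) * h t) - (f t * (of_real (V t) * h t - k t) + f' t * h' t)) (at t)"
      unfolding wronskian_def
      by (intro has_vector_derivative_diff has_vector_derivative_mult f1 f2 h1 h2)
    then have "(wronskian f f' h h' has_vector_derivative f t * k t - g t * h t) (at t)"
      by (simp add: algebra_simps)
    then show "(wronskian f f' h h' has_vector_derivative f t * k t - g t * h t) (at t within {x..y})"
      by (rule has_vector_derivative_at_within)
  qed
qed (simp add: has_integral_refl)

text \<open>By absolute continuity f' is the integral of a function that is now continuous, so the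
  equation holds at every point, one-sidedly at s. This is the form that \<open>ode_unique\<close>
  expects.\<close>

lemma sol_pair_C2:
  assumes f: "sol_pair s f f' g" and g: "continuous_on {0<..s} g" and sb: "s \<le> b" and x: "x \<in> {0<..s}"
  shows "(f' has_vector_derivative of_real (V x) * f x - g x) (at x within {0<..s})"
proof (cases "x = s \<and> False")
  case False
  define c where "c = x / 2"
  have c: "0 < c" "c < x" "c < s" using x by (auto simp: c_def)
  let ?h = "\<lambda>t. of_real (V t) * f t - g t"
  have cont: "continuous_on {c..s} ?h"
    using c sb by (intro continuous_intros continuous_on_subset[OF continuous_V]
      continuous_on_subset[OF sol_pair_continuous[OF f]] continuous_on_subset[OF g]) auto
  obtain N where N: "negligible N" "\<And>x. x \<in> {0<..<s} - N \<Longrightarrow> (f' has_vector_derivative ?h x) (at x)"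
    using sol_pair_negligibleE[OF f] by metis
  have int: "(?h has_integral f' y - f' c) {c..y}" if y: "y \<in> {c..s}" for y
  proof (rule abs_continuous_on_has_integral)
    show "abs_continuous_on f' c y"
      using y by (intro abs_continuous_on_subset[OF sol_pair_AC'[OF f c(1,3)]]) auto
    show "negligible (N \<union> {s})" using N by (intro negligible_Un) auto
    show "(f' has_vector_derivative ?h t) (at t within {c..y})" if "t \<in> {c..y} - (N \<union> {s})" for t
      using N(2)[of t] that y c by (auto intro: has_vector_derivative_at_within)
  qed (use y in auto)
  have "((\<lambda>y. integral {c..y} ?h) has_vector_derivative ?h x) (at x within {c..s})"
    using x c by (intro integral_has_vector_derivative[OF cont]) auto
  then have "((\<lambda>y. f' c + integral {c..y} ?h) has_vector_derivative ?h x) (at x within {c..s})"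
    using has_vector_derivative_add[OF has_vector_derivative_const] by fastforce
  then have "(f' has_vector_derivative ?h x) (at x within {c..s})"
    by (rule has_vector_derivative_transform[rotated 2]) (use x c integral_unique[OF int] in auto)
  then show ?thesis using at_within_Ioc[of c x s] c by simp
qed simp

definition bc0 :: "(real \<Rightarrow> complex) \<Rightarrow> (real \<Rightarrow> complex) \<Rightarrow> bool" where
  "bc0 f f' \<longleftrightarrow> (\<nu> \<in> {0<..<1} \<longrightarrow>
        ((\<lambda>x. of_real (x powr (\<nu> - 1 / 2)) * (of_real (\<nu> + 1 / 2) * f x - of_real x * f' x)) \<longlongrightarrow> 0) (at_right 0))"

text \<open>These rates are shared by \<open>\<xi>\<close> and by every image of Green's operator;
  they make the bracket O(x^(1/2)) and the whole expression O(x^\<nu>).\<close>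

lemma bc0_I:
  assumes "s > 0" "\<And>x. x \<in> {0<..<s} \<Longrightarrow> cmod (f x) \<le> C * x powr (1 / 2)"
    "\<And>x. x \<in> {0<..<s} \<Longrightarrow> cmod (f' x) \<le> C * x powr (- 1 / 2)"
  shows "bc0 f f'"
  unfolding bc0_def
proof (rule impI, rule tendsto_norm_zero_cancel, rule tendsto_sandwich[OF _ _ tendsto_const])
  have "((\<lambda>x. (p + 1) * C * x powr \<nu>) \<longlongrightarrow> (p + 1) * C * 0) (at_right 0)"
    by (intro tendsto_intros tendsto_powr_0_right nu)
  then show "((\<lambda>x. (p + 1) * C * x powr \<nu>) \<longlongrightarrow> 0) (at_right 0)" by simp
  show "\<forall>\<^sub>F x in at_right 0. cmod (of_real (x powr (\<nu> - 1 / 2)) * (of_real p * f x - of_real x * f' x)) \<le> (p + 1) * C * x powr \<nu>"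
  proof (rule eventually_at_rightI[OF _ assms(1)])
    fix x assume x: "x \<in> {0<..<s}"
    have "cmod (of_real p * f x - of_real x * f' x) \<le> p * cmod (f x) + x * cmod (f' x)"
    proof -
      have "\<bar>p\<bar> = p" "\<bar>x\<bar> = x" using x nu by auto
      then show ?thesis
        using norm_triangle_ineq4[of "of_real p * f x" "of_real x * f' x"]
        by (simp only: norm_mult norm_of_real)
    qed
    also have "\<dots> \<le> p * (C * x powr (1 / 2)) + x * (C * x powr (- 1 / 2))"
      using assms(2,3)[OF x] x nu by (intro add_mono mult_left_mono) auto
    also have "x * (C * x powr (- 1 / 2)) = C * x powr (1 / 2)"
      using powr_mult_base[of x "- 1 / 2"] x by simp
    also have "p * (C * x powr (1 / 2)) + C * x powr (1 / 2) = (p + 1) * C * x powr (1 / 2)"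
      by (simp add: algebra_simps)
    finally have "x powr (\<nu> - 1 / 2) * cmod (of_real p * f x - of_real x * f' x) \<le> x powr (\<nu> - 1 / 2) * ((p + 1) * C * x powr (1 / 2))"
      by (intro mult_left_mono) auto
    also have "\<dots> = (p + 1) * C * (x powr (\<nu> - 1 / 2) * x powr (1 / 2))" by simp
    also have "x powr (\<nu> - 1 / 2) * x powr (1 / 2) = x powr \<nu>" by (simp flip: powr_add)
    finally show "cmod (of_real (x powr (\<nu> - 1 / 2)) * (of_real p * f x - of_real x * f' x)) \<le> (p + 1) * C * x powr \<nu>"
      by (simp add: norm_mult)
  qed
qed simp

lemma xi_sqrt_bound:
  obtains C where "C > 0" "\<And>x. x \<in> {0<..b} \<Longrightarrow> cmod (\<xi> z x) \<le> C * x powr (1 / 2)"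
    "\<And>x. x \<in> {0<..b} \<Longrightarrow> cmod (\<xi>' z x) \<le> C * x powr (- 1 / 2)"
proof -
  obtain M where M: "M > 0" "\<And>x. x \<in> {0<..b} \<Longrightarrow> cmod (\<xi> z x) \<le> M * x powr p"
    "\<And>x. x \<in> {0<..b} \<Longrightarrow> cmod (\<xi>' z x) \<le> M * x powr (\<nu> - 1 / 2)"
    using xi_bound by metis
  show thesis
  proof (rule that[of "M * b powr \<nu>"])
    fix x assume x: "x \<in> {0<..b}"
    have "x powr \<nu> \<le> b powr \<nu>" using x nu by (intro powr_mono2) auto
    then have le: "M * x powr \<nu> * y \<le> M * b powr \<nu> * y" if "y \<ge> 0" for y
      using M(1) that by (intro mult_right_mono mult_left_mono) auto
    have "x powr p = x powr \<nu> * x powr (1 / 2)" "x powr (\<nu> - 1 / 2) = x powr \<nu> * x powr (- 1 / 2)"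
      by (simp_all flip: powr_add)
    then show "cmod (\<xi> z x) \<le> M * b powr \<nu> * x powr (1 / 2)" "cmod (\<xi>' z x) \<le> M * b powr \<nu> * x powr (- 1 / 2)"
      using M(2,3)[OF x] le[of "x powr (1 / 2)"] le[of "x powr (- 1 / 2)"] by (simp_all add: mult.assoc)
  qed (use M b_pos in auto)
qed

lemma bc0_xi: "bc0 (\<xi> z) (\<xi>' z)"
proof -
  obtain C where "C > 0" "\<And>x. x \<in> {0<..b} \<Longrightarrow> cmod (\<xi> z x) \<le> C * x powr (1 / 2)"
    "\<And>x. x \<in> {0<..b} \<Longrightarrow> cmod (\<xi>' z x) \<le> C * x powr (- 1 / 2)"
    using xi_sqrt_bound by metis
  then show ?thesis by (intro bc0_I[OF b_pos, of _ C]) auto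
qed

text \<open>The integral of \<kappa> / x over (\<epsilon>, e) grows without bound as \<epsilon>
  decreases.\<close>

lemma not_L2_inverse_sqrt:
  assumes f: "f \<in> L2 s" and \<kappa>: "\<kappa> > 0" and e: "0 < e" "e < s"
    and ge: "\<And>x. x \<in> {0<..e} \<Longrightarrow> \<kappa> / x \<le> (cmod (f x))\<^sup>2"
  shows False
proof -
  let ?F = "\<lambda>x. (cmod (f x))\<^sup>2"
  have int: "set_integrable lborel {0<..<s} ?F" using f by (simp add: L2_iffs)
  then have io: "?F integrable_on {0..s}" by (rule set_integrable_imp_integrable_on_Icc)
  define B where "B = integral {0..s} ?F"
  have B: "B \<ge> 0" unfolding B_def by (rule Henstock_Kurzweil_Integration.integral_nonneg[OF io]) auto
  \<comment> \<open>Chosen so that the integral of \<kappa> / x from \<epsilon> to e is B +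
    1.\<close>
  define \<epsilon> where "\<epsilon> = e * exp (- ((B + 1) / \<kappa>))"
  have \<epsilon>: "0 < \<epsilon>" "\<epsilon> \<le> e" using e \<kappa> B by (auto simp: \<epsilon>_def)
  have "((\<lambda>x. \<kappa> / x) has_integral (\<kappa> * ln e - \<kappa> * ln \<epsilon>)) {\<epsilon>..e}"
    using \<epsilon> by (intro fundamental_theorem_of_calculus)
      (auto intro!: derivative_eq_intros simp flip: has_real_derivative_iff_has_vector_derivative)
  moreover have "?F integrable_on {\<epsilon>..e}"
    using \<epsilon> e by (intro integrable_subinterval_real[OF io]) auto
  ultimately have "\<kappa> * ln e - \<kappa> * ln \<epsilon> \<le> integral {\<epsilon>..e} ?F"
    using ge \<epsilon> by (intro has_integral_le[OF _ integrable_integral]) auto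
  also have "\<dots> \<le> B"
    unfolding B_def using \<epsilon> e io by (intro integral_subset_le integrable_subinterval_real[OF io]) auto
  finally have "\<kappa> * ln e - \<kappa> * ln \<epsilon> \<le> B" .
  moreover have "ln \<epsilon> = ln e - (B + 1) / \<kappa>" using e by (simp add: \<epsilon>_def ln_mult)
  ultimately show False using \<kappa> by (simp add: right_diff_distrib)
qed

text \<open>The Wronskian with \<open>\<xi>\<close> has a limit \<open>L\<close> at \<open>0\<close>. As \<open>(f / \<xi>)' = W / \<xi>\<^sup>2\<close>, l'Hospital's rule gives
  \<open>x\<^bsup>\<nu>-1/2\<^esup> f(x) \<longrightarrow> - L / (2 \<nu> c0)\<close>; for \<open>L \<noteq> 0\<close> this violates square integrability if \<open>\<nu> \<ge> 1\<close> and
  the boundary condition at \<open>0\<close> if \<open>\<nu> < 1\<close>.\<close>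

lemma wronskian_xi:
  assumes s: "0 < s" "s \<le> b" and f: "sol_pair s f f' g" and fL: "f \<in> L2 s" and gL: "g \<in> L2 s"
    and bc: "bc0 f f'" and x: "x \<in> {0<..s}"
  shows "wronskian f f' (\<xi> z) (\<xi>' z) x = integral {0..x} (\<lambda>t. (z * f t - g t) * \<xi> z t)"
proof -
  let ?h = "\<lambda>t. (z * f t - g t) * \<xi> z t"
  let ?W = "wronskian f f' (\<xi> z) (\<xi>' z)"
  have hs: "set_integrable lborel {0<..<s} ?h"
    by (rule L2_mult_integrable[OF L2_diff[OF L2_scale[OF fL] gL] xi_L2[OF s(2)]])
  have hi: "?h integrable_on {0..s}" by (rule set_integrable_imp_integrable_on_Icc(1)[OF hs])
  define F where "F x = integral {0..x} ?h" for x
  have F0: "(F \<longlongrightarrow> 0) (at_right 0)" unfolding F_def by (rule integral_0_tendsto_0[OF hi s(1)])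
  \<comment> \<open>Lagrange's identity makes \<open>?W x - F x\<close> constant; its value L is the
    boundary term at 0 that has to vanish.\<close>
  define L where "L = ?W s - F s"
  have W: "?W x = L + F x" if x: "x \<in> {0<..s}" for x
  proof -
    have "((\<lambda>t. f t * (z * \<xi> z t) - g t * \<xi> z t) has_integral ?W s - ?W x) {x..s}"
      using x by (intro lagrange[OF f sol_pair_xi[OF s]]) auto
    then have "(?h has_integral ?W s - ?W x) {x..s}"
      by (rule has_integral_eq[rotated]) (simp add: algebra_simps)
    then have a: "integral {x..s} ?h = ?W s - ?W x" by (rule integral_unique)
    have b: "F s = F x + integral {x..s} ?h"
      unfolding F_def using x by (intro Henstock_Kurzweil_Integration.integral_combine[symmetric] hi) auto
    show ?thesis unfolding L_def b a by simp
  qed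
  have Wlim: "(?W \<longlongrightarrow> L) (at_right 0)"
  proof (rule Lim_transform_eventually)
    show "((\<lambda>x. L + F x) \<longlongrightarrow> L) (at_right 0)" using tendsto_add[OF tendsto_const F0, of L] by simp
    show "\<forall>\<^sub>F x in at_right 0. L + F x = ?W x"
      by (rule eventually_at_rightI[OF _ s(1)]) (use W in auto)
  qed
  obtain \<delta> where \<delta>: "\<delta> > 0" "\<And>x. x \<in> {0<..<\<delta>} \<Longrightarrow> \<xi> z x \<noteq> 0" using xi_lower by metis
  define X where "X x = \<xi> z x / of_real (x powr p)" for x
  have X: "(X \<longlongrightarrow> of_real c0) (at_right 0)" unfolding X_def by (rule xi_at_0)
  have c0n: "complex_of_real c0 \<noteq> 0" using c0_pos by simp
  have near: "\<forall>\<^sub>F x in at_right 0. x \<in> {0<..<min \<delta> s}"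
    by (rule eventually_at_rightI[of 0 "min \<delta> s"]) (use \<delta> s in auto)
  define r where "r x = f x / \<xi> z x" for x
  have r: "\<forall>\<^sub>F x in at_right 0. (r has_vector_derivative ?W x / (\<xi> z x)\<^sup>2) (at x)"
    using near
  proof eventually_elim
    case (elim x)
    then have x: "x \<in> {0<..s}" "x \<in> {0<..<\<delta>}" "x \<in> {0<..b}" "0 < x" "x < s" "x < b" using s by auto
    have "(f has_vector_derivative f' x) (at x)" "(\<xi> z has_vector_derivative \<xi>' z x) (at x)"
      using sol_pair_deriv[OF f x(1)] xi_deriv[OF x(3), of z] at_within_Ioo[of x s] at_within_Ioo[of x b] x by auto
    then have "((\<lambda>x. f x / \<xi> z x) has_vector_derivative (f' x * \<xi> z x - f x * \<xi>' z x) / (\<xi> z x * \<xi> z x)) (at x)"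
      using \<delta>(2)[OF x(2)] by (auto intro!: derivative_eq_intros simp: has_vector_derivative_def divide_simps fun_eq_iff algebra_simps scaleR_conv_of_real)
    then show ?case by (simp add: r_def[abs_def] wronskian_def power2_eq_square)
  qed
  have "((\<lambda>x. r x * of_real (x powr (2 * \<nu>))) \<longlongrightarrow> - (L / (of_real c0)\<^sup>2) / of_real (2 * \<nu>)) (at_right 0)"
  proof (rule lhopital_complex_powr[OF _ r])
    have "((\<lambda>x. ?W x / (X x)\<^sup>2) \<longlongrightarrow> L / (of_real c0)\<^sup>2) (at_right 0)"
      using c0n by (intro tendsto_intros Wlim X) auto
    then show "((\<lambda>x. ?W x / (\<xi> z x)\<^sup>2 * of_real (x powr (2 * \<nu> + 1))) \<longlongrightarrow> L / (of_real c0)\<^sup>2) (at_right 0)"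
    proof (rule Lim_transform_eventually)
      show "\<forall>\<^sub>F x in at_right 0. ?W x / (X x)\<^sup>2 = ?W x / (\<xi> z x)\<^sup>2 * of_real (x powr (2 * \<nu> + 1))"
        using near
      proof eventually_elim
        case (elim x)
        have "x powr (2 * \<nu> + 1) = (x powr p)\<^sup>2"
          by (simp add: power2_eq_square flip: powr_add)
        then show ?case by (simp add: X_def power_divide)
      qed
    qed
  qed (use nu in simp)
  from tendsto_mult[OF this X]
  have "((\<lambda>x. r x * of_real (x powr (2 * \<nu>)) * X x) \<longlongrightarrow> - L / (of_real (2 * \<nu> * c0))) (at_right 0)"
    using c0n by (simp add: power2_eq_square mult_ac)
  then have lim: "((\<lambda>x. f x * of_real (x powr (\<nu> - 1 / 2))) \<longlongrightarrow> - L / (of_real (2 * \<nu> * c0))) (at_right 0)"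
  proof (rule Lim_transform_eventually)
    show "\<forall>\<^sub>F x in at_right 0. r x * of_real (x powr (2 * \<nu>)) * X x = f x * of_real (x powr (\<nu> - 1 / 2))"
      using near
    proof eventually_elim
      case (elim x)
      have "x powr (2 * \<nu>) = x powr (\<nu> - 1 / 2) * x powr p" by (simp flip: powr_add)
      moreover have "\<xi> z x \<noteq> 0" using \<delta> elim by auto
      ultimately show ?case using elim by (simp add: r_def X_def)
    qed
  qed
  have "L = 0"
  proof (cases "\<nu> < 1")
    case True
    have X': "((\<lambda>x. \<xi>' z x / of_real (x powr (\<nu> - 1 / 2))) \<longlongrightarrow> of_real (p * c0)) (at_right 0)" by (rule xi_at_0)
    let ?lim = "- L / of_real (2 * \<nu> * c0)"
    \<comment> \<open>Solve W = f' \<xi> - f \<xi>' for x f' and insert the limits: the two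
      contributions of f cancel and the boundary bracket tends to -L / c0.\<close>
    have "((\<lambda>x. of_real p * (f x * of_real (x powr (\<nu> - 1 / 2))) - (?W x / X x
        + (f x * of_real (x powr (\<nu> - 1 / 2))) * ((\<xi>' z x / of_real (x powr (\<nu> - 1 / 2))) / X x)))
        \<longlongrightarrow> of_real p * ?lim - (L / of_real c0 + ?lim * (of_real (p * c0) / of_real c0))) (at_right 0)"
      using c0n by (intro tendsto_intros lim Wlim X X') auto
    moreover have "of_real p * ?lim - (L / of_real c0 + ?lim * (of_real (p * c0) / of_real c0)) = - L / of_real c0"
      using c0n by simp
    ultimately have "((\<lambda>x. of_real p * (f x * of_real (x powr (\<nu> - 1 / 2))) - (?W x / X x
        + (f x * of_real (x powr (\<nu> - 1 / 2))) * ((\<xi>' z x / of_real (x powr (\<nu> - 1 / 2))) / X x)))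
        \<longlongrightarrow> - L / of_real c0) (at_right 0)" by (simp only:)
    then have "((\<lambda>x. of_real (x powr (\<nu> - 1 / 2)) * (of_real (\<nu> + 1 / 2) * f x - of_real x * f' x)) \<longlongrightarrow> - L / of_real c0) (at_right 0)"
    proof (rule Lim_transform_eventually)
      show "\<forall>\<^sub>F x in at_right 0. of_real p * (f x * of_real (x powr (\<nu> - 1 / 2))) - (?W x / X x
        + (f x * of_real (x powr (\<nu> - 1 / 2))) * ((\<xi>' z x / of_real (x powr (\<nu> - 1 / 2))) / X x))
        = of_real (x powr (\<nu> - 1 / 2)) * (of_real (\<nu> + 1 / 2) * f x - of_real x * f' x)"
        using near
      proof eventually_elim
        case (elim x)
        then have x0: "x > 0" and xi: "\<xi> z x \<noteq> 0" using \<delta> by auto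
        define P where "P = complex_of_real (x powr (\<nu> - 1 / 2))"
        have Pn: "P \<noteq> 0" using x0 by (simp add: P_def)
        have "x powr p = x * x powr (\<nu> - 1 / 2)"
          using powr_mult_base[of x "\<nu> - 1 / 2"] x0 by (simp add: add.commute)
        then have XP: "X x = \<xi> z x / (of_real x * P)" by (simp add: X_def P_def)
        have e1: "?W x / X x + f x * P * (\<xi>' z x / P / X x) = P * (of_real x * f' x)"
          using Pn xi x0 unfolding XP wronskian_def by (simp add: field_simps)
        show ?case unfolding P_def[symmetric] e1 by (simp add: algebra_simps)
      qed
    qed
    moreover have "((\<lambda>x. of_real (x powr (\<nu> - 1 / 2)) * (of_real (\<nu> + 1 / 2) * f x - of_real x * f' x)) \<longlongrightarrow> 0) (at_right 0)"
      using bc True nu by (simp add: bc0_def)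
    ultimately have "- L / of_real c0 = 0" by (rule tendsto_unique[OF trivial_limit_at_right_real])
    then show ?thesis using c0n by simp
  next
    \<comment> \<open>Here \<nu> - 1/2 \<ge> 1/2, so for L different from 0 the limit forces |f|^2
      to exceed a multiple of 1 / x near 0.\<close>
    case False
    show ?thesis
    proof (rule ccontr)
      assume "L \<noteq> 0"
      define lm where "lm = cmod (- L / of_real (2 * \<nu> * c0))"
      have lm: "lm > 0" using \<open>L \<noteq> 0\<close> c0_pos nu by (simp add: lm_def)
      have "\<forall>\<^sub>F x in at_right 0. lm / 2 < cmod (f x * of_real (x powr (\<nu> - 1 / 2)))"
        using tendsto_norm[OF lim] lm unfolding lm_def[symmetric] by (intro order_tendstoD(1)) auto
      then obtain e where e: "e > 0" "\<And>x. 0 < x \<Longrightarrow> x < e \<Longrightarrow> lm / 2 < cmod (f x * of_real (x powr (\<nu> - 1 / 2)))"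
        by (auto simp: eventually_at_right_field)
      define e' where "e' = min (e / 2) (min (s / 2) (1 / 2))"
      have e': "0 < e'" "e' < e" "e' < s" "e' < 1" using e s by (auto simp: e'_def)
      show False
      proof (rule not_L2_inverse_sqrt[OF fL, of "(lm / 2)\<^sup>2" e'])
        fix x assume x: "x \<in> {0<..e'}"
        then have x1: "0 < x" "x < e" "x < 1" using e' by auto
        have "lm / 2 < cmod (f x) * x powr (\<nu> - 1 / 2)" using e(2)[OF x1(1,2)] by (simp add: norm_mult)
        also have "\<dots> \<le> cmod (f x) * x powr (1 / 2)"
          using x1 False by (intro mult_left_mono powr_mono') auto
        finally have "(lm / 2)\<^sup>2 \<le> (cmod (f x) * x powr (1 / 2))\<^sup>2" using lm by (intro power_mono) auto
        also have "\<dots> = (cmod (f x))\<^sup>2 * x" using x1 by (simp add: power_mult_distrib powr_half_sqrt)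
        finally show "(lm / 2)\<^sup>2 / x \<le> (cmod (f x))\<^sup>2" using x1 by (simp add: divide_le_eq)
      qed (use lm e' in auto)
    qed
  qed
  then show ?thesis using W[OF x] by (simp add: F_def)
qed

lemma wronskian_xi_transform:
  assumes s: "0 < s" "s \<le> b" and f: "sol_pair s f f' g" and fL: "f \<in> L2 s" and gL: "g \<in> L2 s"
    and bc: "bc0 f f'"
  shows "f' s * \<xi> z s - f s * \<xi>' z s = z * transform \<xi> s f z - transform \<xi> s g z"
proof -
  have i1: "set_integrable lborel {0<..<s} (\<lambda>t. \<xi> z t * f t)" "set_integrable lborel {0<..<s} (\<lambda>t. \<xi> z t * g t)"
    by (auto intro: L2_mult_integrable xi_L2 s fL gL)
  have i2: "set_integrable lborel {0<..<s} (\<lambda>t. z * (\<xi> z t * f t))" using i1(1) by simp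
  have "f' s * \<xi> z s - f s * \<xi>' z s = integral {0..s} (\<lambda>t. (z * f t - g t) * \<xi> z t)"
    using wronskian_xi[OF s f fL gL bc, of s z] s by (simp add: wronskian_def)
  also have "\<dots> = (LBINT t:{0<..<s}. (z * f t - g t) * \<xi> z t)"
    by (rule set_integrable_imp_integrable_on_Icc(2)[symmetric])
       (rule L2_mult_integrable[OF L2_diff[OF L2_scale[OF fL] gL] xi_L2[OF s(2)]])
  also have "\<dots> = (LBINT t:{0<..<s}. z * (\<xi> z t * f t) - \<xi> z t * g t)"
    by (simp add: algebra_simps)
  also have "\<dots> = (LBINT t:{0<..<s}. z * (\<xi> z t * f t)) - (LBINT t:{0<..<s}. \<xi> z t * g t)"
    by (rule set_integral_diff(2)[OF i2 i1(2)])
  finally show ?thesis by (simp add: transform_def)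
qed

text \<open>The difference d of the two sides solves the equation and has vanishing Wronskian with
  \<open>\<xi> z\<close>, so near 0 it is a multiple of \<open>\<xi> z\<close>. The leading
  coefficient c0 is real, hence the multiple is 0, and uniqueness at a regular point carries this to
  all of (0,b].\<close>

lemma xi_cnj:
  assumes x: "x \<in> {0<..b}"
  shows "cnj (\<xi> (cnj z) x) = \<xi> z x" and "cnj (\<xi>' (cnj z) x) = \<xi>' z x"
proof -
  let ?w = "cnj z"
  define d where "d t = 1 * cnj (\<xi> ?w t) + (- 1) * \<xi> z t" for t
  define d' where "d' t = 1 * cnj (\<xi>' ?w t) + (- 1) * \<xi>' z t" for t
  have pair: "sol_pair b d d' (\<lambda>t. z * d t)"
    using sol_pair_lin[OF sol_pair_cnj[OF sol_pair_xi[OF b_pos order_refl, of ?w]] sol_pair_xi[OF b_pos order_refl, of z], of 1 "- 1"]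
    by (simp add: d_def[abs_def] d'_def[abs_def] algebra_simps)
  have dL: "d \<in> L2 b"
    unfolding d_def using L2_diff[OF L2_cnj[OF xi_L2[of b ?w]] xi_L2[of b z]] by simp
  have gL: "(\<lambda>t. z * d t) \<in> L2 b" by (rule L2_scale[OF dL])
  have bc: "bc0 d d'"
  proof -
    obtain C1 where C1: "C1 > 0" "\<And>x. x \<in> {0<..b} \<Longrightarrow> cmod (\<xi> z x) \<le> C1 * x powr (1 / 2)"
      "\<And>x. x \<in> {0<..b} \<Longrightarrow> cmod (\<xi>' z x) \<le> C1 * x powr (- 1 / 2)"
      using xi_sqrt_bound by metis
    obtain C2 where C2: "C2 > 0" "\<And>x. x \<in> {0<..b} \<Longrightarrow> cmod (\<xi> ?w x) \<le> C2 * x powr (1 / 2)"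
      "\<And>x. x \<in> {0<..b} \<Longrightarrow> cmod (\<xi>' ?w x) \<le> C2 * x powr (- 1 / 2)"
      using xi_sqrt_bound by metis
    have tri: "cmod (cnj u - v) \<le> cmod u + cmod v" for u v
      using norm_triangle_ineq4[of "cnj u" v] by simp
    show ?thesis
    proof (rule bc0_I[OF b_pos, of _ "C1 + C2"])
      fix x assume "x \<in> {0<..<b}"
      then have x: "x \<in> {0<..b}" by auto
      show "cmod (d x) \<le> (C1 + C2) * x powr (1 / 2)"
        using tri[of "\<xi> ?w x" "\<xi> z x"] C1(2)[OF x] C2(2)[OF x] by (simp add: d_def distrib_right)
      show "cmod (d' x) \<le> (C1 + C2) * x powr (- 1 / 2)"
        using tri[of "\<xi>' ?w x" "\<xi>' z x"] C1(3)[OF x] C2(3)[OF x] by (simp add: d'_def distrib_right)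
    qed
  qed
  have W0: "wronskian d d' (\<xi> z) (\<xi>' z) x = 0" if "x \<in> {0<..b}" for x
    using wronskian_xi[OF b_pos order_refl pair dL gL bc that, of z] by simp
  obtain \<delta> where \<delta>: "\<delta> > 0" "\<delta> \<le> b" "\<And>x. x \<in> {0<..<\<delta>} \<Longrightarrow> \<xi> z x \<noteq> 0" using xi_lower by metis
  have "\<exists>k. \<forall>x\<in>{0<..<\<delta>}. d x / \<xi> z x = k"
  proof (rule has_derivative_zero_constant[of "{0<..<\<delta>}" "\<lambda>x. d x / \<xi> z x"])
    fix x assume x: "x \<in> {0<..<\<delta>}"
    then have xb: "x \<in> {0<..b}" "0 < x" "x < b" using \<delta> by auto
    have "(d has_vector_derivative d' x) (at x)" "(\<xi> z has_vector_derivative \<xi>' z x) (at x)"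
      using sol_pair_deriv[OF pair xb(1)] xi_deriv[OF xb(1), of z] at_within_Ioo[of x b] xb by auto
    then have "((\<lambda>x. d x / \<xi> z x) has_vector_derivative (d' x * \<xi> z x - d x * \<xi>' z x) / (\<xi> z x * \<xi> z x)) (at x)"
      using \<delta>(3)[OF x] by (auto intro!: derivative_eq_intros simp: has_vector_derivative_def divide_simps fun_eq_iff algebra_simps scaleR_conv_of_real)
    then have "((\<lambda>x. d x / \<xi> z x) has_vector_derivative 0) (at x)"
      using W0[OF xb(1)] by (simp add: wronskian_def)
    then show "((\<lambda>x. d x / \<xi> z x) has_derivative (\<lambda>h. 0)) (at x within {0<..<\<delta>})"
      by (simp add: has_vector_derivative_def has_derivative_at_withinI)
  qed simp
  then obtain k where k: "\<And>x. x \<in> {0<..<\<delta>} \<Longrightarrow> d x / \<xi> z x = k" by blast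
  have "((\<lambda>x. d x / of_real (x powr p)) \<longlongrightarrow> 1 * cnj (of_real c0) + - 1 * of_real c0) (at_right 0)"
  proof -
    have "((\<lambda>x. 1 * cnj (\<xi> ?w x / of_real (x powr p)) + - 1 * (\<xi> z x / of_real (x powr p))) \<longlongrightarrow> 1 * cnj (of_real c0) + - 1 * of_real c0) (at_right 0)"
      by (intro tendsto_intros xi_at_0)
    then show ?thesis by (simp add: d_def diff_divide_distrib)
  qed
  then have "((\<lambda>x. d x / of_real (x powr p)) \<longlongrightarrow> 0) (at_right 0)" by simp
  from tendsto_divide[OF this xi_at_0(1)[of z]]
  have "((\<lambda>x. (d x / of_real (x powr p)) / (\<xi> z x / of_real (x powr p))) \<longlongrightarrow> 0) (at_right 0)"
    using c0_pos by simp
  moreover have "\<forall>\<^sub>F x in at_right 0. (d x / of_real (x powr p)) / (\<xi> z x / of_real (x powr p)) = k"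
    by (rule eventually_at_rightI[OF _ \<delta>(1)]) (use k in auto)
  ultimately have "((\<lambda>x::real. k) \<longlongrightarrow> 0) (at_right 0)" by (rule Lim_transform_eventually)
  then have "k = 0" by (simp add: tendsto_const_iff)
  then have d0: "d x = 0" if "x \<in> {0<..<\<delta>}" for x using k[OF that] \<delta>(3)[OF that] by simp
  let ?x0 = "\<delta> / 2"
  have "(d has_vector_derivative d' ?x0) (at ?x0)"
    using sol_pair_deriv[OF pair, of ?x0] at_within_Ioo[of ?x0 b] \<delta> by simp
  moreover have "(d has_vector_derivative 0) (at ?x0)"
    by (rule has_vector_derivative_transform_within_open[of "\<lambda>_. 0" _ _ "{0<..<\<delta>}"]) (use d0 \<delta> in auto)
  ultimately have d'0: "d' ?x0 = 0" by (rule vector_derivative_unique_at)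
  have "d x = 0 \<and> d' x = 0"
  proof (rule ode_unique[of b ?x0 d d' z x])
    show "(d' has_vector_derivative (of_real (V t) - z) * d t) (at t within {0<..b})" if "t \<in> {0<..b}" for t
      using sol_pair_C2[OF pair _ order_refl that] sol_pair_continuous[OF pair]
      by (simp add: left_diff_distrib continuous_on_mult_left)
  qed (use \<delta> d0[of ?x0] d'0 x sol_pair_deriv[OF pair] in auto)
  then show "cnj (\<xi> (cnj z) x) = \<xi> z x" "cnj (\<xi>' (cnj z) x) = \<xi>' z x" by (simp_all add: d_def d'_def)
qed

end

lemma integrable_on_Icc_norm_L2:
  assumes g: "g \<in> L2 s" and "0 \<le> x" "x \<le> y" "y \<le> s"
  shows "(\<lambda>t. cmod (g t)) integrable_on {x..y}" and "integral {x..y} (\<lambda>t. cmod (g t)) \<le> sqrt s * nrm2 s g"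
proof -
  have si: "set_integrable lborel {0<..<s} (\<lambda>t. cmod (g t))"
    by (rule set_integrable_norm[OF L2_integrable[OF g]])
  have i: "(\<lambda>t. cmod (g t)) integrable_on {0..s}" by (rule set_integrable_imp_integrable_on_Icc(1)[OF si])
  show 1: "(\<lambda>t. cmod (g t)) integrable_on {x..y}"
    by (rule integrable_subinterval_real[OF i]) (use assms in auto)
  show "integral {x..y} (\<lambda>t. cmod (g t)) \<le> sqrt s * nrm2 s g"
  proof (cases "s > 0")
    case True
    have "integral {x..y} (\<lambda>t. cmod (g t)) \<le> integral {0..s} (\<lambda>t. cmod (g t))"
      using assms by (intro integral_subset_le 1 i) auto
    also have "\<dots> = (LBINT t:{0<..<s}. cmod (g t))"
      by (rule set_integrable_imp_integrable_on_Icc(2)[OF si, symmetric])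
    also have "\<dots> \<le> sqrt s * nrm2 s g" by (rule L2_norm_integral_le[OF g True])
    finally show ?thesis .
  next
    case False
    then have "x = y" using assms by linarith
    moreover have "0 \<le> sqrt s * nrm2 s g" using False assms L2.nrm_nonneg[OF g] by simp
    ultimately show ?thesis by simp
  qed
qed

text \<open>Membership in L2 concerns the open interval; the endpoints are added as a null set
  because the gauge integrals below run over closed intervals.\<close>

lemma interval_product_integrable:
  assumes g: "g \<in> L2 s" and k: "continuous_on {x<..<y} k" and kb: "\<And>t. t \<in> {x<..<y} \<Longrightarrow> cmod (k t) \<le> K"
    and xy: "0 \<le> x" "y \<le> s"
  shows "set_integrable lborel {x..y} (\<lambda>t. k t * g t)"
proof -
  have gi: "set_integrable lborel {x<..<y} g"
    using xy by (intro set_integrable_subset[OF L2_integrable[OF g]]) auto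
  have gm: "set_borel_measurable lborel {x<..<y} g"
    using gi by (auto simp: set_integrable_def set_borel_measurable_def)
  have km: "set_borel_measurable lborel {x<..<y} k"
    unfolding set_borel_measurable_def using borel_measurable_continuous_on_indicator[OF _ k] by simp
  have "set_integrable lborel {x<..<y} (\<lambda>t. k t * g t)"
  proof (rule set_integrable_bound)
    show "set_integrable lborel {x<..<y} (\<lambda>t. of_real K * g t)" using gi by simp
    show "set_borel_measurable lborel {x<..<y} (\<lambda>t. k t * g t)"
      by (rule set_borel_measurable_mult[OF km gm])
    show "AE t in lborel. t \<in> {x<..<y} \<longrightarrow> norm (k t * g t) \<le> norm (of_real K * g t)"
    proof (rule AE_I2, rule impI)
      fix t assume "t \<in> {x<..<y}"
      then have "cmod (k t) \<le> \<bar>K\<bar>" using kb[of t] by linarith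
      then show "norm (k t * g t) \<le> norm (of_real K * g t)"
        by (simp add: norm_mult mult_right_mono)
    qed
  qed
  moreover have "set_integrable lborel ({x..y} - {x<..<y}) (\<lambda>t. k t * g t)"
  proof -
    have "AE t in lborel. t \<noteq> x" "AE t in lborel. t \<noteq> y" by (rule AE_lborel_singleton)+
    then have "AE t in lborel. indicator ({x..y} - {x<..<y}) t *\<^sub>R (k t * g t) = 0"
      by eventually_elim (auto simp: indicator_def)
    moreover have "(\<lambda>t. indicator ({x..y} - {x<..<y}) t *\<^sub>R (k t * g t)) \<in> borel_measurable lborel"
    proof -
      have fin: "finite ({x..y} - {x<..<y})" by (rule finite_subset[of _ "{x, y}"]) auto
      have eq: "(\<lambda>t. indicator ({x..y} - {x<..<y}) t *\<^sub>R (k t * g t)) = (\<lambda>t. \<Sum>a\<in>{x..y} - {x<..<y}. indicator {a} t *\<^sub>R (k a * g a))"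
      proof
        fix t
        have "(\<Sum>a\<in>{x..y} - {x<..<y}. indicator {a} t *\<^sub>R (k a * g a)) = (\<Sum>a\<in>{x..y} - {x<..<y}. if a = t then k t * g t else 0)"
          by (intro sum.cong) (auto simp: indicator_def)
        then show "indicator ({x..y} - {x<..<y}) t *\<^sub>R (k t * g t) = (\<Sum>a\<in>{x..y} - {x<..<y}. indicator {a} t *\<^sub>R (k a * g a))"
          using fin by (simp add: indicator_def)
      qed
      show ?thesis unfolding eq by measurable
    qed
    ultimately show ?thesis
      unfolding set_integrable_def by (subst integrable_cong_AE[where g = "\<lambda>_. 0"]) auto
  qed
  ultimately have "set_integrable lborel ({x<..<y} \<union> ({x..y} - {x<..<y})) (\<lambda>t. k t * g t)"
    by (rule set_integrable_Un) auto
  moreover have "{x<..<y} \<union> ({x..y} - {x<..<y}) = {x..y}" by auto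
  ultimately show ?thesis by simp
qed

text \<open>The bound on k is asked only to the right of x: for x = 0 nothing is known about the
  solutions at x itself.\<close>

lemma interval_product_bound:
  assumes g: "g \<in> L2 s" and int: "(\<lambda>t. k t * g t) integrable_on {x..y}"
    and kb: "\<And>t. t \<in> {x<..y} \<Longrightarrow> cmod (k t) \<le> K" and K: "K \<ge> 0" and xy: "0 \<le> x" "x \<le> y" "y \<le> s"
  shows "cmod (integral {x..y} (\<lambda>t. k t * g t)) \<le> K * integral {x..y} (\<lambda>t. cmod (g t))"
proof -
  have int': "(\<lambda>t. if t = x then 0 else k t * g t) integrable_on {x..y}"
    by (rule integrable_spike[OF int, of "{x}"]) auto
  have "integral {x..y} (\<lambda>t. k t * g t) = integral {x..y} (\<lambda>t. if t = x then 0 else k t * g t)"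
    by (rule integral_spike[of "{x}"]) auto
  also have "cmod \<dots> \<le> integral {x..y} (\<lambda>t. K * cmod (g t))"
  proof (rule Henstock_Kurzweil_Integration.integral_norm_bound_integral[OF int'])
    show "(\<lambda>t. K * cmod (g t)) integrable_on {x..y}"
      using integrable_on_Icc_norm_L2(1)[OF g xy] by (rule integrable_on_mult_right)
    fix t assume t: "t \<in> {x..y}"
    show "cmod (if t = x then 0 else k t * g t) \<le> K * cmod (g t)"
      using kb[of t] t K by (auto simp: norm_mult mult_right_mono)
  qed
  also have "\<dots> = K * integral {x..y} (\<lambda>t. cmod (g t))" by simp
  finally show ?thesis .
qed

text \<open>The right endpoint s is kept apart from b because the theory is instantiated twice: with
  s = a for the sampling points and with s = b for the ambient space.\<close>

locale endpoint = schroedinger +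
  fixes s \<gamma> :: real
  assumes s: "0 < s" "s \<le> b" and gamma: "0 < \<gamma>" "\<gamma> < pi"
begin

lemma sin_gamma: "sin \<gamma> > 0"
  using gamma by (rule sin_gt_zero)

section \<open>The eigenvalues\<close>

definition bcs :: "(real \<Rightarrow> complex) \<Rightarrow> (real \<Rightarrow> complex) \<Rightarrow> complex" where
  "bcs f f' = f s * of_real (cos \<gamma>) + f' s * of_real (sin \<gamma>)"

definition eigenvalues :: "complex set" where
  "eigenvalues = {z. bcs (\<xi> z) (\<xi>' z) = 0}"

text \<open>As sin \<gamma> is nonzero, the condition expresses the derivative at s through the
  value, with the same factor for both functions.\<close>

lemma bcs_wronskian:
  assumes "bcs f f' = 0" "bcs h h' = 0"
  shows "wronskian f f' h h' s = 0"
proof -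
  have sg: "complex_of_real (sin \<gamma>) \<noteq> 0" using sin_gamma by simp
  have "f' s * of_real (sin \<gamma>) = - (f s * of_real (cos \<gamma>))" "h' s * of_real (sin \<gamma>) = - (h s * of_real (cos \<gamma>))"
    using assms by (simp_all add: bcs_def add_eq_0_iff)
  note eqs = this
  have "of_real (sin \<gamma>) * wronskian f f' h h' s = (f' s * of_real (sin \<gamma>)) * h s - f s * (h' s * of_real (sin \<gamma>))"
    by (simp add: wronskian_def algebra_simps)
  also have "\<dots> = 0" unfolding eqs by simp
  finally show ?thesis using sg by simp
qed

lemma xi_in_L2: "\<xi> z \<in> L2 s"
  by (rule xi_L2[OF s(2)])

lemma xi_cnj_s: "cnj (\<xi> (cnj z) s) = \<xi> z s" "cnj (\<xi>' (cnj z) s) = \<xi>' z s"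
  using xi_cnj[of s z] s by auto

abbreviation \<F> where "\<F> \<equiv> transform \<xi> s"
abbreviation \<S> where "\<S> \<equiv> S_graph \<xi> \<nu> q s \<gamma>"

text \<open>Lagrange's identity over (0,s] without a term at 0. The factor
  \<open>\<F> (\<xi> w) z\<close> is the reproducing kernel at z and the conjugate of w.\<close>

lemma kernel_identity:
  "(z - w) * \<F> (\<xi> w) z = wronskian (\<xi> w) (\<xi>' w) (\<xi> z) (\<xi>' z) s"
proof -
  have "\<F> (\<lambda>x. w * \<xi> w x) z = w * \<F> (\<xi> w) z"
    by (simp add: transform_def mult.left_commute)
  then show ?thesis
    using wronskian_xi_transform[OF s sol_pair_xi[OF s] xi_in_L2 L2_scale[OF xi_in_L2] bc0_xi, of w z]
    by (simp add: wronskian_def left_diff_distrib)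
qed

lemma nrm_xi_pos: "nrm2 s (\<xi> z) > 0"
proof -
  obtain \<delta> where \<delta>: "\<delta> > 0" "\<And>x. x \<in> {0<..<\<delta>} \<Longrightarrow> \<xi> z x \<noteq> 0" using xi_lower by metis
  have "nrm2 s (\<xi> z) \<noteq> 0"
  proof
    assume "nrm2 s (\<xi> z) = 0"
    then have "AE x in lborel. x \<in> {0<..<s} \<longrightarrow> \<xi> z x = 0" using nrm2_eq_0_iff[OF xi_in_L2] by simp
    then obtain N where N: "negligible N" "\<And>x. x \<notin> N \<Longrightarrow> x \<in> {0<..<s} \<longrightarrow> \<xi> z x = 0"
      by (rule AE_lborel_negligibleE) blast
    have "{0<..<min \<delta> s} \<subseteq> N" using N(2) \<delta>(2) by force
    then have "negligible {0<..<min \<delta> s}" using N(1) negligible_subset by blast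
    then show False using open_not_negligible[of "{0<..<min \<delta> s}"] \<delta>(1) s(1) by auto
  qed
  then show ?thesis using L2.nrm_nonneg[OF xi_in_L2, of z] by linarith
qed

text \<open>The reproducing property: evaluating the transform at z is taking the inner product with
  the solution at the conjugate parameter.\<close>

lemma ip2_xi: "ip2 s f (\<xi> (cnj z)) = \<F> f z"
proof -
  have "cnj (\<xi> (cnj z) x) = \<xi> z x" if "x \<in> {0<..<s}" for x
    using xi_cnj(1)[of x z] that s by auto
  then show ?thesis
    unfolding ip2_def transform_def by (intro set_lebesgue_integral_cong) (auto simp: mult.commute)
qed

lemma eigenvalue_cnj: "z \<in> eigenvalues \<Longrightarrow> cnj z \<in> eigenvalues"
proof -
  assume "z \<in> eigenvalues"
  then have "bcs (\<xi> z) (\<xi>' z) = 0" by (simp add: eigenvalues_def)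
  then have "cnj (bcs (\<xi> z) (\<xi>' z)) = 0" by simp
  then show "cnj z \<in> eigenvalues"
    using xi_cnj_s[of "cnj z"] by (simp add: eigenvalues_def bcs_def)
qed

lemma eigenvalue_real:
  assumes z: "z \<in> eigenvalues"
  shows "cnj z = z"
proof -
  have "(z - cnj z) * \<F> (\<xi> (cnj z)) z = 0"
    unfolding kernel_identity
    using z eigenvalue_cnj[OF z] by (intro bcs_wronskian) (auto simp: eigenvalues_def)
  moreover have "\<F> (\<xi> (cnj z)) z = of_real ((nrm2 s (\<xi> (cnj z)))\<^sup>2)"
    using ip2_xi[of "\<xi> (cnj z)" z] L2.ip_self[OF xi_in_L2] by simp
  ultimately show ?thesis using nrm_xi_pos[of "cnj z"] by simp
qed

lemma ip2_eigenvalue: "l \<in> eigenvalues \<Longrightarrow> ip2 s f (\<xi> l) = \<F> f l"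
  using ip2_xi[of f l] eigenvalue_real by simp

lemma eigenfunction_orthogonal:
  assumes "l \<in> eigenvalues" "m \<in> eigenvalues" "l \<noteq> m"
  shows "ip2 s (\<xi> l) (\<xi> m) = 0"
proof -
  have "(m - l) * \<F> (\<xi> l) m = 0"
    unfolding kernel_identity using assms by (intro bcs_wronskian) (auto simp: eigenvalues_def)
  then show ?thesis using assms ip2_eigenvalue by simp
qed

section \<open>Green's operator\<close>

text \<open>A spectral shift below every eigenvalue. Asking for the inequalities at all smaller
  \<mu> as well is what bounds the eigenvalues from below; positivity at m0 itself permits division
  by u.\<close>

definition m0 :: real where
  "m0 = (SOME \<mu>0. \<forall>\<mu>\<le>\<mu>0. (\<forall>x\<in>{0<..s}. 0 < Re (\<xi> (of_real \<mu>) x)) \<and>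
    0 < cos \<gamma> * Re (\<xi> (of_real \<mu>) s) + sin \<gamma> * Re (\<xi>' (of_real \<mu>) s))"

abbreviation u where "u \<equiv> \<xi> (of_real m0)"
abbreviation u' where "u' \<equiv> \<xi>' (of_real m0)"

lemma below_m0:
  assumes "\<mu> \<le> m0"
  shows "(\<forall>x\<in>{0<..s}. 0 < Re (\<xi> (of_real \<mu>) x)) \<and>
    0 < cos \<gamma> * Re (\<xi> (of_real \<mu>) s) + sin \<gamma> * Re (\<xi>' (of_real \<mu>) s)"
proof -
  have "\<exists>\<mu>0. \<forall>\<mu>\<le>\<mu>0. (\<forall>x\<in>{0<..s}. 0 < Re (\<xi> (of_real \<mu>) x)) \<and>
    0 < cos \<gamma> * Re (\<xi> (of_real \<mu>) s) + sin \<gamma> * Re (\<xi>' (of_real \<mu>) s)"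
  proof (rule positive_solution[OF s gamma])
    fix \<mu>0 assume "\<And>\<mu> x. \<mu> \<le> \<mu>0 \<Longrightarrow> x \<in> {0<..s} \<Longrightarrow> 0 < Re (\<xi> (complex_of_real \<mu>) x)"
      "\<And>\<mu>. \<mu> \<le> \<mu>0 \<Longrightarrow> 0 < cos \<gamma> * Re (\<xi> (of_real \<mu>) s) + sin \<gamma> * Re (\<xi>' (of_real \<mu>) s)"
    then show ?thesis by (intro exI[of _ \<mu>0]) simp
  qed
  from someI_ex[OF this] show ?thesis using assms unfolding m0_def[symmetric] by simp
qed

lemmas m0 = bspec[OF conjunct1[OF below_m0[OF order_refl]]] conjunct2[OF below_m0[OF order_refl]]

lemma eigenvalueE:
  assumes "l \<in> eigenvalues"
  obtains k where "l = of_real k" "k > m0"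
proof
  show l: "l = of_real (Re l)" using eigenvalue_real[OF assms] by (simp add: complex_eq_iff)
  show "Re l > m0"
  proof (rule ccontr)
    assume "\<not> Re l > m0"
    then have "0 < Re (bcs (\<xi> l) (\<xi>' l))"
      using below_m0[of "Re l"] l[symmetric] by (simp add: bcs_def mult.commute)
    then show False using assms by (simp add: eigenvalues_def)
  qed
qed

lemma u_nonzero:
  assumes "x \<in> {0<..s}"
  shows "u x \<noteq> 0"
proof
  assume "u x = 0"
  then have "Re (u x) = 0" by simp
  then show False using m0(1)[OF assms] by linarith
qed

lemma bcs_u: "bcs u u' \<noteq> 0"
proof -
  have "Re (bcs u u') > 0" using m0(2) by (simp add: bcs_def mult.commute)
  then show ?thesis by (metis less_irrefl zero_complex.sel(1))
qed

lemma xi_real: "x \<in> {0<..b} \<Longrightarrow> cnj (\<xi> (of_real l) x) = \<xi> (of_real l) x"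
  "x \<in> {0<..b} \<Longrightarrow> cnj (\<xi>' (of_real l) x) = \<xi>' (of_real l) x"
  using xi_cnj[of x "of_real l"] by simp_all

text \<open>Near 0 the leading term gives the bound, elsewhere positivity on a compact
  interval.\<close>

lemma u_lower:
  obtains c where "c > 0" "\<And>x. x \<in> {0<..s} \<Longrightarrow> c * x powr p \<le> cmod (u x)"
proof -
  obtain \<delta> where \<delta>: "\<delta> > 0" "\<And>x. x \<in> {0<..<\<delta>} \<Longrightarrow> c0 / 2 * x powr p \<le> cmod (u x)" using xi_lower by metis
  define e where "e = min (\<delta> / 2) s"
  have e: "0 < e" "e \<le> s" "e < \<delta>" using \<delta> s by (auto simp: e_def)
  have "\<exists>y\<in>{e..s}. \<forall>x\<in>{e..s}. cmod (u y) \<le> cmod (u x)"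
    using e s by (intro continuous_attains_inf continuous_on_norm continuous_on_subset[OF continuous_xi]) auto
  then obtain y where y: "y \<in> {e..s}" "\<And>x. x \<in> {e..s} \<Longrightarrow> cmod (u y) \<le> cmod (u x)" by blast
  have uy: "cmod (u y) > 0" using y e u_nonzero[of y] by auto
  define c where "c = min (c0 / 2) (cmod (u y) / s powr p)"
  have c: "c > 0" using c0_pos uy s by (simp add: c_def)
  have "c * x powr p \<le> cmod (u x)" if x: "x \<in> {0<..s}" for x
  proof (cases "x < \<delta>")
    case True
    have "c * x powr p \<le> c0 / 2 * x powr p"
      unfolding c_def by (rule mult_right_mono[OF min.cobounded1]) simp
    also have "\<dots> \<le> cmod (u x)" using True x by (intro \<delta>(2)) auto
    finally show ?thesis .
  next
    case False
    have "c * x powr p \<le> cmod (u y) / s powr p * s powr p"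
      using x nu c by (intro mult_mono powr_mono2) (auto simp: c_def)
    also have "\<dots> = cmod (u y)" using s by simp
    also have "\<dots> \<le> cmod (u x)" using y(2)[of x] False e x by simp
    finally show ?thesis .
  qed
  with c show thesis by (rule that)
qed

text \<open>Reduction of order: u times the integral of 1 / u^2 from x to s is a second solution,
  with Wronskian 1 against u. Its boundary form at s is -sin \<gamma> / u(s), and adding \<alpha> u
  compensates this, so that \<open>\<eta>\<close> satisfies the boundary condition.\<close>

definition \<alpha> :: complex where "\<alpha> = of_real (sin \<gamma>) / (bcs u u' * u s)"
definition U :: "real \<Rightarrow> complex" where "U x = integral {x..s} (\<lambda>t. 1 / (u t)\<^sup>2)"
definition \<eta> :: "real \<Rightarrow> complex" where "\<eta> x = u x * (\<alpha> + U x)"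
definition \<eta>' :: "real \<Rightarrow> complex" where "\<eta>' x = u' x * (\<alpha> + U x) - 1 / u x"

lemma continuous_inv_u2: "continuous_on {0<..s} (\<lambda>t. 1 / (u t)\<^sup>2)"
  using u_nonzero s by (intro continuous_intros continuous_on_subset[OF continuous_xi]) auto

lemma U_deriv:
  assumes x: "x \<in> {0<..s}"
  shows "(U has_vector_derivative - (1 / (u x)\<^sup>2)) (at x within {0<..s})"
proof -
  have "continuous_on {x / 2..s} (\<lambda>t. 1 / (u t)\<^sup>2)"
    using x by (intro continuous_on_subset[OF continuous_inv_u2]) auto
  from integral_has_vector_derivative'[OF this, of x]
  have "(U has_vector_derivative - (1 / (u x)\<^sup>2)) (at x within {x / 2..s})"
    using x by (simp add: U_def[abs_def])
  then show ?thesis using at_within_Ioc[of "x / 2" x s] x by simp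
qed

lemma xi_deriv_s: "x \<in> {0<..s} \<Longrightarrow> (\<xi> z has_vector_derivative \<xi>' z x) (at x within {0<..s})"
  using sol_pair_deriv[OF sol_pair_xi[OF s]] .

lemma xi'_deriv_s:
  assumes "x \<in> {0<..s}"
  shows "(\<xi>' z has_vector_derivative (of_real (V x) - z) * \<xi> z x) (at x within {0<..s})"
proof -
  have "x \<in> {0<..b}" "{0<..s} \<subseteq> {0<..b}" using assms s by auto
  then show ?thesis by (rule has_vector_derivative_within_subset[OF xi'_deriv])
qed

lemma eta_deriv:
  assumes x: "x \<in> {0<..s}"
  shows "(\<eta> has_vector_derivative \<eta>' x) (at x within {0<..s})"
proof -
  have "((\<lambda>x. u x * (\<alpha> + U x)) has_vector_derivative u x * (0 + - (1 / (u x)\<^sup>2)) + u' x * (\<alpha> + U x)) (at x within {0<..s})"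
    by (intro has_vector_derivative_mult has_vector_derivative_add has_vector_derivative_const U_deriv[OF x] xi_deriv_s[OF x])
  moreover have "u x * (0 + - (1 / (u x)\<^sup>2)) + u' x * (\<alpha> + U x) = \<eta>' x"
    using u_nonzero[OF x] by (simp add: \<eta>'_def power2_eq_square)
  ultimately show ?thesis by (simp add: \<eta>_def[abs_def])
qed

lemma eta'_deriv:
  assumes x: "x \<in> {0<..s}"
  shows "(\<eta>' has_vector_derivative (of_real (V x) - of_real m0) * \<eta> x) (at x within {0<..s})"
proof -
  have inv: "((\<lambda>x. inverse (u x)) has_vector_derivative - (inverse (u x) * u' x * inverse (u x))) (at x within {0<..s})"
    using Deriv.has_derivative_inverse[OF u_nonzero[OF x] xi_deriv_s[OF x, of "of_real m0", unfolded has_vector_derivative_def]]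
    by (simp add: has_vector_derivative_def scaleR_conv_of_real algebra_simps)
  have "((\<lambda>x. u' x * (\<alpha> + U x) - inverse (u x)) has_vector_derivative
      (u' x * (0 + - (1 / (u x)\<^sup>2)) + ((of_real (V x) - of_real m0) * u x) * (\<alpha> + U x)) - - (inverse (u x) * u' x * inverse (u x))) (at x within {0<..s})"
    by (intro has_vector_derivative_diff has_vector_derivative_mult has_vector_derivative_add has_vector_derivative_const
        U_deriv[OF x] xi'_deriv_s[OF x] inv)
  moreover have "(u' x * (0 + - (1 / (u x)\<^sup>2)) + ((of_real (V x) - of_real m0) * u x) * (\<alpha> + U x)) - - (inverse (u x) * u' x * inverse (u x))
      = (of_real (V x) - of_real m0) * \<eta> x"
    by (simp add: \<eta>_def divide_inverse power2_eq_square algebra_simps)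
  ultimately show ?thesis by (simp add: \<eta>'_def[abs_def] divide_inverse)
qed

lemma continuous_eta: "continuous_on {0<..s} \<eta>" "continuous_on {0<..s} \<eta>'"
  unfolding continuous_on_eq_continuous_within
  using eta_deriv eta'_deriv has_vector_derivative_continuous by blast+

lemma wronskian_u_eta:
  assumes "x \<in> {0<..s}"
  shows "u' x * \<eta> x - u x * \<eta>' x = 1"
  using u_nonzero[OF assms] by (simp add: \<eta>_def \<eta>'_def algebra_simps)

lemma bcs_eta: "bcs \<eta> \<eta>' = 0"
proof -
  have us: "u s \<noteq> 0" using u_nonzero[of s] s by simp
  have "bcs \<eta> \<eta>' = \<alpha> * bcs u u' - of_real (sin \<gamma>) / u s"
    by (simp add: bcs_def \<eta>_def \<eta>'_def U_def algebra_simps)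
  also have "\<dots> = 0" using us bcs_u by (simp add: \<alpha>_def)
  finally show ?thesis .
qed

text \<open>Since 1 / u^2 is O(t^(-2 \<nu> - 1)), the factor \<alpha> + U is O(x^(-2 \<nu>)), and it
  multiplies u = O(x^(\<nu> + 1/2)).\<close>

lemma eta_bounds:
  obtains C where "C > 0" "\<And>x. x \<in> {0<..s} \<Longrightarrow> cmod (\<eta> x) \<le> C * x powr (1 / 2 - \<nu>)"
    "\<And>x. x \<in> {0<..s} \<Longrightarrow> cmod (\<eta>' x) \<le> C * x powr (- 1 / 2 - \<nu>)"
proof -
  obtain c where c: "c > 0" "\<And>x. x \<in> {0<..s} \<Longrightarrow> c * x powr p \<le> cmod (u x)" using u_lower by metis
  obtain M where M: "M > 0" "\<And>x. x \<in> {0<..b} \<Longrightarrow> cmod (u x) \<le> M * x powr p"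
    "\<And>x. x \<in> {0<..b} \<Longrightarrow> cmod (u' x) \<le> M * x powr (\<nu> - 1 / 2)" using xi_bound by metis
  define D where "D = cmod \<alpha> * s powr (2 * \<nu>) + 1 / (2 * \<nu> * c\<^sup>2)"
  have D0: "D \<ge> 0" using nu c by (simp add: D_def)
  have aU: "cmod (\<alpha> + U x) \<le> D * x powr (- 2 * \<nu>)" if x: "x \<in> {0<..s}" for x
  proof -
    have "((\<lambda>t. t powr (- 2 * \<nu> - 1) / c\<^sup>2) has_integral
        (- (s powr (- 2 * \<nu>) / (2 * \<nu> * c\<^sup>2)) - - (x powr (- 2 * \<nu>) / (2 * \<nu> * c\<^sup>2)))) {x..s}"
    proof (rule fundamental_theorem_of_calculus)
      fix t assume t: "t \<in> {x..s}"
      have "((\<lambda>t. - (t powr (- 2 * \<nu>) / (2 * \<nu> * c\<^sup>2))) has_real_derivative t powr (- 2 * \<nu> - 1) / c\<^sup>2) (at t within {x..s})"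
        using t x nu c by (auto intro!: derivative_eq_intros simp: field_simps)
      then show "((\<lambda>t. - (t powr (- 2 * \<nu>) / (2 * \<nu> * c\<^sup>2))) has_vector_derivative t powr (- 2 * \<nu> - 1) / c\<^sup>2) (at t within {x..s})"
        by (simp add: has_real_derivative_iff_has_vector_derivative)
    qed (use x in auto)
    note I = this
    have "cmod (U x) \<le> integral {x..s} (\<lambda>t. t powr (- 2 * \<nu> - 1) / c\<^sup>2)"
      unfolding U_def
    proof (rule Henstock_Kurzweil_Integration.integral_norm_bound_integral)
      show "(\<lambda>t. 1 / (u t)\<^sup>2) integrable_on {x..s}"
        using x by (intro integrable_continuous_real continuous_on_subset[OF continuous_inv_u2]) auto
      show "(\<lambda>t. t powr (- 2 * \<nu> - 1) / c\<^sup>2) integrable_on {x..s}" using I by blast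
      fix t assume t: "t \<in> {x..s}"
      then have t': "t \<in> {0<..s}" using x by auto
      have "(c * t powr p)\<^sup>2 \<le> (cmod (u t))\<^sup>2" using c t' by (intro power_mono) auto
      moreover have "(c * t powr p)\<^sup>2 > 0" using c t' by simp
      ultimately have "1 / (cmod (u t))\<^sup>2 \<le> 1 / (c * t powr p)\<^sup>2" by (intro divide_left_mono mult_pos_pos) auto
      also have "\<dots> = t powr (- 2 * \<nu> - 1) / c\<^sup>2"
      proof -
        have "(t powr p)\<^sup>2 = t powr (2 * \<nu> + 1)" by (simp add: power2_eq_square flip: powr_add)
        moreover have "t powr (- 2 * \<nu> - 1) = inverse (t powr (2 * \<nu> + 1))" using powr_minus[of t "2 * \<nu> + 1"] by simp
        ultimately show ?thesis
          by (simp only: power_mult_distrib divide_inverse inverse_mult_distrib mult_1_left) (simp only: mult.commute)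
      qed
      finally show "cmod (1 / (u t)\<^sup>2) \<le> t powr (- 2 * \<nu> - 1) / c\<^sup>2" by (simp add: norm_divide norm_power)
    qed
    also have "\<dots> = x powr (- 2 * \<nu>) / (2 * \<nu> * c\<^sup>2) - s powr (- 2 * \<nu>) / (2 * \<nu> * c\<^sup>2)"
      using integral_unique[OF I] by simp
    also have "\<dots> \<le> 1 / (2 * \<nu> * c\<^sup>2) * x powr (- 2 * \<nu>)" using nu c by simp
    finally have 1: "cmod (U x) \<le> 1 / (2 * \<nu> * c\<^sup>2) * x powr (- 2 * \<nu>)" .
    have "x powr (2 * \<nu>) \<le> s powr (2 * \<nu>)" using x nu by (intro powr_mono2) auto
    then have "x powr (2 * \<nu>) * x powr (- 2 * \<nu>) \<le> s powr (2 * \<nu>) * x powr (- 2 * \<nu>)" by (intro mult_right_mono) auto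
    moreover have "x powr (2 * \<nu>) * x powr (- 2 * \<nu>) = 1" using x by (simp flip: powr_add)
    ultimately have "cmod \<alpha> * 1 \<le> cmod \<alpha> * (s powr (2 * \<nu>) * x powr (- 2 * \<nu>))" by (intro mult_left_mono) auto
    then show ?thesis using 1 norm_triangle_ineq[of \<alpha> "U x"] by (simp add: D_def distrib_right mult.assoc)
  qed
  show thesis
  proof (rule that[of "M * D + 1 / c"])
    show "M * D + 1 / c > 0" using M c D0 by (simp add: add_nonneg_pos)
    fix x assume x: "x \<in> {0<..s}"
    then have xb: "x \<in> {0<..b}" using s by auto
    have "cmod (\<eta> x) \<le> (M * x powr p) * (D * x powr (- 2 * \<nu>))"
      unfolding \<eta>_def norm_mult using M(2)[OF xb] aU[OF x] M(1) by (intro mult_mono) auto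
    also have "\<dots> = M * D * (x powr p * x powr (- 2 * \<nu>))" by simp
    also have "x powr p * x powr (- 2 * \<nu>) = x powr (1 / 2 - \<nu>)" by (simp flip: powr_add)
    also have "M * D * x powr (1 / 2 - \<nu>) \<le> (M * D + 1 / c) * x powr (1 / 2 - \<nu>)"
      using c by (intro mult_right_mono) auto
    finally show "cmod (\<eta> x) \<le> (M * D + 1 / c) * x powr (1 / 2 - \<nu>)" .
    have "cmod (\<eta>' x) \<le> cmod (u' x) * cmod (\<alpha> + U x) + cmod (1 / u x)"
      unfolding \<eta>'_def by (rule order_trans[OF norm_triangle_ineq4]) (simp add: norm_mult)
    also have "\<dots> \<le> (M * x powr (\<nu> - 1 / 2)) * (D * x powr (- 2 * \<nu>)) + 1 / (c * x powr p)"
    proof (rule add_mono)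
      show "cmod (u' x) * cmod (\<alpha> + U x) \<le> (M * x powr (\<nu> - 1 / 2)) * (D * x powr (- 2 * \<nu>))"
        using M(3)[OF xb] aU[OF x] M(1) by (intro mult_mono) auto
      have "0 < c * x powr p" using c x by simp
      then show "cmod (1 / u x) \<le> 1 / (c * x powr p)"
        using c(2)[OF x] by (simp add: norm_divide frac_le)
    qed
    also have "\<dots> = (M * D) * (x powr (\<nu> - 1 / 2) * x powr (- 2 * \<nu>)) + 1 / c * (1 / x powr p)" by simp
    also have "x powr (\<nu> - 1 / 2) * x powr (- 2 * \<nu>) = x powr (- 1 / 2 - \<nu>)"
      unfolding powr_add[symmetric] by (rule arg_cong[where f = "(powr) x"]) simp
    also have "1 / x powr p = x powr (- 1 / 2 - \<nu>)"
    proof -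
      have e: "- 1 / 2 - \<nu> = - p" by simp
      show ?thesis unfolding e powr_minus_divide ..
    qed
    also have "M * D * x powr (- 1 / 2 - \<nu>) + 1 / c * x powr (- 1 / 2 - \<nu>) = (M * D + 1 / c) * x powr (- 1 / 2 - \<nu>)"
      by (simp add: distrib_right)
    finally show "cmod (\<eta>' x) \<le> (M * D + 1 / c) * x powr (- 1 / 2 - \<nu>)" .
  qed
qed

end

lemma abs_continuous_on_cong:
  assumes "abs_continuous_on g c d" "\<And>x. x \<in> {c..d} \<Longrightarrow> f x = g x"
  shows "abs_continuous_on f c d"
proof (rule abs_continuous_on_dominated2[OF assms(1) assms(1), of 1 0])
  fix u v assume "c \<le> u" "u \<le> v" "v \<le> d"
  then show "norm (f v - f u) \<le> 1 * norm (g v - g u) + 0 * norm (g v - g u)"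
    using assms(2)[of u] assms(2)[of v] by simp
qed auto

context endpoint
begin

text \<open>Green's kernel is u of the smaller variable times \<open>\<eta>\<close> of the larger
  one; \<open>green_A\<close> and \<open>green_B\<close> are the parts of the integral left and
  right of x.\<close>

definition green_A :: "(real \<Rightarrow> complex) \<Rightarrow> real \<Rightarrow> complex" where
  "green_A g x = integral {0..x} (\<lambda>t. u t * g t)"

definition green_B :: "(real \<Rightarrow> complex) \<Rightarrow> real \<Rightarrow> complex" where
  "green_B g x = integral {x..s} (\<lambda>t. \<eta> t * g t)"

text \<open>The value 0 outside (0,s] turns linearity, conjugation and the uniform bound into
  statements about all real arguments.\<close>

definition green :: "(real \<Rightarrow> complex) \<Rightarrow> real \<Rightarrow> complex" where
  "green g x = (if x \<in> {0<..s} then \<eta> x * green_A g x + u x * green_B g x else 0)"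

definition green' :: "(real \<Rightarrow> complex) \<Rightarrow> real \<Rightarrow> complex" where
  "green' g x = \<eta>' x * green_A g x + u' x * green_B g x"

lemma u_g_integrable:
  assumes "g \<in> L2 s"
  shows "set_integrable lborel {0..s} (\<lambda>t. u t * g t)"
proof -
  obtain M where M: "M > 0" "\<And>x. x \<in> {0<..b} \<Longrightarrow> cmod (u x) \<le> M * x powr p"
    using xi_bound by metis
  show ?thesis
  proof (rule interval_product_integrable[OF assms])
    show "continuous_on {0<..<s} u" using s by (intro continuous_on_subset[OF continuous_xi]) auto
    fix t assume t: "t \<in> {0<..<s}"
    have "cmod (u t) \<le> M * t powr p" using M(2)[of t] t s by auto
    also have "\<dots> \<le> M * s powr p" using M(1) t nu by (intro mult_left_mono powr_mono2) auto
    finally show "cmod (u t) \<le> M * s powr p" .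
  qed auto
qed

lemma eta_g_integrable:
  assumes "g \<in> L2 s" "0 < x"
  shows "set_integrable lborel {x..s} (\<lambda>t. \<eta> t * g t)"
proof -
  have "continuous_on {x..s} \<eta>" using assms(2) by (intro continuous_on_subset[OF continuous_eta(1)]) auto
  then have "bounded (\<eta> ` {x..s})" by (intro compact_imp_bounded compact_continuous_image) auto
  then obtain K where K: "\<And>t. t \<in> {x..s} \<Longrightarrow> cmod (\<eta> t) \<le> K" unfolding bounded_pos by blast
  show ?thesis
  proof (rule interval_product_integrable[OF assms(1)])
    show "continuous_on {x<..<s} \<eta>" using assms(2) by (intro continuous_on_subset[OF continuous_eta(1)]) auto
    show "\<And>t. t \<in> {x<..<s} \<Longrightarrow> cmod (\<eta> t) \<le> K" using K by auto
  qed (use assms in auto)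
qed

lemmas u_g_integrable_on = set_borel_integral_eq_integral(1)[OF u_g_integrable]
lemmas eta_g_integrable_on = set_borel_integral_eq_integral(1)[OF eta_g_integrable]

text \<open>\<open>green_A\<close> gets two bounds. The one through the integral of |g| over (0,x)
  is o(x^\<nu>), and this is what the symmetry proof uses at the singular endpoint.\<close>

lemma green_AB_bounds:
  obtains C where "C > 0"
    "\<And>g x. g \<in> L2 s \<Longrightarrow> x \<in> {0<..s} \<Longrightarrow> cmod (green_A g x) \<le> C * x powr \<nu> * integral {0..x} (\<lambda>t. cmod (g t))"
    "\<And>g x. g \<in> L2 s \<Longrightarrow> x \<in> {0<..s} \<Longrightarrow> cmod (green_A g x) \<le> C * x powr \<nu> * nrm2 s g"
    "\<And>g x. g \<in> L2 s \<Longrightarrow> x \<in> {0<..s} \<Longrightarrow> cmod (green_B g x) \<le> C * x powr - \<nu> * nrm2 s g"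
proof -
  obtain M where M: "M > 0" "\<And>x. x \<in> {0<..b} \<Longrightarrow> cmod (u x) \<le> M * x powr p"
    using xi_bound by metis
  obtain D where D: "D > 0" "\<And>x. x \<in> {0<..s} \<Longrightarrow> cmod (\<eta> x) \<le> D * x powr (1 / 2 - \<nu>)"
    using eta_bounds by metis
  have sh: "x powr (1 / 2) \<le> sqrt s" if "x \<in> {0<..s}" for x
    using that by (simp add: powr_half_sqrt)
  define A where "A = M * sqrt s"
  have Apos: "A > 0" using M(1) s by (simp add: A_def)
  define C where "C = A + A * sqrt s + D * sqrt s * sqrt s"
  have C: "A \<le> C" "A * sqrt s \<le> C" "D * sqrt s * sqrt s \<le> C" "C > 0"
    using Apos D s by (auto simp: C_def add_nonneg_pos add_pos_nonneg)
  have A1: "cmod (green_A g x) \<le> A * x powr \<nu> * integral {0..x} (\<lambda>t. cmod (g t))"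
    if g: "g \<in> L2 s" and x: "x \<in> {0<..s}" for g x
    unfolding green_A_def
  proof (rule interval_product_bound[OF g])
    show "(\<lambda>t. u t * g t) integrable_on {0..x}"
      using x by (intro integrable_subinterval_real[OF u_g_integrable_on[OF g]]) auto
    fix t assume t: "t \<in> {0<..x}"
    have "cmod (u t) \<le> M * t powr p" using M(2)[of t] t x s by auto
    also have "t powr p = t powr (1 / 2) * t powr \<nu>" by (simp add: add.commute flip: powr_add)
    also have "M * (t powr (1 / 2) * t powr \<nu>) \<le> M * (sqrt s * x powr \<nu>)"
      using M(1) t x nu s sh[of t] by (intro mult_left_mono mult_mono powr_mono2) auto
    finally show "cmod (u t) \<le> A * x powr \<nu>" by (simp add: A_def mult.assoc)
  qed (use x Apos in auto)
  show thesis
  proof (rule that[OF C(4)])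
    fix g x assume g: "g \<in> L2 s" and x: "x \<in> {0<..s}"
    have I: "0 \<le> integral {0..x} (\<lambda>t. cmod (g t))" "integral {0..x} (\<lambda>t. cmod (g t)) \<le> sqrt s * nrm2 s g"
      using x integrable_on_Icc_norm_L2[OF g, of 0 x]
      by (auto intro: Henstock_Kurzweil_Integration.integral_nonneg)
    have "A * x powr \<nu> * integral {0..x} (\<lambda>t. cmod (g t)) \<le> C * x powr \<nu> * integral {0..x} (\<lambda>t. cmod (g t))"
      using C(1) I by (intro mult_right_mono) auto
    then show "cmod (green_A g x) \<le> C * x powr \<nu> * integral {0..x} (\<lambda>t. cmod (g t))"
      using A1[OF g x] by linarith
    have "A * x powr \<nu> * integral {0..x} (\<lambda>t. cmod (g t)) \<le> A * x powr \<nu> * (sqrt s * nrm2 s g)"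
      using Apos I by (intro mult_left_mono) auto
    also have "\<dots> = (A * sqrt s) * (x powr \<nu> * nrm2 s g)" by simp
    also have "\<dots> \<le> C * (x powr \<nu> * nrm2 s g)"
      using C(2) L2.nrm_nonneg[OF g] by (intro mult_right_mono) auto
    finally show "cmod (green_A g x) \<le> C * x powr \<nu> * nrm2 s g"
      using A1[OF g x] by (simp add: mult.assoc)
    have "cmod (green_B g x) \<le> (D * (sqrt s * x powr - \<nu>)) * integral {x..s} (\<lambda>t. cmod (g t))"
      unfolding green_B_def
    proof (rule interval_product_bound[OF g])
      show "(\<lambda>t. \<eta> t * g t) integrable_on {x..s}" using x by (intro eta_g_integrable_on[OF g]) auto
      fix t assume t: "t \<in> {x<..s}"
      have "cmod (\<eta> t) \<le> D * t powr (1 / 2 - \<nu>)" using D(2)[of t] t x by auto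
      also have "t powr (1 / 2 - \<nu>) = t powr (1 / 2) * t powr - \<nu>" by (simp flip: powr_add)
      also have "D * (t powr (1 / 2) * t powr - \<nu>) \<le> D * (sqrt s * x powr - \<nu>)"
        using D(1) t x nu s sh[of t] by (intro mult_left_mono mult_mono powr_mono2') auto
      finally show "cmod (\<eta> t) \<le> D * (sqrt s * x powr - \<nu>)" .
    qed (use x D s in auto)
    also have "\<dots> \<le> (D * (sqrt s * x powr - \<nu>)) * (sqrt s * nrm2 s g)"
      using x D s integrable_on_Icc_norm_L2(2)[OF g, of x s] by (intro mult_left_mono) auto
    also have "\<dots> = (D * sqrt s * sqrt s) * (x powr - \<nu> * nrm2 s g)" by (simp only: mult_ac)
    also have "\<dots> \<le> C * (x powr - \<nu> * nrm2 s g)"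
      using C(3) L2.nrm_nonneg[OF g] by (intro mult_right_mono) auto
    finally show "cmod (green_B g x) \<le> C * x powr - \<nu> * nrm2 s g" by (simp add: mult.assoc)
  qed
qed

text \<open>The powers x^\<nu> and x^(-\<nu>) from the two integrals cancel against those of
  \<open>\<eta>\<close> and u, leaving rates independent of \<nu>.\<close>

lemma green_bounds:
  obtains C where "C > 0"
    "\<And>g x. g \<in> L2 s \<Longrightarrow> x \<in> {0<..s} \<Longrightarrow> cmod (green g x) \<le> C * x powr (1 / 2) * nrm2 s g"
    "\<And>g x. g \<in> L2 s \<Longrightarrow> x \<in> {0<..s} \<Longrightarrow> cmod (green' g x) \<le> C * x powr (- 1 / 2) * nrm2 s g"
proof -
  obtain M where M: "M > 0" "\<And>x. x \<in> {0<..b} \<Longrightarrow> cmod (u x) \<le> M * x powr p"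
    "\<And>x. x \<in> {0<..b} \<Longrightarrow> cmod (u' x) \<le> M * x powr (\<nu> - 1 / 2)"
    using xi_bound by metis
  obtain D where D: "D > 0" "\<And>x. x \<in> {0<..s} \<Longrightarrow> cmod (\<eta> x) \<le> D * x powr (1 / 2 - \<nu>)"
    "\<And>x. x \<in> {0<..s} \<Longrightarrow> cmod (\<eta>' x) \<le> D * x powr (- 1 / 2 - \<nu>)"
    using eta_bounds by metis
  obtain C where C: "C > 0"
    "\<And>g x. g \<in> L2 s \<Longrightarrow> x \<in> {0<..s} \<Longrightarrow> cmod (green_A g x) \<le> C * x powr \<nu> * nrm2 s g"
    "\<And>g x. g \<in> L2 s \<Longrightarrow> x \<in> {0<..s} \<Longrightarrow> cmod (green_B g x) \<le> C * x powr - \<nu> * nrm2 s g"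
    using green_AB_bounds by metis
  show thesis
  proof (rule that[of "D * C + M * C"])
    show "D * C + M * C > 0" using M D C by (simp add: add_pos_pos)
    fix g x assume g: "g \<in> L2 s" and x: "x \<in> {0<..s}"
    then have xb: "x \<in> {0<..b}" using s by auto
    have n: "nrm2 s g \<ge> 0" by (rule L2.nrm_nonneg[OF g])
    have gen: "cmod (h * green_A g x + k * green_B g x) \<le> (D * C + M * C) * x powr e * nrm2 s g"
      if h: "cmod h \<le> D * x powr (e - \<nu>)" and k: "cmod k \<le> M * x powr (e + \<nu>)" for h k e
    proof -
      have "cmod (h * green_A g x + k * green_B g x) \<le> cmod h * cmod (green_A g x) + cmod k * cmod (green_B g x)"
        by (rule order_trans[OF norm_triangle_ineq]) (simp add: norm_mult)
      also have "\<dots> \<le> (D * x powr (e - \<nu>)) * (C * x powr \<nu> * nrm2 s g) + (M * x powr (e + \<nu>)) * (C * x powr - \<nu> * nrm2 s g)"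
        using h k C(2,3)[OF g x] D(1) M(1) by (intro add_mono mult_mono) auto
      also have "\<dots> = D * C * nrm2 s g * (x powr (e - \<nu>) * x powr \<nu>) + M * C * nrm2 s g * (x powr (e + \<nu>) * x powr - \<nu>)"
        by (simp only: mult_ac)
      also have "x powr (e - \<nu>) * x powr \<nu> = x powr e" by (simp flip: powr_add)
      also have "x powr (e + \<nu>) * x powr - \<nu> = x powr e" by (simp flip: powr_add)
      finally show ?thesis by (simp add: algebra_simps)
    qed
    show "cmod (green g x) \<le> (D * C + M * C) * x powr (1 / 2) * nrm2 s g"
      using x gen[of "\<eta> x" "1 / 2" "u x"] D(2)[OF x] M(2)[OF xb] by (simp add: green_def add.commute)
    have e1: "- 1 / 2 + \<nu> = \<nu> - 1 / 2" by simp
    have "cmod (u' x) \<le> M * x powr (- 1 / 2 + \<nu>)" unfolding e1 by (rule M(3)[OF xb])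
    then show "cmod (green' g x) \<le> (D * C + M * C) * x powr (- 1 / 2) * nrm2 s g"
      unfolding green'_def by (intro gen D(3)[OF x])
  qed
qed

lemma green_AB_AC:
  assumes g: "g \<in> L2 s" and c: "0 < c" "c < s"
  shows "abs_continuous_on (green_A g) c s" and "abs_continuous_on (green_B g) c s"
proof -
  have cs: "\<And>t. t \<in> {c..s} \<Longrightarrow> 0 \<le> t \<and> t \<le> s" using c by auto
  have const: "abs_continuous_on (\<lambda>_. k) c s" for k :: complex by (rule abs_continuous_on_lipschitz[of _ _ _ 0]) auto
  have ug: "set_integrable lborel {c..s} (\<lambda>t. u t * g t)"
    using c by (intro set_integrable_subset[OF u_g_integrable[OF g]]) auto
  have AC1: "abs_continuous_on (\<lambda>x. green_A g c + integral {c..x} (\<lambda>t. u t * g t)) c s"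
    by (intro abs_continuous_on_add const abs_continuous_on_integral ug)
  have A: "green_A g x = green_A g c + integral {c..x} (\<lambda>t. u t * g t)" if "x \<in> {c..s}" for x
    unfolding green_A_def using that c
    by (intro Henstock_Kurzweil_Integration.integral_combine[symmetric] integrable_subinterval_real[OF u_g_integrable_on[OF g]]) auto
  show "abs_continuous_on (green_A g) c s" by (rule abs_continuous_on_cong[OF AC1 A])
  have AC2: "abs_continuous_on (\<lambda>x. green_B g c - integral {c..x} (\<lambda>t. \<eta> t * g t)) c s"
    by (intro abs_continuous_on_diff const abs_continuous_on_integral eta_g_integrable[OF g c(1)])
  have B: "green_B g x = green_B g c - integral {c..x} (\<lambda>t. \<eta> t * g t)" if "x \<in> {c..s}" for x
  proof -
    have "integral {c..x} (\<lambda>t. \<eta> t * g t) + integral {x..s} (\<lambda>t. \<eta> t * g t) = integral {c..s} (\<lambda>t. \<eta> t * g t)"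
      using that by (intro Henstock_Kurzweil_Integration.integral_combine eta_g_integrable_on[OF g c(1)]) auto
    then show ?thesis by (simp add: green_B_def algebra_simps)
  qed
  show "abs_continuous_on (green_B g) c s" by (rule abs_continuous_on_cong[OF AC2 B])
qed

text \<open>\<open>\<eta>\<close> is controlled only away from 0, so the second integral is
  differentiated from starting points \<open>c n\<close> that tend to 0, and the countably many null
  sets are united.\<close>

lemma green_AB_deriv:
  assumes g: "g \<in> L2 s"
  obtains N where "negligible N"
    "\<And>x. x \<in> {0<..<s} - N \<Longrightarrow> (green_A g has_vector_derivative u x * g x) (at x)"
    "\<And>x. x \<in> {0<..<s} - N \<Longrightarrow> (green_B g has_vector_derivative - (\<eta> x * g x)) (at x)"
proof -
  obtain N1 where N1: "negligible N1" "\<And>x. x \<in> {0<..<s} - N1 \<Longrightarrow>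
      ((\<lambda>y. integral {0..y} (\<lambda>t. u t * g t)) has_vector_derivative u x * g x) (at x)"
    by (rule AE_has_vector_derivative_integral[OF u_g_integrable_on[OF g]]) blast
  define c where "c n = s / (real n + 2)" for n :: nat
  have c: "0 < c n" "c n < s" for n using s by (auto simp: c_def divide_less_eq add_pos_pos)
  have "\<exists>N. negligible N \<and> (\<forall>x\<in>{c n<..<s} - N. ((\<lambda>y. integral {c n..y} (\<lambda>t. \<eta> t * g t)) has_vector_derivative \<eta> x * g x) (at x))" for n
    by (rule AE_has_vector_derivative_integral[OF eta_g_integrable_on[OF g c(1)[of n]]]) blast
  then obtain N2 where N2: "\<And>n. negligible (N2 n)"
    "\<And>n x. x \<in> {c n<..<s} - N2 n \<Longrightarrow> ((\<lambda>y. integral {c n..y} (\<lambda>t. \<eta> t * g t)) has_vector_derivative \<eta> x * g x) (at x)"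
    by metis
  show thesis
  proof (rule that[of "N1 \<union> (\<Union>n. N2 n)"])
    show "negligible (N1 \<union> (\<Union>n. N2 n))"
      using N1 N2 by (intro negligible_Un negligible_countable_Union) auto
    fix x assume x: "x \<in> {0<..<s} - (N1 \<union> (\<Union>n. N2 n))"
    then show "(green_A g has_vector_derivative u x * g x) (at x)"
      using N1(2)[of x] by (simp add: green_A_def[abs_def])
    obtain n :: nat where n: "s / x < n" using reals_Archimedean2 by blast
    have cn: "c n < x"
    proof -
      have "s < real n * x" using n x by (simp add: divide_less_eq)
      then have "s < x * (real n + 2)" using x by (simp add: algebra_simps)
      then show ?thesis using s by (simp add: c_def divide_less_eq add_pos_pos)
    qed
    have "((\<lambda>y. green_B g (c n) - integral {c n..y} (\<lambda>t. \<eta> t * g t)) has_vector_derivative 0 - \<eta> x * g x) (at x)"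
      using x cn by (intro has_vector_derivative_diff has_vector_derivative_const N2) auto
    then have "((\<lambda>y. green_B g (c n) - integral {c n..y} (\<lambda>t. \<eta> t * g t)) has_vector_derivative - (\<eta> x * g x)) (at x)" by simp
    then show "(green_B g has_vector_derivative - (\<eta> x * g x)) (at x)"
    proof (rule has_vector_derivative_transform_within_open[where S = "{c n<..<s}"])
      fix y assume y: "y \<in> {c n<..<s}"
      have "integral {c n..y} (\<lambda>t. \<eta> t * g t) + integral {y..s} (\<lambda>t. \<eta> t * g t) = integral {c n..s} (\<lambda>t. \<eta> t * g t)"
        using y by (intro Henstock_Kurzweil_Integration.integral_combine eta_g_integrable_on[OF g c(1)]) auto
      then show "green_B g (c n) - integral {c n..y} (\<lambda>t. \<eta> t * g t) = green_B g y"
        by (simp add: green_B_def algebra_simps)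
    qed (use x cn in auto)
  qed
qed

lemma abs_continuous_on_C1_s:
  assumes "\<And>x. x \<in> {0<..s} \<Longrightarrow> (f has_vector_derivative f' x) (at x within {0<..s})" "continuous_on {0<..s} f'" "0 < c"
  shows "abs_continuous_on f c s"
proof (rule abs_continuous_on_C1)
  show "(f has_vector_derivative f' x) (at x within {c..s})" if "x \<in> {c..s}" for x
    using assms(1)[of x] that assms(3) by (auto intro: has_vector_derivative_within_subset[of _ _ _ "{0<..s}"])
  show "continuous_on {c..s} f'" using assms(3) by (intro continuous_on_subset[OF assms(2)]) auto
qed

text \<open>Variation of constants: in the first derivative the derivatives of the two integrals
  cancel, and in the second they leave -g because the Wronskian of u and \<open>\<eta>\<close> is
  1.\<close>

lemma green_sol_pair:
  assumes g: "g \<in> L2 s"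
  shows "sol_pair s (green g) (green' g) (\<lambda>x. of_real m0 * green g x + g x)"
proof -
  let ?G = "\<lambda>x. \<eta> x * green_A g x + u x * green_B g x"
  obtain N where N: "negligible N"
    "\<And>x. x \<in> {0<..<s} - N \<Longrightarrow> (green_A g has_vector_derivative u x * g x) (at x)"
    "\<And>x. x \<in> {0<..<s} - N \<Longrightarrow> (green_B g has_vector_derivative - (\<eta> x * g x)) (at x)"
    using green_AB_deriv[OF g] by metis
  have cV: "continuous_on {0<..s} V" using s by (intro continuous_on_subset[OF continuous_V]) auto
  have cu: "continuous_on {0<..s} (\<xi> z)" "continuous_on {0<..s} (\<xi>' z)" for z
    using s by (auto intro: continuous_on_subset[OF continuous_xi] continuous_on_subset[OF continuous_xi'])
  have AC: "abs_continuous_on \<eta> c s" "abs_continuous_on \<eta>' c s" "abs_continuous_on u c s" "abs_continuous_on u' c s" if "0 < c" for c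
  proof -
    show "abs_continuous_on \<eta> c s" by (rule abs_continuous_on_C1_s[OF eta_deriv continuous_eta(2) that])
    show "abs_continuous_on \<eta>' c s"
    proof -
      have "continuous_on {0<..s} (\<lambda>x. (of_real (V x) - of_real m0) * \<eta> x)"
        by (intro continuous_intros cV continuous_eta(1))
      from abs_continuous_on_C1_s[OF eta'_deriv this that] show ?thesis .
    qed
    show "abs_continuous_on u c s" by (rule abs_continuous_on_C1_s[OF xi_deriv_s cu(2) that])
    show "abs_continuous_on u' c s"
    proof -
      have "continuous_on {0<..s} (\<lambda>x. (of_real (V x) - of_real m0) * u x)"
        by (intro continuous_intros cV cu(1))
      from abs_continuous_on_C1_s[OF xi'_deriv_s this that] show ?thesis .
    qed
  qed
  have ACG: "abs_continuous_on ?G c s" and ACG': "abs_continuous_on (green' g) c s" if c: "0 < c" "c < s" for c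
    unfolding green'_def
    by (intro abs_continuous_on_add abs_continuous_on_mult AC green_AB_AC[OF g] c)+
  have d: "(\<eta> has_vector_derivative \<eta>' x) (at x)" "(\<eta>' has_vector_derivative (of_real (V x) - of_real m0) * \<eta> x) (at x)"
    "(u has_vector_derivative u' x) (at x)" "(u' has_vector_derivative (of_real (V x) - of_real m0) * u x) (at x)"
    if "x \<in> {0<..<s}" for x
    using eta_deriv[of x] eta'_deriv[of x] xi_deriv_s[of x] xi'_deriv_s[of x] that at_within_Ioo[of x s] by auto
  have dG: "(?G has_vector_derivative green' g x) (at x)" if x: "x \<in> {0<..<s} - N" for x
  proof -
    have x': "x \<in> {0<..<s}" using x by simp
    have "(?G has_vector_derivative (\<eta> x * (u x * g x) + \<eta>' x * green_A g x) + (u x * - (\<eta> x * g x) + u' x * green_B g x)) (at x)"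
      by (intro has_vector_derivative_add has_vector_derivative_mult d[OF x'] N x)
    then show ?thesis by (simp add: green'_def algebra_simps)
  qed
  have cont': "continuous_on {0<..s} (green' g)"
    using ACG' by (intro continuous_on_Ioc abs_continuous_on_imp_continuous_on)
  \<comment> \<open>The product rule is available only almost everywhere, but
    \<open>green' g\<close> is continuous; integrating it back gives the derivative at every point,
    one-sidedly at s.\<close>
  have deriv: "(green g has_vector_derivative green' g x) (at x within {0<..s})" if x: "x \<in> {0<..s}" for x
  proof -
    define c where "c = x / 2"
    have c: "0 < c" "c < x" "c < s" using x by (auto simp: c_def)
    have int: "(green' g has_integral ?G y - ?G c) {c..y}" if y: "y \<in> {c..s}" for y
    proof (rule abs_continuous_on_has_integral)
      show "abs_continuous_on ?G c y" using y by (intro abs_continuous_on_subset[OF ACG[OF c(1,3)]]) auto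
      show "negligible (N \<union> {s})" using N by (intro negligible_Un) auto
      show "(?G has_vector_derivative green' g t) (at t within {c..y})" if "t \<in> {c..y} - (N \<union> {s})" for t
        using dG[of t] that y c by (auto intro: has_vector_derivative_at_within)
    qed (use y in auto)
    have "((\<lambda>y. integral {c..y} (green' g)) has_vector_derivative green' g x) (at x within {c..s})"
      using x c by (intro integral_has_vector_derivative continuous_on_subset[OF cont']) auto
    then have "((\<lambda>y. ?G c + integral {c..y} (green' g)) has_vector_derivative 0 + green' g x) (at x within {c..s})"
      by (intro has_vector_derivative_add has_vector_derivative_const)
    then have "(green g has_vector_derivative 0 + green' g x) (at x within {c..s})"
      by (rule has_vector_derivative_transform[rotated 2]) (use x c integral_unique[OF int] in \<open>auto simp: green_def\<close>)
    then show ?thesis using at_within_Ioc[of c x s] c by simp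
  qed
  show ?thesis
    unfolding sol_pair_def
  proof (intro conjI ballI)
    show "green' g \<in> AC_loc s" using ACG' by (simp add: AC_loc_def)
    show "AE x in lborel. x \<in> {0<..<s} \<longrightarrow> (green' g has_vector_derivative
        of_real (V x) * green g x - (of_real m0 * green g x + g x)) (at x)"
    proof (rule negligible_AE_lborel[OF N(1)], rule impI)
      fix x assume x: "x \<notin> N" "x \<in> {0<..<s}"
      then have x': "x \<in> {0<..<s} - N" "x \<in> {0<..s}" by auto
      have w: "u' x * \<eta> x = 1 + u x * \<eta>' x" using wronskian_u_eta[OF x'(2)] by (simp add: algebra_simps)
      let ?e = "(\<eta>' x * (u x * g x) + ((of_real (V x) - of_real m0) * \<eta> x) * green_A g x)
          + (u' x * - (\<eta> x * g x) + ((of_real (V x) - of_real m0) * u x) * green_B g x)"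
      have "((\<lambda>x. \<eta>' x * green_A g x + u' x * green_B g x) has_vector_derivative ?e) (at x)"
        by (intro has_vector_derivative_add has_vector_derivative_mult d[OF x(2)] N x'(1))
      moreover have "?e = of_real (V x) * green g x - (of_real m0 * green g x + g x)"
      proof -
        have "?e = (of_real (V x) - of_real m0) * (\<eta> x * green_A g x + u x * green_B g x) - (u' x * \<eta> x) * g x + u x * \<eta>' x * g x"
          by (simp add: algebra_simps)
        also have "\<dots> = (of_real (V x) - of_real m0) * (\<eta> x * green_A g x + u x * green_B g x) - g x"
          unfolding w by (simp add: algebra_simps)
        finally show ?thesis using x'(2) by (simp add: green_def algebra_simps)
      qed
      ultimately show "(green' g has_vector_derivative of_real (V x) * green g x - (of_real m0 * green g x + g x)) (at x)"
        by (simp add: green'_def[abs_def])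
    qed
  qed (rule deriv)
qed

lemma bcs_green: "bcs (green g) (green' g) = 0"
proof -
  have "green_B g s = 0" by (simp add: green_B_def)
  moreover have "s \<in> {0<..s}" using s by simp
  ultimately have "bcs (green g) (green' g) = green_A g s * bcs \<eta> \<eta>'"
    by (simp add: bcs_def green_def green'_def algebra_simps)
  then show ?thesis by (simp add: bcs_eta)
qed

lemma bc0_green:
  assumes g: "g \<in> L2 s"
  shows "bc0 (green g) (green' g)"
proof -
  obtain C where C: "C > 0"
    "\<And>g x. g \<in> L2 s \<Longrightarrow> x \<in> {0<..s} \<Longrightarrow> cmod (green g x) \<le> C * x powr (1 / 2) * nrm2 s g"
    "\<And>g x. g \<in> L2 s \<Longrightarrow> x \<in> {0<..s} \<Longrightarrow> cmod (green' g x) \<le> C * x powr (- 1 / 2) * nrm2 s g"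
    using green_bounds by metis
  show ?thesis
  proof (rule bc0_I[OF s(1), of _ "C * nrm2 s g"])
    fix x assume "x \<in> {0<..<s}"
    then have x: "x \<in> {0<..s}" by auto
    show "cmod (green g x) \<le> C * nrm2 s g * x powr (1 / 2)" using C(2)[OF g x] by (simp only: mult_ac)
    show "cmod (green' g x) \<le> C * nrm2 s g * x powr (- 1 / 2)" using C(3)[OF g x] by (simp only: mult_ac)
  qed
qed

lemma green_uniform_bound:
  obtains C where "C > 0" "\<And>g x. g \<in> L2 s \<Longrightarrow> cmod (green g x) \<le> C * nrm2 s g"
proof -
  obtain C where C: "C > 0"
    "\<And>g x. g \<in> L2 s \<Longrightarrow> x \<in> {0<..s} \<Longrightarrow> cmod (green g x) \<le> C * x powr (1 / 2) * nrm2 s g"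
    using green_bounds by metis
  show thesis
  proof (rule that[of "C * s powr (1 / 2)"])
    show "C * s powr (1 / 2) > 0" using C(1) s by simp
    fix g x assume g: "g \<in> L2 s"
    have n: "nrm2 s g \<ge> 0" by (rule L2.nrm_nonneg[OF g])
    show "cmod (green g x) \<le> C * s powr (1 / 2) * nrm2 s g"
    proof (cases "x \<in> {0<..s}")
      case True
      have "C * x powr (1 / 2) * nrm2 s g \<le> C * s powr (1 / 2) * nrm2 s g"
        using True C(1) n by (intro mult_right_mono mult_left_mono powr_mono2) auto
      then show ?thesis using C(2)[OF g True] by linarith
    next
      case False
      then show ?thesis using C(1) n by (simp only: green_def if_False) simp
    qed
  qed
qed

lemma green_L2:
  assumes g: "g \<in> L2 s"
  shows "green g \<in> L2 s"
proof -
  obtain C where C: "C > 0" "\<And>g x. g \<in> L2 s \<Longrightarrow> cmod (green g x) \<le> C * nrm2 s g"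
    using green_uniform_bound by metis
  show ?thesis
  proof (rule L2_continuous_bounded)
    show "continuous_on {0<..<s} (green g)"
      by (rule continuous_on_subset[OF sol_pair_continuous[OF green_sol_pair[OF g]]]) auto
    show "\<And>x. x \<in> {0<..<s} \<Longrightarrow> cmod (green g x) \<le> C * nrm2 s g" by (rule C(2)[OF g])
  qed
qed

lemma green_lin:
  assumes f: "f \<in> L2 s" and g: "g \<in> L2 s"
  shows "green (\<lambda>x. a * f x + c * g x) = (\<lambda>x. a * green f x + c * green g x)"
proof
  fix x
  show "green (\<lambda>x. a * f x + c * g x) x = a * green f x + c * green g x"
  proof (cases "x \<in> {0<..s}")
    case True
    have i: "(\<lambda>t. u t * h t) integrable_on {0..x}" "(\<lambda>t. \<eta> t * h t) integrable_on {x..s}" if "h \<in> L2 s" for h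
      using True by (auto intro!: integrable_subinterval_real[OF u_g_integrable_on[OF that]] eta_g_integrable_on[OF that])
    have "green_A (\<lambda>x. a * f x + c * g x) x = integral {0..x} (\<lambda>t. a * (u t * f t) + c * (u t * g t))"
      unfolding green_A_def by (simp add: algebra_simps)
    also have "\<dots> = a * green_A f x + c * green_A g x"
      unfolding green_A_def using i(1)[OF f] i(1)[OF g]
      by (subst Henstock_Kurzweil_Integration.integral_add) (auto intro: integrable_on_mult_right)
    finally have A: "green_A (\<lambda>x. a * f x + c * g x) x = a * green_A f x + c * green_A g x" .
    have "green_B (\<lambda>x. a * f x + c * g x) x = integral {x..s} (\<lambda>t. a * (\<eta> t * f t) + c * (\<eta> t * g t))"
      unfolding green_B_def by (simp add: algebra_simps)
    also have "\<dots> = a * green_B f x + c * green_B g x"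
      unfolding green_B_def using i(2)[OF f] i(2)[OF g]
      by (subst Henstock_Kurzweil_Integration.integral_add) (auto intro: integrable_on_mult_right)
    finally have B: "green_B (\<lambda>x. a * f x + c * g x) x = a * green_B f x + c * green_B g x" .
    show ?thesis using True A B by (simp add: green_def algebra_simps)
  qed (simp only: green_def if_False, simp)
qed

text \<open>Neither endpoint contributes to Lagrange's identity between \<open>green g\<close> and
  an eigenfunction, so on coefficients Green's operator is division by l - m0.\<close>

lemma green_transform:
  assumes g: "g \<in> L2 s" and l: "l \<in> eigenvalues"
  shows "(l - of_real m0) * \<F> (green g) l = \<F> g l"
proof -
  let ?h = "\<lambda>x. of_real m0 * green g x + g x"
  have hL: "?h \<in> L2 s" by (intro L2_add L2_scale green_L2 g)
  have "wronskian (green g) (green' g) (\<xi> l) (\<xi>' l) s = 0"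
    using l by (intro bcs_wronskian bcs_green) (simp add: eigenvalues_def)
  then have "l * \<F> (green g) l = \<F> ?h l"
    using wronskian_xi_transform[OF s green_sol_pair[OF g] green_L2[OF g] hL bc0_green[OF g], of l]
    by (simp add: wronskian_def)
  also have "\<F> ?h l = (LBINT t:{0<..<s}. of_real m0 * (\<xi> l t * green g t) + \<xi> l t * g t)"
    by (simp add: transform_def algebra_simps)
  also have "\<dots> = (LBINT t:{0<..<s}. of_real m0 * (\<xi> l t * green g t)) + (LBINT t:{0<..<s}. \<xi> l t * g t)"
  proof (rule set_integral_add(2))
    show "set_integrable lborel {0<..<s} (\<lambda>t. of_real m0 * (\<xi> l t * green g t))"
      using L2_mult_integrable[OF xi_in_L2 green_L2[OF g], of l] by simp
    show "set_integrable lborel {0<..<s} (\<lambda>t. \<xi> l t * g t)" by (rule L2_mult_integrable[OF xi_in_L2 g])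
  qed
  finally show ?thesis by (simp add: transform_def left_diff_distrib)
qed

lemma eta_real:
  assumes x: "x \<in> {0<..s}"
  shows "cnj (\<eta> x) = \<eta> x"
proof -
  have ur: "cnj (u t) = u t" "cnj (u' t) = u' t" if "t \<in> {0<..s}" for t
    using xi_real[of t m0] that s by auto
  have "cnj \<alpha> = \<alpha>" using ur[of s] s by (simp add: \<alpha>_def bcs_def)
  moreover have "cnj (U x) = U x"
    unfolding U_def integral_cnj using x ur by (intro integral_cong) auto
  ultimately show ?thesis using ur[OF x] by (simp add: \<eta>_def)
qed

text \<open>The kernel is built from the real functions u and \<open>\<eta>\<close>. This lets the
  symmetry of the bilinear form pass to the inner product.\<close>

lemma green_cnj: "green (\<lambda>x. cnj (g x)) = (\<lambda>x. cnj (green g x))"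
proof
  fix x
  show "green (\<lambda>x. cnj (g x)) x = cnj (green g x)"
  proof (cases "x \<in> {0<..s}")
    case True
    have ur: "cnj (u t) = u t" if "t \<in> {0<..s}" for t using xi_real[of t m0] that s by auto
    have A: "green_A (\<lambda>x. cnj (g x)) x = cnj (green_A g x)"
      unfolding green_A_def integral_cnj
      by (rule integral_spike[of "{0}"]) (use ur True in auto)
    have B: "green_B (\<lambda>x. cnj (g x)) x = cnj (green_B g x)"
      unfolding green_B_def integral_cnj using True eta_real by (intro integral_cong) auto
    show ?thesis using True ur[OF True] eta_real[OF True] A B by (simp add: green_def)
  qed (simp only: green_def if_False, simp)
qed

text \<open>The Wronskian of \<open>green f\<close> and \<open>green g\<close> equals \<open>green_A g * green_B f - green_A f * green_B g\<close>,
  where \<open>green_A\<close> is \<open>o(x\<^sup>\<nu>)\<close> and \<open>green_B\<close> is \<open>O(x\<^bsup>-\<nu>\<^esup>)\<close> at \<open>0\<close>.\<close>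

lemma green_symmetric_bilinear:
  assumes f: "f \<in> L2 s" and g: "g \<in> L2 s"
  shows "(LBINT x:{0<..<s}. green f x * g x) = (LBINT x:{0<..<s}. f x * green g x)"
proof -
  let ?W = "wronskian (green f) (green' f) (green g) (green' g)"
  let ?h = "\<lambda>x. green f x * g x - f x * green g x"
  have fg: "set_integrable lborel {0<..<s} (\<lambda>x. green f x * g x)" and gf: "set_integrable lborel {0<..<s} (\<lambda>x. f x * green g x)"
    by (auto intro: L2_mult_integrable green_L2 f g)
  have hs: "set_integrable lborel {0<..<s} ?h" by (rule set_integral_diff(1)[OF fg gf])
  have hi: "?h integrable_on {0..s}" by (rule set_integrable_imp_integrable_on_Icc(1)[OF hs])
  have Ws: "?W s = 0" by (intro bcs_wronskian bcs_green)
  have W: "?W x = - integral {x..s} ?h" if x: "x \<in> {0<..s}" for x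
  proof -
    have "((\<lambda>t. green f t * (of_real m0 * green g t + g t) - (of_real m0 * green f t + f t) * green g t) has_integral ?W s - ?W x) {x..s}"
      using x by (intro lagrange[OF green_sol_pair[OF f] green_sol_pair[OF g]]) auto
    then have "(?h has_integral ?W s - ?W x) {x..s}"
      by (rule has_integral_eq[rotated]) (simp add: algebra_simps)
    then show ?thesis using Ws by (simp add: integral_unique)
  qed
  obtain C where C: "C > 0"
    "\<And>g x. g \<in> L2 s \<Longrightarrow> x \<in> {0<..s} \<Longrightarrow> cmod (green_A g x) \<le> C * x powr \<nu> * integral {0..x} (\<lambda>t. cmod (g t))"
    "\<And>g x. g \<in> L2 s \<Longrightarrow> x \<in> {0<..s} \<Longrightarrow> cmod (green_B g x) \<le> C * x powr - \<nu> * nrm2 s g"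
    using green_AB_bounds by metis
  have AB: "cmod (green_A k x * green_B l x) \<le> C * C * nrm2 s l * integral {0..x} (\<lambda>t. cmod (k t))"
    if k: "k \<in> L2 s" and l: "l \<in> L2 s" and x: "x \<in> {0<..s}" for k l x
  proof -
    have "cmod (green_A k x * green_B l x) \<le> (C * x powr \<nu> * integral {0..x} (\<lambda>t. cmod (k t))) * (C * x powr - \<nu> * nrm2 s l)"
      unfolding norm_mult using C(2)[OF k x] C(3)[OF l x] norm_ge_zero order_trans by (intro mult_mono) blast+
    also have "\<dots> = C * C * nrm2 s l * integral {0..x} (\<lambda>t. cmod (k t)) * (x powr \<nu> * x powr - \<nu>)"
      by (simp only: mult_ac)
    also have "x powr \<nu> * x powr - \<nu> = 1" using x by (simp flip: powr_add)
    finally show ?thesis by simp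
  qed
  have lim0: "((\<lambda>x. integral {0..x} (\<lambda>t. cmod (k t))) \<longlongrightarrow> 0) (at_right 0)" if "k \<in> L2 s" for k
    using integral_0_tendsto_0[OF integrable_on_Icc_norm_L2(1)[OF that, of 0 s]] s by simp
  have l1: "(?W \<longlongrightarrow> 0) (at_right 0)"
  proof (rule tendsto_norm_zero_cancel, rule tendsto_sandwich[OF _ _ tendsto_const])
    let ?b = "\<lambda>x. C * C * nrm2 s f * integral {0..x} (\<lambda>t. cmod (g t)) + C * C * nrm2 s g * integral {0..x} (\<lambda>t. cmod (f t))"
    have "(?b \<longlongrightarrow> C * C * nrm2 s f * 0 + C * C * nrm2 s g * 0) (at_right 0)"
      by (intro tendsto_intros lim0 f g)
    then show "(?b \<longlongrightarrow> 0) (at_right 0)" by simp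
    show "\<forall>\<^sub>F x in at_right 0. cmod (?W x) \<le> ?b x"
    proof (rule eventually_at_rightI[OF _ s(1)])
      fix x assume "x \<in> {0<..<s}"
      then have x: "x \<in> {0<..s}" by auto
      have w: "u' x * \<eta> x = 1 + u x * \<eta>' x" using wronskian_u_eta[OF x] by (simp add: algebra_simps)
      have "?W x = (u' x * \<eta> x - u x * \<eta>' x) * (green_A g x * green_B f x - green_A f x * green_B g x)"
        using x by (simp add: wronskian_def green_def green'_def algebra_simps)
      also have "\<dots> = green_A g x * green_B f x - green_A f x * green_B g x" unfolding w by simp
      finally have "cmod (?W x) \<le> cmod (green_A g x * green_B f x) + cmod (green_A f x * green_B g x)"
        by (simp add: norm_triangle_ineq4)
      then show "cmod (?W x) \<le> ?b x" using AB[OF g f x] AB[OF f g x] by linarith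
    qed
  qed simp
  have l2: "(?W \<longlongrightarrow> - integral {0..s} ?h) (at_right 0)"
  proof (rule Lim_transform_eventually)
    have "((\<lambda>x. integral {0..x} ?h - integral {0..s} ?h) \<longlongrightarrow> 0 - integral {0..s} ?h) (at_right 0)"
      by (intro tendsto_intros integral_0_tendsto_0[OF hi s(1)])
    then show "((\<lambda>x. integral {0..x} ?h - integral {0..s} ?h) \<longlongrightarrow> - integral {0..s} ?h) (at_right 0)" by simp
    show "\<forall>\<^sub>F x in at_right 0. integral {0..x} ?h - integral {0..s} ?h = ?W x"
    proof (rule eventually_at_rightI[OF _ s(1)])
      fix x assume x: "x \<in> {0<..<s}"
      then have x': "0 \<le> x" "x \<le> s" "x \<in> {0<..s}" by auto
      have a: "integral {0..s} ?h = integral {0..x} ?h + integral {x..s} ?h"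
        by (rule Henstock_Kurzweil_Integration.integral_combine[OF x'(1,2) hi, symmetric])
      show "integral {0..x} ?h - integral {0..s} ?h = ?W x"
        unfolding a W[OF x'(3)] by simp
    qed
  qed
  have "- integral {0..s} ?h = 0"
    by (rule tendsto_unique[OF trivial_limit_at_right_real l2 l1])
  then have "(LBINT x:{0<..<s}. ?h x) = 0" using set_integrable_imp_integrable_on_Icc(2)[OF hs] by simp
  then show ?thesis using set_integral_diff(2)[OF fg gf] by simp
qed

lemma green_symmetric:
  assumes f: "f \<in> L2 s" and g: "g \<in> L2 s"
  shows "ip2 s (green f) g = ip2 s f (green g)"
  using green_symmetric_bilinear[OF f L2_cnj[OF g]] by (simp add: ip2_def green_cnj)

end

lemma continuous_AE_zero:
  fixes f :: "real \<Rightarrow> complex"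
  assumes "continuous_on {0<..<s} f" "AE x in lborel. x \<in> {0<..<s} \<longrightarrow> f x = 0" "x \<in> {0<..<s}"
  shows "f x = 0"
proof (rule ccontr)
  assume "f x \<noteq> 0"
  let ?S = "{0<..<s} \<inter> f -` (- {0})"
  have "open ?S" by (rule continuous_open_preimage[OF assms(1)]) auto
  moreover have "x \<in> ?S" using assms(3) \<open>f x \<noteq> 0\<close> by simp
  ultimately have "\<not> negligible ?S" using open_not_negligible by blast
  moreover obtain N where "negligible N" "\<And>x. x \<notin> N \<Longrightarrow> x \<in> {0<..<s} \<longrightarrow> f x = 0"
    using assms(2) by (rule AE_lborel_negligibleE) blast
  then have "negligible ?S" by (rule_tac negligible_subset) auto
  ultimately show False by simp
qed

lemma nrm2_le_bound:
  assumes f: "f \<in> L2 s" and B: "\<And>x. x \<in> {0<..<s} \<Longrightarrow> cmod (f x) \<le> B" and "B \<ge> 0" "s > 0"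
  shows "nrm2 s f \<le> sqrt s * B"
proof -
  have "(nrm2 s f)\<^sup>2 = (LBINT x:{0<..<s}. (cmod (f x))\<^sup>2)" by (rule nrm2_sq[OF f])
  also have "\<dots> \<le> (LBINT x:{0<..<s}. B\<^sup>2)"
  proof (rule set_integral_mono)
    show "set_integrable lborel {0<..<s} (\<lambda>x. (cmod (f x))\<^sup>2)" using f by (simp add: L2_iffs)
    show "set_integrable lborel {0<..<s} (\<lambda>x. B\<^sup>2)" using assms(4) by (simp add: set_integrable_def)
    show "\<And>x. x \<in> {0<..<s} \<Longrightarrow> (cmod (f x))\<^sup>2 \<le> B\<^sup>2" using B by (intro power_mono) auto
  qed
  also have "\<dots> = (sqrt s * B)\<^sup>2"
    using assms(4) by (simp add: set_lebesgue_integral_def power_mult_distrib)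
  finally show ?thesis by (rule power2_le_imp_le) (use assms in auto)
qed

lemma has_vector_derivative_Ioc_unique:
  assumes "x \<in> {0<..s}" "(f has_vector_derivative d) (at x within {0<..s})"
    "(f has_vector_derivative d') (at x within {0<..s})"
  shows "d = d'"
proof -
  have "at x within {0<..s} = at x within cbox (x / 2) s"
    using assms(1) at_within_Ioc[of "x / 2" x s] by simp
  then show ?thesis
    using vector_derivative_unique_within_closed_interval[of "x / 2" s x f d d'] assms
    by (cases "x / 2 < s") auto
qed

context orthogonal_family
begin

text \<open>A dual form of Bessel's inequality that avoids representing T by a vector: test T on the
  combination with coefficients cnj (T (e j)) / nrm (e j)^2. There T takes as value the sum S in
  question, and the squared norm is S as well, so S \<le> C sqrt S.\<close>

lemma bessel_functional:
  assumes T: "\<And>x y. x \<in> V \<Longrightarrow> y \<in> V \<Longrightarrow> T (x + y) = T x + T y"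
      "\<And>c x. x \<in> V \<Longrightarrow> T (sc c x) = c * T x"
      "\<And>x. x \<in> V \<Longrightarrow> cmod (T x) \<le> C * nrm x"
    and A: "finite A" "A \<subseteq> I"
  shows "(\<Sum>j\<in>A. (cmod (T (e j)))\<^sup>2 / (nrm (e j))\<^sup>2) \<le> C\<^sup>2"
proof -
  define m where "m j = cnj (T (e j)) / of_real ((nrm (e j))\<^sup>2)" for j
  define S where "S = (\<Sum>j\<in>A. (cmod (T (e j)))\<^sup>2 / (nrm (e j))\<^sup>2)"
  have S0: "S \<ge> 0" unfolding S_def by (intro sum_nonneg) simp
  have T0: "T 0 = 0" using T(1)[OF V_zero V_zero] by simp
  have Tsum: "T (\<Sum>j\<in>B. sc (m j) (e j)) = (\<Sum>j\<in>B. m j * T (e j))" if "B \<subseteq> A" for B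
    using finite_subset[OF that A(1)] that
  proof (induction B rule: finite_induct)
    case (insert j B)
    have "sc (m j) (e j) \<in> V" "(\<Sum>j\<in>B. sc (m j) (e j)) \<in> V" "e j \<in> V"
      using insert.prems A(2) eV by (auto intro!: V_sum V_sc)
    then show ?case using insert T by simp
  qed (simp add: T0)
  have sq: "m j * T (e j) = of_real ((cmod (T (e j)))\<^sup>2 / (nrm (e j))\<^sup>2)" for j
    by (simp add: m_def of_real_cmod_sq mult.commute)
  have nS: "(nrm (\<Sum>j\<in>A. sc (m j) (e j)))\<^sup>2 = S"
  proof -
    have "(cmod (m j))\<^sup>2 * (nrm (e j))\<^sup>2 = (cmod (T (e j)))\<^sup>2 / (nrm (e j))\<^sup>2" if "j \<in> A" for j
      using e_pos[of j] that A(2)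
      by (auto simp: m_def norm_divide norm_power norm_mult power_divide field_simps power2_eq_square)
    then show ?thesis unfolding nrm_comb[OF A] S_def by (intro sum.cong refl) auto
  qed
  have GV: "(\<Sum>j\<in>A. sc (m j) (e j)) \<in> V" using A eV by (auto intro!: V_sum V_sc)
  have "T (\<Sum>j\<in>A. sc (m j) (e j)) = of_real S"
    unfolding Tsum[OF order_refl] sq S_def by simp
  then have "S \<le> C * nrm (\<Sum>j\<in>A. sc (m j) (e j))" using T(3)[OF GV] S0 by simp
  then have "S\<^sup>2 \<le> (C * nrm (\<Sum>j\<in>A. sc (m j) (e j)))\<^sup>2" using S0 by (intro power_mono) auto
  then have "S\<^sup>2 \<le> C\<^sup>2 * S" by (simp only: power_mult_distrib nS)
  then have "S * S \<le> C\<^sup>2 * S" by (simp only: power2_eq_square)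
  then show ?thesis
    using S0 mult_le_cancel_right[of S S "C\<^sup>2"] unfolding S_def[symmetric] by (cases "S = 0") simp_all
qed

end

context endpoint
begin

section \<open>Compactness and completeness of the eigenfunctions\<close>

text \<open>The bound on the derivative blows up like x^(-1/2) at 0, so the Lipschitz constant is
  uniform only on [c,s].\<close>

lemma green_equicontinuous:
  obtains D where "D > 0" "\<And>g c x y. \<lbrakk>g \<in> L2 s; nrm2 s g \<le> 1; 0 < c; x \<in> {c..s}; y \<in> {c..s}\<rbrakk> \<Longrightarrow>
    cmod (green g x - green g y) \<le> D * c powr (- 1 / 2) * \<bar>x - y\<bar>"
proof -
  obtain C where C: "C > 0"
    "\<And>g x. g \<in> L2 s \<Longrightarrow> x \<in> {0<..s} \<Longrightarrow> cmod (green' g x) \<le> C * x powr (- 1 / 2) * nrm2 s g"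
    using green_bounds by metis
  show thesis
  proof (rule that[OF C(1)])
    fix g c x y assume g: "g \<in> L2 s" "nrm2 s g \<le> 1" and c: "0 < c" and xy: "x \<in> {c..s}" "y \<in> {c..s}"
    have "norm (green g x - green g y) \<le> C * c powr (- 1 / 2) * norm (x - y)"
    proof (rule differentiable_bound[of "{c..s}" _ "\<lambda>x h. h *\<^sub>R green' g x"])
      fix t assume t: "t \<in> {c..s}"
      then have t': "t \<in> {0<..s}" using c by auto
      have "(green g has_vector_derivative green' g t) (at t within {c..s})"
        using sol_pair_deriv[OF green_sol_pair[OF g(1)] t'] c
        by (auto intro: has_vector_derivative_within_subset[of _ _ _ "{0<..s}"])
      then show "(green g has_derivative (\<lambda>h. h *\<^sub>R green' g t)) (at t within {c..s})"
        by (simp add: has_vector_derivative_def)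
      have "onorm (\<lambda>h::real. h *\<^sub>R green' g t) \<le> cmod (green' g t)"
        by (rule onorm_le) (simp add: mult.commute)
      also have "\<dots> \<le> C * t powr (- 1 / 2) * nrm2 s g" by (rule C(2)[OF g(1) t'])
      also have "\<dots> \<le> C * c powr (- 1 / 2) * 1"
        using C(1) t c g L2.nrm_nonneg[OF g(1)] by (intro mult_mono powr_mono2') auto
      finally show "onorm (\<lambda>h. h *\<^sub>R green' g t) \<le> C * c powr (- 1 / 2)" by simp
    qed (use xy in auto)
    then show "cmod (green g x - green g y) \<le> C * c powr (- 1 / 2) * \<bar>x - y\<bar>" by simp
  qed
qed

text \<open>A diagonal sequence converges at the rationals, equicontinuity away from 0 extends this
  to each point of (0,s), and dominated convergence turns it into L2 convergence. No uniformity at 0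
  is involved.\<close>

lemma green_compact:
  assumes f: "\<And>n :: nat. f n \<in> L2 s" "\<And>n. nrm2 s (f n) \<le> 1"
  shows "\<exists>k h. strict_mono (k :: nat \<Rightarrow> nat) \<and> h \<in> L2 s \<and> (\<lambda>n. nrm2 s (green (f (k n)) - h)) \<longlonglongrightarrow> 0"
proof -
  obtain C where C: "C > 0" "\<And>g x. g \<in> L2 s \<Longrightarrow> cmod (green g x) \<le> C * nrm2 s g"
    using green_uniform_bound by metis
  have bd: "cmod (green (f n) x) \<le> C" for n x
  proof -
    have "cmod (green (f n) x) \<le> C * nrm2 s (f n)" by (rule C(2)[OF f(1)])
    also have "\<dots> \<le> C * 1" using C(1) f(2) by (intro mult_left_mono) auto
    finally show ?thesis by simp
  qed
  obtain D where D: "D > 0" "\<And>g c x y. \<lbrakk>g \<in> L2 s; nrm2 s g \<le> 1; 0 < c; x \<in> {c..s}; y \<in> {c..s}\<rbrakk> \<Longrightarrow>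
    cmod (green g x - green g y) \<le> D * c powr (- 1 / 2) * \<bar>x - y\<bar>"
    using green_equicontinuous by metis
  have "countable (\<rat> \<inter> {0<..<s} :: real set)" by (intro countable_Int1 countable_rat)
  then obtain k where k: "strict_mono (k :: nat \<Rightarrow> nat)"
    and conv: "\<And>x. x \<in> \<rat> \<inter> {0<..<s} \<Longrightarrow> \<exists>l. (\<lambda>n. green (f (k n)) x) \<longlonglongrightarrow> l"
    using function_convergent_subsequence[of "\<rat> \<inter> {0<..<s}" "\<lambda>n x. green (f n) x" C] bd by blast
  define G where "G n x = green (f (k n)) x" for n x
  have Gconv: "convergent (\<lambda>n. G n x)" if x: "x \<in> {0<..<s}" for x
  proof (rule Cauchy_convergent, rule metric_CauchyI)
    fix \<epsilon> :: real assume \<epsilon>: "\<epsilon> > 0"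
    define c where "c = x / 2"
    have c: "0 < c" "c < x" using x by (auto simp: c_def)
    define K where "K = D * c powr (- 1 / 2)"
    have K: "K > 0" using D(1) c by (simp add: K_def)
    obtain y where y: "y \<in> \<rat>" "x - min (x - c) (\<epsilon> / (3 * K)) < y" "y < x"
      using Rats_dense_in_real[of "x - min (x - c) (\<epsilon> / (3 * K))" x] K \<epsilon> c by auto
    then have y': "y \<in> {c..s}" "y \<in> \<rat> \<inter> {0<..<s}" and xy: "\<bar>x - y\<bar> < \<epsilon> / (3 * K)" using c x by auto
    have close: "cmod (G n x - G n y) < \<epsilon> / 3" for n
    proof -
      have "cmod (G n x - G n y) \<le> K * \<bar>x - y\<bar>"
        unfolding G_def K_def using x c by (intro D(2) f y'(1)) auto
      also have "\<dots> < K * (\<epsilon> / (3 * K))" using xy K by (rule mult_strict_left_mono)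
      finally show ?thesis using K by simp
    qed
    obtain l where "(\<lambda>n. G n y) \<longlonglongrightarrow> l" using conv[OF y'(2)] by (auto simp: G_def)
    then have "Cauchy (\<lambda>n. G n y)" by (rule LIMSEQ_imp_Cauchy)
    then obtain N where N: "\<And>m n. m \<ge> N \<Longrightarrow> n \<ge> N \<Longrightarrow> dist (G m y) (G n y) < \<epsilon> / 3"
      using \<epsilon> unfolding Cauchy_def by (meson divide_pos_pos zero_less_numeral)
    show "\<exists>N. \<forall>m\<ge>N. \<forall>n\<ge>N. dist (G m x) (G n x) < \<epsilon>"
    proof (intro exI[of _ N] allI impI)
      fix m n assume mn: "N \<le> m" "N \<le> n"
      have "dist (G m x) (G n x) \<le> dist (G m x) (G m y) + dist (G m y) (G n y) + dist (G n y) (G n x)"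
        by (metis add.commute add_left_mono dist_triangle dist_triangle_le order_trans)
      also have "\<dots> < \<epsilon> / 3 + \<epsilon> / 3 + \<epsilon> / 3"
        using close[of m] close[of n] N[OF mn] by (simp add: dist_norm norm_minus_commute)
      finally show "dist (G m x) (G n x) < \<epsilon>" by simp
    qed
  qed
  \<comment> \<open>The indicator makes the limit a measurable function on the whole line that
    vanishes outside (0,s).\<close>
  define h where "h x = lim (\<lambda>n. indicator {0<..<s} x *\<^sub>R G n x)" for x
  have hx: "(\<lambda>n. G n x) \<longlonglongrightarrow> h x" if "x \<in> {0<..<s}" for x
    using Gconv[OF that] that by (simp add: h_def convergent_LIMSEQ_iff)
  have h0: "h x = 0" if "x \<notin> {0<..<s}" for x
    using that by (simp add: h_def)
  have GL: "G n \<in> L2 s" for n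
    unfolding G_def[abs_def] by (rule green_L2[OF f(1)])
  have Gm: "(\<lambda>x. indicator {0<..<s} x *\<^sub>R G n x) \<in> borel_measurable lborel" for n
    using GL[of n] by (simp add: L2_iffs set_borel_measurable_def)
  have hm: "h \<in> borel_measurable lborel"
    unfolding h_def[abs_def] by (rule borel_measurable_lim_metric) (rule Gm)
  have hb: "cmod (h x) \<le> C" if "x \<in> {0<..<s}" for x
    using tendsto_norm[OF hx[OF that]] bd by (intro LIMSEQ_le_const2[of "\<lambda>n. cmod (G n x)"]) (auto simp: G_def)
  have hL: "h \<in> L2 s"
  proof (rule L2_bounded[OF _ hb])
    have "(\<lambda>x. indicator {0<..<s} x *\<^sub>R h x) = h" using h0 by (auto simp: fun_eq_iff indicator_def)
    then show "set_borel_measurable lborel {0<..<s} h" using hm by (simp add: set_borel_measurable_def)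
  qed
  have "(\<lambda>n. LINT x|lborel. indicator {0<..<s} x *\<^sub>R (cmod ((G n - h) x))\<^sup>2) \<longlonglongrightarrow> (LINT x::real|lborel. (0::real))"
  proof (rule integral_dominated_convergence[where w = "\<lambda>x. indicator {0<..<s} x *\<^sub>R (2 * C)\<^sup>2"])
    show "(\<lambda>x. indicator {0<..<s} x *\<^sub>R (cmod ((G n - h) x))\<^sup>2) \<in> borel_measurable lborel" for n
      by (rule borel_measurable_integrable)
        (rule conjunct2[OF L2.V_diff[OF GL[of n] hL, unfolded L2_iff set_integrable_def]])
    show "integrable lborel (\<lambda>x. indicator {0<..<s} x *\<^sub>R (2 * C)\<^sup>2)" using s by simp
    show "AE x in lborel. (\<lambda>n. indicator {0<..<s} x *\<^sub>R (cmod ((G n - h) x))\<^sup>2) \<longlonglongrightarrow> 0"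
    proof (rule AE_I2)
      fix x
      show "(\<lambda>n. indicator {0<..<s} x *\<^sub>R (cmod ((G n - h) x))\<^sup>2) \<longlonglongrightarrow> 0"
      proof (cases "x \<in> {0<..<s}")
        case True
        have "(\<lambda>n. (cmod (G n x - h x))\<^sup>2) \<longlonglongrightarrow> (cmod (h x - h x))\<^sup>2" by (intro tendsto_intros hx[OF True])
        then show ?thesis using True by simp
      qed simp
    qed
    show "AE x in lborel. norm (indicator {0<..<s} x *\<^sub>R (cmod ((G n - h) x))\<^sup>2) \<le> indicator {0<..<s} x *\<^sub>R (2 * C)\<^sup>2" for n
    proof (rule AE_I2)
      fix x
      show "norm (indicator {0<..<s} x *\<^sub>R (cmod ((G n - h) x))\<^sup>2) \<le> indicator {0<..<s} x *\<^sub>R (2 * C)\<^sup>2"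
      proof (cases "x \<in> {0<..<s}")
        case True
        have "cmod (G n x - h x) \<le> 2 * C"
          using norm_triangle_ineq4[of "G n x" "h x"] bd[of "k n" x] hb[OF True] by (simp add: G_def)
        then have "(cmod (G n x - h x))\<^sup>2 \<le> (2 * C)\<^sup>2" by (intro power_mono) auto
        then show ?thesis using True by simp
      qed simp
    qed
  qed simp
  then have "(\<lambda>n. (nrm2 s (G n - h))\<^sup>2) \<longlonglongrightarrow> 0"
    by (simp add: nrm2_sq[OF L2.V_diff[OF GL hL]] set_lebesgue_integral_def)
  then have "(\<lambda>n. sqrt ((nrm2 s (G n - h))\<^sup>2)) \<longlonglongrightarrow> sqrt 0" by (rule tendsto_real_sqrt)
  then have "(\<lambda>n. nrm2 s (G n - h)) \<longlonglongrightarrow> 0"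
    using L2.nrm_nonneg[OF L2.V_diff[OF GL hL]] by simp
  then show ?thesis
    using k hL unfolding G_def[abs_def] by blast
qed

lemma green_cong_AE:
  assumes f: "f \<in> L2 s" and g: "g \<in> L2 s" and 0: "nrm2 s (f - g) = 0"
  shows "green f = green g"
proof
  fix x
  obtain C where C: "C > 0" "\<And>g x. g \<in> L2 s \<Longrightarrow> cmod (green g x) \<le> C * nrm2 s g"
    using green_uniform_bound by metis
  have d: "f - g = (\<lambda>x. 1 * f x + (- 1) * g x)" by (simp add: fun_eq_iff)
  have "cmod (green (f - g) x) \<le> C * nrm2 s (f - g)" by (rule C(2)[OF L2.V_diff[OF f g]])
  then have "green (f - g) x = 0" using 0 by simp
  moreover have "green (f - g) x = green f x - green g x"
    unfolding d green_lin[OF f g] by simp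
  ultimately show "green f x = green g x" by simp
qed

text \<open>If \<open>green f\<close> vanishes almost everywhere on (0,s), it vanishes there by
  continuity, hence so do its derivatives, and the equation leaves f = 0 almost everywhere.\<close>

lemma green_nonzero:
  assumes f: "f \<in> L2 s" "nrm2 s f > 0"
  shows "nrm2 s (green f) > 0"
proof (rule ccontr)
  assume "\<not> nrm2 s (green f) > 0"
  then have "nrm2 s (green f) = 0" using L2.nrm_nonneg[OF green_L2[OF f(1)]] by simp
  then have AE0: "AE x in lborel. x \<in> {0<..<s} \<longrightarrow> green f x = 0"
    using nrm2_eq_0_iff[OF green_L2[OF f(1)]] by simp
  note P = green_sol_pair[OF f(1)]
  have z: "green f x = 0" if "x \<in> {0<..<s}" for x
    using that by (intro continuous_AE_zero[OF _ AE0] continuous_on_subset[OF sol_pair_continuous[OF P]]) auto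
  have z': "green' f x = 0" if x: "x \<in> {0<..<s}" for x
  proof -
    have "(green f has_vector_derivative green' f x) (at x)"
      using sol_pair_deriv[OF P, of x] at_within_Ioo[of x s] x by auto
    moreover have "(green f has_vector_derivative 0) (at x)"
      by (rule has_vector_derivative_transform_within_open[of "\<lambda>_. 0" _ _ "{0<..<s}"]) (use z x in auto)
    ultimately show ?thesis by (rule vector_derivative_unique_at)
  qed
  have "AE x in lborel. x \<in> {0<..<s} \<longrightarrow> (green' f has_vector_derivative of_real (V x) * green f x - (of_real m0 * green f x + f x)) (at x)"
    using P by (simp add: sol_pair_def)
  then have "AE x in lborel. x \<in> {0<..<s} \<longrightarrow> f x = 0"
  proof eventually_elim
    case (elim x)
    show ?case
    proof
      assume x: "x \<in> {0<..<s}"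
      then have "(green' f has_vector_derivative - f x) (at x)" using elim z[OF x] by simp
      moreover have "(green' f has_vector_derivative 0) (at x)"
        by (rule has_vector_derivative_transform_within_open[of "\<lambda>_. 0" _ _ "{0<..<s}"]) (use z' x in auto)
      ultimately have "- f x = 0" by (rule vector_derivative_unique_at)
      then show "f x = 0" by simp
    qed
  qed
  then show False using nrm2_eq_0_iff[OF f(1)] f(2) by simp
qed

lemma xi_s_nonzero:
  assumes "l \<in> eigenvalues"
  shows "\<xi> l s \<noteq> 0"
proof
  assume 0: "\<xi> l s = 0"
  then have d0: "\<xi>' l s = 0" using assms sin_gamma by (simp add: eigenvalues_def bcs_def)
  have "\<xi> l x = 0" if "x \<in> {0<..s}" for x
    using ode_unique[of s s "\<xi> l" "\<xi>' l" l x] s 0 d0 that xi_deriv_s xi'_deriv_s by auto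
  then have "AE x in lborel. x \<in> {0<..<s} \<longrightarrow> \<xi> l x = 0" by auto
  then show False using nrm2_eq_0_iff[OF xi_in_L2, of l] nrm_xi_pos[of l] by simp
qed

lemma eigenvalue_neq_m0: "l \<in> eigenvalues \<Longrightarrow> l \<noteq> of_real m0"
  using bcs_u by (auto simp: eigenvalues_def)

text \<open>The Wronskian of e and \<open>\<xi> l\<close> vanishes at s, and the boundary condition
  turns this into e(s) times the boundary form of \<open>\<xi> l\<close> being 0. In either case a
  solution with zero data at s arises, so uniqueness is invoked at the regular endpoint and not at
  0.\<close>

lemma eigenfunction_multiple:
  assumes e: "sol_pair s e e' (\<lambda>x. l * e x)" and eL: "e \<in> L2 s" and bc: "bc0 e e'" "bcs e e' = 0"
  shows "(\<forall>x\<in>{0<..s}. e x = 0) \<or> l \<in> eigenvalues \<and> (\<exists>c. \<forall>x\<in>{0<..s}. e x = c * \<xi> l x)"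
proof -
  have sg: "complex_of_real (sin \<gamma>) \<noteq> 0" using sin_gamma by simp
  have sI: "s \<in> {0<..s}" using s by simp
  have zero: "\<forall>x\<in>{0<..s}. f x = 0" if f: "sol_pair s f f' (\<lambda>x. l * f x)" and f0: "f s = 0" and fb: "bcs f f' = 0" for f f'
  proof
    fix x assume x: "x \<in> {0<..s}"
    have f'0: "f' s = 0" using fb f0 sg by (simp add: bcs_def)
    have d: "(f' has_vector_derivative (of_real (V t) - l) * f t) (at t within {0<..s})" if "t \<in> {0<..s}" for t
      using sol_pair_C2[OF f _ s(2) that] sol_pair_continuous[OF f]
      by (simp add: left_diff_distrib continuous_on_mult_left)
    show "f x = 0"
      using ode_unique[OF s(2) sI sol_pair_deriv[OF f] d f0 f'0 x] by simp
  qed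
  have "\<F> (\<lambda>x. l * e x) l = l * \<F> e l"
    by (simp add: transform_def mult.left_commute)
  then have W: "e' s * \<xi> l s - e s * \<xi>' l s = 0"
    using wronskian_xi_transform[OF s e eL L2_scale[OF eL] bc(1), of l] by simp
  have e's: "e' s * of_real (sin \<gamma>) = - (e s * of_real (cos \<gamma>))"
    using bc(2) by (simp add: bcs_def add_eq_0_iff)
  have "0 = of_real (sin \<gamma>) * (e' s * \<xi> l s - e s * \<xi>' l s)" using W by simp
  also have "\<dots> = (e' s * of_real (sin \<gamma>)) * \<xi> l s - e s * \<xi>' l s * of_real (sin \<gamma>)"
    by (simp add: algebra_simps)
  also have "\<dots> = - (e s * bcs (\<xi> l) (\<xi>' l))" unfolding e's by (simp add: bcs_def algebra_simps)
  finally consider "e s = 0" | "l \<in> eigenvalues" by (auto simp: eigenvalues_def)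
  then show ?thesis
  proof cases
    case 1
    then show ?thesis using zero[OF e _ bc(2)] by simp
  next
    case 2
    define c where "c = e s / \<xi> l s"
    have P: "sol_pair s (\<lambda>x. 1 * e x + (- c) * \<xi> l x) (\<lambda>x. 1 * e' x + (- c) * \<xi>' l x)
        (\<lambda>x. l * (1 * e x + (- c) * \<xi> l x))"
      using sol_pair_lin[OF e sol_pair_xi[OF s, of l], of 1 "- c"] by (simp add: algebra_simps)
    have "\<forall>x\<in>{0<..s}. 1 * e x + (- c) * \<xi> l x = 0"
    proof (rule zero[OF P])
      show "1 * e s + (- c) * \<xi> l s = 0" using xi_s_nonzero[OF 2] by (simp add: c_def)
      have "bcs (\<xi> l) (\<xi>' l) = 0" using 2 by (simp add: eigenvalues_def)
      then have "bcs e e' + (- c) * bcs (\<xi> l) (\<xi>' l) = 0" using bc(2) by simp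
      then show "bcs (\<lambda>x. 1 * e x + (- c) * \<xi> l x) (\<lambda>x. 1 * e' x + (- c) * \<xi>' l x) = 0"
        by (simp add: bcs_def algebra_simps)
    qed
    then show ?thesis using 2 by auto
  qed
qed

text \<open>Green's operator leaves the orthogonal complement of the eigenfunctions invariant; an eigenvector
  of its restriction would be an eigenfunction orthogonal to itself.\<close>

theorem eigenfunctions_total:
  assumes f: "f \<in> L2 s" and orth: "\<And>l. l \<in> eigenvalues \<Longrightarrow> ip2 s f (\<xi> l) = 0"
  shows "nrm2 s f = 0"
proof (rule ccontr)
  assume "nrm2 s f \<noteq> 0"
  then have fpos: "nrm2 s f > 0" using L2.nrm_nonneg[OF f] by simp
  \<comment> \<open>The spectral argument runs inside \<open>M\<close>: it is invariant under
    \<open>green\<close>, and limits of images stay in it, as \<open>gcpt\<close> checks.\<close>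
  define M where "M = {f \<in> L2 s. \<forall>l\<in>eigenvalues. ip2 s f (\<xi> l) = 0}"
  have inL: "g \<in> L2 s" if "g \<in> M" for g using that unfolding M_def by blast
  have Mo: "ip2 s g (\<xi> l) = 0" if "g \<in> M" "l \<in> eigenvalues" for g l using that unfolding M_def by blast
  have MI: "g \<in> M" if "g \<in> L2 s" "\<And>l. l \<in> eigenvalues \<Longrightarrow> ip2 s g (\<xi> l) = 0" for g
    using that unfolding M_def by blast
  interpret M: semi_inner M "\<lambda>c f x. c * f x" "ip2 s"
  proof
    show "0 \<in> M" by (intro MI L2.V_zero L2.ip_zero_left xi_in_L2)
    show "x + y \<in> M" if "x \<in> M" "y \<in> M" for x y
    proof (rule MI)
      show "x + y \<in> L2 s" using that by (intro L2.V_add inL)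
      show "ip2 s (x + y) (\<xi> l) = 0" if "l \<in> eigenvalues" for l
        using L2.ip_add[OF inL[OF \<open>x \<in> M\<close>] inL[OF \<open>y \<in> M\<close>] xi_in_L2] Mo[OF \<open>x \<in> M\<close> that] Mo[OF \<open>y \<in> M\<close> that] by simp
    qed
    show "(\<lambda>t. c * x t) \<in> M" if "x \<in> M" for x c
    proof (rule MI)
      show "(\<lambda>t. c * x t) \<in> L2 s" using that by (intro L2_scale inL)
      show "ip2 s (\<lambda>t. c * x t) (\<xi> l) = 0" if "l \<in> eigenvalues" for l
        using L2.ip_sc[OF inL[OF \<open>x \<in> M\<close>] xi_in_L2] Mo[OF \<open>x \<in> M\<close> that] by simp
    qed
    show "(\<lambda>t. - 1 * x t) = - x" for x :: "real \<Rightarrow> complex" by (simp add: fun_eq_iff)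
  qed (blast intro: L2.ip_add L2.ip_sc L2.ip_cnj L2.ip_nonneg inL)+
  obtain C where C: "C > 0" "\<And>g x. g \<in> L2 s \<Longrightarrow> cmod (green g x) \<le> C * nrm2 s g"
    using green_uniform_bound by metis
  have fM: "f \<in> M" using f orth by (rule MI)
  have gM: "green g \<in> M" if g: "g \<in> M" for g
  proof (rule MI[OF green_L2[OF inL[OF g]]])
    fix l assume l: "l \<in> eigenvalues"
    have "(l - of_real m0) * \<F> (green g) l = 0"
      using green_transform[OF inL[OF g] l] Mo[OF g l] ip2_eigenvalue[OF l] by simp
    then show "ip2 s (green g) (\<xi> l) = 0"
      using eigenvalue_neq_m0[OF l] ip2_eigenvalue[OF l] by simp
  qed
  have lin1: "green (x + y) = green x + green y" if "x \<in> M" "y \<in> M" for x y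
    using green_lin[OF inL[OF that(1)] inL[OF that(2)], of 1 1] by (simp add: plus_fun_def)
  have lin2: "green (\<lambda>t. c * x t) = (\<lambda>t. c * green x t)" if "x \<in> M" for x c
    using green_lin[OF inL[OF that] inL[OF that], of c 0] by simp
  have gbd: "nrm2 s (green x) \<le> (sqrt s * C) * nrm2 s x" if "x \<in> M" for x
    using nrm2_le_bound[OF green_L2[OF inL[OF that]] C(2)[OF inL[OF that]]] C(1) L2.nrm_nonneg[OF inL[OF that]] s
    by (simp add: mult.assoc)
  have gcpt: "\<exists>k h. strict_mono (k :: nat \<Rightarrow> nat) \<and> h \<in> M \<and> (\<lambda>n. nrm2 s (green (F (k n)) - h)) \<longlonglongrightarrow> 0"
    if F: "\<And>n. F n \<in> M \<and> nrm2 s (F n) \<le> 1" for F :: "nat \<Rightarrow> real \<Rightarrow> complex"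
  proof -
    obtain k h where kh: "strict_mono (k :: nat \<Rightarrow> nat)" "h \<in> L2 s" "(\<lambda>n. nrm2 s (green (F (k n)) - h)) \<longlonglongrightarrow> 0"
      using green_compact[of F] F inL by blast
    have "h \<in> M"
    proof (rule MI[OF kh(2)])
      fix l assume l: "l \<in> eigenvalues"
      have "cmod (ip2 s h (\<xi> l)) \<le> nrm2 s (green (F (k n)) - h) * nrm2 s (\<xi> l)" for n
      proof -
        have gF: "green (F (k n)) \<in> M" using F by (intro gM) blast
        have "ip2 s (green (F (k n)) - h) (\<xi> l) = - ip2 s h (\<xi> l)"
          using L2.ip_diff[OF inL[OF gF] kh(2) xi_in_L2] Mo[OF gF l] by simp
        then show ?thesis
          using L2.cauchy_schwarz[OF L2.V_diff[OF inL[OF gF] kh(2)] xi_in_L2, of l] by (metis norm_minus_cancel)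
      qed
      moreover have "(\<lambda>n. nrm2 s (green (F (k n)) - h) * nrm2 s (\<xi> l)) \<longlonglongrightarrow> 0"
        using tendsto_mult_left_zero[OF kh(3)] by simp
      ultimately have "cmod (ip2 s h (\<xi> l)) \<le> 0" by (intro LIMSEQ_le_const) auto
      then show "ip2 s h (\<xi> l) = 0" by simp
    qed
    with kh show ?thesis by blast
  qed
  obtain \<tau> v where \<tau>: "\<tau> \<noteq> 0" and v: "v \<in> M" "nrm2 s v > 0"
    and eig: "nrm2 s (green v - (\<lambda>x. complex_of_real \<tau> * v x)) = 0"
    by (rule M.spectral[of green "sqrt s * C" f, OF gM lin1 lin2 green_symmetric[OF inL inL] gbd gcpt fM green_nonzero[OF f fpos]])
  \<comment> \<open>\<open>green v\<close> equals \<tau> v only up to a null set; e is the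
    representative of v for which the relation holds everywhere.\<close>
  define e where "e x = (1 / of_real \<tau>) * green v x" for x
  have vL: "v \<in> L2 s" by (rule inL[OF v(1)])
  have eM: "e \<in> M"
    using M.V_sc[OF gM[OF v(1)], of "1 / of_real \<tau>"] by (simp add: e_def[abs_def])
  have eL: "e \<in> L2 s" by (rule inL[OF eM])
  have ev: "nrm2 s (v - e) = 0"
  proof -
    have "v - e = (\<lambda>x. (- 1 / of_real \<tau>) * (green v - (\<lambda>x. complex_of_real \<tau> * v x)) x)"
      using \<tau> by (simp add: fun_eq_iff e_def field_simps)
    then show ?thesis
      using L2.nrm_sc[OF L2.V_diff[OF green_L2[OF vL] L2_scale[OF vL]], of "- 1 / of_real \<tau>" "of_real \<tau>"] eig by simp
  qed
  have ge: "green v = green e" by (rule green_cong_AE[OF vL eL ev])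
  \<comment> \<open>Applied to \<open>green e\<close>, the differential expression returns m0 times
    \<open>green e\<close> plus e, and e is \<open>green e\<close> divided by \<tau>.\<close>
  define l where "l = complex_of_real (m0 + 1 / \<tau>)"
  have pair: "sol_pair s (green e) (green' e) (\<lambda>x. l * green e x)"
  proof -
    have "of_real m0 * green e x + e x = l * green e x" for x
    proof -
      have "e x = (1 / of_real \<tau>) * green e x" unfolding ge[symmetric] by (rule e_def)
      then have "of_real m0 * green e x + e x = of_real m0 * green e x + (1 / of_real \<tau>) * green e x" by (rule arg_cong)
      then show ?thesis by (simp add: l_def distrib_right)
    qed
    then show ?thesis using green_sol_pair[OF eL] by simp
  qed
  have geL: "green e \<in> L2 s" by (rule green_L2[OF eL])
  have epos: "nrm2 s e > 0"
    using L2.nrm_diff_ge[OF vL eL] ev v(2) by simp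
  have "\<forall>x\<in>{0<..s}. green e x = 0"
    using eigenfunction_multiple[OF pair geL bc0_green[OF eL] bcs_green]
  proof
    assume "l \<in> eigenvalues \<and> (\<exists>c. \<forall>x\<in>{0<..s}. green e x = c * \<xi> l x)"
    then obtain c where l: "l \<in> eigenvalues" and c: "\<And>x. x \<in> {0<..s} \<Longrightarrow> green e x = c * \<xi> l x" by blast
    have "ip2 s (green e) (\<xi> l) = ip2 s (\<lambda>x. c * \<xi> l x) (\<xi> l)"
      unfolding ip2_def by (intro set_lebesgue_integral_cong) (auto simp: c)
    also have "\<dots> = c * of_real ((nrm2 s (\<xi> l))\<^sup>2)"
      using L2.ip_sc[OF xi_in_L2 xi_in_L2] L2.ip_self[OF xi_in_L2] by simp
    finally have "c = 0" using Mo[OF gM[OF eM] l] nrm_xi_pos[of l] by simp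
    then show ?thesis using c by simp
  qed
  then have "nrm2 s (green e) = 0" using nrm2_eq_0_iff[OF geL] by auto
  then show False using green_nonzero[OF eL epos] by simp
qed

text \<open>The difference solves the equation for m0 and meets both boundary conditions, hence is 0
  because m0 is not an eigenvalue. The derivative is included so that bounds on evaluations of
  \<open>green'\<close> become bounds on \<open>\<xi>'\<close>.\<close>

lemma green_eigenfunction:
  assumes l: "l \<in> eigenvalues" and x: "x \<in> {0<..s}"
  shows "(l - of_real m0) * green (\<xi> l) x = \<xi> l x" "(l - of_real m0) * green' (\<xi> l) x = \<xi>' l x"
proof -
  let ?k = "l - of_real m0"
  define w where "w x = ?k * green (\<xi> l) x + (- 1) * \<xi> l x" for x
  define w' where "w' x = ?k * green' (\<xi> l) x + (- 1) * \<xi>' l x" for x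
  have wL: "w \<in> L2 s"
    using L2_diff[OF L2_scale[OF green_L2[OF xi_in_L2]] xi_in_L2, of ?k l l] by (simp add: w_def[abs_def])
  have P: "sol_pair s w w' (\<lambda>x. of_real m0 * w x)"
    using sol_pair_lin[OF green_sol_pair[OF xi_in_L2[of l]] sol_pair_xi[OF s, of l], of ?k "- 1"]
    by (simp add: w_def[abs_def] w'_def[abs_def] algebra_simps)
  have bc: "bc0 w w'"
    unfolding bc0_def
  proof
    assume n: "\<nu> \<in> {0<..<1}"
    let ?b = "\<lambda>f f' x. of_real (x powr (\<nu> - 1 / 2)) * (of_real p * f x - of_real x * f' x) :: complex"
    have "((\<lambda>x. ?k * ?b (green (\<xi> l)) (green' (\<xi> l)) x - ?b (\<xi> l) (\<xi>' l) x) \<longlongrightarrow> ?k * 0 - 0) (at_right 0)"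
      using bc0_green[OF xi_in_L2, of l] bc0_xi[of l] n unfolding bc0_def by (intro tendsto_intros) auto
    moreover have "?k * ?b (green (\<xi> l)) (green' (\<xi> l)) x - ?b (\<xi> l) (\<xi>' l) x = ?b w w' x" for x
      by (simp add: w_def w'_def ring_distribs mult.left_commute)
    ultimately show "(?b w w' \<longlongrightarrow> 0) (at_right 0)" by simp
  qed
  have "bcs w w' = ?k * bcs (green (\<xi> l)) (green' (\<xi> l)) - bcs (\<xi> l) (\<xi>' l)"
    by (simp add: bcs_def w_def w'_def algebra_simps)
  then have "bcs w w' = 0" using l by (simp add: bcs_green eigenvalues_def)
  then have w0: "w x = 0" if "x \<in> {0<..s}" for x
    using eigenfunction_multiple[OF P wL bc] that eigenvalue_neq_m0 by blast
  then show "?k * green (\<xi> l) x = \<xi> l x" using x by (simp add: w_def)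
  have "(w has_vector_derivative w' x) (at x within {0<..s})" by (rule sol_pair_deriv[OF P x])
  moreover have "(w has_vector_derivative 0) (at x within {0<..s})"
    by (rule has_vector_derivative_transform[of x _ _ "\<lambda>_. 0"]) (use w0 x in auto)
  ultimately have "w' x = 0" by (rule has_vector_derivative_Ioc_unique[OF x])
  then show "?k * green' (\<xi> l) x = \<xi>' l x" by (simp add: w'_def)
qed

section \<open>Bessel bounds for eigenfunctions and eigenvalues\<close>

sublocale orthogonal_family "L2 s" "\<lambda>c f x. c * f x" "ip2 s" \<xi> eigenvalues
proof
  show "\<xi> l \<in> L2 s" "nrm2 s (\<xi> l) > 0" for l by (rule xi_in_L2, rule nrm_xi_pos)
qed (rule eigenfunction_orthogonal)

lemma green'_lin:
  assumes f: "f \<in> L2 s" and g: "g \<in> L2 s" and x: "x \<in> {0<..s}"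
  shows "green' (\<lambda>x. a * f x + c * g x) x = a * green' f x + c * green' g x"
proof (rule has_vector_derivative_Ioc_unique[OF x])
  have L: "(\<lambda>x. a * f x + c * g x) \<in> L2 s" by (intro L2_add L2_scale f g)
  show "(green (\<lambda>x. a * f x + c * g x) has_vector_derivative green' (\<lambda>x. a * f x + c * g x) x) (at x within {0<..s})"
    by (rule sol_pair_deriv[OF green_sol_pair[OF L] x])
  show "(green (\<lambda>x. a * f x + c * g x) has_vector_derivative a * green' f x + c * green' g x) (at x within {0<..s})"
    unfolding green_lin[OF f g]
    by (intro has_vector_derivative_add has_vector_derivative_mult_right sol_pair_deriv[OF green_sol_pair] f g x)
qed

text \<open>Plays the role of l^2 K(l,l); the shift by m0 comes from Green's operator and keeps the
  value positive at every eigenvalue.\<close>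

abbreviation weight :: "complex \<Rightarrow> real" where
  "weight l \<equiv> (cmod (l - of_real m0))\<^sup>2 * (nrm2 s (\<xi> l))\<^sup>2"

text \<open>Bessel's inequality for the functionals that evaluate \<open>green g\<close> and
  \<open>green' g\<close> at x; the latter is bounded by a multiple of x^(-1/2), whence C /
  x.\<close>

lemma eigenfunction_sums:
  obtains C where "C > 0"
    "\<And>A x. \<lbrakk>finite A; A \<subseteq> eigenvalues; x \<in> {0<..s}\<rbrakk> \<Longrightarrow>
      (\<Sum>l\<in>A. (cmod (\<xi> l x))\<^sup>2 / weight l) \<le> C"
    "\<And>A x. \<lbrakk>finite A; A \<subseteq> eigenvalues; x \<in> {0<..s}\<rbrakk> \<Longrightarrow>
      (\<Sum>l\<in>A. (cmod (\<xi>' l x))\<^sup>2 / weight l) \<le> C / x"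
proof -
  obtain C1 where C1: "C1 > 0" "\<And>g x. g \<in> L2 s \<Longrightarrow> cmod (green g x) \<le> C1 * nrm2 s g"
    using green_uniform_bound by metis
  obtain C2 where C2: "C2 > 0"
    "\<And>g x. g \<in> L2 s \<Longrightarrow> x \<in> {0<..s} \<Longrightarrow> cmod (green' g x) \<le> C2 * x powr (- 1 / 2) * nrm2 s g"
    using green_bounds by metis
  show thesis
  proof (rule that[of "C1\<^sup>2 + C2\<^sup>2"])
    fix A x assume A: "finite A" "A \<subseteq> eigenvalues" and x: "x \<in> {0<..s}"
    have eq: "(cmod (\<xi> l x))\<^sup>2 / weight l = (cmod (green (\<xi> l) x))\<^sup>2 / (nrm2 s (\<xi> l))\<^sup>2"
      "(cmod (\<xi>' l x))\<^sup>2 / weight l = (cmod (green' (\<xi> l) x))\<^sup>2 / (nrm2 s (\<xi> l))\<^sup>2"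
      if "l \<in> A" for l
      using that A(2) eigenvalue_neq_m0[of l] green_eigenfunction[OF _ x, of l, symmetric]
      by (auto simp: norm_mult power_mult_distrib)
    have lin: "green (f + g) x = green f x + green g x" "green' (f + g) x = green' f x + green' g x"
      if "f \<in> L2 s" "g \<in> L2 s" for f g
      using green_lin[OF that, of 1 1] green'_lin[OF that x, of 1 1] by (simp_all add: plus_fun_def)
    have sc: "green (\<lambda>t. c * f t) x = c * green f x" "green' (\<lambda>t. c * f t) x = c * green' f x"
      if "f \<in> L2 s" for f c
      using green_lin[OF that that, of c 0] green'_lin[OF that that x, of c 0] by simp_all
    have "(\<Sum>l\<in>A. (cmod (green (\<xi> l) x))\<^sup>2 / (nrm2 s (\<xi> l))\<^sup>2) \<le> C1\<^sup>2"
      by (rule bessel_functional[of "\<lambda>g. green g x", OF lin(1) sc(1) C1(2) A])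
    also have "\<dots> \<le> C1\<^sup>2 + C2\<^sup>2" by simp
    finally show "(\<Sum>l\<in>A. (cmod (\<xi> l x))\<^sup>2 / weight l) \<le> C1\<^sup>2 + C2\<^sup>2"
      using sum.cong[OF refl eq(1), of A] by simp
    have "(\<Sum>l\<in>A. (cmod (green' (\<xi> l) x))\<^sup>2 / (nrm2 s (\<xi> l))\<^sup>2) \<le> (C2 * x powr (- 1 / 2))\<^sup>2"
      by (rule bessel_functional[of "\<lambda>g. green' g x", OF lin(2) sc(2) C2(2)[OF _ x] A])
    also have "(C2 * x powr (- 1 / 2))\<^sup>2 = C2\<^sup>2 / x"
    proof -
      have "(x powr (- 1 / 2))\<^sup>2 = x powr (- 1)" by (simp add: power2_eq_square flip: powr_add)
      moreover have "x powr (- 1) = 1 / x" using powr_minus_divide[of x 1] x by simp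
      ultimately show ?thesis by (simp only: power_mult_distrib) simp
    qed
    also have "\<dots> \<le> (C1\<^sup>2 + C2\<^sup>2) / x" using x by (intro divide_right_mono) simp_all
    finally show "(\<Sum>l\<in>A. (cmod (\<xi>' l x))\<^sup>2 / weight l) \<le> (C1\<^sup>2 + C2\<^sup>2) / x"
      using sum.cong[OF refl eq(2), of A] by simp
  qed (use C1(1) in \<open>simp add: add_pos_nonneg\<close>)
qed

text \<open>Green's operator is Hilbert--Schmidt.\<close>

lemma eigenvalue_sum_bound:
  obtains C where "C > 0" "\<And>A. finite A \<Longrightarrow> A \<subseteq> eigenvalues \<Longrightarrow> (\<Sum>l\<in>A. 1 / (cmod (l - of_real m0))\<^sup>2) \<le> C"
proof -
  obtain C where C: "C > 0" "\<And>A x. \<lbrakk>finite A; A \<subseteq> eigenvalues; x \<in> {0<..s}\<rbrakk> \<Longrightarrow>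
      (\<Sum>l\<in>A. (cmod (\<xi> l x))\<^sup>2 / weight l) \<le> C"
    "\<And>A x. \<lbrakk>finite A; A \<subseteq> eigenvalues; x \<in> {0<..s}\<rbrakk> \<Longrightarrow>
      (\<Sum>l\<in>A. (cmod (\<xi>' l x))\<^sup>2 / weight l) \<le> C / x"
    by (rule eigenfunction_sums) blast
  show thesis
  proof (rule that[of "C * s"])
    fix A assume A: "finite A" "A \<subseteq> eigenvalues"
    define k where "k l = (cmod (l - of_real m0))\<^sup>2 * (nrm2 s (\<xi> l))\<^sup>2" for l
    have int: "integrable lborel (\<lambda>x. indicator {0<..<s} x *\<^sub>R ((cmod (\<xi> l x))\<^sup>2 / k l))" for l
      unfolding set_integrable_def[symmetric]
      by (rule set_integrable_divide) (use xi_in_L2[of l] in \<open>simp add: L2_iffs\<close>)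
    \<comment> \<open>Integration over (0,s) cancels the norm of the eigenfunction contained in the
      weight.\<close>
    have n: "(LBINT x:{0<..<s}. (cmod (\<xi> l x))\<^sup>2 / k l) = 1 / (cmod (l - of_real m0))\<^sup>2" if "l \<in> A" for l
    proof -
      have "(LBINT x:{0<..<s}. (cmod (\<xi> l x))\<^sup>2 / k l) = (nrm2 s (\<xi> l))\<^sup>2 / k l"
        by (simp add: nrm2_sq[OF xi_in_L2])
      then show ?thesis using nrm_xi_pos[of l] by (simp add: k_def)
    qed
    have "(\<Sum>l\<in>A. 1 / (cmod (l - of_real m0))\<^sup>2) = (\<Sum>l\<in>A. LBINT x:{0<..<s}. (cmod (\<xi> l x))\<^sup>2 / k l)"
      using n by simp
    also have "\<dots> = (LBINT x:{0<..<s}. \<Sum>l\<in>A. (cmod (\<xi> l x))\<^sup>2 / k l)"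
      unfolding set_lebesgue_integral_def scaleR_sum_right
      by (rule Bochner_Integration.integral_sum[symmetric]) (rule int)
    also have "\<dots> \<le> (LBINT x:{0<..<s}. C)"
    proof (rule set_integral_mono)
      show "set_integrable lborel {0<..<s} (\<lambda>x. \<Sum>l\<in>A. (cmod (\<xi> l x))\<^sup>2 / k l)"
        unfolding set_integrable_def scaleR_sum_right by (rule Bochner_Integration.integrable_sum) (rule int)
      show "set_integrable lborel {0<..<s} (\<lambda>x. C)" using s by (simp add: set_integrable_def)
      show "(\<Sum>l\<in>A. (cmod (\<xi> l x))\<^sup>2 / k l) \<le> C" if "x \<in> {0<..<s}" for x
        unfolding k_def using that by (intro C(2) A) auto
    qed
    also have "\<dots> = C * s" using s by (simp add: set_lebesgue_integral_def)
    finally show "(\<Sum>l\<in>A. 1 / (cmod (l - of_real m0))\<^sup>2) \<le> C * s" .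
  qed (use C(1) s in simp)
qed

text \<open>Each eigenvalue in the disc contributes at least a fixed amount to the bounded sum of
  \<open>eigenvalue_sum_bound\<close>.\<close>

lemma finite_eigenvalues_bounded: "finite {l \<in> eigenvalues. cmod l \<le> R}"
proof (rule ccontr)
  assume inf: "infinite {l \<in> eigenvalues. cmod l \<le> R}"
  obtain C where C: "C > 0" "\<And>A. finite A \<Longrightarrow> A \<subseteq> eigenvalues \<Longrightarrow> (\<Sum>l\<in>A. 1 / (cmod (l - of_real m0))\<^sup>2) \<le> C"
    by (rule eigenvalue_sum_bound) blast
  define k where "k = (\<bar>R\<bar> + \<bar>m0\<bar>)\<^sup>2"
  obtain n :: nat where n: "real n > C * k" using reals_Archimedean2 by blast
  obtain A where A: "A \<subseteq> {l \<in> eigenvalues. cmod l \<le> R}" "finite A" "card A = n"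
    using infinite_arbitrarily_large[OF inf] by blast
  have le: "1 / k \<le> 1 / (cmod (l - of_real m0))\<^sup>2" "k > 0" if "l \<in> A" for l
  proof -
    have pos: "cmod (l - of_real m0) > 0" using that A(1) eigenvalue_neq_m0[of l] by auto
    have "cmod (l - of_real m0) \<le> \<bar>R\<bar> + \<bar>m0\<bar>"
      using norm_triangle_ineq4[of l "of_real m0"] that A(1) by auto
    then have "(cmod (l - of_real m0))\<^sup>2 \<le> k" unfolding k_def by (intro power_mono) auto
    moreover have "(cmod (l - of_real m0))\<^sup>2 > 0" using pos by simp
    ultimately show "1 / k \<le> 1 / (cmod (l - of_real m0))\<^sup>2" "k > 0"
      using frac_le[of 1 1 "(cmod (l - of_real m0))\<^sup>2" k] by linarith+
  qed
  have "real n * (1 / k) = (\<Sum>l\<in>A. 1 / k)" using A by simp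
  also have "\<dots> \<le> (\<Sum>l\<in>A. 1 / (cmod (l - of_real m0))\<^sup>2)" using le by (intro sum_mono) auto
  also have "\<dots> \<le> C" using A by (intro C(2)) auto
  finally have "real n / k \<le> C" by simp
  moreover have "k \<ge> 0" by (simp add: k_def)
  moreover have "k > 0"
  proof -
    have "n \<noteq> 0" using n C(1) \<open>k \<ge> 0\<close> by (intro notI) (simp add: mult_less_0_iff)
    then have "A \<noteq> {}" using A(3) by auto
    then show ?thesis using le(2) by auto
  qed
  ultimately show False using n by (simp add: divide_le_eq)
qed

sublocale complete_orthogonal_family "L2 s" "\<lambda>c f x. c * f x" "ip2 s" \<xi> eigenvalues
proof
  show "\<exists>h\<in>L2 s. (\<lambda>n. nrm2 s (f n - h)) \<longlonglongrightarrow> 0"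
    if "\<And>n :: nat. f n \<in> L2 s" "\<And>\<epsilon>. \<epsilon> > 0 \<Longrightarrow> \<exists>N. \<forall>m\<ge>N. \<forall>n\<ge>N. nrm2 s (f m - f n) < \<epsilon>" for f
    using s(1) that by (rule L2_complete)
qed (rule eigenfunctions_total)

end

context endpoint
begin

section \<open>The spectrum\<close>

lemma transform_lin:
  assumes "f \<in> L2 s" "g \<in> L2 s"
  shows "\<F> (\<lambda>x. a * f x + c * g x) z = a * \<F> f z + c * \<F> g z"
proof -
  have "(\<lambda>x. a * f x + c * g x) = (\<lambda>x. a * f x) + (\<lambda>x. c * g x)" by (simp add: fun_eq_iff)
  then show ?thesis
    unfolding ip2_xi[symmetric]
    using L2.ip_add[OF L2_scale[OF assms(1)] L2_scale[OF assms(2)] xi_in_L2] L2.ip_sc[OF assms(1) xi_in_L2]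
      L2.ip_sc[OF assms(2) xi_in_L2] by simp
qed

lemma transform_cong_AE:
  assumes "f \<in> L2 s" "g \<in> L2 s" "nrm2 s (f - g) = 0"
  shows "\<F> f = \<F> g"
proof
  fix z
  have "cmod (ip2 s (f - g) (\<xi> (cnj z))) \<le> nrm2 s (f - g) * nrm2 s (\<xi> (cnj z))"
    by (rule L2.cauchy_schwarz[OF L2.V_diff[OF assms(1,2)] xi_in_L2])
  then show "\<F> f z = \<F> g z"
    unfolding ip2_xi[symmetric] using L2.ip_diff[OF assms(1,2) xi_in_L2] assms(3) by simp
qed

text \<open>Values at eigenvalues are inner products with a total system. This injectivity modulo
  null sets gives meaning to the definite descriptions in \<open>dB_norm\<close> and
  \<open>dB_inner\<close>.\<close>

lemma transform_injective:
  assumes f: "f \<in> L2 s" and g: "g \<in> L2 s"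
    and eq: "\<And>l. l \<in> eigenvalues \<Longrightarrow> \<F> f l = \<F> g l"
  shows "nrm2 s (f - g) = 0"
proof (rule eigenfunctions_total)
  show "f - g \<in> L2 s" by (rule L2.V_diff[OF f g])
  show "ip2 s (f - g) (\<xi> l) = 0" if "l \<in> eigenvalues" for l
    using L2.ip_diff[OF f g xi_in_L2, of l] eq[OF that]
    by (simp add: ip2_eigenvalue[OF that, of f] ip2_eigenvalue[OF that, of g])
qed

lemma transform_cong_eigenvalues:
  assumes "f \<in> L2 s" "g \<in> L2 s" "\<And>l. l \<in> eigenvalues \<Longrightarrow> \<F> f l = \<F> g l"
  shows "\<F> f = \<F> g"
  by (rule transform_cong_AE[OF assms(1,2) transform_injective[OF assms]])

lemma dB_norm_transform:
  assumes f: "f \<in> L2 s"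
  shows "dB_norm \<xi> s (\<F> f) = nrm2 s f"
  unfolding dB_norm_def nrm2_eq[symmetric]
proof (rule the_equality)
  show "\<exists>\<phi>\<in>L2 s. \<F> f = \<F> \<phi> \<and> nrm2 s f = nrm2 s \<phi>" using f by blast
  fix r assume "\<exists>\<phi>\<in>L2 s. \<F> f = \<F> \<phi> \<and> r = nrm2 s \<phi>"
  then obtain \<phi> where \<phi>: "\<phi> \<in> L2 s" "\<F> f = \<F> \<phi>" "r = nrm2 s \<phi>" by blast
  have "nrm2 s (f - \<phi>) = 0" by (rule transform_injective[OF f \<phi>(1)]) (simp add: \<phi>(2))
  then show "r = nrm2 s f" using L2.nrm_diff_ge[OF f \<phi>(1)] \<phi>(3) by simp
qed

lemma ip2_cong:
  assumes "f \<in> L2 s" "f' \<in> L2 s" "g \<in> L2 s" "g' \<in> L2 s" "nrm2 s (f - f') = 0" "nrm2 s (g - g') = 0"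
  shows "ip2 s f g = ip2 s f' g'"
proof -
  have "ip2 s (f - f') g = 0"
    using L2.cauchy_schwarz[OF L2.V_diff[OF assms(1,2)] assms(3)] assms(5) by simp
  moreover have "ip2 s f' (g - g') = 0"
    using L2.cauchy_schwarz[OF assms(2) L2.V_diff[OF assms(3,4)]] assms(6) by simp
  ultimately show ?thesis
    using L2.ip_diff[OF assms(1,2,3)] L2.ip_diff_right[OF assms(2,3,4)] by simp
qed

lemma dB_inner_transform:
  assumes f: "f \<in> L2 s" and g: "g \<in> L2 s"
  shows "dB_inner \<xi> s (\<F> f) (\<F> g) = ip2 s f g"
  unfolding dB_inner_def ip2_def[symmetric]
proof (rule the_equality)
  show "\<exists>\<phi>\<in>L2 s. \<exists>\<psi>\<in>L2 s. \<F> f = \<F> \<phi> \<and> \<F> g = \<F> \<psi> \<and> ip2 s f g = ip2 s \<phi> \<psi>"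
    using f g by blast
  fix c assume "\<exists>\<phi>\<in>L2 s. \<exists>\<psi>\<in>L2 s. \<F> f = \<F> \<phi> \<and> \<F> g = \<F> \<psi> \<and> c = ip2 s \<phi> \<psi>"
  then obtain \<phi> \<psi> where *: "\<phi> \<in> L2 s" "\<psi> \<in> L2 s" "\<F> f = \<F> \<phi>"
    "\<F> g = \<F> \<psi>" "c = ip2 s \<phi> \<psi>" by blast
  have "nrm2 s (\<phi> - f) = 0" by (rule transform_injective[OF *(1) f]) (simp add: *(3))
  moreover have "nrm2 s (\<psi> - g) = 0" by (rule transform_injective[OF *(2) g]) (simp add: *(4))
  ultimately show "c = ip2 s f g" using ip2_cong[OF *(1) f *(2) g] *(5) by simp
qed

section \<open>The operator, its resolvent and the spectrum\<close>

lemma H_graphD: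
  assumes "(f, g) \<in> H_graph \<nu> q s \<gamma>"
  shows "f \<in> L2 s" "g \<in> L2 s" "sol_pair s f (dx s f) g" "bcs f (dx s f) = 0" "bc0 f (dx s f)"
proof -
  have AE: "AE x in lborel. x \<in> {0<..<s} \<longrightarrow> (\<exists>\<phi>''. (dx s f has_vector_derivative \<phi>'') (at x) \<and>
      g x = - \<phi>'' + of_real (V x) * f x)"
    using assms by (simp add: H_graph_def)
  have "AE x in lborel. x \<in> {0<..<s} \<longrightarrow> (dx s f has_vector_derivative of_real (V x) * f x - g x) (at x)"
    using AE by eventually_elim auto
  then show "sol_pair s f (dx s f) g" using assms by (simp add: H_graph_def sol_pair_def)
qed (use assms in \<open>simp_all add: H_graph_def bcs_def bc0_def\<close>)

lemma H_graphI:
  assumes fL: "f \<in> L2 s" and gL: "g \<in> L2 s" and f: "sol_pair s f f' g" and bc: "bcs f f' = 0" "bc0 f f'"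
  shows "(f, g) \<in> H_graph \<nu> q s \<gamma>"
proof -
  have d: "dx s f x = f' x" if x: "x \<in> {0<..s}" for x
  proof (rule has_vector_derivative_Ioc_unique[OF x])
    show "(f has_vector_derivative f' x) (at x within {0<..s})" by (rule sol_pair_deriv[OF f x])
    then show "(f has_vector_derivative dx s f x) (at x within {0<..s})"
      unfolding dx_def by (simp add: vector_derivative_works[symmetric] differentiableI_vector)
  qed
  have sI: "s \<in> {0<..s}" using s by simp
  have "abs_continuous_on (dx s f) c s" if c: "0 < c" "c < s" for c
    by (rule abs_continuous_on_cong[OF sol_pair_AC'[OF f c]]) (use d c in auto)
  moreover have "AE x in lborel. x \<in> {0<..<s} \<longrightarrow> (\<exists>\<phi>''. (dx s f has_vector_derivative \<phi>'') (at x) \<and>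
      g x = - \<phi>'' + of_real (V x) * f x)"
  proof -
    have "AE x in lborel. x \<in> {0<..<s} \<longrightarrow> (f' has_vector_derivative of_real (V x) * f x - g x) (at x)"
      using f by (simp add: sol_pair_def)
    then show ?thesis
    proof eventually_elim
      case (elim x)
      show ?case
      proof (intro impI exI conjI)
        assume x: "x \<in> {0<..<s}"
        show "(dx s f has_vector_derivative of_real (V x) * f x - g x) (at x)"
          by (rule has_vector_derivative_transform_within_open[of f' _ _ "{0<..<s}"]) (use elim x d in auto)
      qed simp
    qed
  qed
  moreover have "bcs f (dx s f) = 0" using bc(1) d[OF sI] by (simp add: bcs_def)
  moreover have "bc0 f (dx s f)"
    unfolding bc0_def
  proof
    assume n: "\<nu> \<in> {0<..<1}"
    let ?b = "\<lambda>f'. \<lambda>x. complex_of_real (x powr (\<nu> - 1 / 2)) * (of_real p * f x - of_real x * f' x)"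
    have "(?b f' \<longlongrightarrow> 0) (at_right 0)" using bc(2) n by (simp add: bc0_def)
    moreover have "\<forall>\<^sub>F x in at_right 0. ?b f' x = ?b (dx s f) x"
      by (rule eventually_at_rightI[OF _ s(1)]) (use d in auto)
    ultimately show "(?b (dx s f) \<longlongrightarrow> 0) (at_right 0)" by (rule Lim_transform_eventually)
  qed
  ultimately show ?thesis
    using fL gL sol_pair_deriv[OF f] d sol_pair_AC[OF f] by (auto simp: H_graph_def AC_loc_def bcs_def bc0_def)
qed

text \<open>At an eigenvalue the boundary term at s vanishes as well, so there the operator acts as
  multiplication by l.\<close>

lemma H_graph_transform:
  assumes H: "(f, g) \<in> H_graph \<nu> q s \<gamma>" and l: "l \<in> eigenvalues"
  shows "\<F> g l = l * \<F> f l"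
proof -
  note D = H_graphD[OF H]
  have "wronskian f (dx s f) (\<xi> l) (\<xi>' l) s = 0"
    using l D(4) by (intro bcs_wronskian) (simp_all add: eigenvalues_def)
  then show ?thesis
    using wronskian_xi_transform[OF s D(3,1,2,5), of l] by (simp add: wronskian_def)
qed

lemma S_graphE:
  assumes "(F, G) \<in> \<S>"
  obtains f g where "(f, g) \<in> H_graph \<nu> q s \<gamma>" "F = \<F> f" "G = \<F> g"
  using assms by (auto simp: S_graph_def)

lemma S_graphI: "(f, g) \<in> H_graph \<nu> q s \<gamma> \<Longrightarrow> (\<F> f, \<F> g) \<in> \<S>"
  by (force simp: S_graph_def)

lemma eigenvalues_distance:
  assumes "\<mu> \<notin> eigenvalues"
  obtains d where "d > 0" "\<And>l. l \<in> eigenvalues \<Longrightarrow> d \<le> cmod (l - \<mu>)"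
proof -
  \<comment> \<open>The 1 covers the eigenvalues outside the disc, whose distance from \<mu> exceeds
    1, and keeps the set nonempty.\<close>
  define B where "B = insert 1 ((\<lambda>l. cmod (l - \<mu>)) ` {l \<in> eigenvalues. cmod l \<le> cmod \<mu> + 1})"
  have fin: "finite B" "B \<noteq> {}" using finite_eigenvalues_bounded by (auto simp: B_def)
  show thesis
  proof (rule that[of "Min B"])
    show "Min B > 0" using fin assms by (auto simp: B_def Min_gr_iff)
    fix l assume l: "l \<in> eigenvalues"
    show "Min B \<le> cmod (l - \<mu>)"
    proof (cases "cmod l \<le> cmod \<mu> + 1")
      case True
      then show ?thesis using fin l by (intro Min_le) (auto simp: B_def)
    next
      case False
      have "Min B \<le> 1" using fin by (intro Min_le) (auto simp: B_def)
      then show ?thesis using False norm_triangle_ineq2[of l \<mu>] by simp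
    qed
  qed
qed

text \<open>Dividing the coefficients of g by l - \<mu> yields an L2 function h, but only up to null
  sets, so h itself may be too rough for the domain. A solution f satisfies (H - m0) f = g + (\<mu>
  - m0) f; applying Green's operator to g + (\<mu> - m0) h therefore produces the right
  representative.\<close>

lemma resolvent_exists:
  assumes \<mu>: "\<mu> \<notin> eigenvalues" and g: "g \<in> L2 s"
  shows "\<exists>F. (F, \<lambda>z. \<F> g z + \<mu> * F z) \<in> \<S>"
proof -
  obtain d where d: "d > 0" "\<And>l. l \<in> eigenvalues \<Longrightarrow> d \<le> cmod (l - \<mu>)"
    using eigenvalues_distance[OF \<mu>] by blast
  have \<mu>': "l - \<mu> \<noteq> 0" if "l \<in> eigenvalues" for l using \<mu> that by auto
  define m where "m l = ip2 s g (\<xi> l) / of_real ((nrm2 s (\<xi> l))\<^sup>2) / (l - \<mu>)" for l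
  have "(\<lambda>l. (cmod (m l))\<^sup>2 * (nrm2 s (\<xi> l))\<^sup>2) summable_on eigenvalues"
  proof (rule summable_on_comparison_test)
    show "(\<lambda>l. (1 / d\<^sup>2) * ((cmod (ip2 s g (\<xi> l)))\<^sup>2 / (nrm2 s (\<xi> l))\<^sup>2)) summable_on eigenvalues"
      by (intro summable_on_cmult_right bessel_summable[OF g])
    fix l assume l: "l \<in> eigenvalues"
    let ?n = "(nrm2 s (\<xi> l))\<^sup>2" and ?i = "(cmod (ip2 s g (\<xi> l)))\<^sup>2"
    have n: "?n > 0" using nrm_xi_pos[of l] by simp
    have "cmod (m l) = cmod (ip2 s g (\<xi> l)) / ?n / cmod (l - \<mu>)"
      unfolding m_def norm_divide norm_of_real by simp
    moreover have "(i / N / x)\<^sup>2 * N = i\<^sup>2 / N / x\<^sup>2" if "N > 0" for i N x :: real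
      using that by (simp add: power_divide power2_eq_square)
    ultimately have "(cmod (m l))\<^sup>2 * ?n = ?i / ?n / (cmod (l - \<mu>))\<^sup>2" using n by (simp only:)
    also have "\<dots> \<le> ?i / ?n / d\<^sup>2"
      using d(1) d(2)[OF l] by (intro divide_left_mono power_mono mult_pos_pos) auto
    finally show "(cmod (m l))\<^sup>2 * ?n \<le> (1 / d\<^sup>2) * (?i / ?n)" by (simp add: mult.commute)
  qed simp
  then obtain h where h: "h \<in> L2 s" "\<And>l. l \<in> eigenvalues \<Longrightarrow> ip2 s h (\<xi> l) = m l * of_real ((nrm2 s (\<xi> l))\<^sup>2)"
    by (rule riesz_fischer) blast
  have Th: "\<F> h l = \<F> g l / (l - \<mu>)" if "l \<in> eigenvalues" for l
    using h(2)[OF that] nrm_xi_pos[of l] by (simp add: m_def ip2_eigenvalue[OF that])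
  define k where "k x = 1 * g x + (\<mu> - of_real m0) * h x" for x
  define f where "f = green k"
  define j where "j x = of_real m0 * f x + 1 * k x" for x
  have kL: "k \<in> L2 s" unfolding k_def[abs_def] by (intro L2_add L2_scale g h)
  have fL: "f \<in> L2 s" unfolding f_def by (rule green_L2[OF kL])
  have jL: "j \<in> L2 s" unfolding j_def[abs_def] by (intro L2_add L2_scale fL kL)
  have H: "(f, j) \<in> H_graph \<nu> q s \<gamma>"
    using green_sol_pair[OF kL] by (intro H_graphI[OF fL jL, of "green' k"]) (auto simp: f_def j_def[abs_def] bcs_green bc0_green[OF kL])
  have jg: "\<F> j = \<F> (\<lambda>x. 1 * g x + \<mu> * f x)"
  proof (rule transform_cong_eigenvalues[OF jL])
    show "(\<lambda>x. 1 * g x + \<mu> * f x) \<in> L2 s" by (intro L2_add L2_scale g fL)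
    fix l assume l: "l \<in> eigenvalues"
    have Tk: "\<F> k l = \<F> g l + (\<mu> - of_real m0) * (\<F> g l / (l - \<mu>))"
      unfolding k_def[abs_def] transform_lin[OF g h(1)] Th[OF l] by simp
    also have "\<dots> = (l - of_real m0) * (\<F> g l / (l - \<mu>))"
      using \<mu>'[OF l] by (simp add: divide_simps) (simp add: algebra_simps)
    finally have Tk: "\<F> k l = (l - of_real m0) * (\<F> g l / (l - \<mu>))" .
    have Tf: "\<F> f l = \<F> g l / (l - \<mu>)"
      using green_transform[OF kL l] eigenvalue_neq_m0[OF l] unfolding f_def[symmetric] Tk
      by (simp only: mult_cancel_left eq_iff_diff_eq_0[symmetric] right_minus_eq) simp
    have "\<F> g l = (l - \<mu>) * \<F> f l" using Tf \<mu>'[OF l] by simp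
    moreover have "\<F> j l = l * \<F> f l"
      unfolding j_def[abs_def] transform_lin[OF fL kL] Tk Tf by (simp only: left_diff_distrib) simp
    ultimately show "\<F> j l = \<F> (\<lambda>x. 1 * g x + \<mu> * f x) l"
      unfolding transform_lin[OF g fL] by (simp add: algebra_simps)
  qed
  have "\<F> j = (\<lambda>z. \<F> g z + \<mu> * \<F> f z)"
    unfolding jg by (rule ext) (simp add: transform_lin[OF g fL, of 1, simplified])
  then show ?thesis using S_graphI[OF H] by auto
qed

text \<open>At an eigenvalue both candidates satisfy (l - \<mu>) F = G, and agreement at the
  eigenvalues is enough.\<close>

lemma resolvent_unique:
  assumes \<mu>: "\<mu> \<notin> eigenvalues"
    and F1: "(F1, \<lambda>z. G z + \<mu> * F1 z) \<in> \<S>" and F2: "(F2, \<lambda>z. G z + \<mu> * F2 z) \<in> \<S>"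
  shows "F1 = F2"
proof -
  obtain f1 g1 where 1: "(f1, g1) \<in> H_graph \<nu> q s \<gamma>" "F1 = \<F> f1" "(\<lambda>z. G z + \<mu> * F1 z) = \<F> g1"
    by (rule S_graphE[OF F1])
  obtain f2 g2 where 2: "(f2, g2) \<in> H_graph \<nu> q s \<gamma>" "F2 = \<F> f2" "(\<lambda>z. G z + \<mu> * F2 z) = \<F> g2"
    by (rule S_graphE[OF F2])
  have "\<F> f1 l = \<F> f2 l" if l: "l \<in> eigenvalues" for l
  proof -
    have "G l + \<mu> * F1 l = l * F1 l" using fun_cong[OF 1(3), of l] H_graph_transform[OF 1(1) l] 1(2) by simp
    moreover have "G l + \<mu> * F2 l = l * F2 l" using fun_cong[OF 2(3), of l] H_graph_transform[OF 2(1) l] 2(2) by simp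
    ultimately have "(l - \<mu>) * F1 l = (l - \<mu>) * F2 l" unfolding left_diff_distrib by (metis add_diff_cancel_right')
    then show ?thesis using \<mu> l 1(2) 2(2) by auto
  qed
  then show ?thesis unfolding 1(2) 2(2) by (rule transform_cong_eigenvalues[OF H_graphD(1)[OF 1(1)] H_graphD(1)[OF 2(1)]])
qed

text \<open>On coefficients the resolvent divides by l - \<mu>, whose modulus is at least d;
  Parseval's identity transfers this to norms.\<close>

lemma resolvent_bounded:
  assumes \<mu>: "\<mu> \<notin> eigenvalues"
  shows "\<exists>C. \<forall>(F, G)\<in>\<S>. dB_norm \<xi> s F \<le> C * dB_norm \<xi> s (\<lambda>z. G z - \<mu> * F z)"
proof -
  obtain d where d: "d > 0" "\<And>l. l \<in> eigenvalues \<Longrightarrow> d \<le> cmod (l - \<mu>)"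
    using eigenvalues_distance[OF \<mu>] by blast
  have "dB_norm \<xi> s F \<le> (1 / d) * dB_norm \<xi> s (\<lambda>z. G z - \<mu> * F z)" if FG: "(F, G) \<in> \<S>" for F G
  proof -
    obtain f g where H: "(f, g) \<in> H_graph \<nu> q s \<gamma>" and FG': "F = \<F> f" "G = \<F> g"
      by (rule S_graphE[OF FG])
    note fL = H_graphD(1)[OF H] and gL = H_graphD(2)[OF H]
    define h where "h x = 1 * g x + (- \<mu>) * f x" for x
    have hL: "h \<in> L2 s" unfolding h_def[abs_def] by (intro L2_add L2_scale fL gL)
    have Th: "(\<lambda>z. G z - \<mu> * F z) = \<F> h"
      unfolding FG' h_def[abs_def] by (rule ext) (simp add: transform_lin[OF gL fL, of 1 "- \<mu>", simplified])
    have "(nrm2 s f)\<^sup>2 \<le> (1 / d\<^sup>2) * (nrm2 s h)\<^sup>2"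
    proof (rule has_sum_mono[OF parseval_norm[OF fL] has_sum_cmult_right[OF parseval_norm[OF hL]]])
      fix l assume l: "l \<in> eigenvalues"
      have "ip2 s h (\<xi> l) = (l - \<mu>) * ip2 s f (\<xi> l)"
        unfolding ip2_eigenvalue[OF l] h_def[abs_def] transform_lin[OF gL fL] H_graph_transform[OF H l]
        by (simp add: algebra_simps)
      then have eq: "(cmod (ip2 s h (\<xi> l)))\<^sup>2 = (cmod (l - \<mu>))\<^sup>2 * (cmod (ip2 s f (\<xi> l)))\<^sup>2"
        by (simp add: norm_mult power_mult_distrib)
      have "d\<^sup>2 \<le> (cmod (l - \<mu>))\<^sup>2" using d(1) d(2)[OF l] by (intro power_mono) auto
      then have "d\<^sup>2 * (cmod (ip2 s f (\<xi> l)))\<^sup>2 \<le> (cmod (ip2 s h (\<xi> l)))\<^sup>2"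
        unfolding eq by (rule mult_right_mono) simp
      then have "(cmod (ip2 s f (\<xi> l)))\<^sup>2 \<le> (1 / d\<^sup>2) * (cmod (ip2 s h (\<xi> l)))\<^sup>2"
        using d(1) by (simp add: field_simps)
      then have "(cmod (ip2 s f (\<xi> l)))\<^sup>2 / (nrm2 s (\<xi> l))\<^sup>2 \<le> ((1 / d\<^sup>2) * (cmod (ip2 s h (\<xi> l)))\<^sup>2) / (nrm2 s (\<xi> l))\<^sup>2"
        by (rule divide_right_mono) simp
      then show "(cmod (ip2 s f (\<xi> l)))\<^sup>2 / (nrm2 s (\<xi> l))\<^sup>2 \<le> (1 / d\<^sup>2) * ((cmod (ip2 s h (\<xi> l)))\<^sup>2 / (nrm2 s (\<xi> l))\<^sup>2)"
        by simp
    qed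
    also have "\<dots> = ((1 / d) * nrm2 s h)\<^sup>2" by (simp add: power_divide)
    finally have "nrm2 s f \<le> (1 / d) * nrm2 s h"
      by (rule power2_le_imp_le) (use d(1) L2.nrm_nonneg[OF hL] in simp)
    then show ?thesis unfolding Th unfolding FG' dB_norm_transform[OF hL] dB_norm_transform[OF fL] .
  qed
  then show ?thesis by (intro exI[of _ "1 / d"]) blast
qed

text \<open>The multiples 0 and 1 of \<open>\<xi> \<mu>\<close> give two solutions of the
  homogeneous equation.\<close>

lemma eigenvalue_in_spectrum:
  assumes \<mu>: "\<mu> \<in> eigenvalues"
  shows "\<exists>F1 F2. F1 \<noteq> F2 \<and> (F1, \<lambda>z. \<mu> * F1 z) \<in> \<S> \<and> (F2, \<lambda>z. \<mu> * F2 z) \<in> \<S>"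
proof -
  have H: "(\<lambda>x. c * \<xi> \<mu> x, \<lambda>x. \<mu> * (c * \<xi> \<mu> x)) \<in> H_graph \<nu> q s \<gamma>" for c
  proof (rule H_graphI)
    show "(\<lambda>x. c * \<xi> \<mu> x) \<in> L2 s" "(\<lambda>x. \<mu> * (c * \<xi> \<mu> x)) \<in> L2 s" by (intro L2_scale xi_in_L2)+
    show "sol_pair s (\<lambda>x. c * \<xi> \<mu> x) (\<lambda>x. c * \<xi>' \<mu> x) (\<lambda>x. \<mu> * (c * \<xi> \<mu> x))"
      using sol_pair_lin[OF sol_pair_xi[OF s, of \<mu>] sol_pair_xi[OF s, of \<mu>], of c 0] by (simp add: mult.left_commute)
    have "bcs (\<lambda>x. c * \<xi> \<mu> x) (\<lambda>x. c * \<xi>' \<mu> x) = c * bcs (\<xi> \<mu>) (\<xi>' \<mu>)" by (simp add: bcs_def algebra_simps)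
    then show "bcs (\<lambda>x. c * \<xi> \<mu> x) (\<lambda>x. c * \<xi>' \<mu> x) = 0" using \<mu> by (simp add: eigenvalues_def)
    show "bc0 (\<lambda>x. c * \<xi> \<mu> x) (\<lambda>x. c * \<xi>' \<mu> x)"
      unfolding bc0_def
    proof
      let ?b = "\<lambda>f f' x. of_real (x powr (\<nu> - 1 / 2)) * (of_real p * f x - of_real x * f' x) :: complex"
      assume n: "\<nu> \<in> {0<..<1}"
      have "((\<lambda>x. c * ?b (\<xi> \<mu>) (\<xi>' \<mu>) x) \<longlongrightarrow> c * 0) (at_right 0)"
        using bc0_xi[of \<mu>] n unfolding bc0_def by (intro tendsto_intros) auto
      moreover have "(\<lambda>x. c * ?b (\<xi> \<mu>) (\<xi>' \<mu>) x) = ?b (\<lambda>x. c * \<xi> \<mu> x) (\<lambda>x. c * \<xi>' \<mu> x)"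
        by (rule ext) (simp add: right_diff_distrib mult.left_commute)
      ultimately show "(?b (\<lambda>x. c * \<xi> \<mu> x) (\<lambda>x. c * \<xi>' \<mu> x) \<longlongrightarrow> 0) (at_right 0)" by (simp only: mult_zero_right)
    qed
  qed
  define F where "F c = \<F> (\<lambda>x. c * \<xi> \<mu> x)" for c
  have T: "F c z = c * \<F> (\<xi> \<mu>) z" "\<F> (\<lambda>x. \<mu> * (c * \<xi> \<mu> x)) z = \<mu> * F c z" for c z
    unfolding F_def
    using transform_lin[OF xi_in_L2 xi_in_L2, of c \<mu> 0 \<mu> z]
      transform_lin[OF L2_scale[OF xi_in_L2] xi_in_L2, of \<mu> c \<mu> 0 \<mu> z] by simp_all
  have S: "(F c, \<lambda>z. \<mu> * F c z) \<in> \<S>" for c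
  proof -
    have "\<F> (\<lambda>x. \<mu> * (c * \<xi> \<mu> x)) = (\<lambda>z. \<mu> * F c z)" by (rule ext) (rule T(2))
    then show ?thesis using S_graphI[OF H[of c]] by (simp add: F_def)
  qed
  have "F 1 \<mu> \<noteq> 0"
  proof -
    have "of_real ((nrm2 s (\<xi> \<mu>))\<^sup>2) = F 1 \<mu>"
      using L2.ip_self[OF xi_in_L2, of \<mu>] unfolding ip2_eigenvalue[OF \<mu>] T(1) by simp
    then show ?thesis using nrm_xi_pos[of \<mu>] by (metis of_real_eq_0_iff power_not_zero less_irrefl)
  qed
  then have "F 1 \<noteq> F 0" using T(1)[of 0 \<mu>] by auto
  then show ?thesis using S by blast
qed

theorem S_spectrum_eq: "S_spectrum \<xi> \<nu> q s \<gamma> = eigenvalues"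
proof -
  have "(\<forall>G\<in>dB_space \<xi> s. \<exists>!F. (F, \<lambda>z. G z + \<mu> * F z) \<in> \<S>) \<and>
     (\<exists>C. \<forall>(F, G)\<in>\<S>. dB_norm \<xi> s F \<le> C * dB_norm \<xi> s (\<lambda>z. G z - \<mu> * F z))
    \<longleftrightarrow> \<mu> \<notin> eigenvalues" for \<mu>
  proof (intro iffI conjI)
    assume \<mu>: "\<mu> \<notin> eigenvalues"
    show "\<forall>G\<in>dB_space \<xi> s. \<exists>!F. (F, \<lambda>z. G z + \<mu> * F z) \<in> \<S>"
    proof
      fix G assume "G \<in> dB_space \<xi> s"
      then obtain g where g: "g \<in> L2 s" "G = \<F> g" by (auto simp: dB_space_def)
      obtain F where F: "(F, \<lambda>z. G z + \<mu> * F z) \<in> \<S>"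
        using resolvent_exists[OF \<mu> g(1)] g(2) by blast
      show "\<exists>!F. (F, \<lambda>z. G z + \<mu> * F z) \<in> \<S>"
      proof (rule ex1I)
        show "(F, \<lambda>z. G z + \<mu> * F z) \<in> \<S>" by (rule F)
      qed (rule resolvent_unique[OF \<mu> _ F])
    qed
    show "\<exists>C. \<forall>(F, G)\<in>\<S>. dB_norm \<xi> s F \<le> C * dB_norm \<xi> s (\<lambda>z. G z - \<mu> * F z)"
      by (rule resolvent_bounded[OF \<mu>])
  next
    assume R: "(\<forall>G\<in>dB_space \<xi> s. \<exists>!F. (F, \<lambda>z. G z + \<mu> * F z) \<in> \<S>) \<and>
     (\<exists>C. \<forall>(F, G)\<in>\<S>. dB_norm \<xi> s F \<le> C * dB_norm \<xi> s (\<lambda>z. G z - \<mu> * F z))"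
    have "\<F> (\<lambda>x. 0) = (\<lambda>z. 0)" by (simp add: transform_def fun_eq_iff)
    then have "(\<lambda>z. 0) \<in> dB_space \<xi> s" using L2_zero[of s] by (force simp: dB_space_def)
    then have "\<exists>!F. (F, \<lambda>z. 0 + \<mu> * F z) \<in> \<S>" using R by blast
    then show "\<mu> \<notin> eigenvalues" using eigenvalue_in_spectrum[of \<mu>] by auto
  qed
  then show ?thesis unfolding S_spectrum_def spectrum_def by auto
qed

end

section \<open>The projector\<close>

lemma L2_extend:
  assumes f: "f \<in> L2 a" and "a \<le> b"
  shows "(\<lambda>x. if x \<in> {0<..<a} then f x else 0) \<in> L2 b"
proof -
  let ?f = "\<lambda>x. if x \<in> {0<..<a} then f x else 0"
  have "indicator {0<..<b} x *\<^sub>R ?f x = indicator {0<..<a} x *\<^sub>R f x"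
    "indicator {0<..<b} x *\<^sub>R (cmod (?f x))\<^sup>2 = indicator {0<..<a} x *\<^sub>R (cmod (f x))\<^sup>2" for x
    using assms(2) by (auto simp: indicator_def)
  then show ?thesis
    using f unfolding L2_iff set_borel_measurable_def set_integrable_def by simp
qed

lemma set_integral_extend:
  fixes h :: "real \<Rightarrow> 'a::{banach, second_countable_topology}"
  assumes "\<And>x. x \<in> {0<..<a} \<Longrightarrow> h x = k x" "\<And>x. x \<notin> {0<..<a} \<Longrightarrow> h x = 0" "a \<le> b"
  shows "(LBINT x:{0<..<b}. h x) = (LBINT x:{0<..<a}. k x)"
  unfolding set_lebesgue_integral_def
  using assms by (intro Bochner_Integration.integral_cong) (auto simp: indicator_def)

text \<open>Inner products with elements of the smaller space see only the restriction of \<phi> to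
  (0,a), so the projector is restriction. The angle pi/2 in both interpretations is an arbitrary
  choice: it selects a complete system that makes the transform injective.\<close>

lemma (in schroedinger) dB_proj_transform:
  assumes ab: "0 < a" "a \<le> b" and \<phi>: "\<phi> \<in> L2 b"
  shows "dB_proj \<xi> a b (transform \<xi> b \<phi>) = transform \<xi> a \<phi>"
proof -
  interpret A: endpoint \<nu> b q \<xi> a "pi / 2" by unfold_locales (use ab in auto)
  interpret B: endpoint \<nu> b q \<xi> b "pi / 2" by unfold_locales (use b_pos in auto)
  define ext where "ext f x = (if x \<in> {0<..<a} then f x else 0)" for f :: "real \<Rightarrow> complex" and x
  have extL: "ext f \<in> L2 b" if "f \<in> L2 a" for f
    unfolding ext_def[abs_def] using that ab(2) by (rule L2_extend)
  have Text: "transform \<xi> b (ext f) = transform \<xi> a f" for f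
    unfolding transform_def by (rule ext, rule set_integral_extend) (use ab(2) in \<open>auto simp: ext_def\<close>)
  have \<phi>a: "\<phi> \<in> L2 a" by (rule L2_subset[OF \<phi> ab(2)])
  have key: "dB_inner \<xi> b (\<lambda>z. transform \<xi> b \<phi> z - transform \<xi> a \<psi> z) (transform \<xi> a h) = ip2 a (\<phi> - \<psi>) h"
    if \<psi>: "\<psi> \<in> L2 a" and h: "h \<in> L2 a" for \<psi> h
  proof -
    have "(\<lambda>z. transform \<xi> b \<phi> z - transform \<xi> a \<psi> z) = transform \<xi> b (\<phi> - ext \<psi>)"
    proof
      fix z
      have "\<phi> - ext \<psi> = (\<lambda>x. 1 * \<phi> x + (- 1) * ext \<psi> x)" by (simp add: fun_eq_iff)
      then show "transform \<xi> b \<phi> z - transform \<xi> a \<psi> z = transform \<xi> b (\<phi> - ext \<psi>) z"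
        by (simp only: B.transform_lin[OF \<phi> extL[OF \<psi>]] Text) simp
    qed
    then have "dB_inner \<xi> b (\<lambda>z. transform \<xi> b \<phi> z - transform \<xi> a \<psi> z) (transform \<xi> a h) = ip2 b (\<phi> - ext \<psi>) (ext h)"
      using B.dB_inner_transform[OF L2.V_diff[OF \<phi> extL[OF \<psi>]] extL[OF h]] by (simp add: Text)
    also have "\<dots> = ip2 a (\<phi> - \<psi>) h"
      unfolding ip2_def by (rule set_integral_extend) (use ab(2) in \<open>auto simp: ext_def\<close>)
    finally show ?thesis .
  qed
  show ?thesis
    unfolding dB_proj_def
  proof (rule the_equality)
    show "transform \<xi> a \<phi> \<in> dB_space \<xi> a \<and>
      (\<forall>H\<in>dB_space \<xi> a. dB_inner \<xi> b (\<lambda>z. transform \<xi> b \<phi> z - transform \<xi> a \<phi> z) H = 0)"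
      using \<phi>a key[OF \<phi>a] by (auto simp: dB_space_def L2.ip_zero_left)
    fix G assume G: "G \<in> dB_space \<xi> a \<and> (\<forall>H\<in>dB_space \<xi> a. dB_inner \<xi> b (\<lambda>z. transform \<xi> b \<phi> z - G z) H = 0)"
    then obtain \<psi> where \<psi>: "\<psi> \<in> L2 a" "G = transform \<xi> a \<psi>" by (auto simp: dB_space_def)
    note d = L2.V_diff[OF \<phi>a \<psi>(1)]
    have "transform \<xi> a (\<phi> - \<psi>) \<in> dB_space \<xi> a" using d by (auto simp: dB_space_def)
    then have "dB_inner \<xi> b (\<lambda>z. transform \<xi> b \<phi> z - transform \<xi> a \<psi> z) (transform \<xi> a (\<phi> - \<psi>)) = 0"
      using G \<psi>(2) by blast
    then have "nrm2 a (\<phi> - \<psi>) = 0" unfolding key[OF \<psi>(1) d] L2.ip_self[OF d] by simp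
    then show "G = transform \<xi> a \<phi>" using A.transform_cong_AE[OF \<phi>a \<psi>(1)] \<psi>(2) by simp
  qed
qed

section \<open>High energies\<close>

context schroedinger
begin

definition energy :: "real \<Rightarrow> real \<Rightarrow> real" where
  "energy k x = (cmod (\<xi>' (of_real k) x))\<^sup>2 + k * (cmod (\<xi> (of_real k) x))\<^sup>2"

text \<open>With the weight equal to the spectral parameter, the two terms k cancel in
  \<open>energy_bound\<close> and only V drives the energy; this makes \<kappa> uniform in k \<ge>
  1.\<close>

lemma energy_comparison:
  assumes "0 < c" "c \<le> b"
  obtains \<kappa> K where "\<kappa> > 0" "K > 0" "\<And>x. x \<in> {c..b} \<Longrightarrow> \<bar>V x\<bar> \<le> K"
    "\<And>k x y. \<lbrakk>1 \<le> k; x \<in> {c..b}; y \<in> {c..b}\<rbrakk> \<Longrightarrow> energy k x \<le> \<kappa> * energy k y"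
proof -
  have "compact (V ` {c..b})"
    using assms by (intro compact_continuous_image continuous_on_subset[OF continuous_V]) auto
  then have "bounded (V ` {c..b})" by (rule compact_imp_bounded)
  then obtain K where K: "K > 0" "\<And>x. x \<in> {c..b} \<Longrightarrow> \<bar>V x\<bar> \<le> K"
    unfolding bounded_pos by auto
  show thesis
  proof (rule that[of "exp (K * b)" K])
    fix k x y :: real assume k: "1 \<le> k" and xy: "x \<in> {c..b}" "y \<in> {c..b}"
    have sub: "{c..b} \<subseteq> {0<..b}" using assms by auto
    have "energy k x \<le> exp (K * \<bar>x - y\<bar>) * energy k y"
      unfolding energy_def
    proof (rule energy_bound[OF sub, of k _ _ "of_real k"])
      show "k > 0" using k by simp
      show "(\<xi> (of_real k) has_vector_derivative \<xi>' (of_real k) t) (at t within {c..b})"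
        "(\<xi>' (of_real k) has_vector_derivative (of_real (V t) - of_real k) * \<xi> (of_real k) t) (at t within {c..b})"
        if "t \<in> {c..b}" for t
        by (rule has_vector_derivative_within_subset[OF xi_deriv sub] has_vector_derivative_within_subset[OF xi'_deriv sub],
            use that sub in blast)+
      have "K * 1 \<le> K * sqrt k" using k K(1) by (intro mult_left_mono) auto
      then show "cmod (of_real (V t) - of_real k + of_real k) \<le> K * sqrt k" if "t \<in> {c..b}" for t
        using K(2)[OF that] by simp
    qed (rule xy)+
    also have "\<dots> \<le> exp (K * b) * energy k y"
      using k K(1) xy assms by (intro mult_right_mono) (auto simp: energy_def)
    finally show "energy k x \<le> exp (K * b) * energy k y" .
  qed (use K in auto)
qed

text \<open>Equipartition: integrating \<open>(\<xi> \<xi>')' = \<xi>'\<^sup>2 + (V - k) \<xi>\<^sup>2\<close> shows that, up to lower order terms, half of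
  the integrated energy is kinetic.\<close>

lemma energy_le_kinetic:
  assumes a: "0 < a" "a \<le> b"
  obtains k0 \<kappa> C where "k0 \<ge> 1" "\<kappa> > 0" "C > 0"
    "\<And>k x. \<lbrakk>k0 \<le> k; x \<in> {a..b}\<rbrakk> \<Longrightarrow> k * (cmod (\<xi> (of_real k) x))\<^sup>2 \<le> \<kappa> * energy k a"
    "\<And>k. k0 \<le> k \<Longrightarrow> energy k a \<le> C * integral {a / 2..a} (\<lambda>x. (cmod (\<xi>' (of_real k) x))\<^sup>2)"
proof -
  have c: "0 < a / 2" "a / 2 \<le> b" using a by auto
  obtain \<kappa> K where \<kappa>: "\<kappa> > 0" and K: "K > 0" "\<And>x. x \<in> {a / 2..b} \<Longrightarrow> \<bar>V x\<bar> \<le> K"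
    and cmp: "\<And>k x y. \<lbrakk>1 \<le> k; x \<in> {a / 2..b}; y \<in> {a / 2..b}\<rbrakk> \<Longrightarrow> energy k x \<le> \<kappa> * energy k y"
    by (rule energy_comparison[OF c]) blast
  \<comment> \<open>Chosen so that the error terms together amount to a / (4 \<kappa>) times the
    energy, half of the main term a / (2 \<kappa>).\<close>
  define T where "T = 4 * \<kappa>\<^sup>2 * (a / 2 * K + 1) / a"
  have T: "T > 0" unfolding T_def using a \<kappa> K(1) by (intro divide_pos_pos mult_pos_pos add_pos_pos) auto
  define k0 where "k0 = max 1 (T\<^sup>2)"
  have aI: "a \<in> {a / 2..b}" using a by auto
  show thesis
  proof (rule that[of k0 \<kappa> "8 * \<kappa> / a"])
    show "k0 \<ge> 1" "\<kappa> > 0" "8 * \<kappa> / a > 0" using \<kappa> a by (auto simp: k0_def)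
    fix k assume k: "k0 \<le> k"
    have k1: "1 \<le> k" and kT: "T\<^sup>2 \<le> k" using k by (auto simp: k0_def)
    have sk: "T \<le> sqrt k" "1 \<le> sqrt k" using real_le_rsqrt[OF kT] k1 by auto
    let ?E = "energy k a"
    have E: "?E \<ge> 0" using k1 by (simp add: energy_def)
    show "k * (cmod (\<xi> (of_real k) x))\<^sup>2 \<le> \<kappa> * ?E" if "x \<in> {a..b}" for x
    proof -
      have "energy k x \<le> \<kappa> * ?E" using that a by (intro cmp[OF k1 _ aI]) auto
      moreover have "energy k x \<ge> k * (cmod (\<xi> (of_real k) x))\<^sup>2" by (simp add: energy_def)
      ultimately show ?thesis by linarith
    qed
    define r where "r x = Re (\<xi> (of_real k) x)" for x
    define r' where "r' x = Re (\<xi>' (of_real k) x)" for x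
    let ?I = "{a / 2..a}"
    have sub: "x \<in> {0<..b}" "x \<in> {a / 2..b}" if "x \<in> ?I" for x using that a by auto
    have im: "Im (\<xi> (of_real k) x) = 0" "Im (\<xi>' (of_real k) x) = 0" if "x \<in> ?I" for x
      using xi_cnj[OF sub(1)[OF that], of "of_real k"] by (auto simp: complex_eq_iff)
    have sq: "(cmod (\<xi> (of_real k) x))\<^sup>2 = (r x)\<^sup>2" "(cmod (\<xi>' (of_real k) x))\<^sup>2 = (r' x)\<^sup>2" if "x \<in> ?I" for x
      using im[OF that] by (auto simp: r_def r'_def cmod_power2)
    have energy: "energy k x = (r' x)\<^sup>2 + k * (r x)\<^sup>2" if "x \<in> ?I" for x
      by (simp add: energy_def sq[OF that])
    have dr: "(r has_vector_derivative r' x) (at x within ?I)" if "x \<in> ?I" for x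
      unfolding r_def[abs_def] r'_def
      using sub(1)
      by (intro bounded_linear.has_vector_derivative[OF bounded_linear_Re]
          has_vector_derivative_within_subset[OF xi_deriv[OF sub(1)[OF that]]]) auto
    have dr': "(r' has_vector_derivative (V x - k) * r x) (at x within ?I)" if "x \<in> ?I" for x
    proof -
      have "((\<lambda>x. Re (\<xi>' (of_real k) x)) has_vector_derivative Re ((of_real (V x) - of_real k) * \<xi> (of_real k) x)) (at x within ?I)"
        using sub(1)
        by (intro bounded_linear.has_vector_derivative[OF bounded_linear_Re]
            has_vector_derivative_within_subset[OF xi'_deriv[OF sub(1)[OF that]]]) auto
      then show ?thesis by (simp add: r_def r'_def[abs_def])
    qed
    have cont: "continuous_on ?I r'"
      unfolding continuous_on_eq_continuous_within using dr' has_vector_derivative_continuous by blast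
    define B where "B = r a * r' a - r (a / 2) * r' (a / 2)"
    have ftc: "((\<lambda>x. (r' x)\<^sup>2 + (V x - k) * (r x)\<^sup>2) has_integral B) ?I"
      unfolding B_def
    proof (rule fundamental_theorem_of_calculus[of "a / 2" a "\<lambda>x. r x * r' x"])
      fix x assume x: "x \<in> ?I"
      show "((\<lambda>x. r x * r' x) has_vector_derivative (r' x)\<^sup>2 + (V x - k) * (r x)\<^sup>2) (at x within ?I)"
        using has_vector_derivative_mult[OF dr[OF x] dr'[OF x]] by (simp add: power2_eq_square algebra_simps)
    qed (use a in simp)
    have int: "(\<lambda>x. (r' x)\<^sup>2) integrable_on ?I"
      by (intro integrable_continuous_interval continuous_intros cont)
    \<comment> \<open>Twice the kinetic part minus the integrand of B is the energy minus V
      r^2.\<close>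
    have ids: "((\<lambda>x. 2 * (r' x)\<^sup>2 - ((r' x)\<^sup>2 + (V x - k) * (r x)\<^sup>2)) has_integral 2 * integral ?I (\<lambda>x. (r' x)\<^sup>2) - B) ?I"
      by (intro has_integral_diff has_integral_mult_right integrable_integral int ftc)
    \<comment> \<open>The product r r' is at most the energy over 2 sqrt k, hence small against it
      for large k; this controls the boundary term B.\<close>
    have half: "\<bar>r x * r' x\<bar> \<le> \<kappa> * ?E / (2 * T)" if x: "x \<in> ?I" for x
    proof -
      have "2 * T * \<bar>r x * r' x\<bar> \<le> 2 * sqrt k * \<bar>r x * r' x\<bar>" using sk by (intro mult_right_mono) auto
      also have "\<dots> \<le> (r' x)\<^sup>2 + k * (r x)\<^sup>2"
        using zero_le_power2[of "\<bar>r' x\<bar> - sqrt k * \<bar>r x\<bar>"] k1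
        by (simp add: power2_diff power_mult_distrib abs_mult algebra_simps)
      also have "\<dots> \<le> \<kappa> * ?E" using cmp[OF k1 sub(2)[OF x] aI] energy[OF x] by simp
      finally show ?thesis using T by (simp add: pos_le_divide_eq mult.commute)
    qed
    have "((\<lambda>x. ?E / \<kappa> - K * \<kappa> * ?E / T) has_integral (?E / \<kappa> - K * \<kappa> * ?E / T) * (a / 2)) ?I"
      using has_integral_const_real[of "?E / \<kappa> - K * \<kappa> * ?E / T" "a / 2" a] a by (simp add: mult.commute)
    then have "(?E / \<kappa> - K * \<kappa> * ?E / T) * (a / 2) \<le> 2 * integral ?I (\<lambda>x. (r' x)\<^sup>2) - B"
    proof (rule has_integral_le[OF _ ids])
      fix x assume x: "x \<in> ?I"
      have "?E / \<kappa> \<le> energy k x"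
        using cmp[OF k1 aI sub(2)[OF x]] \<kappa> by (simp add: divide_le_eq mult.commute)
      moreover have "- V x * (r x)\<^sup>2 \<ge> - (K * \<kappa> * ?E / T)"
      proof -
        have "T * 1 \<le> sqrt k * sqrt k" using sk T by (intro mult_mono) auto
        then have Tk: "T \<le> k" using k1 by simp
        have "T * (r x)\<^sup>2 \<le> k * (r x)\<^sup>2" using Tk by (rule mult_right_mono) simp
        also have "\<dots> \<le> \<kappa> * ?E" using cmp[OF k1 sub(2)[OF x] aI] energy[OF x] zero_le_power2[of "r' x"] by linarith
        finally have "(r x)\<^sup>2 \<le> \<kappa> * ?E / T" using T by (simp add: pos_le_divide_eq mult.commute)
        then have "K * (r x)\<^sup>2 \<le> K * (\<kappa> * ?E / T)" using K(1) by (intro mult_left_mono) auto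
        moreover have "V x * (r x)\<^sup>2 \<le> K * (r x)\<^sup>2" using K(2)[OF sub(2)[OF x]] by (intro mult_right_mono) auto
        ultimately show ?thesis by simp
      qed
      ultimately show "?E / \<kappa> - K * \<kappa> * ?E / T \<le> 2 * (r' x)\<^sup>2 - ((r' x)\<^sup>2 + (V x - k) * (r x)\<^sup>2)"
        unfolding energy[OF x] by (simp add: algebra_simps)
    qed
    moreover have "- B \<le> \<kappa> * ?E / T"
      using half[of a] half[of "a / 2"] a by (simp add: B_def abs_le_iff)
    ultimately have "(?E / \<kappa> - K * \<kappa> * ?E / T) * (a / 2) - \<kappa> * ?E / T \<le> 2 * integral ?I (\<lambda>x. (r' x)\<^sup>2)"
      by linarith
    moreover have "(?E / \<kappa> - K * \<kappa> * ?E / T) * (a / 2) - \<kappa> * ?E / T = ?E * (a / (2 * \<kappa>)) - ?E * (\<kappa> * (a / 2 * K + 1) / T)"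
      using T \<kappa> by (simp add: field_simps)
    moreover have "\<kappa> * (a / 2 * K + 1) / T = a / (4 * \<kappa>)"
    proof -
      have "a / 2 * K + 1 > 0" using a K(1) by (intro add_pos_pos mult_pos_pos) auto
      moreover have "\<kappa> * w / (4 * \<kappa>\<^sup>2 * w / a) = a / (4 * \<kappa>)" if "w > 0" for w
        using that \<kappa> a by (simp add: power2_eq_square)
      ultimately show ?thesis unfolding T_def by simp
    qed
    ultimately have "?E * (a / (2 * \<kappa>)) - ?E * (a / (4 * \<kappa>)) \<le> 2 * integral ?I (\<lambda>x. (r' x)\<^sup>2)" by (simp only:)
    moreover have "?E * (a / (2 * \<kappa>)) - ?E * (a / (4 * \<kappa>)) = ?E * (a / (4 * \<kappa>))"
      using \<kappa> by (simp add: field_simps)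
    ultimately have "?E * (a / (4 * \<kappa>)) \<le> 2 * integral ?I (\<lambda>x. (r' x)\<^sup>2)" by (simp only:)
    then have "?E \<le> 8 * \<kappa> / a * integral ?I (\<lambda>x. (r' x)\<^sup>2)"
      using \<kappa> a by (simp add: field_simps)
    also have "integral ?I (\<lambda>x. (r' x)\<^sup>2) = integral ?I (\<lambda>x. (cmod (\<xi>' (of_real k) x))\<^sup>2)"
      by (rule Henstock_Kurzweil_Integration.integral_cong) (simp add: sq)
    finally show "?E \<le> 8 * \<kappa> / a * integral ?I (\<lambda>x. (cmod (\<xi>' (of_real k) x))\<^sup>2)" .
  qed
qed

end

context endpoint
begin

abbreviation kinetic :: "complex \<Rightarrow> real" where
  "kinetic l \<equiv> integral {s / 2..s} (\<lambda>x. (cmod (\<xi>' l x))\<^sup>2)"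

text \<open>The pointwise bound C / x is at most 2 C / s on [s/2, s], an interval of length s / 2.
  Averaging replaces the value at one point, where the derivative of an eigenfunction may be
  small.\<close>

lemma kinetic_sum_bound:
  obtains C where "C > 0" "\<And>A. \<lbrakk>finite A; A \<subseteq> eigenvalues\<rbrakk> \<Longrightarrow>
    (\<Sum>l\<in>A. kinetic l / weight l) \<le> C"
proof -
  obtain C where C: "C > 0"
    "\<And>A x. \<lbrakk>finite A; A \<subseteq> eigenvalues; x \<in> {0<..s}\<rbrakk> \<Longrightarrow>
      (\<Sum>l\<in>A. (cmod (\<xi>' l x))\<^sup>2 / weight l) \<le> C / x"
    by (rule eigenfunction_sums) blast
  show thesis
  proof (rule that[OF C(1)])
    fix A assume A: "finite A" "A \<subseteq> eigenvalues"
    define w where "w l = (cmod (l - of_real m0))\<^sup>2 * (nrm2 s (\<xi> l))\<^sup>2" for l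
    have "{s / 2..s} \<subseteq> {0<..b}" using s by auto
    then have int: "(\<lambda>x. (cmod (\<xi>' l x))\<^sup>2) integrable_on {s / 2..s}" for l
      by (intro integrable_continuous_interval continuous_intros continuous_on_subset[OF continuous_xi'])
    have h: "((\<lambda>x. \<Sum>l\<in>A. (cmod (\<xi>' l x))\<^sup>2 / w l) has_integral
        (\<Sum>l\<in>A. kinetic l / w l)) {s / 2..s}"
      by (intro has_integral_sum A has_integral_divide integrable_integral int)
    have "((\<lambda>x. C / (s / 2)) has_integral (s - s / 2) *\<^sub>R (C / (s / 2))) {s / 2..s}"
      using has_integral_const_real[of "C / (s / 2)" "s / 2" s] s by simp
    then have "(\<Sum>l\<in>A. kinetic l / w l) \<le> (s - s / 2) *\<^sub>R (C / (s / 2))"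
    proof (rule has_integral_le[OF h])
      fix x assume x: "x \<in> {s / 2..s}"
      have "(\<Sum>l\<in>A. (cmod (\<xi>' l x))\<^sup>2 / w l) \<le> C / x"
        unfolding w_def using x s by (intro C(2) A) auto
      also have "\<dots> \<le> C / (s / 2)" using x s C(1) by (intro divide_left_mono mult_pos_pos) auto
      finally show "(\<Sum>l\<in>A. (cmod (\<xi>' l x))\<^sup>2 / w l) \<le> C / (s / 2)" .
    qed
    also have "(s - s / 2) *\<^sub>R (C / (s / 2)) = C" using s by simp
    finally show "(\<Sum>l\<in>A. kinetic l / weight l) \<le> C"
      by (simp only: w_def)
  qed
qed

text \<open>Multiplication of the kernel identity by sin \<gamma> lets the boundary condition
  replace \<xi>'(l,s) by a multiple of \<xi>(l,s). For large l the energy E bounds the latter by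
  sqrt(E / l), the former only by sqrt E.\<close>

lemma eigenvalue_kernel_bound:
  assumes l: "l \<in> eigenvalues"
  shows "sin \<gamma> * cmod (z - l) * cmod (\<F> (\<xi> l) z) \<le> cmod (\<xi> l s) * (cmod (\<xi> z s) + cmod (\<xi>' z s))"
proof -
  have bc: "of_real (sin \<gamma>) * \<xi>' l s = - (of_real (cos \<gamma>) * \<xi> l s)"
    using l by (simp add: eigenvalues_def bcs_def add_eq_0_iff mult.commute)
  have "of_real (sin \<gamma>) * ((z - l) * \<F> (\<xi> l) z) = (of_real (sin \<gamma>) * \<xi>' l s) * \<xi> z s - \<xi> l s * (of_real (sin \<gamma>) * \<xi>' z s)"
    unfolding kernel_identity by (simp add: wronskian_def algebra_simps)
  also have "\<dots> = - (\<xi> l s * (of_real (cos \<gamma>) * \<xi> z s + of_real (sin \<gamma>) * \<xi>' z s))"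
    unfolding bc by (simp add: algebra_simps)
  finally have "cmod (of_real (sin \<gamma>) * ((z - l) * \<F> (\<xi> l) z))
      = cmod (\<xi> l s) * cmod (of_real (cos \<gamma>) * \<xi> z s + of_real (sin \<gamma>) * \<xi>' z s)"
    by (simp only: norm_minus_cancel norm_mult)
  also have "\<dots> \<le> cmod (\<xi> l s) * (cmod (\<xi> z s) + cmod (\<xi>' z s))"
  proof (rule mult_left_mono)
    have "cmod (of_real (cos \<gamma>) * \<xi> z s + of_real (sin \<gamma>) * \<xi>' z s) \<le> \<bar>cos \<gamma>\<bar> * cmod (\<xi> z s) + \<bar>sin \<gamma>\<bar> * cmod (\<xi>' z s)"
      using norm_triangle_ineq[of "of_real (cos \<gamma>) * \<xi> z s" "of_real (sin \<gamma>) * \<xi>' z s"] by (simp only: norm_mult norm_of_real)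
    also have "\<dots> \<le> 1 * cmod (\<xi> z s) + 1 * cmod (\<xi>' z s)" by (intro add_mono mult_right_mono) auto
    finally show "cmod (of_real (cos \<gamma>) * \<xi> z s + of_real (sin \<gamma>) * \<xi>' z s) \<le> cmod (\<xi> z s) + cmod (\<xi>' z s)" by simp
  qed simp
  finally show ?thesis using sin_gamma by (simp add: norm_mult mult.assoc)
qed

lemma xi_norm_bound_compact:
  assumes "compact K"
  obtains M where "M > 0" "\<And>z. z \<in> K \<Longrightarrow> nrm2 s (\<xi> z) \<le> M" "\<And>z. z \<in> K \<Longrightarrow> cmod (\<xi> z s) + cmod (\<xi>' z s) \<le> M"
proof -
  obtain M where M: "M > 0" "\<And>z x. z \<in> K \<Longrightarrow> x \<in> {0<..b} \<Longrightarrow> cmod (\<xi> z x) \<le> M * x powr p"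
    "\<And>z x. z \<in> K \<Longrightarrow> x \<in> {0<..b} \<Longrightarrow> cmod (\<xi>' z x) \<le> M * x powr (\<nu> - 1 / 2)"
    by (rule xi_bound_compact[OF assms]) blast
  define M1 where "M1 = sqrt s * (M * s powr p)"
  define M2 where "M2 = M * s powr p + M * s powr (\<nu> - 1 / 2)"
  have pos: "M1 > 0" "M2 > 0" unfolding M1_def M2_def using M(1) s by (auto intro!: add_pos_pos mult_pos_pos)
  show thesis
  proof (rule that[of "M1 + M2"])
    show "M1 + M2 > 0" using pos by simp
    fix z assume z: "z \<in> K"
    have "nrm2 s (\<xi> z) \<le> M1"
      unfolding M1_def
    proof (rule nrm2_le_bound[OF xi_in_L2])
      fix x assume x: "x \<in> {0<..<s}"
      have "cmod (\<xi> z x) \<le> M * x powr p" using x s by (intro M(2) z) auto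
      also have "\<dots> \<le> M * s powr p" using M(1) x nu by (intro mult_left_mono powr_mono2) auto
      finally show "cmod (\<xi> z x) \<le> M * s powr p" .
    qed (use M(1) s in auto)
    then show "nrm2 s (\<xi> z) \<le> M1 + M2" using pos by simp
    have "s \<in> {0<..b}" using s by simp
    then have "cmod (\<xi> z s) + cmod (\<xi>' z s) \<le> M2" unfolding M2_def by (intro add_mono M(2,3) z)
    then show "cmod (\<xi> z s) + cmod (\<xi>' z s) \<le> M1 + M2" using pos by simp
  qed
qed

end

section \<open>The sampling theorem\<close>

text \<open>The cut-off is a half-line; integration over (0,b) supplies the other end.\<close>

definition tail :: "real \<Rightarrow> (real \<Rightarrow> complex) \<Rightarrow> real \<Rightarrow> complex" where
  "tail a f x = (if x \<in> {a..} then f x else 0)"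

lemma tail_L2: "f \<in> L2 b \<Longrightarrow> tail a f \<in> L2 b"
  unfolding tail_def[abs_def] by (rule L2_cutoff) auto

context endpoint
begin

text \<open>An upper bound for the norm of the functional that sends the part of a function beyond s
  to its contribution to the sampling series at l.\<close>

abbreviation leakage :: "complex \<Rightarrow> complex \<Rightarrow> real" where
  "leakage z l \<equiv> cmod (\<F> (\<xi> l) z) * nrm2 b (tail s (\<xi> l)) / (nrm2 s (\<xi> l))\<^sup>2"

text \<open>With E the energy at s and l = k, kernel and tail each contribute sqrt(E / k) and the
  kernel a further 1 / k, so the product is of order E / k^2; E in turn is bounded by its kinetic
  part averaged over [s/2, s].\<close>

lemma kernel_tail_bound_high:
  assumes K: "compact K"
  obtains D L where "D > 0" "\<And>l z. \<lbrakk>l \<in> eigenvalues; L < cmod l; z \<in> K\<rbrakk> \<Longrightarrow>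
    leakage z l
      \<le> D * (kinetic l / weight l)"
proof -
  obtain R where R: "R > 0" "\<And>z. z \<in> K \<Longrightarrow> cmod z \<le> R"
    using compact_imp_bounded[OF K] unfolding bounded_pos by blast
  obtain M where M: "M > 0" "\<And>z. z \<in> K \<Longrightarrow> cmod (\<xi> z s) + cmod (\<xi>' z s) \<le> M"
    by (rule xi_norm_bound_compact[OF K]) blast
  obtain k0 \<kappa> C where k0: "k0 \<ge> 1" and \<kappa>: "\<kappa> > 0" and C: "C > 0"
    and pot: "\<And>k x. \<lbrakk>k0 \<le> k; x \<in> {s..b}\<rbrakk> \<Longrightarrow> k * (cmod (\<xi> (of_real k) x))\<^sup>2 \<le> \<kappa> * energy k s"
    and kin: "\<And>k. k0 \<le> k \<Longrightarrow> energy k s \<le> C * integral {s / 2..s} (\<lambda>x. (cmod (\<xi>' (of_real k) x))\<^sup>2)"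
    by (rule energy_le_kinetic[OF s]) blast
  \<comment> \<open>Beyond k0 the energy estimates apply; |m0| gives k - m0 \<le> 2 k and, together
    with 2 R, the bound |z - l| \<ge> (k - m0) / 2.\<close>
  define L where "L = k0 + \<bar>m0\<bar> + 2 * R"
  \<comment> \<open>In the factor 4, one 2 comes from |z - l| \<ge> (k - m0) / 2 and the other from
    1 / k \<le> 2 / (k - m0).\<close>
  define D where "D = 4 * M * sqrt (b * \<kappa>) / sin \<gamma> * C"
  show thesis
  proof (rule that[of D L])
    show "D > 0" unfolding D_def using M(1) b_pos \<kappa> sin_gamma C by simp
    fix l z assume l: "l \<in> eigenvalues" and L: "L < cmod l" and z: "z \<in> K"
    obtain k where k: "l = of_real k" "k > m0" using eigenvalueE[OF l] by blast
    \<comment> \<open>Eigenvalues exceed m0, so a large modulus means a large positive k.\<close>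
    have kL: "k > L" using L k k0 R(1) by (auto simp: L_def abs_if split: if_splits)
    have kk: "k0 \<le> k" "k > 0" "k - m0 \<le> 2 * k" "k - m0 > 0" using kL k(2) k0 R(1) by (auto simp: L_def)
    have lm: "cmod (l - of_real m0) = k - m0" using kk unfolding k(1) by (simp flip: of_real_diff)
    have lz: "cmod (z - l) \<ge> (k - m0) / 2"
      using norm_triangle_ineq3[of l z] R(2)[OF z] kL k0 kk(2) unfolding k(1) L_def
      by (simp add: norm_minus_commute field_simps)
    define E where "E = energy k s"
    have E: "E \<ge> 0" using kk by (simp add: E_def energy_def)
    have xs: "cmod (\<xi> l s) \<le> sqrt (E / k)"
    proof (rule real_le_rsqrt)
      have "k * (cmod (\<xi> l s))\<^sup>2 \<le> E" by (simp add: E_def energy_def k(1))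
      then show "(cmod (\<xi> l s))\<^sup>2 \<le> E / k" using kk(2) by (simp add: pos_le_divide_eq mult.commute)
    qed
    have tl: "nrm2 b (tail s (\<xi> l)) \<le> sqrt b * sqrt (\<kappa> * (E / k))"
    proof (rule nrm2_le_bound[OF tail_L2[OF xi_L2[OF order_refl]]])
      show nn: "0 \<le> sqrt (\<kappa> * (E / k))" using \<kappa> E kk by simp
      fix x assume x: "x \<in> {0<..<b}"
      show "cmod (tail s (\<xi> l) x) \<le> sqrt (\<kappa> * (E / k))"
      proof (cases "x \<ge> s")
        case True
        have "(cmod (\<xi> l x))\<^sup>2 \<le> \<kappa> * (E / k)"
          using pot[OF kk(1), of x] True x kk(2) by (simp add: E_def k(1) pos_le_divide_eq mult.commute)
        then show ?thesis using True by (simp add: tail_def real_le_rsqrt)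
      qed (use nn in \<open>simp add: tail_def\<close>)
    qed (rule b_pos)
    have "sin \<gamma> * ((k - m0) / 2) * cmod (\<F> (\<xi> l) z) \<le> sin \<gamma> * cmod (z - l) * cmod (\<F> (\<xi> l) z)"
      using lz sin_gamma by (intro mult_right_mono mult_left_mono) auto
    also have "\<dots> \<le> cmod (\<xi> l s) * (cmod (\<xi> z s) + cmod (\<xi>' z s))" by (rule eigenvalue_kernel_bound[OF l])
    also have "\<dots> \<le> sqrt (E / k) * M" using xs M(2)[OF z] by (intro mult_mono) (auto simp: E kk less_imp_le)
    finally have tr: "cmod (\<F> (\<xi> l) z) \<le> 2 * M / sin \<gamma> * sqrt (E / k) / (k - m0)"
      using sin_gamma kk(4) by (simp add: field_simps)
    have "cmod (\<F> (\<xi> l) z) * nrm2 b (tail s (\<xi> l))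
        \<le> (2 * M / sin \<gamma> * sqrt (E / k) / (k - m0)) * (sqrt b * sqrt (\<kappa> * (E / k)))"
      using tr tl L2.nrm_nonneg[OF tail_L2[OF xi_L2[OF order_refl]], of s l] order_trans[OF norm_ge_zero tr]
      by (intro mult_mono) auto
    also have "\<dots> = 2 * M * sqrt (b * \<kappa>) / sin \<gamma> * ((sqrt (E / k) * sqrt (E / k)) / (k - m0))"
      unfolding real_sqrt_mult[of \<kappa> "E / k"] real_sqrt_mult[of b \<kappa>]
    proof -
      show "2 * M / sin \<gamma> * Q / (k - m0) * (sb * (sk * Q)) = 2 * M * (sb * sk) / sin \<gamma> * (Q * Q / (k - m0))" for Q sb sk
        by (simp add: mult_ac)
    qed
    also have "sqrt (E / k) * sqrt (E / k) = E / k" using E kk(2) by simp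
    also have "2 * M * sqrt (b * \<kappa>) / sin \<gamma> * (E / k / (k - m0)) \<le> 2 * M * sqrt (b * \<kappa>) / sin \<gamma> * (2 * (E / (k - m0)\<^sup>2))"
    proof (rule mult_left_mono)
      have "E / k \<le> E / ((k - m0) / 2)" using kk E by (intro divide_left_mono mult_pos_pos) auto
      then have "E / k / (k - m0) \<le> E / ((k - m0) / 2) / (k - m0)" using kk(4) by (intro divide_right_mono) auto
      then show "E / k / (k - m0) \<le> 2 * (E / (k - m0)\<^sup>2)" by (simp add: power2_eq_square mult.commute)
      show "0 \<le> 2 * M * sqrt (b * \<kappa>) / sin \<gamma>" using M(1) b_pos \<kappa> sin_gamma by simp
    qed
    also have "\<dots> = 4 * M * sqrt (b * \<kappa>) / sin \<gamma> * (E / (k - m0)\<^sup>2)" by simp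
    also have "\<dots> \<le> 4 * M * sqrt (b * \<kappa>) / sin \<gamma> * (C * kinetic l / (k - m0)\<^sup>2)"
    proof (intro mult_left_mono divide_right_mono)
      show "E \<le> C * kinetic l" unfolding E_def k(1) by (rule kin[OF kk(1)])
      show "0 \<le> 4 * M * sqrt (b * \<kappa>) / sin \<gamma>" using M(1) b_pos \<kappa> sin_gamma by simp
    qed simp
    also have "\<dots> = D * (kinetic l / (cmod (l - of_real m0))\<^sup>2)"
      unfolding lm D_def by simp
    finally have "leakage z l
        \<le> D * (kinetic l / (cmod (l - of_real m0))\<^sup>2) / (nrm2 s (\<xi> l))\<^sup>2"
      by (rule divide_right_mono) simp
    then show "leakage z l
        \<le> D * (kinetic l / weight l)"
      by simp
  qed
qed

text \<open>The finitely many eigenvalues of modulus at most L are estimated one by one with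
  Cauchy-Schwarz; all others are controlled at once by \<open>kinetic_sum_bound\<close>.\<close>

lemma kernel_tail_sum_bound:
  assumes K: "compact K"
  obtains D where "D > 0" "\<And>A z. \<lbrakk>finite A; A \<subseteq> eigenvalues; z \<in> K\<rbrakk> \<Longrightarrow>
    (\<Sum>l\<in>A. leakage z l) \<le> D"
proof -
  obtain D L where D: "D > 0" and high: "\<And>l z. \<lbrakk>l \<in> eigenvalues; L < cmod l; z \<in> K\<rbrakk> \<Longrightarrow>
    leakage z l
      \<le> D * (kinetic l / weight l)"
    by (rule kernel_tail_bound_high[OF K]) blast
  obtain C where C: "C > 0" "\<And>A. \<lbrakk>finite A; A \<subseteq> eigenvalues\<rbrakk> \<Longrightarrow>
    (\<Sum>l\<in>A. kinetic l / weight l) \<le> C"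
    by (rule kinetic_sum_bound) blast
  obtain M where M: "M > 0" "\<And>z. z \<in> K \<Longrightarrow> nrm2 s (\<xi> z) \<le> M"
    by (rule xi_norm_bound_compact[OF K]) blast
  define B where "B = {l \<in> eigenvalues. cmod l \<le> L}"
  have finB: "finite B" unfolding B_def by (rule finite_eigenvalues_bounded)
  define t where "t l = nrm2 b (tail s (\<xi> l))" for l
  have t: "t l \<ge> 0" for l unfolding t_def by (rule L2.nrm_nonneg[OF tail_L2[OF xi_L2[OF order_refl]]])
  define W where "W z l = cmod (\<F> (\<xi> l) z) * t l / (nrm2 s (\<xi> l))\<^sup>2" for z l
  define N where "N = (\<Sum>l\<in>B. M * t l / nrm2 s (\<xi> l))"
  have N: "N \<ge> 0" unfolding N_def using M(1) t nrm_xi_pos by (intro sum_nonneg divide_nonneg_pos mult_nonneg_nonneg) auto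
  show thesis
  proof (rule that[of "N + D * C"])
    show "N + D * C > 0" using N D C(1) by (intro add_nonneg_pos mult_pos_pos)
    fix A z assume A: "finite A" "A \<subseteq> eigenvalues" and z: "z \<in> K"
    have "sum (W z) A = sum (W z) (A \<inter> B) + sum (W z) (A - B)"
      using sum.Int_Diff[OF A(1)] by blast
    moreover have "sum (W z) (A \<inter> B) \<le> N"
    proof -
      have "W z l \<le> M * t l / nrm2 s (\<xi> l)" for l
      proof -
        have n: "nrm2 s (\<xi> l) > 0" by (rule nrm_xi_pos)
        have "cmod (\<F> (\<xi> l) z) \<le> nrm2 s (\<xi> z) * nrm2 s (\<xi> l)"
          unfolding transform_def by (rule L2_integral_le[OF xi_in_L2 xi_in_L2])
        also have "\<dots> \<le> M * nrm2 s (\<xi> l)" using M(2)[OF z] n by (intro mult_right_mono) auto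
        finally have "W z l \<le> (M * nrm2 s (\<xi> l)) * t l / (nrm2 s (\<xi> l))\<^sup>2"
          unfolding W_def using t by (intro divide_right_mono mult_right_mono) auto
        then show ?thesis using n by (simp add: power2_eq_square)
      qed
      then have "sum (W z) (A \<inter> B) \<le> (\<Sum>l\<in>A \<inter> B. M * t l / nrm2 s (\<xi> l))" by (rule sum_mono)
      also have "\<dots> \<le> N"
        unfolding N_def using M(1) t nrm_xi_pos
        by (intro sum_mono2 finB divide_nonneg_pos mult_nonneg_nonneg) auto
      finally show ?thesis .
    qed
    moreover have "sum (W z) (A - B) \<le> D * C"
    proof -
      have "sum (W z) (A - B) \<le> (\<Sum>l\<in>A - B. D * (kinetic l / weight l))"
      proof (rule sum_mono)
        fix l assume "l \<in> A - B"
        then have "l \<in> eigenvalues" "L < cmod l" using A(2) by (auto simp: B_def)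
        then show "W z l \<le> D * (kinetic l / weight l)"
          unfolding W_def t_def using z by (rule high)
      qed
      also have "\<dots> \<le> D * C"
        unfolding sum_distrib_left[symmetric] using D A by (intro mult_left_mono C(2)) auto
      finally show ?thesis .
    qed
    ultimately show "(\<Sum>l\<in>A. leakage z l) \<le> N + D * C"
      by (simp add: W_def t_def)
  qed
qed

lemma dB_kernel_eigenvalue:
  assumes l: "l \<in> eigenvalues"
  shows "dB_kernel \<xi> s z l = \<F> (\<xi> l) z" "dB_kernel \<xi> s l l = of_real ((nrm2 s (\<xi> l))\<^sup>2)"
proof -
  show k: "dB_kernel \<xi> s z l = \<F> (\<xi> l) z" for z
    by (simp add: dB_kernel_def transform_def eigenvalue_real[OF l])
  show "dB_kernel \<xi> s l l = of_real ((nrm2 s (\<xi> l))\<^sup>2)"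
    unfolding k ip2_eigenvalue[OF l, symmetric] by (rule L2.ip_self[OF xi_in_L2])
qed

text \<open>Parseval's identity for f and the solution at the conjugate of z: the coefficients of f
  are the samples, those of the solution are the kernel values.\<close>

lemma sampling_exact:
  assumes f: "f \<in> L2 s"
  shows "(sampling_term \<xi> s (\<F> f) z has_sum \<F> f z) eigenvalues"
proof -
  have "((\<lambda>l. ip2 s f (\<xi> l) * ip2 s (\<xi> l) (\<xi> (cnj z)) / of_real ((nrm2 s (\<xi> l))\<^sup>2)) has_sum ip2 s f (\<xi> (cnj z))) eigenvalues"
    by (rule parseval[OF f xi_in_L2])
  then show ?thesis
    unfolding ip2_xi
  proof (rule has_sum_cong[THEN iffD1, rotated])
    fix l assume l: "l \<in> eigenvalues"
    show "ip2 s f (\<xi> l) * \<F> (\<xi> l) z / of_real ((nrm2 s (\<xi> l))\<^sup>2) = sampling_term \<xi> s (\<F> f) z l"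
      unfolding sampling_term_def dB_kernel_eigenvalue(2)[OF l]
      unfolding dB_kernel_eigenvalue(1)[OF l] ip2_eigenvalue[OF l] by simp
  qed
qed

lemma transform_tail:
  assumes f: "f \<in> L2 b"
  shows "transform \<xi> b f z = \<F> f z + transform \<xi> b (tail s f) z"
    "cmod (transform \<xi> b (tail s f) z) \<le> nrm2 b (tail s (\<xi> z)) * nrm2 b (tail s f)"
proof -
  interpret B: endpoint \<nu> b q \<xi> b \<gamma> by unfold_locales (use b_pos gamma in auto)
  define h where "h x = (if x \<in> {0<..<s} then f x else 0)" for x
  have hL: "h \<in> L2 b"
    unfolding h_def[abs_def] by (rule L2_extend[OF L2_subset[OF f s(2)] s(2)])
  have "transform \<xi> b f z = transform \<xi> b (\<lambda>x. 1 * h x + 1 * tail s f x) z"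
    unfolding transform_def by (rule set_lebesgue_integral_cong) (auto simp: h_def tail_def)
  also have "\<dots> = transform \<xi> b h z + transform \<xi> b (tail s f) z"
    using B.transform_lin[OF hL tail_L2[OF f], of 1 1] by simp
  also have "transform \<xi> b h z = \<F> f z"
    unfolding transform_def by (rule set_integral_extend) (use s in \<open>auto simp: h_def\<close>)
  finally show "transform \<xi> b f z = \<F> f z + transform \<xi> b (tail s f) z" .
  have "transform \<xi> b (tail s f) z = (LBINT x:{0<..<b}. tail s (\<xi> z) x * tail s f x)"
    unfolding transform_def by (rule set_lebesgue_integral_cong) (auto simp: tail_def)
  then show "cmod (transform \<xi> b (tail s f) z) \<le> nrm2 b (tail s (\<xi> z)) * nrm2 b (tail s f)"
    using L2_integral_le[OF tail_L2[OF xi_L2[OF order_refl]] tail_L2[OF f]] by simp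
qed

lemma sampling_tail_term:
  assumes f: "f \<in> L2 b" and l: "l \<in> eigenvalues"
  shows "cmod (sampling_term \<xi> s (transform \<xi> b (tail s f)) z l)
    \<le> leakage z l * nrm2 b (tail s f)"
proof -
  have "cmod (sampling_term \<xi> s (transform \<xi> b (tail s f)) z l)
      = cmod (\<F> (\<xi> l) z) / (nrm2 s (\<xi> l))\<^sup>2 * cmod (transform \<xi> b (tail s f) l)"
    unfolding sampling_term_def dB_kernel_eigenvalue(2)[OF l]
    unfolding dB_kernel_eigenvalue(1)[OF l] norm_mult norm_divide norm_of_real by simp
  also have "\<dots> \<le> cmod (\<F> (\<xi> l) z) / (nrm2 s (\<xi> l))\<^sup>2 * (nrm2 b (tail s (\<xi> l)) * nrm2 b (tail s f))"
    by (rule mult_left_mono[OF transform_tail(2)[OF f]]) simp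
  finally show ?thesis by simp
qed

text \<open>On the part over (0,s) the series is exact, so the error is the transform of the tail
  minus its own series, bounded through M and D respectively. Summability is part of the claim
  because \<open>infsum\<close> is 0 on families that are not summable.\<close>

lemma sampling_error:
  assumes K: "compact K"
  shows "\<exists>D>0. \<forall>f\<in>L2 b. \<forall>z\<in>K. sampling_term \<xi> s (transform \<xi> b f) z summable_on eigenvalues \<and>
      cmod (transform \<xi> b f z - infsum (sampling_term \<xi> s (transform \<xi> b f) z) eigenvalues) \<le> D * nrm2 b (tail s f)"
proof -
  interpret B: endpoint \<nu> b q \<xi> b \<gamma> by unfold_locales (use b_pos gamma in auto)
  obtain D where D: "D > 0" "\<And>A z. \<lbrakk>finite A; A \<subseteq> eigenvalues; z \<in> K\<rbrakk> \<Longrightarrow>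
    (\<Sum>l\<in>A. leakage z l) \<le> D"
    by (rule kernel_tail_sum_bound[OF K]) blast
  obtain M where M: "M > 0" "\<And>z. z \<in> K \<Longrightarrow> nrm2 b (\<xi> z) \<le> M"
    by (rule B.xi_norm_bound_compact[OF K]) blast
  have main: "sampling_term \<xi> s (transform \<xi> b f) z summable_on eigenvalues \<and>
      cmod (transform \<xi> b f z - infsum (sampling_term \<xi> s (transform \<xi> b f) z) eigenvalues) \<le> (M + D) * nrm2 b (tail s f)"
    if f: "f \<in> L2 b" and z: "z \<in> K" for f z
  proof -
    let ?t = "sampling_term \<xi> s (transform \<xi> b (tail s f)) z" and ?n = "nrm2 b (tail s f)"
    have n: "?n \<ge> 0" by (rule L2.nrm_nonneg[OF tail_L2[OF f]])
    have fin: "(\<Sum>l\<in>A. norm (?t l)) \<le> D * ?n" if A: "finite A" "A \<subseteq> eigenvalues" for A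
    proof -
      have "(\<Sum>l\<in>A. norm (?t l)) \<le> (\<Sum>l\<in>A. leakage z l * ?n)"
        using A(2) by (intro sum_mono sampling_tail_term f) auto
      also have "\<dots> \<le> D * ?n"
        unfolding sum_distrib_right[symmetric] by (rule mult_right_mono[OF D(2)[OF A z] n])
      finally show ?thesis .
    qed
    have abs: "(\<lambda>l. norm (?t l)) summable_on eigenvalues"
      by (rule nonneg_bdd_above_summable_on) (auto intro!: bdd_aboveI[of _ "D * ?n"] fin)
    have summ: "?t summable_on eigenvalues" by (rule abs_summable_summable[OF abs])
    have le: "cmod (infsum ?t eigenvalues) \<le> D * ?n"
      by (rule order_trans[OF norm_infsum_bound[OF abs] infsum_le_finite_sums[OF abs fin]])
    have "((\<lambda>l. sampling_term \<xi> s (\<F> f) z l + ?t l) has_sum \<F> f z + infsum ?t eigenvalues) eigenvalues"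
      by (intro has_sum_add sampling_exact L2_subset[OF f s(2)] has_sum_infsum summ)
    moreover have "(\<lambda>l. sampling_term \<xi> s (\<F> f) z l + ?t l) = sampling_term \<xi> s (transform \<xi> b f) z"
      by (rule ext) (simp add: sampling_term_def transform_tail(1)[OF f] distrib_left)
    ultimately have hs: "(sampling_term \<xi> s (transform \<xi> b f) z has_sum \<F> f z + infsum ?t eigenvalues) eigenvalues"
      by simp
    have eq: "transform \<xi> b f z - infsum (sampling_term \<xi> s (transform \<xi> b f) z) eigenvalues
        = transform \<xi> b (tail s f) z - infsum ?t eigenvalues"
      unfolding infsumI[OF hs] unfolding transform_tail(1)[OF f] by simp
    have "cmod (transform \<xi> b f z - infsum (sampling_term \<xi> s (transform \<xi> b f) z) eigenvalues)
        \<le> cmod (transform \<xi> b (tail s f) z) + cmod (infsum ?t eigenvalues)"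
      unfolding eq by (rule norm_triangle_ineq4)
    also have "\<dots> \<le> M * ?n + D * ?n"
    proof (rule add_mono[OF _ le])
      have "cmod (transform \<xi> b (tail s f) z) \<le> nrm2 b (\<xi> z) * ?n"
        unfolding transform_def by (rule L2_integral_le[OF xi_L2[OF order_refl] tail_L2[OF f]])
      also have "\<dots> \<le> M * ?n" using M(2)[OF z] n by (rule mult_right_mono)
      finally show "cmod (transform \<xi> b (tail s f) z) \<le> M * ?n" .
    qed
    finally show ?thesis using has_sum_imp_summable[OF hs] by (simp only: distrib_right)
  qed
  have "M + D > 0" using M(1) D(1) by simp
  then show ?thesis using main by blast
qed

lemma dB_norm_projection_error:
  assumes f: "f \<in> L2 b"
  shows "dB_norm \<xi> b (\<lambda>w. transform \<xi> b f w - dB_proj \<xi> s b (transform \<xi> b f) w) = nrm2 b (tail s f)"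
proof -
  interpret B: endpoint \<nu> b q \<xi> b \<gamma> by unfold_locales (use b_pos gamma in auto)
  have "(\<lambda>w. transform \<xi> b f w - dB_proj \<xi> s b (transform \<xi> b f) w) = transform \<xi> b (tail s f)"
    unfolding dB_proj_transform[OF s f] by (rule ext) (simp add: transform_tail(1)[OF f])
  then show ?thesis by (simp only: B.dB_norm_transform[OF tail_L2[OF f]])
qed

end

text \<open>On a bounded interval 1 + |f|^r dominates |f| for finite r, and a constant does for r
  infinite.\<close>

lemma Lp_set_integrable:
  fixes f :: "real \<Rightarrow> real"
  assumes f: "f \<in> Lp r b" and r: "1 \<le> r"
  shows "set_integrable lborel {0<..<b} f"
proof (cases "r = \<infinity>")
  case True
  then obtain M where M: "AE x in lborel. x \<in> {0<..<b} \<longrightarrow> norm (f x) \<le> M" using f by (auto simp: Lp_def)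
  show ?thesis
  proof (rule set_integrable_bound)
    show "set_integrable lborel {0<..<b} (\<lambda>x. M)" by (cases "0 \<le> b") (simp_all add: set_integrable_def)
    show "set_borel_measurable lborel {0<..<b} f" using f by (simp add: Lp_def)
    show "AE x in lborel. x \<in> {0<..<b} \<longrightarrow> norm (f x) \<le> norm M" using M by eventually_elim auto
  qed
next
  case False
  then obtain \<rho> where \<rho>: "r = ereal \<rho>" using r by (cases r) auto
  have \<rho>1: "\<rho> \<ge> 1" using r \<rho> by simp
  show ?thesis
  proof (rule set_integrable_bound)
    have "set_integrable lborel {0<..<b} (\<lambda>x. norm (f x) powr \<rho>)" using f \<rho> by (simp add: Lp_def)
    moreover have "set_integrable lborel {0<..<b} (\<lambda>x. 1 :: real)" by (cases "0 \<le> b") (simp_all add: set_integrable_def)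
    ultimately show "set_integrable lborel {0<..<b} (\<lambda>x. 1 + norm (f x) powr \<rho>)" by (intro set_integral_add)
    show "set_borel_measurable lborel {0<..<b} f" using f by (simp add: Lp_def)
    have "norm (f x) \<le> norm (1 + norm (f x) powr \<rho>)" for x
    proof (cases "norm (f x) \<le> 1")
      case False
      then have "norm (f x) powr 1 \<le> norm (f x) powr \<rho>" using \<rho>1 by (intro powr_mono) auto
      then show ?thesis using False by simp
    qed (simp add: add_increasing2)
    then show "AE x in lborel. x \<in> {0<..<b} \<longrightarrow> norm (f x) \<le> norm (1 + norm (f x) powr \<rho>)" by simp
  qed
qed

text \<open>The summability conjunct certifies that the series in the estimate is a genuine sum and
  not the default value of \<open>infsum\<close>.\<close>

theorem mainTheorem2:
  fixes \<nu> a b \<gamma> :: real and q :: "real \<Rightarrow> real" and r :: ereal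
    and \<xi> :: "complex \<Rightarrow> real \<Rightarrow> complex"
  assumes "0 < \<nu>" and "0 < b" and "0 < a" and "a < b" and "0 < \<gamma>" and "\<gamma> < pi"
    and "q \<in> AC_loc b"
    and "2 < r" and "(\<lambda>x. x * q x) \<in> Lp r b"
    and "regular_solution \<nu> q b \<xi>"
  shows "(\<forall>F\<in>dB_space \<xi> b. \<forall>z. sampling_term \<xi> a F z summable_on S_spectrum \<xi> \<nu> q a \<gamma>) \<and>
    (\<forall>K. compact K \<longrightarrow> (\<exists>D>0. \<forall>F\<in>dB_space \<xi> b. \<forall>z\<in>K.
       cmod (F z - sampling_series \<xi> \<nu> q a \<gamma> F z)
         \<le> D * dB_norm \<xi> b (\<lambda>w. F w - dB_proj \<xi> a b F w)))"
proof -
  have "1 \<le> r" using assms(8) order_trans[of 1 2 r] by simp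
  then have "set_integrable lborel {0<..<b} (\<lambda>x. x * q x)" by (rule Lp_set_integrable[OF assms(9)])
  then have "set_integrable lborel {0<..<b} (\<lambda>x. norm (x * q x))" by (rule set_integrable_norm)
  then have "set_integrable lborel {0<..<b} (\<lambda>x. x * \<bar>q x\<bar>)"
    by (rule set_integrable_cong[THEN iffD1, rotated -1]) (auto simp: abs_mult)
  then interpret endpoint \<nu> b q \<xi> a \<gamma> by unfold_locales (use assms in auto)
  show ?thesis
    unfolding sampling_series_def S_spectrum_eq
  proof (intro conjI ballI allI impI)
    fix F and z :: complex assume "F \<in> dB_space \<xi> b"
    then obtain f where f: "f \<in> L2 b" "F = transform \<xi> b f" by (auto simp: dB_space_def)
    show "sampling_term \<xi> a F z summable_on eigenvalues"
      unfolding f(2) using sampling_error[OF compact_sing[of z]] f(1) by blast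
  next
    fix K :: "complex set" assume K: "compact K"
    obtain D where D: "D > 0" "\<And>f z. \<lbrakk>f \<in> L2 b; z \<in> K\<rbrakk> \<Longrightarrow>
      cmod (transform \<xi> b f z - infsum (sampling_term \<xi> a (transform \<xi> b f) z) eigenvalues) \<le> D * nrm2 b (tail a f)"
      using sampling_error[OF K] by blast
    have "cmod (F z - infsum (sampling_term \<xi> a F z) eigenvalues) \<le> D * dB_norm \<xi> b (\<lambda>w. F w - dB_proj \<xi> a b F w)"
      if F: "F \<in> dB_space \<xi> b" and z: "z \<in> K" for F z
    proof -
      obtain f where f: "f \<in> L2 b" "F = transform \<xi> b f" using F by (auto simp: dB_space_def)
      show ?thesis unfolding f(2) dB_norm_projection_error[OF f(1)] by (rule D(2)[OF f(1) z])
    qed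
    then show "\<exists>D>0. \<forall>F\<in>dB_space \<xi> b. \<forall>z\<in>K. cmod (F z - infsum (sampling_term \<xi> a F z) eigenvalues)
        \<le> D * dB_norm \<xi> b (\<lambda>w. F w - dB_proj \<xi> a b F w)"
      using D(1) by blast
  qed
qed

end
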